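(* Let $\theta\in\{0,1\}$, let $m$ be a nonnegative integer, and let a function $v(\mu)$ have the form $$v(\mu)=\frac{f(\mu)}{\mu},$$ where $f\in PW_\pi^-$ satisfies $$\int_{-\infty}^{\infty}|\mu^{m}f(\mu)|^2\,d\mu<\infty.$$ Then there exists a (complex-valued) function $q\in W_2^m(0,\pi)$ such that the characteristic determinant $\Delta(\mu)$ of the boundary value problem $$u''-q(x)u+\lambda u=0 \ \text{ on } (0,\pi),\qquad u'(0)+(-1)^\theta u'(\pi)=0,\quad u(0)+(-1)^{\theta+1}u(\pi)=0,$$ with this potential $q$ satisfies $\Delta(\mu)=v(\mu)$ for all $\mu\in\mathbb{C}$.
   Context: For $\sigma>0$, $PW_\sigma$ denotes the class of entire functions $f(z)$ of exponential type $\le\sigma$ such that $\|f\|_{L_2(\mathbb{R})}<\infty$, and $PW_\sigma^-$ denotes the set of odd functions in $PW_\sigma$. (Since such an odd $f$ vanishes at $0$, $f(\mu)/\mu$ is understood as an entire function.) $W_2^m(0,\pi)$ is the Sobolev space of complex-valued functions on $(0,\pi)$ with weak derivatives up to order $m$ in $L_2(0,\pi)$; $W_2^0(0,\pi)=L_2(0,\pi)$. For a complex-valued $q\in L_1(0,\pi)$ and $\lambda=\mu^2$, let $c(x,\mu)$, $s(x,\mu)$ be the solutions of $u''-q(x)u+\mu^2u=0$ on $[0,\pi]$ with initial conditions $c(0,\mu)=s'(0,\mu)=1$, $c'(0,\mu)=s(0,\mu)=0$ (the prime denotes $d/dx$). The characteristic determinant of the boundary value problem in the claim is $$\Delta(\mu)=c(\pi,\mu)-s'(\pi,\mu);$$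 the eigenvalues of the problem are the numbers $\lambda=\mu^2$ with $\Delta(\mu)=0$. *)

theory Defs
  imports "HOL-Analysis.Analysis" "HOL-Complex_Analysis.Complex_Analysis"
begin

text \<open>All function spaces consist of representatives, that is, of functions and not of
  classes of functions up to equality almost everywhere.\<close>

definition L2 :: "real set \<Rightarrow> (real \<Rightarrow> complex) set" where
  "L2 S = {f. f \<in> borel_measurable (lebesgue_on S) \<and>
              integrable (lebesgue_on S) (\<lambda>x. (norm (f x))\<^sup>2)}"

definition exponential_type_le :: "real \<Rightarrow> (complex \<Rightarrow> complex) \<Rightarrow> bool" where
  "exponential_type_le \<sigma> f \<longleftrightarrow>
     (\<forall>\<epsilon>>0. \<exists>C. \<forall>z. norm (f z) \<le> C * exp ((\<sigma> + \<epsilon>) * norm z))"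

definition PW :: "real \<Rightarrow> (complex \<Rightarrow> complex) set" where
  "PW \<sigma> = {f. f holomorphic_on UNIV \<and> exponential_type_le \<sigma> f \<and>
              (\<lambda>x. f (complex_of_real x)) \<in> L2 UNIV}"

definition PW_odd :: "real \<Rightarrow> (complex \<Rightarrow> complex) set" where
  "PW_odd \<sigma> = {f \<in> PW \<sigma>. \<forall>z. f (- z) = - f z}"

definition test_function :: "(real \<Rightarrow> real) \<Rightarrow> bool" where
  "test_function \<phi> \<longleftrightarrow>
     (\<forall>k x. (deriv ^^ k) \<phi> field_differentiable (at x)) \<and>
     (\<exists>a b. 0 < a \<and> b < pi \<and> (\<forall>x. x \<notin> {a..b} \<longrightarrow> \<phi> x = 0))"

definition weak_derivative :: "nat \<Rightarrow> (real \<Rightarrow> complex) \<Rightarrow> (real \<Rightarrow> complex) \<Rightarrow> bool" where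
  "weak_derivative k q g \<longleftrightarrow>
     (\<forall>\<phi>. test_function \<phi> \<longrightarrow>
        (LINT x|lebesgue_on {0<..<pi}. q x * complex_of_real ((deriv ^^ k) \<phi> x)) =
        (-1) ^ k * (LINT x|lebesgue_on {0<..<pi}. g x * complex_of_real (\<phi> x)))"

definition sobolev :: "nat \<Rightarrow> (real \<Rightarrow> complex) set" where
  "sobolev m = {q \<in> L2 {0<..<pi}. \<forall>k\<in>{1..m}. \<exists>g \<in> L2 {0<..<pi}. weak_derivative k q g}"

abbreviation deriv_pi :: "(real \<Rightarrow> complex) \<Rightarrow> real \<Rightarrow> complex" where
  "deriv_pi u x \<equiv> vector_derivative u (at x within {0..pi})"

text \<open>\<open>F\<close> is absolutely continuous on \<open>[0, \<pi>]\<close> with derivative \<open>f\<close> almost everywhere.\<close>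

definition primitive_of :: "(real \<Rightarrow> 'a) \<Rightarrow> (real \<Rightarrow> 'a::{real_normed_field, euclidean_space}) \<Rightarrow> bool" where
  "primitive_of F f \<longleftrightarrow>
     integrable (lebesgue_on {0..pi}) f \<and>
     (\<forall>x\<in>{0..pi}. F x = F 0 + (LINT t|lebesgue_on {0..x}. f t))"

text \<open>Solutions of \<open>u'' - q u + lam u = 0\<close> for integrable \<open>q\<close>: \<open>u\<close> is continuously
  differentiable, \<open>u'\<close> is absolutely continuous, and the equation holds almost everywhere.\<close>

definition solves :: "(real \<Rightarrow> complex) \<Rightarrow> complex \<Rightarrow> (real \<Rightarrow> complex) \<Rightarrow> bool" where
  "solves q lam u \<longleftrightarrow>
     (\<exists>u' u''. (\<forall>x\<in>{0..pi}. (u has_vector_derivative u' x) (at x within {0..pi})) \<and>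
               primitive_of u' u'' \<and>
               (AE x in lebesgue_on {0..pi}. u'' x - q x * u x + lam * u x = 0))"

text \<open>Existence and uniqueness of the two solutions on \<open>[0, \<pi>]\<close>, for integrable \<open>q\<close>, are
  shown in \<open>ex_solution\<close> and \<open>solution_unique\<close> below.\<close>

definition c_sol :: "(real \<Rightarrow> complex) \<Rightarrow> complex \<Rightarrow> real \<Rightarrow> complex" where
  "c_sol q \<mu> = (SOME u. solves q (\<mu>\<^sup>2) u \<and> u 0 = 1 \<and> deriv_pi u 0 = 0)"

definition s_sol :: "(real \<Rightarrow> complex) \<Rightarrow> complex \<Rightarrow> real \<Rightarrow> complex" where
  "s_sol q \<mu> = (SOME u. solves q (\<mu>\<^sup>2) u \<and> u 0 = 0 \<and> deriv_pi u 0 = 1)"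

definition char_det :: "(real \<Rightarrow> complex) \<Rightarrow> complex \<Rightarrow> complex" where
  "char_det q \<mu> = c_sol q \<mu> pi - deriv_pi (s_sol q \<mu>) pi"

definition bvp_eigenvalue :: "nat \<Rightarrow> (real \<Rightarrow> complex) \<Rightarrow> complex \<Rightarrow> bool" where
  "bvp_eigenvalue \<theta> q lam \<longleftrightarrow>
     (\<exists>u. solves q lam u \<and> (\<exists>x\<in>{0..pi}. u x \<noteq> 0) \<and>
          deriv_pi u 0 + (-1) ^ \<theta> * deriv_pi u pi = 0 \<and>
          u 0 + (-1) ^ (\<theta> + 1) * u pi = 0)"

lemma integrable_sub:
  fixes f :: "real \<Rightarrow> 'a::euclidean_space"
  assumes "integrable (lebesgue_on {0..pi}) f" "x \<in> {0..pi}"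
  shows "integrable (lebesgue_on {0..x}) f"
  using integrable_subinterval[OF assms(1), of 0 x] assms(2) by auto

lemma continuous_on_lint:
  fixes f :: "real \<Rightarrow> 'a::euclidean_space"
  assumes "integrable (lebesgue_on {0..pi}) f"
  shows "continuous_on {0..pi} (\<lambda>x. LINT t|lebesgue_on {0..x}. f t)"
proof -
  have "(LINT t|lebesgue_on {0..x}. f t) = integral {0..x} f" if "x \<in> {0..pi}" for x
    using integrable_sub[OF assms that] by (simp add: lebesgue_integral_eq_integral)
  moreover have "continuous_on {0..pi} (\<lambda>x. integral {0..x} f)"
    using assms by (intro indefinite_integral_continuous_1 integrable_on_lebesgue_on) auto
  ultimately show ?thesis
    using continuous_on_cong[of "{0..pi}" "{0..pi}"] by (metis (no_types, lifting))
qed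

lemma primitive_ofD:
  "primitive_of F f \<Longrightarrow> x \<in> {0..pi} \<Longrightarrow> F x = F 0 + (LINT t|lebesgue_on {0..x}. f t)"
  unfolding primitive_of_def by blast

lemma primitive_of_continuous: "primitive_of F f \<Longrightarrow> continuous_on {0..pi} F"
proof -
  assume F: "primitive_of F f"
  then have "continuous_on {0..pi} (\<lambda>x. F 0 + (LINT t|lebesgue_on {0..x}. f t))"
    unfolding primitive_of_def by (intro continuous_intros continuous_on_lint) auto
  then show ?thesis
    using F unfolding primitive_of_def by (metis (no_types, lifting) continuous_on_cong)
qed

lemma integrable_cont_mult:
  fixes f :: "real \<Rightarrow> 'a::{real_normed_field, euclidean_space}"
  assumes "continuous_on {a..b} F" "integrable (lebesgue_on {a..b}) f"
  shows "integrable (lebesgue_on {a..b}) (\<lambda>x. F x * f x)"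
proof -
  have "bounded (F ` {a..b})"
    using assms(1) by (intro compact_imp_bounded compact_continuous_image) auto
  then obtain B where B: "\<And>x. x \<in> {a..b} \<Longrightarrow> norm (F x) \<le> B"
    unfolding bounded_iff by fast
  have m: "F \<in> borel_measurable (lebesgue_on {a..b})"
    using assms(1) by (intro continuous_imp_measurable_on_sets_lebesgue) auto
  show ?thesis
  proof (rule Bochner_Integration.integrable_bound[of _ "\<lambda>x. B * norm (f x)"])
    show "integrable (lebesgue_on {a..b}) (\<lambda>x. B * norm (f x))"
      using assms(2) by auto
    show "(\<lambda>x. F x * f x) \<in> borel_measurable (lebesgue_on {a..b})"
      using m assms(2) by auto
    have "norm (F x * f x) \<le> norm (B * norm (f x))" if "x \<in> {a..b}" for x
      using B[OF that] by (simp add: norm_mult abs_mult mult_right_mono)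
    then show "AE x in lebesgue_on {a..b}. norm (F x * f x) \<le> norm (B * norm (f x))"
      by (intro AE_I2) auto
  qed
qed

lemma lint_prod:
  fixes f g :: "real \<Rightarrow> 'a::{real_normed_field, euclidean_space}"
  assumes f: "integrable (lebesgue_on {0..pi}) f" and g: "integrable (lebesgue_on {0..pi}) g"
    and x: "x \<in> {0..pi}"
  defines "F \<equiv> \<lambda>s. (LINT t|lebesgue_on {0..s}. f t)"
  defines "G \<equiv> \<lambda>s. (LINT t|lebesgue_on {0..s}. g t)"
  shows "F x * G x = (LINT t|lebesgue_on {0..x}. f t * G t + F t * g t)"
proof -
  define M where "M = lebesgue_on {0..x}"
  have sf: "sigma_finite_measure M"
    unfolding M_def
    by (intro finite_measure.axioms(1) finite_measure_lebesgue_on) auto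
  interpret sigma_finite_measure M by fact
  interpret P: pair_sigma_finite M M ..
  have fM: "integrable M f" and gM: "integrable M g"
    using f g x integrable_sub unfolding M_def by auto
  have [measurable]: "f \<in> borel_measurable M" "g \<in> borel_measurable M"
    using fM gM by auto
  have [measurable]: "(\<lambda>t. t) \<in> borel_measurable M"
    unfolding M_def by (intro continuous_imp_measurable_on_sets_lebesgue) (auto intro: continuous_intros)
  have [measurable]: "Measurable.pred (M \<Otimes>\<^sub>M M) (\<lambda>p. fst p \<le> snd p)"
    by measurable
  define k where "k = (\<lambda>s t. if s \<le> t then f s * g t else 0)"
  have km: "case_prod k \<in> borel_measurable (M \<Otimes>\<^sub>M M)"
    unfolding k_def case_prod_beta by measurable
  have kb: "norm (k s t) \<le> norm (f s) * norm (g t)" for s t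
    by (auto simp: k_def norm_mult)
  have kint: "integrable M (k s)" for s
  proof (rule Bochner_Integration.integrable_bound[of _ "\<lambda>t. norm (f s) * norm (g t)"])
    show "k s \<in> borel_measurable M"
      unfolding k_def by measurable
  qed (use gM kb in \<open>auto simp: abs_mult\<close>)
  have "integrable M (\<lambda>s. \<integral>t. norm (k s t) \<partial>M)"
  proof (rule Bochner_Integration.integrable_bound[of _ "\<lambda>s. norm (f s) * (\<integral>t. norm (g t) \<partial>M)"])
    show "(\<lambda>s. \<integral>t. norm (k s t) \<partial>M) \<in> borel_measurable M"
      using km by (intro borel_measurable_lebesgue_integral) (auto simp: case_prod_beta)
    have "(\<integral>t. norm (k s t) \<partial>M) \<le> norm (f s) * (\<integral>t. norm (g t) \<partial>M)" for s
    proof -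
      have "(\<integral>t. norm (k s t) \<partial>M) \<le> (\<integral>t. norm (f s) * norm (g t) \<partial>M)"
        using kint gM kb by (intro integral_mono) auto
      then show ?thesis by simp
    qed
    then show "AE s in M. norm (\<integral>t. norm (k s t) \<partial>M)
        \<le> norm (norm (f s) * (\<integral>t. norm (g t) \<partial>M))"
      by (auto simp: abs_mult)
  qed (use fM in auto)
  then have kI: "integrable (M \<Otimes>\<^sub>M M) (case_prod k)"
    using km kint by (intro P.Fubini_integrable) auto
  have sub: "(\<integral>s. h s * (if s \<in> A then 1 else 0) \<partial>M) = (LINT s|lebesgue_on A. h s)"
    if "A \<subseteq> {0..x}" "A \<in> sets lebesgue" for A and h :: "real \<Rightarrow> 'a"
  proof -
    have "(\<integral>s. h s * (if s \<in> A then 1 else 0) \<partial>M) =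
          (LINT s|lebesgue. indicator {0..x} s *\<^sub>R (h s * (if s \<in> A then 1 else 0)))"
      unfolding M_def by (subst integral_restrict_space) auto
    also have "\<dots> = (LINT s|lebesgue. indicator A s *\<^sub>R h s)"
      using that(1) by (intro Bochner_Integration.integral_cong) (auto simp: indicator_def)
    also have "\<dots> = (LINT s|lebesgue_on A. h s)"
      using that(2) by (subst integral_restrict_space) auto
    finally show ?thesis .
  qed
  have inner1: "(\<integral>s. k s t \<partial>M) = F t * g t" if "t \<in> {0..x}" for t
  proof -
    have "(\<integral>s. k s t \<partial>M) = (\<integral>s. (f s * (if s \<in> {0..t} then 1 else 0)) * g t \<partial>M)"
      by (intro Bochner_Integration.integral_cong) (auto simp: k_def M_def)
    also have "\<dots> = (\<integral>s. (f s * (if s \<in> {0..t} then 1 else 0)) \<partial>M) * g t"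
      by (rule integral_mult_left_zero)
    also have "\<dots> = F t * g t"
      using that by (subst sub) (auto simp: F_def)
    finally show ?thesis .
  qed
  have inner2: "(\<integral>t. k s t \<partial>M) = f s * (G x - G s)" if "s \<in> {0..x}" for s
  proof -
    have "(\<integral>t. k s t \<partial>M) = (\<integral>t. f s * (g t * (if t \<in> {s..x} then 1 else 0)) \<partial>M)"
      by (intro Bochner_Integration.integral_cong) (auto simp: k_def M_def)
    also have "\<dots> = f s * (\<integral>t. (g t * (if t \<in> {s..x} then 1 else 0)) \<partial>M)"
      by (rule integral_mult_right_zero)
    also have "\<dots> = f s * (LINT t|lebesgue_on {s..x}. g t)"
      using that by (subst sub) auto
    also have "(LINT t|lebesgue_on {s..x}. g t) = G x - G s"
      using Equivalence_Measurable_On_Borel.integral_combine[of 0 x g s] gM that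
      by (auto simp: G_def M_def)
    finally show ?thesis .
  qed
  have cF: "continuous_on {0..x} F" and cG: "continuous_on {0..x} G"
    using continuous_on_subset[OF continuous_on_lint[OF f], of "{0..x}"]
          continuous_on_subset[OF continuous_on_lint[OF g], of "{0..x}"] x
    by (auto simp: F_def G_def)
  have iFg: "integrable M (\<lambda>t. F t * g t)"
    using integrable_cont_mult[OF cF] gM by (simp add: M_def)
  have ifG: "integrable M (\<lambda>t. f t * G t)"
    using integrable_cont_mult[OF cG fM[unfolded M_def]] by (simp add: M_def mult.commute)
  have "(\<integral>t. F t * g t \<partial>M) = (\<integral>t. (\<integral>s. k s t \<partial>M) \<partial>M)"
    using inner1 by (intro Bochner_Integration.integral_cong) (auto simp: M_def)
  also have "\<dots> = (\<integral>s. (\<integral>t. k s t \<partial>M) \<partial>M)"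
    by (rule P.Fubini_integral[OF kI])
  also have "\<dots> = (\<integral>s. f s * G x - f s * G s \<partial>M)"
    using inner2 by (intro Bochner_Integration.integral_cong) (auto simp: M_def algebra_simps)
  also have "\<dots> = (\<integral>s. f s * G x \<partial>M) - (\<integral>s. f s * G s \<partial>M)"
    using ifG fM by (intro Bochner_Integration.integral_diff) auto
  also have "(\<integral>s. f s * G x \<partial>M) = F x * G x"
    by (simp add: F_def M_def)
  finally show ?thesis
    using ifG iFg by (simp add: M_def)
qed

lemma primitive_of_mult:
  assumes F: "primitive_of F f" and G: "primitive_of G g"
  shows "primitive_of (\<lambda>x. F x * G x) (\<lambda>x. f x * G x + F x * g x)"
proof -
  define \<Phi> where "\<Phi> = (\<lambda>s. (LINT t|lebesgue_on {0..s}. f t))"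
  define \<Gamma> where "\<Gamma> = (\<lambda>s. (LINT t|lebesgue_on {0..s}. g t))"
  have f: "integrable (lebesgue_on {0..pi}) f" and g: "integrable (lebesgue_on {0..pi}) g"
    using F G by (auto simp: primitive_of_def)
  have Fe: "F x = F 0 + \<Phi> x" and Ge: "G x = G 0 + \<Gamma> x" if "x \<in> {0..pi}" for x
    using F G that unfolding primitive_of_def \<Phi>_def \<Gamma>_def by blast+
  have cF: "continuous_on {0..pi} F" and cG: "continuous_on {0..pi} G"
    using F G primitive_of_continuous by blast+
  have i: "integrable (lebesgue_on {0..pi}) (\<lambda>x. f x * G x + F x * g x)"
    using integrable_cont_mult[OF cF g] integrable_cont_mult[OF cG f]
    by (intro Bochner_Integration.integrable_add) (auto simp: mult.commute)
  moreover have "F x * G x = F 0 * G 0 + (LINT t|lebesgue_on {0..x}. f t * G t + F t * g t)"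
    if x: "x \<in> {0..pi}" for x
  proof -
    have c: "continuous_on {0..x} \<Phi>" "continuous_on {0..x} \<Gamma>"
      using continuous_on_subset[OF continuous_on_lint[OF f], of "{0..x}"]
          continuous_on_subset[OF continuous_on_lint[OF g], of "{0..x}"] x
      by (auto simp: \<Phi>_def \<Gamma>_def)
    note fx = integrable_sub[OF f x] and gx = integrable_sub[OF g x]
    have i1: "integrable (lebesgue_on {0..x}) (\<lambda>t. f t * \<Gamma> t)"
      "integrable (lebesgue_on {0..x}) (\<lambda>t. \<Phi> t * g t)"
      using integrable_cont_mult[OF c(2) fx] integrable_cont_mult[OF c(1) gx]
      by (auto simp: mult.commute)
    have "(LINT t|lebesgue_on {0..x}. f t * G t + F t * g t) =
       (LINT t|lebesgue_on {0..x}. (f t * G 0 + F 0 * g t) + (f t * \<Gamma> t + \<Phi> t * g t))"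
    proof (rule Bochner_Integration.integral_cong[OF refl])
      fix t assume "t \<in> space (lebesgue_on {0..x})"
      then have "t \<in> {0..pi}" using x by auto
      then show "f t * G t + F t * g t = (f t * G 0 + F 0 * g t) + (f t * \<Gamma> t + \<Phi> t * g t)"
        by (simp add: Fe[of t] Ge[of t] algebra_simps)
    qed
    also have "\<dots> = (LINT t|lebesgue_on {0..x}. f t * G 0 + F 0 * g t) + \<Phi> x * \<Gamma> x"
      using i1 fx gx lint_prod[OF f g x, folded \<Phi>_def \<Gamma>_def]
      by (subst Bochner_Integration.integral_add) (auto simp: \<Phi>_def \<Gamma>_def)
    also have "(LINT t|lebesgue_on {0..x}. f t * G 0 + F 0 * g t) = \<Phi> x * G 0 + F 0 * \<Gamma> x"
      using fx gx by (subst Bochner_Integration.integral_add) (auto simp: \<Phi>_def \<Gamma>_def)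
    finally show ?thesis
      by (simp add: Fe[OF x] Ge[OF x] algebra_simps)
  qed
  ultimately show ?thesis
    unfolding primitive_of_def by blast
qed


lemma primitive_of_diff:
  assumes "primitive_of F f" "primitive_of G g"
  shows "primitive_of (\<lambda>x. F x - G x) (\<lambda>x. f x - g x)"
proof -
  have "F x - G x = F 0 - G 0 + (LINT t|lebesgue_on {0..x}. f t - g t)" if "x \<in> {0..pi}" for x
  proof -
    have "integrable (lebesgue_on {0..x}) f" "integrable (lebesgue_on {0..x}) g"
      using assms that integrable_sub unfolding primitive_of_def by blast+
    then show ?thesis
      by (simp add: primitive_ofD[OF assms(1) that] primitive_ofD[OF assms(2) that])
  qed
  moreover have "integrable (lebesgue_on {0..pi}) (\<lambda>x. f x - g x)"
    using assms unfolding primitive_of_def by (intro Bochner_Integration.integrable_diff) blast+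
  ultimately show ?thesis
    unfolding primitive_of_def by blast
qed

lemma primitive_of_const:
  assumes "primitive_of F f" "AE x in lebesgue_on {0..pi}. f x = 0" "x \<in> {0..pi}"
  shows "F x = F 0"
proof -
  have "AE t in lebesgue_on {0..x}. f t = 0"
  proof -
    have "AE t in lebesgue. t \<in> {0..pi} \<longrightarrow> f t = 0"
      using assms(2) by (subst (asm) AE_restrict_space_iff) auto
    then have "AE t in lebesgue. t \<in> {0..x} \<longrightarrow> f t = 0"
      using assms(3) by (auto elim!: eventually_mono)
    then show ?thesis
      by (subst AE_restrict_space_iff) auto
  qed
  then have "(LINT t|lebesgue_on {0..x}. f t) = 0"
    by (rule integral_eq_zero_AE)
  then show ?thesis
    by (simp add: primitive_ofD[OF assms(1,3)])
qed

lemma primitive_of_C1: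
  assumes "\<And>x. x \<in> {0..pi} \<Longrightarrow> (u has_vector_derivative u' x) (at x within {0..pi})"
    and c: "continuous_on {0..pi} u'"
  shows "primitive_of u u'"
proof -
  have i: "integrable (lebesgue_on {0..pi}) u'"
    using c by (rule continuous_imp_integrable_real)
  moreover have "u x = u 0 + (LINT t|lebesgue_on {0..x}. u' t)" if x: "x \<in> {0..pi}" for x
  proof -
    have "(u' has_integral (u x - u 0)) {0..x}"
    proof (rule fundamental_theorem_of_calculus)
      show "(u has_vector_derivative u' y) (at y within {0..x})" if "y \<in> {0..x}" for y
        using has_vector_derivative_within_subset[OF assms(1)[of y], of "{0..x}"] that x by auto
    qed (use x in auto)
    then have "integral {0..x} u' = u x - u 0"
      by (rule integral_unique)
    moreover have "(LINT t|lebesgue_on {0..x}. u' t) = integral {0..x} u'"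
      using integrable_sub[OF i x] by (simp add: lebesgue_integral_eq_integral)
    ultimately show ?thesis by simp
  qed
  ultimately show ?thesis
    unfolding primitive_of_def by blast
qed

lemma solvesE:
  assumes "solves q lam u"
  obtains u'' where "primitive_of u (deriv_pi u)" "primitive_of (deriv_pi u) u''"
    "AE x in lebesgue_on {0..pi}. u'' x - q x * u x + lam * u x = 0"
    "\<And>x. x \<in> {0..pi} \<Longrightarrow> (u has_vector_derivative deriv_pi u x) (at x within {0..pi})"
proof -
  obtain u' u'' where d: "\<And>x. x \<in> {0..pi} \<Longrightarrow> (u has_vector_derivative u' x) (at x within {0..pi})"
    and p: "primitive_of u' u''"
    and ae: "AE x in lebesgue_on {0..pi}. u'' x - q x * u x + lam * u x = 0"
    using assms unfolding solves_def by blast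
  have e: "deriv_pi u x = u' x" if "x \<in> {0..pi}" for x
    using vector_derivative_within_closed_interval[OF _ that d[OF that]] by simp
  have "primitive_of (deriv_pi u) u''"
    unfolding primitive_of_def
  proof (intro conjI ballI)
    show "integrable (lebesgue_on {0..pi}) u''"
      using p by (simp add: primitive_of_def)
    show "deriv_pi u x = deriv_pi u 0 + (LINT t|lebesgue_on {0..x}. u'' t)" if "x \<in> {0..pi}" for x
      using e[OF that] e[of 0] primitive_ofD[OF p that] by simp
  qed
  moreover have "(u has_vector_derivative deriv_pi u x) (at x within {0..pi})"
    if "x \<in> {0..pi}" for x
    using d[OF that] e[OF that] by simp
  moreover from this have "primitive_of u (deriv_pi u)"
    by (rule primitive_of_C1) (use calculation(1) primitive_of_continuous in auto)
  ultimately show ?thesis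
    using ae that by blast
qed

lemma wronskian_const:
  assumes "solves q lam u" "solves q lam w" "x \<in> {0..pi}"
  shows "u x * deriv_pi w x - deriv_pi u x * w x = u 0 * deriv_pi w 0 - deriv_pi u 0 * w 0"
proof -
  obtain u'' where u: "primitive_of u (deriv_pi u)" "primitive_of (deriv_pi u) u''"
    "AE x in lebesgue_on {0..pi}. u'' x - q x * u x + lam * u x = 0"
    by (rule solvesE[OF assms(1)])
  obtain w'' where w: "primitive_of w (deriv_pi w)" "primitive_of (deriv_pi w) w''"
    "AE x in lebesgue_on {0..pi}. w'' x - q x * w x + lam * w x = 0"
    by (rule solvesE[OF assms(2)])
  have p: "primitive_of (\<lambda>x. u x * deriv_pi w x - deriv_pi u x * w x)
     (\<lambda>x. (deriv_pi u x * deriv_pi w x + u x * w'' x) - (u'' x * w x + deriv_pi u x * deriv_pi w x))"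
    by (rule primitive_of_diff[OF primitive_of_mult[OF u(1) w(2)] primitive_of_mult[OF u(2) w(1)]])
  have "AE x in lebesgue_on {0..pi}.
     (deriv_pi u x * deriv_pi w x + u x * w'' x) - (u'' x * w x + deriv_pi u x * deriv_pi w x) = 0"
    using u(3) w(3)
  proof eventually_elim
    case (elim x)
    have "(deriv_pi u x * deriv_pi w x + u x * w'' x) - (u'' x * w x + deriv_pi u x * deriv_pi w x)
      = u x * (w'' x - q x * w x + lam * w x) - (u'' x - q x * u x + lam * u x) * w x"
      by (simp add: algebra_simps)
    then show ?case unfolding elim by simp
  qed
  from primitive_of_const[OF p this assms(3)] show ?thesis .
qed

lemma primitive_of_lint:
  assumes "integrable (lebesgue_on {0..pi}) f"
  shows "primitive_of (\<lambda>x. a + (LINT t|lebesgue_on {0..x}. f t)) f"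
proof -
  have "(LINT t|lebesgue_on {0..0::real}. f t) = 0"
    by (intro integral_eq_zero_null_sets null_setsI) (auto simp: emeasure_restrict_space null_sets_def)
  with assms show ?thesis unfolding primitive_of_def by auto
qed

lemma primitive_of_power:
  fixes K :: "real \<Rightarrow> real"
  assumes "primitive_of K k" "K 0 = 0"
  shows "primitive_of (\<lambda>x. K x ^ Suc n) (\<lambda>x. real (Suc n) * (K x ^ n * k x))"
proof (induction n)
  case 0
  then show ?case using assms by simp
next
  case (Suc n)
  from primitive_of_mult[OF assms(1) Suc.IH] show ?case
    by (simp add: algebra_simps)
qed

lemma ex_solution:
  assumes q: "integrable (lebesgue_on {0..pi}) q"
  shows "\<exists>u. solves q lam u \<and> u 0 = a \<and> deriv_pi u 0 = b"
proof -
  define p where "p = (\<lambda>x. q x - lam)"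
  have c1: "integrable (lebesgue_on {0..pi}) (\<lambda>x. c)" for c :: complex
    by (rule continuous_imp_integrable_real) auto
  have c2: "integrable (lebesgue_on {0..pi}) (\<lambda>x. c)" for c :: real
    by (rule continuous_imp_integrable_real) auto
  have p: "integrable (lebesgue_on {0..pi}) p"
    unfolding p_def using q c1 by auto
  define k where "k = (\<lambda>x. 1 + norm (p x))"
  have k: "integrable (lebesgue_on {0..pi}) k"
    unfolding k_def using p c2 by auto
  define K where "K = (\<lambda>x. 0 + (LINT t|lebesgue_on {0..x}. k t))"
  have K: "primitive_of K k"
    unfolding K_def using k by (rule primitive_of_lint)
  have K0: "K 0 = 0"
  proof -
    have "K 0 = K 0 + (LINT t|lebesgue_on {0..0}. k t)"
      using K pi_ge_zero unfolding primitive_of_def by (metis atLeastAtMost_iff order_refl)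
    then show ?thesis unfolding K_def by simp
  qed
  have Knn: "0 \<le> K x" for x
    unfolding K_def by (simp, rule Bochner_Integration.integral_nonneg) (simp add: k_def)
  have Kmono: "K x \<le> K pi" if "x \<in> {0..pi}" for x
  proof -
    have "K pi = K x + (LINT t|lebesgue_on {x..pi}. k t)"
      using Equivalence_Measurable_On_Borel.integral_combine[OF k, of x] that by (auto simp: K_def)
    moreover have "0 \<le> (LINT t|lebesgue_on {x..pi}. k t)"
      by (rule Bochner_Integration.integral_nonneg) (simp add: k_def)
    ultimately show ?thesis by simp
  qed
  have cK: "continuous_on {0..pi} K"
    using K by (rule primitive_of_continuous)
  define M where "M = norm a + norm b"
  have M: "0 \<le> M" unfolding M_def by simp
  define B where "B = (\<lambda>n x. M * K x ^ n / fact n)"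
  have Bk: "integrable (lebesgue_on {0..pi}) (\<lambda>t. B n t * k t)" for n
    unfolding B_def by (intro integrable_cont_mult k continuous_intros cK) auto
  have Bint: "(LINT t|lebesgue_on {0..x}. B n t * k t) = B (Suc n) x" if x: "x \<in> {0..pi}" for n x
  proof -
    have "K x ^ Suc n = K 0 ^ Suc n + (LINT t|lebesgue_on {0..x}. real (Suc n) * (K t ^ n * k t))"
      using primitive_of_power[OF K K0, of n] x unfolding primitive_of_def by blast
    then have "K x ^ Suc n = real (Suc n) * (LINT t|lebesgue_on {0..x}. K t ^ n * k t)"
      using K0 by simp
    moreover have "(LINT t|lebesgue_on {0..x}. B n t * k t) =
        M / fact n * (LINT t|lebesgue_on {0..x}. K t ^ n * k t)"
      unfolding B_def by (subst integral_mult_right_zero[symmetric]) (simp add: mult.assoc)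
    ultimately show ?thesis
      by (simp add: B_def del: power_Suc of_nat_Suc)
  qed
  define T where "T = (\<lambda>(U, V). ((\<lambda>x::real. LINT t|lebesgue_on {0..x}. V t :: complex),
                                (\<lambda>x. LINT t|lebesgue_on {0..x}. U t * p t :: complex)))"
  define U where "U = (\<lambda>n. fst ((T ^^ n) ((\<lambda>_. a), (\<lambda>_. b))))"
  define V where "V = (\<lambda>n. snd ((T ^^ n) ((\<lambda>_. a), (\<lambda>_. b))))"
  have U0: "U 0 = (\<lambda>_. a)" and V0: "V 0 = (\<lambda>_. b)"
    by (auto simp: U_def V_def)
  have US: "U (Suc n) = (\<lambda>x. LINT t|lebesgue_on {0..x}. V n t)"
    and VS: "V (Suc n) = (\<lambda>x. LINT t|lebesgue_on {0..x}. U n t * p t)" for n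
    by (auto simp: U_def V_def T_def case_prod_beta)
  have cont: "continuous_on {0..pi} (U n) \<and> continuous_on {0..pi} (V n)" for n
  proof (induction n)
    case 0
    then show ?case by (simp add: U0 V0)
  next
    case (Suc n)
    then have "integrable (lebesgue_on {0..pi}) (V n)"
      "integrable (lebesgue_on {0..pi}) (\<lambda>t. U n t * p t)"
      using continuous_imp_integrable_real[of 0 pi "V n"] integrable_cont_mult[OF _ p, of "U n"]
      by blast+
    then show ?case
      unfolding US VS by (intro conjI continuous_on_lint)
  qed
  have iV: "integrable (lebesgue_on {0..pi}) (V n)"
    and iU: "integrable (lebesgue_on {0..pi}) (\<lambda>t. U n t * p t)" for n
    using cont[of n] continuous_imp_integrable_real[of 0 pi "V n"] integrable_cont_mult[OF _ p, of "U n"]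
    by blast+
  have Bnn: "0 \<le> B n x" for n x
    using M Knn by (simp add: B_def)
  have bnd: "\<forall>x\<in>{0..pi}. norm (U n x) \<le> B n x \<and> norm (V n x) \<le> B n x" for n
  proof (induction n)
    case 0
    then show ?case by (simp add: U0 V0 B_def M_def)
  next
    case (Suc n)
    show ?case
    proof (intro ballI)
      fix x assume x: "x \<in> {0..pi}"
      have 1: "norm (V n t) \<le> B n t * k t" and 2: "norm (U n t * p t) \<le> B n t * k t"
        if t: "t \<in> {0..x}" for t
      proof -
        have t': "t \<in> {0..pi}" using t x by auto
        have "norm (V n t) \<le> B n t * 1" using Suc t' by simp
        also have "\<dots> \<le> B n t * k t" by (intro mult_left_mono Bnn) (simp add: k_def)
        finally show "norm (V n t) \<le> B n t * k t" .
        have "norm (U n t * p t) \<le> B n t * norm (p t)"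
          using Suc t' by (simp add: norm_mult mult_right_mono)
        also have "\<dots> \<le> B n t * k t" by (intro mult_left_mono Bnn) (simp add: k_def)
        finally show "norm (U n t * p t) \<le> B n t * k t" .
      qed
      show "norm (U (Suc n) x) \<le> B (Suc n) x \<and> norm (V (Suc n) x) \<le> B (Suc n) x"
        unfolding US VS Bint[OF x, symmetric]
        using 1 2 integrable_sub[OF iV x] integrable_sub[OF iU x] integrable_sub[OF Bk x]
        by (intro conjI Bochner_Integration.integral_norm_bound_integral) auto
    qed
  qed
  define C where "C = (\<lambda>n. M * (K pi ^ n / fact n))"
  have BC: "B n x \<le> C n" if "x \<in> {0..pi}" for n x
    using Kmono[OF that] Knn M
    by (auto simp: B_def C_def intro!: mult_left_mono divide_right_mono power_mono)
  have sC: "summable C"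
    unfolding C_def using summable_exp_generic[of "K pi"]
    by (intro summable_mult) (simp add: scaleR_conv_of_real field_simps)
  have bU: "norm (U n x) \<le> C n" and bV: "norm (V n x) \<le> C n" if "x \<in> {0..pi}" for n x
    using bnd[of n] BC[OF that, of n] that by force+
  have sU: "summable (\<lambda>n. norm (U n x))" and sV: "summable (\<lambda>n. norm (V n x))"
    if "x \<in> {0..pi}" for x
    using bU[OF that] bV[OF that] by (auto intro: summable_comparison_test'[OF sC])
  define u where "u = (\<lambda>x. \<Sum>n. U n x)"
  define v where "v = (\<lambda>x. \<Sum>n. V n x)"
  have up: "u x * p x = (\<Sum>n. U n x * p x)" if "x \<in> {0..pi}" for x
    unfolding u_def using summable_norm_cancel[OF sU[OF that]] by (rule suminf_mult2)
  have swap: "integrable (lebesgue_on {0..x}) (\<lambda>t. \<Sum>n. h n t) \<and>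
      (\<lambda>n. LINT t|lebesgue_on {0..x}. h n t) sums (LINT t|lebesgue_on {0..x}. (\<Sum>n. h n t))"
    if h: "\<And>n. integrable (lebesgue_on {0..pi}) (h n)"
      and hb: "\<And>n t. t \<in> {0..pi} \<Longrightarrow> norm (h n t) \<le> C n * k t" and x: "x \<in> {0..pi}"
    for h :: "nat \<Rightarrow> real \<Rightarrow> complex" and x
  proof -
    have i: "integrable (lebesgue_on {0..x}) (h n)" for n
      using h x by (rule integrable_sub)
    have b: "norm (h n t) \<le> C n * k t" if "t \<in> {0..x}" for n t
      using hb that x by auto
    have s: "summable (\<lambda>n. C n * k t)" for t
      using sC by (rule summable_mult2)
    have ae: "AE t in lebesgue_on {0..x}. summable (\<lambda>n. norm (h n t))"
      using b by (intro AE_I2 summable_comparison_test'[OF s]) auto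
    have "norm (LINT t|lebesgue_on {0..x}. norm (h n t)) \<le> C n * K x" for n
    proof -
      have "(LINT t|lebesgue_on {0..x}. norm (h n t)) \<le> (LINT t|lebesgue_on {0..x}. C n * k t)"
        using i b integrable_sub[OF k x] by (intro integral_mono) auto
      then show ?thesis by (simp add: K_def)
    qed
    then have "summable (\<lambda>n. LINT t|lebesgue_on {0..x}. norm (h n t))"
      by (intro summable_comparison_test'[OF summable_mult2[OF sC]])
    from integrable_suminf[OF i ae this] sums_integral[OF i ae this] show ?thesis by simp
  qed
  have Ck: "norm (V n t) \<le> C n * k t" "norm (U n t * p t) \<le> C n * k t"
    if t: "t \<in> {0..pi}" for n t
  proof -
    have Cn: "0 \<le> C n" using Bnn[of n t] BC[OF t, of n] by linarith
    have "norm (V n t) \<le> C n * 1" using bV t by simp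
    also have "\<dots> \<le> C n * k t" by (intro mult_left_mono Cn) (simp add: k_def)
    finally show "norm (V n t) \<le> C n * k t" .
    have "norm (U n t * p t) \<le> C n * norm (p t)"
      using bU t by (simp add: norm_mult mult_right_mono)
    also have "\<dots> \<le> C n * k t" by (intro mult_left_mono Cn) (simp add: k_def)
    finally show "norm (U n t * p t) \<le> C n * k t" .
  qed
  have pie: "pi \<in> {0..pi}" "0 \<in> {0..pi}" by auto
  have ipu: "integrable (lebesgue_on {0..pi}) (\<lambda>t. u t * p t)"
    using conjunct1[OF swap[of "\<lambda>n t. U n t * p t", OF iU Ck(2) pie(1)]]
    by (rule Bochner_Integration.integrable_cong[THEN iffD1, rotated 2]) (auto simp: up)
  have iv: "integrable (lebesgue_on {0..pi}) v"
    using conjunct1[OF swap[of V, OF iV Ck(1) pie(1)]] by (simp add: v_def)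
  have u_eq: "u x = a + (LINT t|lebesgue_on {0..x}. v t)" if x: "x \<in> {0..pi}" for x
  proof -
    have "(\<lambda>n. U (Suc n) x) sums (LINT t|lebesgue_on {0..x}. v t)"
      using swap[of V, OF iV Ck(1) x] by (simp add: v_def US)
    then have "(\<lambda>n. U n x) sums ((LINT t|lebesgue_on {0..x}. v t) + U 0 x)"
      by (subst (asm) sums_Suc_iff) simp
    then show ?thesis by (simp add: u_def sums_unique[symmetric] U0)
  qed
  have v_eq: "v x = b + (LINT t|lebesgue_on {0..x}. u t * p t)" if x: "x \<in> {0..pi}" for x
  proof -
    have "(LINT t|lebesgue_on {0..x}. (\<Sum>n. U n t * p t)) = (LINT t|lebesgue_on {0..x}. u t * p t)"
      using x by (intro Bochner_Integration.integral_cong) (auto simp: up)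
    then have "(\<lambda>n. V (Suc n) x) sums (LINT t|lebesgue_on {0..x}. u t * p t)"
      using swap[of "\<lambda>n t. U n t * p t", OF iU Ck(2) x] by (simp add: VS)
    then have "(\<lambda>n. V n x) sums ((LINT t|lebesgue_on {0..x}. u t * p t) + V 0 x)"
      by (subst (asm) sums_Suc_iff) simp
    then show ?thesis by (simp add: v_def sums_unique[symmetric] V0)
  qed
  have null: "(LINT t|lebesgue_on {0..0::real}. f t) = 0" for f :: "real \<Rightarrow> complex"
    by (intro integral_eq_zero_null_sets null_setsI) (auto simp: emeasure_restrict_space null_sets_def)
  have pv: "primitive_of v (\<lambda>t. u t * p t)"
    unfolding primitive_of_def using v_eq ipu v_eq[OF pie(2)] null by (metis add.right_neutral)
  have cv: "continuous_on {0..pi} v"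
    using pv by (rule primitive_of_continuous)
  have du: "(u has_vector_derivative v x) (at x within {0..pi})" if x: "x \<in> {0..pi}" for x
  proof -
    have "((\<lambda>y. a + integral {0..y} v) has_vector_derivative v x) (at x within {0..pi})"
      using integral_has_vector_derivative[OF cv x]
      by (auto intro!: derivative_eq_intros)
    moreover have "a + integral {0..y} v = u y" if y: "y \<in> {0..pi}" for y
      using u_eq[OF y] integrable_sub[OF iv y] by (simp add: lebesgue_integral_eq_integral)
    ultimately show ?thesis
      by (intro has_vector_derivative_transform[OF x, of u "\<lambda>y. a + integral {0..y} v"]) auto
  qed
  have "solves q lam u"
    unfolding solves_def
    by (intro exI[of _ v] exI[of _ "\<lambda>t. u t * p t"] conjI)
      (use du pv in \<open>auto simp: p_def algebra_simps\<close>)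
  moreover have "u 0 = a" "v 0 = b"
    using u_eq[OF pie(2)] v_eq[OF pie(2)] null by auto
  moreover have "deriv_pi u 0 = v 0"
    using vector_derivative_within_closed_interval[OF _ pie(2) du[OF pie(2)]] by simp
  ultimately show ?thesis by metis
qed

lemma c_sol:
  assumes "integrable (lebesgue_on {0..pi}) q"
  shows "solves q (\<mu>\<^sup>2) (c_sol q \<mu>)" "c_sol q \<mu> 0 = 1" "deriv_pi (c_sol q \<mu>) 0 = 0"
  using someI_ex[OF ex_solution[OF assms, of "\<mu>\<^sup>2" 1 0]] unfolding c_sol_def by auto

lemma s_sol:
  assumes "integrable (lebesgue_on {0..pi}) q"
  shows "solves q (\<mu>\<^sup>2) (s_sol q \<mu>)" "s_sol q \<mu> 0 = 0" "deriv_pi (s_sol q \<mu>) 0 = 1"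
  using someI_ex[OF ex_solution[OF assms, of "\<mu>\<^sup>2" 0 1]] unfolding s_sol_def by auto

lemma solution_repr:
  assumes q: "integrable (lebesgue_on {0..pi}) q" and u: "solves q (\<mu>\<^sup>2) u" and x: "x \<in> {0..pi}"
  shows "u x = u 0 * c_sol q \<mu> x + deriv_pi u 0 * s_sol q \<mu> x"
    and "deriv_pi u x = u 0 * deriv_pi (c_sol q \<mu>) x + deriv_pi u 0 * deriv_pi (s_sol q \<mu>) x"
    and "c_sol q \<mu> x * deriv_pi (s_sol q \<mu>) x - deriv_pi (c_sol q \<mu>) x * s_sol q \<mu> x = 1"
proof -
  note c = c_sol[OF q, of \<mu>] and s = s_sol[OF q, of \<mu>]
  let ?c = "c_sol q \<mu> x" and ?s = "s_sol q \<mu> x"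
  let ?c' = "deriv_pi (c_sol q \<mu>) x" and ?s' = "deriv_pi (s_sol q \<mu>) x"
  have 1: "?c * ?s' - ?c' * ?s = 1"
    using wronskian_const[OF c(1) s(1) x] c s by simp
  then show "?c * ?s' - ?c' * ?s = 1" .
  have 2: "u 0 = u x * ?s' - deriv_pi u x * ?s"
    using wronskian_const[OF u s(1) x] s by simp
  have 3: "deriv_pi u 0 = ?c * deriv_pi u x - ?c' * u x"
    using wronskian_const[OF c(1) u x] c by simp
  have "u 0 * ?c + deriv_pi u 0 * ?s = u x * (?c * ?s' - ?c' * ?s)"
    unfolding 2 3 by (simp add: algebra_simps)
  then show "u x = u 0 * ?c + deriv_pi u 0 * ?s" using 1 by simp
  have "u 0 * ?c' + deriv_pi u 0 * ?s' = deriv_pi u x * (?c * ?s' - ?c' * ?s)"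
    unfolding 2 3 by (simp add: algebra_simps)
  then show "deriv_pi u x = u 0 * ?c' + deriv_pi u 0 * ?s'" using 1 by simp
qed

lemma solution_unique:
  assumes q: "integrable (lebesgue_on {0..pi}) q"
    and "solves q lam u" "solves q lam w" "u 0 = w 0" "deriv_pi u 0 = deriv_pi w 0" "x \<in> {0..pi}"
  shows "u x = w x" "deriv_pi u x = deriv_pi w x"
proof -
  have u: "solves q ((csqrt lam)\<^sup>2) u" and w: "solves q ((csqrt lam)\<^sup>2) w"
    using assms(2,3) by simp_all
  show "u x = w x"
    unfolding solution_repr(1)[OF q u assms(6)] solution_repr(1)[OF q w assms(6)] assms(4,5) ..
  show "deriv_pi u x = deriv_pi w x"
    unfolding solution_repr(2)[OF q u assms(6)] solution_repr(2)[OF q w assms(6)] assms(4,5) ..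
qed


lemma L2_integrable:
  assumes "q \<in> L2 {0<..<pi}"
  shows "integrable (lebesgue_on {0..pi}) q"
proof -
  let ?M = "lebesgue_on {0<..<pi}"
  have m: "q \<in> borel_measurable ?M" and i: "integrable ?M (\<lambda>x. (norm (q x))\<^sup>2)"
    using assms by (auto simp: L2_def)
  interpret finite_measure ?M
    by (intro finite_measure_lebesgue_on) (auto simp: lmeasurable_box)
  have "norm (q x) \<le> norm (1 + (norm (q x))\<^sup>2)" for x
  proof -
    have "2 * norm (q x) \<le> (norm (q x))\<^sup>2 + 1"
      using sum_squares_bound[of "norm (q x)" 1] by simp
    then have "norm (q x) \<le> 1 + (norm (q x))\<^sup>2"
      using norm_ge_zero[of "q x"] by linarith
    then show ?thesis by simp
  qed
  then have "integrable ?M q"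
    using m i
    by (intro Bochner_Integration.integrable_bound[of ?M "\<lambda>x. 1 + (norm (q x))\<^sup>2" q]
        Bochner_Integration.integrable_add integrable_const AE_I2)
  then have "q absolutely_integrable_on {0<..<pi}"
    using integrable_restrict_space[of "{0<..<pi}" lebesgue q] by (simp add: set_integrable_def)
  then have "q absolutely_integrable_on {0..pi}"
    by (simp add: absolutely_integrable_on_Icc_iff_Ioo)
  then show ?thesis
    using integrable_restrict_space[of "{0..pi}" lebesgue q] by (simp add: set_integrable_def)
qed

text \<open>\<^const>\<open>char_det\<close> is the characteristic determinant of the boundary value problem:\<close>

lemma bvp_eigenvalue_iff:
  assumes q: "integrable (lebesgue_on {0..pi}) q"
  shows "bvp_eigenvalue \<theta> q (\<mu>\<^sup>2) \<longleftrightarrow> char_det q \<mu> = 0"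
proof -
  define e :: complex where "e = (-1) ^ \<theta>"
  have e: "e * e = 1" by (simp add: e_def flip: power_mult_distrib)
  define c where "c = c_sol q \<mu> pi"
  define s where "s = s_sol q \<mu> pi"
  define c' where "c' = deriv_pi (c_sol q \<mu>) pi"
  define s' where "s' = deriv_pi (s_sol q \<mu>) pi"
  have pie: "pi \<in> {0..pi}" "0 \<in> {0..pi}" by auto
  have w: "c * s' - c' * s = 1"
    using solution_repr(3)[OF q c_sol(1)[OF q] pie(1)] by (simp add: c_def s_def c'_def s'_def)
  have rep: "u pi = u 0 * c + deriv_pi u 0 * s" "deriv_pi u pi = u 0 * c' + deriv_pi u 0 * s'"
    if "solves q (\<mu>\<^sup>2) u" for u
    using solution_repr(1,2)[OF q that pie(1)] by (auto simp: c_def s_def c'_def s'_def)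
  have nz: "(\<exists>x\<in>{0..pi}. u x \<noteq> 0) \<longleftrightarrow> u 0 \<noteq> 0 \<or> deriv_pi u 0 \<noteq> 0"
    if u: "solves q (\<mu>\<^sup>2) u" for u
  proof
    show "u 0 \<noteq> 0 \<or> deriv_pi u 0 \<noteq> 0" if ex: "\<exists>x\<in>{0..pi}. u x \<noteq> 0"
    proof (rule ccontr)
      assume z: "\<not> ?thesis"
      obtain x where x: "x \<in> {0..pi}" "u x \<noteq> 0" using ex by blast
      show False using solution_repr(1)[OF q u x(1)] x(2) z by simp
    qed
  next
    assume nn: "u 0 \<noteq> 0 \<or> deriv_pi u 0 \<noteq> 0"
    show "\<exists>x\<in>{0..pi}. u x \<noteq> 0"
    proof (rule ccontr)
      assume "\<not> ?thesis"
      then have z: "\<And>x. x \<in> {0..pi} \<Longrightarrow> u x = 0" by blast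
      have "((\<lambda>x. 0) has_vector_derivative (0::complex)) (at 0 within {0..pi})" by simp
      then have "(u has_vector_derivative 0) (at 0 within {0..pi})"
        by (rule has_vector_derivative_transform[rotated 2]) (use z in auto)
      then have "deriv_pi u 0 = 0"
        using vector_derivative_within_closed_interval[OF _ pie(2)] by simp
      then show False using nn z by auto
    qed
  qed
  have bc: "bvp_eigenvalue \<theta> q (\<mu>\<^sup>2) \<longleftrightarrow>
     (\<exists>A B. (A \<noteq> 0 \<or> B \<noteq> 0) \<and> B + e * (A * c' + B * s') = 0 \<and> A - e * (A * c + B * s) = 0)"
    (is "_ \<longleftrightarrow> ?R")
  proof
    assume "bvp_eigenvalue \<theta> q (\<mu>\<^sup>2)"
    then obtain u where u: "solves q (\<mu>\<^sup>2) u" "\<exists>x\<in>{0..pi}. u x \<noteq> 0"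
      "deriv_pi u 0 + e * deriv_pi u pi = 0" "u 0 - e * u pi = 0"
      unfolding bvp_eigenvalue_def e_def by auto
    show ?R
      using u(3,4) nz[OF u(1)] u(2) unfolding rep[OF u(1)] by (intro exI[of _ "u 0"] exI[of _ "deriv_pi u 0"]) simp
  next
    assume ?R
    then obtain A B where AB: "A \<noteq> 0 \<or> B \<noteq> 0" "B + e * (A * c' + B * s') = 0"
      "A - e * (A * c + B * s) = 0" by blast
    obtain u where u: "solves q (\<mu>\<^sup>2) u" "u 0 = A" "deriv_pi u 0 = B"
      using ex_solution[OF q] by blast
    have "deriv_pi u 0 + e * deriv_pi u pi = 0 \<and> u 0 - e * u pi = 0"
      unfolding rep[OF u(1)] u(2,3) using AB by blast
    moreover have "\<exists>x\<in>{0..pi}. u x \<noteq> 0"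
      using nz[OF u(1)] u AB by blast
    ultimately show "bvp_eigenvalue \<theta> q (\<mu>\<^sup>2)"
      unfolding bvp_eigenvalue_def using u(1) by (intro exI[of _ u]) (simp add: e_def)
  qed
  have cd: "char_det q \<mu> = c - s'"
    by (simp add: char_det_def c_def s'_def)
  show ?thesis
    unfolding bc cd
  proof
    assume "\<exists>A B. (A \<noteq> 0 \<or> B \<noteq> 0) \<and> B + e * (A * c' + B * s') = 0 \<and> A - e * (A * c + B * s) = 0"
    then obtain A B where AB: "A \<noteq> 0 \<or> B \<noteq> 0" "B + e * (A * c' + B * s') = 0"
      "A - e * (A * c + B * s) = 0" by blast
    have "A * (c - s') = 0" "B * (c - s') = 0"
      using AB(2,3) e w by algebra+
    then show "c - s' = 0" using AB(1) by auto
  next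
    assume z: "c - s' = 0"
    show "\<exists>A B. (A \<noteq> 0 \<or> B \<noteq> 0) \<and> B + e * (A * c' + B * s') = 0 \<and> A - e * (A * c + B * s) = 0"
    proof (cases "1 + e * s' \<noteq> 0 \<or> - e * c' \<noteq> 0")
      case True
      have "(- e * c') + e * ((1 + e * s') * c' + (- e * c') * s') = 0"
        by (simp add: algebra_simps)
      moreover have "(1 + e * s') - e * ((1 + e * s') * c + (- e * c') * s) =
          1 - (e * e) * (c * s' - c' * s) - e * (c - s')"
        by (simp add: algebra_simps)
      then have "(1 + e * s') - e * ((1 + e * s') * c + (- e * c') * s) = 0"
        unfolding z e w by simp
      ultimately have "\<exists>A B. (A \<noteq> 0 \<or> B \<noteq> 0) \<and> B + e * (A * c' + B * s') = 0 \<and> A - e * (A * c + B * s) = 0"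
        using True by blast
      then show ?thesis .
    next
      case F: False
      show ?thesis
      proof (cases "e * s \<noteq> 0 \<or> 1 - e * c \<noteq> 0")
        case True
        have "(1 - e * c) + e * ((e * s) * c' + (1 - e * c) * s') =
            1 - (e * e) * (c * s' - c' * s) - e * (c - s')"
          by (simp add: algebra_simps)
        then have "(1 - e * c) + e * ((e * s) * c' + (1 - e * c) * s') = 0"
          unfolding z e w by simp
        moreover have "(e * s) - e * ((e * s) * c + (1 - e * c) * s) = 0"
          by (simp add: algebra_simps)
        ultimately show ?thesis using True by blast
      next
        case False
        have "0 + e * (1 * c' + 0 * s') = 0" "1 - e * (1 * c + 0 * s) = 0"
          using False F by auto
        then show ?thesis by (metis zero_neq_one)
      qed
    qed
  qed
qed

end

theory Submission
  imports Defs
begin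

text \<open>
  Let \<open>v = f / \<mu>\<close>, an even entire function. Adding a real constant \<open>Q\<close> to a potential replaces
  \<open>\<mu>\<^sup>2\<close> by \<open>\<mu>\<^sup>2 - Q\<close> in the equation, so it suffices to find \<open>p\<close> with
  \<open>\<mu> char_det p \<mu> = F \<mu>\<close>, where \<open>F \<mu> = \<mu> v (sqrt (\<mu>\<^sup>2 + Q))\<close>, and to take \<open>q = p + Q\<close>. The function
  \<open>F\<close> is again odd and of exponential type \<open>\<pi>\<close>, and the substitution \<open>\<nu>\<^sup>2 = x\<^sup>2 + Q\<close> bounds its norm
  on the real line by the part of the norm of \<open>f\<close> outside \<open>[-sqrt Q, sqrt Q]\<close>. For large \<open>Q\<close> the data
  are therefore as small as desired (\<open>small_shifted_data\<close>), and a perturbative inverse problem remains.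

  That problem is solved among potentials that are odd about \<open>\<pi>/2\<close>. For these the quadratic term of
  the Born expansion cancels in the determinant, and \<open>\<mu> char_det p \<mu>\<close> is the sine transform of
  \<open>p\<close> plus a remainder of third order in \<open>p\<close> that decays like \<open>1/\<mu>\<^sup>2\<close> (\<open>char_det_odd\<close>,
  \<open>remainder_lipschitz\<close>). At the integers the sine transform reads off the sine coefficients of \<open>p\<close>,
  and the samples \<open>F n\<close> are square summable by the Plancherel-Polya inequality, so the equations at the
  integers are a fixed point problem for the coefficients, solved by contraction
  (\<open>exists_small_potential\<close>). The difference \<open>\<mu> char_det p \<mu> - F \<mu>\<close> is then an entire function that
  vanishes at all integers and is \<open>O(exp (\<pi> |Im \<mu>|))\<close>. It is a multiple of \<open>sin (\<pi> \<mu>)\<close>, and it tends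
  to \<open>0\<close> along the half integers, so it vanishes identically (\<open>char_det_eq_from_samples\<close>).

  Smoothness is gained one derivative at a time (\<open>bootstrap\<close>). If \<open>p\<close> has \<open>k\<close> derivatives in \<open>L\<^sub>2\<close> and
  the derivatives of order less than \<open>k\<close> vanish at both end points, then integrating the Born terms by
  parts (\<open>born_term_leibniz\<close>) improves the decay of the remainder to \<open>1/\<mu>^(k + 2)\<close>. The decay of the
  samples of \<open>F\<close>, which encodes the square integrability of \<open>\<mu>^m F\<close>, then gives one more derivative of \<open>p\<close>,
  and the decay at the half integers forces the derivative of order \<open>k\<close> to vanish at the end points.
\<close>

section \<open>Entire functions of exponential type\<close>

text \<open>
  The maximum principle on an unbounded closed set: a bound outside a large ball turns the set into a
  compact one.
\<close>

lemma max_principle_decay: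
  assumes hol: "g holomorphic_on U" and U: "open U" "S \<subseteq> U" and S: "closed S"
    and fr: "\<And>z. z \<in> frontier S \<Longrightarrow> norm (g z) \<le> B"
    and far: "\<And>z. z \<in> S \<Longrightarrow> R \<le> norm z \<Longrightarrow> norm (g z) \<le> B"
    and z: "z \<in> S"
  shows "norm (g z) \<le> B"
proof (rule maximum_modulus_frontier[where S = "S \<inter> cball 0 (max R (norm z) + 1)" and f = g])
  let ?T = "S \<inter> cball 0 (max R (norm z) + 1)"
  have cl: "closed ?T" using S by auto
  show "g holomorphic_on interior ?T"
    using hol by (rule holomorphic_on_subset) (use U interior_subset in blast)
  show "continuous_on (closure ?T) g"
    unfolding closure_closed[OF cl]
    using hol by (intro holomorphic_on_imp_continuous_on holomorphic_on_subset[OF hol]) (use U in auto)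
  show "bounded ?T" by (rule bounded_subset[OF bounded_cball]) auto
  show "norm (g w) \<le> B" if "w \<in> frontier ?T" for w
  proof -
    have "w \<in> ?T" using that cl frontier_subset_closed by blast
    moreover have "w \<in> frontier S \<or> w \<in> frontier (cball 0 (max R (norm z) + 1))"
      using that frontier_Int_subset by blast
    ultimately show ?thesis
      using fr far by (auto simp: frontier_cball)
  qed
  show "z \<in> ?T" using z by auto
qed

text \<open>
  The power \<open>3/2\<close> lies between the exponential type to be beaten and the order \<open>2\<close> at which the
  comparison function would stop decaying inside a quadrant.
\<close>

lemma growth_three_halves:
  fixes K c :: real
  assumes "c > 0" "B > 0" "C > 0"
  shows "\<exists>R. \<forall>r\<ge>R. C * exp (K * r) * exp (- (c * (r * sqrt r))) \<le> B"
proof -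
  define L where "L = \<bar>K\<bar> + \<bar>ln (C / B)\<bar>"
  have "C * exp (K * r) * exp (- (c * (r * sqrt r))) \<le> B" if r: "r \<ge> max 1 ((L / c)\<^sup>2)" for r
  proof -
    have L: "L \<ge> 0" by (simp add: L_def)
    have "L / c \<le> sqrt r" using r by (intro real_le_rsqrt) auto
    then have "L \<le> c * sqrt r" using assms by (simp add: field_simps)
    then have "L * r \<le> c * sqrt r * r" using r by (intro mult_right_mono) auto
    moreover have "K * r + ln (C / B) \<le> L * r"
    proof -
      have "K * r \<le> \<bar>K\<bar> * r" "ln (C/B) \<le> \<bar>ln (C/B)\<bar> * 1" "\<bar>ln (C/B)\<bar> * 1 \<le> \<bar>ln (C/B)\<bar> * r"
        using r mult_left_mono[of 1 r "\<bar>ln (C/B)\<bar>"] by (auto intro!: mult_right_mono)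
      then show ?thesis unfolding L_def by (simp add: algebra_simps)
    qed
    ultimately have "ln (C/B) + K * r - c * (r * sqrt r) \<le> 0" by (simp add: algebra_simps)
    then have "exp (ln (C/B) + K * r - c * (r * sqrt r)) \<le> 1" by simp
    then have "C / B * exp (K * r) * exp (- (c * (r * sqrt r))) \<le> 1"
      using assms by (simp add: exp_add exp_diff exp_minus field_simps)
    then show ?thesis using assms by (simp add: field_simps)
  qed
  then show ?thesis by blast
qed

text \<open>
  The form in which the auxiliary parameter of a comparison argument is sent to \<open>0\<close>.
\<close>

lemma le_by_exp_limit:
  fixes a x B :: real
  assumes "\<And>\<delta>. \<delta> > 0 \<Longrightarrow> x \<le> B * exp (\<delta> * a)"
  shows "x \<le> B"
proof -
  have "((\<lambda>\<delta>. B * exp (\<delta> * a)) \<longlongrightarrow> B * exp (0 * a)) (at_right 0)"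
    by (intro tendsto_intros)
  moreover have "eventually (\<lambda>\<delta>::real. x \<le> B * exp (\<delta> * a)) (at_right 0)"
    using assms by (auto simp: eventually_at_right_less eventually_at intro!: exI[of _ 1])
  ultimately show ?thesis
    using tendsto_lowerbound[of _ "B * exp (0*a)" "at_right (0::real)" x] by simp
qed

text \<open>
  The quadrant is rotated to be symmetric about the positive real axis. There \<open>z powr (3/2)\<close> has argument
  at most \<open>3\<pi>/8\<close>, so \<open>exp (- \<delta> z powr (3/2))\<close> is bounded by \<open>1\<close> and decays faster than \<open>h\<close> can grow.
  The maximum principle applies to the product, and \<open>\<delta>\<close> tends to \<open>0\<close>.
\<close>

lemma Phragmen_Lindelof_quadrant:
  fixes h :: "complex \<Rightarrow> complex"
  assumes hol: "h holomorphic_on UNIV" and gr: "\<And>z. norm (h z) \<le> C * exp (K * norm z)"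
    and re: "\<And>x. x \<ge> 0 \<Longrightarrow> norm (h (complex_of_real x)) \<le> B"
    and im: "\<And>y. y \<ge> 0 \<Longrightarrow> norm (h (\<i> * complex_of_real y)) \<le> B"
    and B: "B > 0" and z0: "Re z0 \<ge> 0" "Im z0 \<ge> 0"
  shows "norm (h z0) \<le> B"
proof -
  (* Adding 1 keeps the rotated quadrant away from the branch point of the power 3/2. *)
  define w where "w = (\<lambda>z. cis (- pi / 4) * z + 1)"
  define P where "P = (\<lambda>z. exp ((3/2) * Ln (w z)))"
  define Q where "Q = {z. Re z \<ge> 0} \<inter> {z. Im z \<ge> 0}"
  have Rew: "Re (w z) = (Re z + Im z) / sqrt 2 + 1" and Imw: "Im (w z) = (Im z - Re z) / sqrt 2" for z
    by (simp_all add: w_def cos_45 sin_45 field_simps real_div_sqrt)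
  have wpos: "Re (w z) \<ge> 1" and wc: "\<bar>Im (w z)\<bar> \<le> Re (w z)" and wn: "norm z \<le> norm (w z)" if "z \<in> Q" for z
  proof -
    have nn: "(Re z + Im z) / sqrt 2 \<ge> 0" using that by (auto simp: Q_def)
    show "Re (w z) \<ge> 1" unfolding Rew using nn by linarith
    have "\<bar>Im z - Re z\<bar> \<le> Re z + Im z" using that by (auto simp: Q_def)
    then have "\<bar>Im z - Re z\<bar> / sqrt 2 \<le> (Re z + Im z) / sqrt 2" by (intro divide_right_mono) auto
    then show "\<bar>Im (w z)\<bar> \<le> Re (w z)" unfolding Rew Imw by simp
    have "(norm (w z))\<^sup>2 = ((Re z + Im z) / sqrt 2 + 1)\<^sup>2 + ((Im z - Re z) / sqrt 2)\<^sup>2"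
      by (simp add: cmod_power2 Rew Imw)
    also have "\<dots> = (norm z)\<^sup>2 + 1 + 2 * ((Re z + Im z) / sqrt 2)"
      by (simp add: cmod_power2 power2_sum power2_diff power_divide power_mult_distrib add_divide_distrib diff_divide_distrib)
    finally have "(norm z)\<^sup>2 \<le> (norm (w z))\<^sup>2" using nn by linarith
    then show "norm z \<le> norm (w z)" by (rule power2_le_imp_le) simp
  qed
  define U where "U = {z. Re (w z) > 0}"
  have oU: "open U" unfolding U_def Rew by (intro open_Collect_less continuous_intros) auto
  have wn0: "w z \<noteq> 0" if "z \<in> U" for z using that by (auto simp: U_def)
  have Phol: "P holomorphic_on U"
    unfolding P_def w_def
    by (intro holomorphic_intros) (auto simp: U_def w_def complex_nonpos_Reals_iff)
  define c where "c = cos (3 * pi / 8)"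
  have c: "c > 0" unfolding c_def by (rule cos_gt_zero_pi) auto
  have ReP: "Re (P z) \<ge> c * (norm z * sqrt (norm z))" if z: "z \<in> Q" for z
  proof -
    have w0: "w z \<noteq> 0" using wpos[OF z] by auto
    have arg: "\<bar>Im (Ln (w z))\<bar> \<le> pi / 4"
    proof -
      have "Im (Ln (w z)) = arctan (Im (w z) / Re (w z))"
        unfolding Arg_eq_Im_Ln[OF w0, symmetric] using wpos[OF z] by (intro arg_conv_arctan) linarith
      moreover have "\<bar>Im (w z) / Re (w z)\<bar> \<le> 1"
        using wpos[OF z] wc[OF z] by (simp add: field_simps)
      then have "\<bar>arctan (Im (w z) / Re (w z))\<bar> \<le> pi / 4"
        by (rule arctan_le_pi4)
      ultimately show ?thesis by simp
    qed
    have "cos \<bar>(3/2) * Im (Ln (w z))\<bar> \<ge> cos (3 * pi / 8)"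
      using arg pi_gt_zero by (intro cos_monotone_0_pi_le) (auto simp: abs_mult)
    then have cc: "cos ((3/2) * Im (Ln (w z))) \<ge> c" by (simp only: c_def cos_abs_real)
    have nw: "exp (3/2 * ln (norm (w z))) = norm (w z) * sqrt (norm (w z))"
    proof -
      have "exp (3/2 * ln (norm (w z))) = exp (ln (norm (w z)) + 1/2 * ln (norm (w z)))" by (simp add: field_simps)
      also have "\<dots> = norm (w z) * (norm (w z)) powr (1/2)" using w0 by (simp only: exp_add) (simp add: powr_def)
      finally show ?thesis by (simp add: powr_half_sqrt)
    qed
    have "c * (norm z * sqrt (norm z)) \<le> c * (norm (w z) * sqrt (norm (w z)))"
      using c wn[OF z] by (intro mult_left_mono mult_mono) auto
    also have "\<dots> \<le> cos ((3/2) * Im (Ln (w z))) * (norm (w z) * sqrt (norm (w z)))"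
      using cc by (intro mult_right_mono) auto
    also have "\<dots> = Re (P z)"
      using w0 by (simp add: P_def Re_exp nw[symmetric])
    finally show ?thesis .
  qed
  have C0: "0 \<le> C" using order_trans[OF norm_ge_zero gr[of 0]] by simp
  have main: "norm (h z0) \<le> B * exp (\<delta> * Re (P z0))" if d: "\<delta> > 0" for \<delta>
  proof -
    define g where "g = (\<lambda>z. h z * exp (- (of_real \<delta> * P z)))"
    obtain R where R: "\<And>r. r \<ge> R \<Longrightarrow> (C+1) * exp (K * r) * exp (- ((\<delta> * c) * (r * sqrt r))) \<le> B"
      using growth_three_halves[of "\<delta> * c" B "C + 1" K] d c B C0 by auto
    have ng: "norm (g z) \<le> norm (h z) * exp (- ((\<delta> * c) * (norm z * sqrt (norm z))))" if "z \<in> Q" for z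
      using ReP[OF that] d by (auto simp: g_def norm_mult mult.assoc intro!: mult_left_mono)
    have ng': "norm (g z) \<le> norm (h z)" if "z \<in> Q" for z
    proof -
      have "exp (- ((\<delta> * c) * (norm z * sqrt (norm z)))) \<le> 1" using d c by auto
      then have "norm (h z) * exp (- ((\<delta> * c) * (norm z * sqrt (norm z)))) \<le> norm (h z) * 1"
        by (intro mult_left_mono) auto
      then show ?thesis using ng[OF that] by simp
    qed
    have "norm (g z0) \<le> B"
    proof (rule max_principle_decay[where U = U and S = Q and R = R and g = g])
      show "g holomorphic_on U" unfolding g_def
        by (intro holomorphic_intros Phol holomorphic_on_subset[OF hol]) auto
      show "open U" by fact
      show "Q \<subseteq> U" using wpos by (force simp: U_def)
      show "closed Q" unfolding Q_def by (intro closed_Int closed_halfspace_Re_ge closed_halfspace_Im_ge)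
      show "norm (g z) \<le> B" if "z \<in> frontier Q" for z
      proof -
        have zQ: "z \<in> Q" using that \<open>closed Q\<close> frontier_subset_closed by blast
        have "frontier {z. Re z \<ge> 0} = {z. Re z = 0}" "frontier {z. Im z \<ge> 0} = {z. Im z = 0}"
          using frontier_halfspace_ge[of "1::complex" 0] frontier_halfspace_ge[of \<i> 0]
          by (simp_all add: inner_complex_def)
        then have "Re z = 0 \<or> Im z = 0"
          using that frontier_Int_subset[of "{z. Re z \<ge> 0}" "{z. Im z \<ge> 0}"] unfolding Q_def by blast
        then have "norm (h z) \<le> B"
        proof
          assume "Re z = 0"
          then have "z = \<i> * of_real (Im z)" by (simp add: complex_eq_iff)
          then show ?thesis using im[of "Im z"] zQ unfolding Q_def by auto
        next
          assume "Im z = 0"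
          then have "z = of_real (Re z)" by (simp add: complex_eq_iff)
          then show ?thesis using re[of "Re z"] zQ unfolding Q_def by auto
        qed
        then show ?thesis using ng'[OF zQ] by simp
      qed
      show "norm (g z) \<le> B" if z: "z \<in> Q" "R \<le> norm z" for z
      proof -
        have "norm (h z) \<le> (C+1) * exp (K * norm z)"
          using gr[of z] by (simp add: distrib_right add.commute add_increasing)
        then have "norm (h z) * exp (- ((\<delta> * c) * (norm z * sqrt (norm z)))) \<le> 
           (C+1) * exp (K * norm z) * exp (- ((\<delta> * c) * (norm z * sqrt (norm z))))"
          by (intro mult_right_mono) auto
        then show ?thesis using ng[OF z(1)] R[OF z(2)] by linarith
      qed
      show "z0 \<in> Q" using z0 by (simp add: Q_def)
    qed
    then have "norm (h z0) * exp (- (\<delta> * Re (P z0))) \<le> B"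
      by (simp add: g_def norm_mult)
    then show ?thesis by (simp add: exp_minus field_simps)
  qed
  from le_by_exp_limit[OF main] show ?thesis by blast
qed

text \<open>
  Dividing by \<open>1 - \<i> \<delta> z\<close>, which is at least \<open>1\<close> in absolute value on the half plane, produces decay at
  infinity without increasing the boundary values.
\<close>

lemma bounded_half_plane_max:
  fixes h :: "complex \<Rightarrow> complex"
  assumes hol: "h holomorphic_on UNIV" and bd: "\<And>z. Im z \<ge> 0 \<Longrightarrow> norm (h z) \<le> D"
    and re: "\<And>x. norm (h (complex_of_real x)) \<le> M" and M: "M > 0" and z0: "Im z0 \<ge> 0"
  shows "norm (h z0) \<le> M"
proof -
  define S where "S = {z::complex. Im z \<ge> 0}"
  have D: "D \<ge> 0" using order_trans[OF norm_ge_zero bd[of 0]] by simp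
  have main: "norm (h z0) \<le> M * (1 + \<delta> * norm z0)" if d: "\<delta> > 0" for \<delta>
  proof -
    define e where "e = (\<lambda>z. 1 - \<i> * of_real \<delta> * z)"
    define g where "g = (\<lambda>z. h z / e z)"
    have Re: "Re (e z) = 1 + \<delta> * Im z" for z by (simp add: e_def)
    have e1: "norm (e z) \<ge> 1" if "z \<in> S" for z
      using that d complex_Re_le_cmod[of "e z"] by (simp add: Re S_def) (smt (verit) mult_nonneg_nonneg)
    have e2: "norm (e z) \<ge> \<delta> * norm z - 1" for z
      using norm_triangle_ineq4[of 1 "e z"] d by (simp add: e_def norm_mult)
    define U where "U = {z. Re (e z) > 0}"
    have "norm (g z0) \<le> M"
    proof (rule max_principle_decay[where U = U and S = S and R = "(D / M + 1) / \<delta>" and g = g])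
      show "g holomorphic_on U" unfolding g_def e_def
        by (intro holomorphic_intros holomorphic_on_subset[OF hol]) (auto simp: U_def e_def dest: arg_cong[of _ _ Re])
      show "open U" unfolding U_def Re by (intro open_Collect_less continuous_intros)
      show "S \<subseteq> U" unfolding U_def Re S_def using d by (auto intro!: add_pos_nonneg)
      show "closed S" unfolding S_def by (rule closed_halfspace_Im_ge)
      show "norm (g z) \<le> M" if "z \<in> frontier S" for z
      proof -
        have "Im z = 0" using that frontier_halfspace_ge[of \<i> 0] by (simp add: S_def inner_complex_def)
        then have "z = of_real (Re z)" "z \<in> S" by (simp_all add: complex_eq_iff S_def)
        then have "norm (h z) \<le> M" "norm (e z) \<ge> 1" using re[of "Re z"] e1 by auto
        then have "norm (h z) \<le> M * norm (e z)"
          using M mult_left_mono[of 1 "norm (e z)" M] by linarith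
        then show ?thesis using \<open>norm (e z) \<ge> 1\<close> M by (simp add: g_def norm_divide divide_le_eq)
      qed
      show "norm (g z) \<le> M" if z: "z \<in> S" "(D / M + 1) / \<delta> \<le> norm z" for z
      proof -
        have "norm (e z) \<ge> D / M" using e2[of z] z(2) d by (simp add: field_simps)
        then have "D \<le> M * norm (e z)" using M by (simp add: field_simps)
        then have "norm (h z) \<le> M * norm (e z)" using bd[of z] z(1) by (simp add: S_def)
        then show ?thesis using e1[OF z(1)] M by (simp add: g_def norm_divide divide_le_eq)
      qed
      show "z0 \<in> S" using z0 by (simp add: S_def)
    qed
    moreover have "norm (e z0) \<ge> 1" using e1 z0 by (simp add: S_def)
    ultimately have "norm (h z0) \<le> M * norm (e z0)"
      by (simp add: g_def norm_divide divide_le_eq split: if_splits)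
    also have "norm (e z0) \<le> 1 + \<delta> * norm z0"
      using norm_triangle_ineq4[of 1 "\<i> * of_real \<delta> * z0"] d by (simp add: e_def norm_mult)
    finally show ?thesis using M by simp
  qed
  have "norm (h z0) \<le> M * exp (\<delta> * norm z0)" if "\<delta> > 0" for \<delta>
    using main[OF that] M mult_left_mono[OF exp_ge_add_one_self[of "\<delta> * norm z0"], of M]
    by linarith
  from le_by_exp_limit[OF this] show ?thesis by blast
qed

text \<open>
  Multiplication by \<open>exp (\<i> (\<sigma> + \<epsilon>) z)\<close> makes \<open>f\<close> bounded on the imaginary axis. The Phragmen-Lindelof
  principle in both quadrants bounds it on the half plane, and the bound then improves to the one on the
  real line.
\<close>

lemma exponential_type_bounded_upper:
  assumes hol: "f holomorphic_on UNIV" and ty: "exponential_type_le \<sigma> f"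
    and re: "\<And>x. norm (f (complex_of_real x)) \<le> M" and z: "Im z \<ge> 0"
  shows "norm (f z) \<le> M * exp (\<sigma> * Im z)"
proof -
  have "norm (f z) \<le> (M+\<eta>) * exp (\<sigma> * Im z)" if eta: "\<eta> > 0" for \<eta>
  proof -
  have M0: "M \<ge> 0" using order_trans[OF norm_ge_zero re] .
  have "norm (f z) * exp (- \<sigma> * Im z) \<le> (M+\<eta>) * exp (\<epsilon> * Im z)" if e: "\<epsilon> > 0" for \<epsilon>
  proof -
    obtain C where C: "\<And>z. norm (f z) \<le> C * exp ((\<sigma> + \<epsilon>) * norm z)"
      using ty e unfolding exponential_type_le_def by blast
    have C0: "0 \<le> C" using order_trans[OF norm_ge_zero C[of 0]] by simp
    define h where "h = (\<lambda>z. f z * exp (\<i> * of_real (\<sigma> + \<epsilon>) * z))"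
    have hol': "h holomorphic_on UNIV" unfolding h_def by (intro holomorphic_intros hol)
    have nh: "norm (h z) = norm (f z) * exp (- (\<sigma> + \<epsilon>) * Im z)" for z
      by (simp add: h_def norm_mult algebra_simps)
    define B where "B = max (M+\<eta>) C"
    have B: "B > 0" using M0 eta by (simp add: B_def)
    have g: "norm (h z) \<le> C * exp (2 * \<bar>\<sigma> + \<epsilon>\<bar> * norm z)" for z
    proof -
      have "- (\<sigma> + \<epsilon>) * Im z \<le> \<bar>\<sigma> + \<epsilon>\<bar> * norm z" 
      proof -
        have "- (\<sigma> + \<epsilon>) * Im z \<le> \<bar>- (\<sigma> + \<epsilon>) * Im z\<bar>" by (rule abs_ge_self)
        also have "\<dots> = \<bar>\<sigma> + \<epsilon>\<bar> * \<bar>Im z\<bar>" by (simp only: abs_mult abs_minus_cancel)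
        also have "\<dots> \<le> \<bar>\<sigma> + \<epsilon>\<bar> * norm z" by (intro mult_left_mono abs_Im_le_cmod) auto
        finally show ?thesis .
      qed
      moreover have "(\<sigma> + \<epsilon>) * norm z \<le> \<bar>\<sigma> + \<epsilon>\<bar> * norm z"
        by (intro mult_right_mono) auto
      ultimately have "norm (h z) \<le> (C * exp (\<bar>\<sigma> + \<epsilon>\<bar> * norm z)) * exp (\<bar>\<sigma> + \<epsilon>\<bar> * norm z)"
        unfolding nh using C[of z] C0 
        by (intro mult_mono) (auto intro: order_trans[OF C[of z]] mult_left_mono)
      then show ?thesis by (simp add: mult.assoc mult.left_commute mult.commute exp_add[symmetric])
    qed
    have hre: "norm (h (of_real x)) \<le> B" for x
      using re[of x] eta by (simp add: nh B_def)
    have him: "norm (h (\<i> * of_real y)) \<le> B" if "y \<ge> 0" for y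
    proof -
      have "norm (h (\<i> * of_real y)) \<le> C * exp ((\<sigma> + \<epsilon>) * y) * exp (- (\<sigma> + \<epsilon>) * y)"
        unfolding nh using C[of "\<i> * of_real y"] that C0 by (intro mult_mono) (auto simp: norm_mult)
      also have "\<dots> = C" by (simp add: mult.assoc exp_add[symmetric] del: minus_add_distrib)
      finally show ?thesis by (simp add: B_def)
    qed
    have bd: "norm (h z) \<le> B" if iz: "Im z \<ge> 0" for z
    proof (cases "Re z \<ge> 0")
      case True
      show ?thesis
        by (rule Phragmen_Lindelof_quadrant[OF hol' g hre him B True iz])
    next
      case False
      have "norm ((\<lambda>z. h (\<i> * z)) (- \<i> * z)) \<le> B"
      proof (rule Phragmen_Lindelof_quadrant[where h = "\<lambda>z. h (\<i> * z)" and C = C and K = "2 * \<bar>\<sigma> + \<epsilon>\<bar>"])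
        show "(\<lambda>z. h (\<i> * z)) holomorphic_on UNIV"
          using holomorphic_on_compose_gen[OF holomorphic_on_mult[OF holomorphic_on_const holomorphic_on_ident] hol', of \<i> UNIV]
          by (simp add: o_def)
        show "norm (h (\<i> * z)) \<le> C * exp (2 * \<bar>\<sigma> + \<epsilon>\<bar> * norm z)" for z
          using g[of "\<i> * z"] by (simp add: norm_mult)
        show "norm (h (\<i> * (\<i> * of_real y))) \<le> B" for y
          using hre[of "- y"] by (simp add: mult.assoc[symmetric])
      qed (use him B False iz in auto)
      then show ?thesis by (simp add: mult.assoc[symmetric])
    qed
    have hre': "norm (h (of_real x)) \<le> M + \<eta>" for x
      using re[of x] eta by (simp add: nh)
    have M': "M + \<eta> > 0" using M0 eta by simp
    have "norm (h z) \<le> M + \<eta>"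
      by (rule bounded_half_plane_max[where D = B, OF hol' _ hre' M' z]) (rule bd)
    then have "norm (f z) * (exp (- (\<sigma> + \<epsilon>) * Im z) * exp (\<epsilon> * Im z)) \<le> (M + \<eta>) * exp (\<epsilon> * Im z)"
      unfolding nh mult.assoc[symmetric] by (rule mult_right_mono) simp
    moreover have "exp (- (\<sigma> + \<epsilon>) * Im z) * exp (\<epsilon> * Im z) = exp (- \<sigma> * Im z)"
      unfolding exp_add[symmetric] by (simp add: algebra_simps)
    ultimately show ?thesis by (simp only:)
  qed
  from le_by_exp_limit[OF this] have "norm (f z) * exp (- \<sigma> * Im z) \<le> M + \<eta>" .
  from mult_right_mono[OF this, of "exp (\<sigma> * Im z)"] show ?thesis
    by (simp add: mult.assoc exp_add[symmetric])
  qed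
  then have "norm (f z) / exp (\<sigma> * Im z) \<le> M + \<eta>" if "\<eta> > 0" for \<eta>
    using that by (simp add: divide_le_eq)
  then have "norm (f z) / exp (\<sigma> * Im z) \<le> M"
    by (rule field_le_epsilon)
  then show ?thesis by (simp add: divide_le_eq)
qed

lemma exponential_type_uminus: "exponential_type_le \<sigma> f \<Longrightarrow> exponential_type_le \<sigma> (\<lambda>z. f (- z))"
  unfolding exponential_type_le_def by (metis norm_minus_cancel)

lemma exponential_type_bounded_line:
  assumes hol: "f holomorphic_on UNIV" and ty: "exponential_type_le \<sigma> f"
    and re: "\<And>x. norm (f (complex_of_real x)) \<le> M"
  shows "norm (f z) \<le> M * exp (\<sigma> * \<bar>Im z\<bar>)"
proof (cases "Im z \<ge> 0")
  case True
  then show ?thesis using exponential_type_bounded_upper[OF hol ty re True] by simp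
next
  case False
  have "(\<lambda>z. f (- z)) holomorphic_on UNIV"
    using holomorphic_on_compose_gen[OF holomorphic_on_minus[OF holomorphic_on_ident] hol, of UNIV]
    by (simp add: o_def)
  moreover have "norm (f (- complex_of_real x)) \<le> M" for x using re[of "-x"] by simp
  ultimately have "norm (f (- (- z))) \<le> M * exp (\<sigma> * Im (- z))"
    using False by (intro exponential_type_bounded_upper exponential_type_uminus ty) auto
  then show ?thesis using False by simp
qed

section \<open>Sampling Paley-Wiener functions\<close>

lemma exponential_type_shift:
  assumes "exponential_type_le \<sigma> f" "\<sigma> \<ge> 0"
  shows "exponential_type_le \<sigma> (\<lambda>z. f (z + a))"
  unfolding exponential_type_le_def
proof (intro allI impI)
  fix \<epsilon> :: real assume e: "\<epsilon> > 0"
  then obtain C where C: "\<And>z. norm (f z) \<le> C * exp ((\<sigma> + \<epsilon>) * norm z)"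
    using assms unfolding exponential_type_le_def by blast
  have C0: "0 \<le> C" using order_trans[OF norm_ge_zero C[of 0]] by simp
  have "norm (f (z + a)) \<le> (C * exp ((\<sigma> + \<epsilon>) * norm a)) * exp ((\<sigma> + \<epsilon>) * norm z)" for z
  proof -
    have "(\<sigma> + \<epsilon>) * norm (z + a) \<le> (\<sigma> + \<epsilon>) * (norm z + norm a)"
      using assms e by (intro mult_left_mono norm_triangle_ineq) auto
    then have "C * exp ((\<sigma> + \<epsilon>) * norm (z + a)) \<le> C * exp ((\<sigma> + \<epsilon>) * (norm z + norm a))"
      using C0 by (intro mult_left_mono) auto
    then show ?thesis using C[of "z + a"] by (simp add: algebra_simps exp_add)
  qed
  then show "\<exists>C. \<forall>z. norm (f (z + a)) \<le> C * exp ((\<sigma> + \<epsilon>) * norm z)" by blast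
qed

lemma exponential_type_add:
  assumes "exponential_type_le \<sigma> f" "exponential_type_le \<sigma> g"
  shows "exponential_type_le \<sigma> (\<lambda>z. f z + g z)"
  unfolding exponential_type_le_def
proof (intro allI impI)
  fix \<epsilon> :: real assume e: "\<epsilon> > 0"
  then obtain C D where "\<And>z. norm (f z) \<le> C * exp ((\<sigma> + \<epsilon>) * norm z)"
    and "\<And>z. norm (g z) \<le> D * exp ((\<sigma> + \<epsilon>) * norm z)"
    using assms unfolding exponential_type_le_def by blast
  then have "norm (f z + g z) \<le> (C + D) * exp ((\<sigma> + \<epsilon>) * norm z)" for z
    by (simp add: distrib_right norm_triangle_mono)
  then show "\<exists>C. \<forall>z. norm (f z + g z) \<le> C * exp ((\<sigma> + \<epsilon>) * norm z)" by blast
qed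

lemma exponential_type_cmult:
  assumes "exponential_type_le \<sigma> f"
  shows "exponential_type_le \<sigma> (\<lambda>z. c * f z)"
  unfolding exponential_type_le_def
proof (intro allI impI)
  fix \<epsilon> :: real assume e: "\<epsilon> > 0"
  then obtain C where "\<And>z. norm (f z) \<le> C * exp ((\<sigma> + \<epsilon>) * norm z)"
    using assms unfolding exponential_type_le_def by blast
  then have "norm (c * f z) \<le> (norm c * C) * exp ((\<sigma> + \<epsilon>) * norm z)" for z
    by (simp add: norm_mult mult.assoc mult_left_mono)
  then show "\<exists>C. \<forall>z. norm (c * f z) \<le> C * exp ((\<sigma> + \<epsilon>) * norm z)" by blast
qed

lemma exponential_type_zero: "exponential_type_le \<sigma> (\<lambda>z. 0)"
  unfolding exponential_type_le_def by (auto intro!: exI[of _ 0])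

lemma exponential_type_sum:
  assumes "\<And>i. i \<in> I \<Longrightarrow> exponential_type_le \<sigma> (f i)"
  shows "exponential_type_le \<sigma> (\<lambda>z. \<Sum>i\<in>I. f i z)"
  using assms by (induction I rule: infinite_finite_induct)
    (auto intro: exponential_type_add exponential_type_zero)

lemma entire_shift:
  fixes f :: "complex \<Rightarrow> complex"
  assumes "f holomorphic_on UNIV"
  shows "(\<lambda>z. f (z + a)) holomorphic_on UNIV"
  using holomorphic_on_compose_gen[OF holomorphic_on_add[OF holomorphic_on_ident holomorphic_on_const] assms, of a UNIV]
  by (simp add: o_def)

lemma entire_real_continuous:
  fixes f :: "complex \<Rightarrow> complex"
  assumes "f holomorphic_on UNIV"
  shows "continuous_on A (\<lambda>x. f (complex_of_real x))"
  using continuous_on_compose2[OF holomorphic_on_imp_continuous_on[OF assms] continuous_on_of_real[OF continuous_on_id]]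
  by auto

lemma has_vector_derivative_complex_of_real:
  "(complex_of_real has_vector_derivative 1) (at t within S)"
  unfolding has_vector_derivative_def
  using bounded_linear_imp_has_derivative[OF bounded_linear_of_real, of "at t within S"]
  by (simp add: scaleR_conv_of_real)

text \<open>
  Control of integrals over short intervals suffices for a pointwise bound: the function
  \<open>z \<mapsto> F h z\<close>, the integral of \<open>f\<close> from \<open>z\<close> to \<open>z + h\<close>, is of the same exponential type and bounded on the
  line, hence everywhere, and by the Cauchy inequality its derivative \<open>f (z + h) - f z\<close> is bounded too.
  So \<open>f z\<close> differs little from its average over \<open>[z, z + 1]\<close>.
\<close>

lemma bound_from_short_averages:
  assumes hol: "f holomorphic_on UNIV" and ty: "exponential_type_le \<sigma> f" and s: "\<sigma> \<ge> 0"
    and av: "\<And>x h. 0 \<le> h \<Longrightarrow> h \<le> 1 \<Longrightarrow> norm (integral {x..x+h} (\<lambda>t. f (complex_of_real t))) \<le> M"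
  shows "norm (f z) \<le> (1 + exp \<sigma>) * M * exp (\<sigma> * \<bar>Im z\<bar>)"
proof -
  obtain G where "\<And>x. (G has_field_derivative f x) (at x)"
    using holomorphic_convex_primitive'[OF convex_UNIV open_UNIV hol] by auto
  then have G: "(G has_field_derivative f x) (at x within S)" for x S
    by (rule has_field_derivative_at_within)
  have M0: "M \<ge> 0" using order_trans[OF norm_ge_zero av[of 0 0]] by simp
  define F where "F = (\<lambda>h z. G (z + complex_of_real h) - G z)"
  have dF: "(F h has_field_derivative (f (z + of_real h) - f z)) (at z)" for h z
    unfolding F_def
    by (intro derivative_intros G) (rule DERIV_shift[THEN iffD1, OF G])
  have holF: "F h holomorphic_on UNIV" for h
    using dF by (auto simp: holomorphic_on_def field_differentiable_def)
  have tyF: "exponential_type_le \<sigma> (F h)" if h: "0 \<le> h" "h \<le> 1" for h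
    unfolding exponential_type_le_def
  proof (intro allI impI)
    fix \<epsilon> :: real assume e: "\<epsilon> > 0"
    then obtain C where C: "\<And>z. norm (f z) \<le> C * exp ((\<sigma> + \<epsilon>) * norm z)"
      using ty unfolding exponential_type_le_def by blast
    have C0: "0 \<le> C" using order_trans[OF norm_ge_zero C[of 0]] by simp
    have "norm (F h z) \<le> (C * exp (\<sigma> + \<epsilon>)) * exp ((\<sigma> + \<epsilon>) * norm z)" for z
    proof -
      have "norm (G (z + of_real h) - G z) \<le> (C * exp (\<sigma> + \<epsilon>)) * exp ((\<sigma> + \<epsilon>) * norm z) * norm ((z + of_real h) - z)"
      proof (rule field_differentiable_bound[where S = "cball z 1" and f' = f])
        show "norm (f w) \<le> (C * exp (\<sigma> + \<epsilon>)) * exp ((\<sigma> + \<epsilon>) * norm z)" if "w \<in> cball z 1" for w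
        proof -
          have "norm w \<le> norm z + 1"
            using that norm_triangle_ineq2[of w z] by (simp add: dist_norm norm_minus_commute)
          then have "(\<sigma> + \<epsilon>) * norm w \<le> (\<sigma> + \<epsilon>) * (norm z + 1)" using s e by (intro mult_left_mono) auto
          then have "C * exp ((\<sigma> + \<epsilon>) * norm w) \<le> C * exp ((\<sigma> + \<epsilon>) * (norm z + 1))"
            using C0 by (intro mult_left_mono) auto
          then show ?thesis using C[of w] by (simp add: algebra_simps exp_add)
        qed
      qed (use G h in \<open>auto simp: dist_norm\<close>)
      also have "\<dots> \<le> (C * exp (\<sigma> + \<epsilon>)) * exp ((\<sigma> + \<epsilon>) * norm z) * 1"
        using h C0 by (intro mult_left_mono) auto
      finally show ?thesis by (simp add: F_def)
    qed
    then show "\<exists>C. \<forall>z. norm (F h z) \<le> C * exp ((\<sigma> + \<epsilon>) * norm z)" by blast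
  qed
  have reF: "norm (F h (of_real x)) \<le> M" if h: "0 \<le> h" "h \<le> 1" for h x
  proof -
    have "((\<lambda>t. f (complex_of_real t)) has_integral (G (of_real (x + h)) - G (of_real x))) {x..x+h}"
    proof (rule fundamental_theorem_of_calculus)
      show "((\<lambda>x. G (complex_of_real x)) has_vector_derivative f (complex_of_real t)) (at t within {x..x + h})" for t
        using field_vector_diff_chain_within[OF has_vector_derivative_complex_of_real G] by (simp add: o_def)
    qed (use h in auto)
    then show ?thesis using av[of h x] h by (simp add: F_def integral_unique)
  qed
  have bF: "norm (F h z) \<le> M * exp (\<sigma> * \<bar>Im z\<bar>)" if h: "0 \<le> h" "h \<le> 1" for h z
    by (rule exponential_type_bounded_line[OF holF tyF[OF h] reF[OF h]])
  have diff: "norm (f (z + of_real h) - f z) \<le> M * exp \<sigma> * exp (\<sigma> * \<bar>Im z\<bar>)" if h: "0 \<le> h" "h \<le> 1" for h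
  proof -
    have "norm ((deriv ^^ 1) (F h) z) \<le> fact 1 * (M * exp \<sigma> * exp (\<sigma> * \<bar>Im z\<bar>)) / 1 ^ 1"
    proof (rule Cauchy_inequality)
      show "norm (F h w) \<le> M * exp \<sigma> * exp (\<sigma> * \<bar>Im z\<bar>)" if "norm (z - w) = 1" for w
      proof -
        have "\<bar>Im w\<bar> \<le> \<bar>Im z\<bar> + 1" using abs_Im_le_cmod[of "z - w"] that by simp
        then have "\<sigma> * \<bar>Im w\<bar> \<le> \<sigma> * (\<bar>Im z\<bar> + 1)" using s by (intro mult_left_mono) auto
        then have "M * exp (\<sigma> * \<bar>Im w\<bar>) \<le> M * exp (\<sigma> * (\<bar>Im z\<bar> + 1))"
          using M0 by (intro mult_left_mono) auto
        then show ?thesis using bF[OF h, of w] by (simp add: algebra_simps exp_add)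
      qed
    qed (auto intro: holomorphic_on_subset[OF holF] holomorphic_on_imp_continuous_on)
    then show ?thesis using DERIV_imp_deriv[OF dF[of h z]] by simp
  qed
  have i1: "((\<lambda>t. f (z + complex_of_real t)) has_integral F 1 z) {0..1}"
  proof -
    have "((\<lambda>t. f (z + complex_of_real t)) has_integral (G (z + complex_of_real 1) - G (z + complex_of_real 0))) {0..1}"
    proof (rule fundamental_theorem_of_calculus)
      show "((\<lambda>x. G (z + complex_of_real x)) has_vector_derivative f (z + complex_of_real t)) (at t within {0..1})" for t
        using field_vector_diff_chain_within[OF has_vector_derivative_add[OF has_vector_derivative_const has_vector_derivative_complex_of_real] G]
        by (simp add: o_def)
    qed auto
    then show ?thesis by (simp add: F_def)
  qed
  have i2: "((\<lambda>t. f (z + complex_of_real t) - f z) has_integral (F 1 z - f z)) {0..1}"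
    using has_integral_diff[OF i1 has_integral_const_real[of "f z" 0 1]] by simp
  have "norm (F 1 z - f z) \<le> M * exp \<sigma> * exp (\<sigma> * \<bar>Im z\<bar>) * Henstock_Kurzweil_Integration.content {0..1::real}"
    by (rule has_integral_bound_real[where S = "{}", OF _ _ i2]) (use M0 diff in auto)
  then have "norm (f z) \<le> norm (F 1 z) + M * exp \<sigma> * exp (\<sigma> * \<bar>Im z\<bar>)"
    using norm_triangle_sub[of "f z" "F 1 z"] by (simp add: norm_minus_commute)
  then show ?thesis using bF[of 1 z] by (simp add: algebra_simps)
qed

text \<open>
  The sum of squares is the value at \<open>b\<close> of the entire function \<open>\<Phi> z = (\<Sum>n<N. cnj (f (b + n)) * f (z + n))\<close>.
  The integrals of \<open>\<Phi>\<close> over intervals of length at most \<open>1\<close> involve the energy of \<open>f\<close> only once, because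
  translates of such an interval by integers do not overlap. \<open>bound_from_short_averages\<close> therefore
  bounds the sum in terms of the energy and of itself, and the latter is absorbed.
\<close>

lemma Plancherel_Polya:
  assumes hol: "f holomorphic_on UNIV" and ty: "exponential_type_le \<sigma> f" and s: "\<sigma> \<ge> 0"
    and E: "\<And>a b. integral {a..b} (\<lambda>t. (norm (f (complex_of_real t)))\<^sup>2) \<le> E"
  shows "(\<Sum>n<N. (norm (f (complex_of_real (b + real n))))\<^sup>2) \<le> (1 + exp \<sigma>)\<^sup>2 * E"
proof -
  define C where "C = 1 + exp \<sigma>"
  have C: "C > 0" unfolding C_def by (simp add: add_pos_pos)
  define c where "c = (\<lambda>n. cnj (f (complex_of_real (b + real n))))"
  define S where "S = (\<Sum>n<N. (norm (c n))\<^sup>2)"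
  have S0: "S \<ge> 0" unfolding S_def by (intro sum_nonneg) auto
  define \<Phi> where "\<Phi> = (\<lambda>z. \<Sum>n<N. c n * f (z + of_nat n))"
  (* The weight C in the inequality 2 x y <= x^2 / C + C y^2 is chosen so that S is absorbed in the end. *)
  define M where "M = (S / C + C * E) / 2"
  have tp: "exponential_type_le \<sigma> \<Phi>" unfolding \<Phi>_def
    by (intro exponential_type_sum exponential_type_cmult exponential_type_shift ty s)
  have hp: "\<Phi> holomorphic_on UNIV" unfolding \<Phi>_def
    by (intro holomorphic_intros entire_shift hol)
  have cf: "continuous_on A (\<lambda>t. f (complex_of_real (t + a)))" for A a
    using entire_real_continuous[OF entire_shift[OF hol, of "of_real a"]] by simp
  have ci: "(\<lambda>t. (norm (f (complex_of_real (t + a))))\<^sup>2) integrable_on {u..v}" for a u v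
    by (intro integrable_continuous_interval continuous_intros cf)
  have shift: "integral {x..x+h} (\<lambda>t. (norm (f (complex_of_real (t + a))))\<^sup>2) =
      integral {x+a..x+a+h} (\<lambda>t. (norm (f (complex_of_real t)))\<^sup>2)" if "h \<ge> 0" for a x h
    using integral_shift[of x a "x+h" "\<lambda>t. (norm (f (complex_of_real t)))\<^sup>2"] that cf[of _ 0]
    by (simp add: o_def algebra_simps continuous_intros)
  have sumE: "(\<Sum>n<N. integral {x..x+h} (\<lambda>t. (norm (f (complex_of_real (t + real n))))\<^sup>2)) \<le> E"
    if h: "0 \<le> h" "h \<le> 1" for x h
  proof -
    have "(\<Sum>n<N. integral {x..x+h} (\<lambda>t. (norm (f (complex_of_real (t + real n))))\<^sup>2)) \<le>
      (\<Sum>n<N. integral {x+real n..x+real n+1} (\<lambda>t. (norm (f (complex_of_real t)))\<^sup>2))"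
      unfolding shift[OF h(1)] using h ci[of 0]
      by (intro sum_mono integral_subset_le) auto
    also have "\<dots> = integral {x..x+real N} (\<lambda>t. (norm (f (complex_of_real t)))\<^sup>2)"
    proof (induction N)
      case (Suc N)
      have "integral {x..x+real N} (\<lambda>t. (norm (f (complex_of_real t)))\<^sup>2) +
         integral {x+real N..x+real (Suc N)} (\<lambda>t. (norm (f (complex_of_real t)))\<^sup>2) =
         integral {x..x+real (Suc N)} (\<lambda>t. (norm (f (complex_of_real t)))\<^sup>2)"
        using ci[of 0] by (intro Henstock_Kurzweil_Integration.integral_combine) auto
      then show ?case using Suc by (simp add: algebra_simps)
    qed simp
    also have "\<dots> \<le> E" by (rule E)
    finally show ?thesis .
  qed
  have "norm (integral {x..x+h} (\<lambda>t. \<Phi> (complex_of_real t))) \<le> M" if h: "0 \<le> h" "h \<le> 1" for x h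
  proof -
    define bb where "bb = (\<lambda>t. (S / C + C * (\<Sum>n<N. (norm (f (complex_of_real (t + real n))))\<^sup>2)) / 2)"
    have "norm (\<Phi> (of_real t)) \<le> bb t" for t
    proof -
      have "norm (\<Phi> (of_real t)) \<le> (\<Sum>n<N. norm (c n * f (of_real t + of_nat n)))"
        unfolding \<Phi>_def by (rule norm_sum)
      also have "\<dots> \<le> (\<Sum>n<N. ((norm (c n))\<^sup>2 / C + C * (norm (f (complex_of_real (t + real n))))\<^sup>2) / 2)"
      proof (rule sum_mono)
        fix n
        let ?a = "norm (c n)" and ?b = "norm (f (complex_of_real (t + real n)))"
        have "0 \<le> (?a - C * ?b)\<^sup>2 / C" using C by simp
        also have "\<dots> = ?a\<^sup>2 / C + C * ?b\<^sup>2 - 2 * (?a * ?b)"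
          using C by (simp add: power2_eq_square field_simps)
        finally show "norm (c n * f (of_real t + of_nat n)) \<le> (?a\<^sup>2 / C + C * ?b\<^sup>2) / 2"
          by (simp add: norm_mult)
      qed
      also have "\<dots> = bb t"
        unfolding bb_def S_def by (simp add: sum.distrib sum_divide_distrib sum_distrib_left add_divide_distrib)
      finally show ?thesis .
    qed
    moreover have bi: "bb integrable_on {x..x+h}"
      unfolding bb_def by (intro integrable_continuous_interval continuous_intros cf) auto
    moreover have "(\<lambda>t. \<Phi> (complex_of_real t)) integrable_on {x..x+h}"
      by (intro integrable_continuous_interval entire_real_continuous hp)
    ultimately have "norm (integral {x..x+h} (\<lambda>t. \<Phi> (complex_of_real t))) \<le> integral {x..x+h} bb"
      by (intro integral_norm_bound_integral) auto
    also have "integral {x..x+h} bb = (h * (S / C) + C * (\<Sum>n<N. integral {x..x+h} (\<lambda>t. (norm (f (complex_of_real (t + real n))))\<^sup>2))) / 2"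
    proof -
      have "((\<lambda>t. (S / C + C * (\<Sum>n<N. (norm (f (complex_of_real (t + real n))))\<^sup>2)) / 2) has_integral
         (h *\<^sub>R (S / C) + C * (\<Sum>n<N. integral {x..x+h} (\<lambda>t. (norm (f (complex_of_real (t + real n))))\<^sup>2))) / 2) {x..x+h}"
        using has_integral_const_real[of "S / C" x "x+h"] h
        by (intro has_integral_divide has_integral_add has_integral_mult_right has_integral_sum
              integrable_integral ci) auto
      from integral_unique[OF this] show ?thesis unfolding bb_def by (simp only: real_scaleR_def)
    qed
    also have "\<dots> \<le> M"
    proof -
      have "h * (S / C) \<le> 1 * (S / C)" using h S0 C by (intro mult_right_mono) auto
      moreover have "C * (\<Sum>n<N. integral {x..x+h} (\<lambda>t. (norm (f (complex_of_real (t + real n))))\<^sup>2)) \<le> C * E"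
        using sumE[OF h] C by (intro mult_left_mono) auto
      ultimately show ?thesis unfolding M_def mult_1_left by (intro divide_right_mono add_mono) simp_all
    qed
    finally show ?thesis .
  qed
  from bound_from_short_averages[OF hp tp s this, of "of_real b"]
  have "norm (\<Phi> (of_real b)) \<le> C * M" by (simp add: C_def)
  moreover have "\<Phi> (of_real b) = of_real S"
    unfolding \<Phi>_def S_def c_def
    unfolding of_real_sum complex_mod_cnj complex_norm_square
    by (simp add: mult.commute)
  ultimately have "S \<le> C * M" using S0 by simp
  then have "S \<le> S / 2 + C\<^sup>2 * E / 2" using C unfolding M_def by (simp add: field_simps power2_eq_square)
  then have "S \<le> C\<^sup>2 * E" by simp
  then show ?thesis by (simp add: S_def c_def C_def)
qed

text \<open>
  A single sample at an arbitrary real point bounds \<open>f\<close> on the line.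
\<close>

lemma real_line_bound:
  assumes hol: "f holomorphic_on UNIV" and ty: "exponential_type_le \<sigma> f" and s: "\<sigma> \<ge> 0"
    and E: "\<And>a b. integral {a..b} (\<lambda>t. (norm (f (complex_of_real t)))\<^sup>2) \<le> E"
  shows "norm (f z) \<le> (1 + exp \<sigma>) * sqrt E * exp (\<sigma> * \<bar>Im z\<bar>)"
proof (rule exponential_type_bounded_line[OF hol ty])
  fix x
  have "(norm (f (of_real x)))\<^sup>2 \<le> (1 + exp \<sigma>)\<^sup>2 * E"
    using Plancherel_Polya[OF assms, where N = 1 and b = x] by simp
  then have "norm (f (of_real x)) \<le> sqrt ((1 + exp \<sigma>)\<^sup>2 * E)"
    by (rule real_le_rsqrt)
  also have "\<dots> = (1 + exp \<sigma>) * sqrt E"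
    by (simp add: real_sqrt_mult add_nonneg_nonneg)
  finally show "norm (f (of_real x)) \<le> (1 + exp \<sigma>) * sqrt E" .
qed

section \<open>Entire functions vanishing at the integers\<close>

lemma sin_pi_zero_iff: "sin (complex_of_real pi * z) = 0 \<longleftrightarrow> (\<exists>n::int. z = of_int n)"
proof -
  have "sin (complex_of_real pi * z) = 0 \<longleftrightarrow> (\<exists>n::int. complex_of_real pi * z = of_real (of_int n * pi))"
    by (rule sin_eq_0)
  also have "\<dots> \<longleftrightarrow> (\<exists>n::int. z = of_int n)"
    by (intro ex_cong1) (auto simp: mult.commute)
  finally show ?thesis .
qed

text \<open>
  The two cases cover the sides of the rectangles of height \<open>2\<close> over the intervals between consecutive half
  integers.
\<close>

lemma norm_sin_pi_lower:
  assumes "\<bar>Im z\<bar> \<ge> 1 \<or> cos (2 * (pi * Re z)) = - 1"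
  shows "exp (pi * \<bar>Im z\<bar>) / 4 \<le> norm (sin (complex_of_real pi * z))"
proof -
  define y where "y = \<bar>Im z\<bar>"
  define X where "X = exp (pi * y)"
  have y: "y \<ge> 0" by (simp add: y_def)
  have X1: "X \<ge> 1" unfolding X_def using y by simp
  have sq: "(norm (sin (complex_of_real pi * z)))\<^sup>2 = (X\<^sup>2 + inverse (X\<^sup>2) - 2 * cos (2 * (pi * Re z))) / 4"
  proof (cases "Im z \<ge> 0")
    case True
    then have "X\<^sup>2 = exp (2 * (pi * Im z))" by (simp add: X_def y_def exp_double[symmetric])
    then show ?thesis unfolding norm_sin_squared by (simp add: mult.left_commute)
  next
    case False
    then have "X\<^sup>2 = inverse (exp (2 * (pi * Im z)))"
      by (simp add: X_def y_def exp_double[symmetric] exp_minus power_inverse)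
    then show ?thesis unfolding norm_sin_squared by (simp add: mult.left_commute)
  qed
  have aux: "a / 16 \<le> (a + i - 2 * c) / 4"
    if "a \<ge> 16 \<or> a \<ge> 0 \<and> c = - 1" "i \<ge> 0" "c \<le> 1" for a i c :: real
    using that by auto
  have "(X / 4)\<^sup>2 \<le> (norm (sin (complex_of_real pi * z)))\<^sup>2"
  proof (cases "y \<ge> 1")
    case True
    have "pi \<le> pi * y" using True by simp
    then have "4 \<le> 1 + pi * y" using pi_gt3 by linarith
    then have "4 \<le> X" unfolding X_def using exp_ge_add_one_self[of "pi * y"] by linarith
    then have "4 * 4 \<le> X * X" by (intro mult_mono) auto
    then have "X\<^sup>2 \<ge> 16" by (simp add: power2_eq_square)
    moreover have "inverse (X\<^sup>2) \<ge> 0" by simp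
    moreover have "cos (2 * (pi * Re z)) \<le> 1" by simp
    moreover have "(X / 4)\<^sup>2 = X\<^sup>2 / 16" by (simp add: power_divide)
    ultimately show ?thesis unfolding sq by (metis aux cos_le_one)
  next
    case False
    then have "cos (2 * (pi * Re z)) = - 1" using assms by (auto simp: y_def)
    moreover have "inverse (X\<^sup>2) \<ge> 0" by simp
    moreover have "X\<^sup>2 \<ge> 0" by simp
    moreover have "(X / 4)\<^sup>2 = X\<^sup>2 / 16" by (simp add: power_divide)
    ultimately show ?thesis unfolding sq by (metis aux cos_le_one)
  qed
  then have "X / 4 \<le> norm (sin (complex_of_real pi * z))"
    by (rule power2_le_imp_le) simp
  then show ?thesis by (simp add: X_def y_def)
qed

text \<open>
  The quotient \<open>H z / sin (\<pi> z)\<close> has removable singularities. It is bounded for \<open>|Im z| \<ge> 1\<close> and on the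
  vertical lines through half integers, hence everywhere by the maximum principle, and the Liouville
  theorem applies.
\<close>

lemma entire_vanishing_at_integers:
  fixes H :: "complex \<Rightarrow> complex"
  assumes hol: "H holomorphic_on UNIV" and zero: "\<And>n::int. H (of_int n) = 0"
    and bd: "\<And>z. norm (H z) \<le> C * exp (pi * \<bar>Im z\<bar>)"
  shows "\<exists>c. \<forall>z. H z = c * sin (of_real pi * z)"
proof -
  define s where "s = (\<lambda>z::complex. sin (of_real pi * z))"
  have dH: "(H has_field_derivative deriv H z) (at z)" for z
    using holomorphic_derivI[OF hol open_UNIV] by simp
  have ds: "(s has_field_derivative (of_real pi * cos (of_real pi * z))) (at z)" for z
    unfolding s_def by (auto intro!: derivative_eq_intros)
  define G where "G = (\<lambda>z. if s z = 0 then deriv H z / (of_real pi * cos (of_real pi * z)) else H z / s z)"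
  have cont: "isCont G z" if z: "s z = 0" for z
  proof -
    obtain n :: int where n: "z = of_int n" using z sin_pi_zero_iff s_def by auto
    have c0: "cos (of_real pi * z) \<noteq> 0"
    proof
      assume "cos (of_real pi * z) = 0"
      with sin_cos_squared_add[of "of_real pi * z"] z show False by (simp add: s_def)
    qed
    have "((\<lambda>w. ((H w - H z) / (w - z)) / ((s w - s z) / (w - z))) \<longlongrightarrow> 
        deriv H z / (of_real pi * cos (of_real pi * z))) (at z)"
      using dH[of z] ds[of z] c0
      by (intro tendsto_divide) (auto simp: has_field_derivative_iff)
    moreover have "eventually (\<lambda>w. ((H w - H z) / (w - z)) / ((s w - s z) / (w - z)) = G w) (at z)"
    proof -
      have "eventually (\<lambda>w. w \<noteq> z \<and> w \<in> ball z 1) (at z)"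
        unfolding eventually_at by (intro exI[of _ 1]) (auto simp: dist_commute)
      then show ?thesis
      proof eventually_elim
        case (elim w)
        have "s w \<noteq> 0"
        proof
          assume "s w = 0"
          then obtain k :: int where k: "w = of_int k" using sin_pi_zero_iff s_def by auto
          have "norm (of_int (k - n) :: complex) < 1" using elim unfolding n k
            by (simp add: dist_norm norm_minus_commute)
          then have "\<bar>k - n\<bar> < 1" by (simp only: norm_of_int of_int_less_1_iff flip: of_int_abs)
          then show False using elim n k by auto
        qed
        then show ?case using elim z zero[of n] n by (simp add: G_def)
      qed
    qed
    ultimately have "(G \<longlongrightarrow> deriv H z / (of_real pi * cos (of_real pi * z))) (at z)"
      using tendsto_cong by force
    then show ?thesis using z by (simp add: isCont_def G_def)
  qed
  have os: "open {z. s z \<noteq> 0}"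
    unfolding s_def by (intro open_Collect_neq continuous_intros)
  have hol1: "G holomorphic_on {z. s z \<noteq> 0}"
  proof -
    have "(\<lambda>z. H z / s z) holomorphic_on {z. s z \<noteq> 0}"
      unfolding s_def by (intro holomorphic_intros holomorphic_on_subset[OF hol]) auto
    then show ?thesis by (rule holomorphic_transform) (simp add: G_def)
  qed
  have "isCont G z" for z
    using cont[of z] holomorphic_on_imp_continuous_on[OF hol1] continuous_on_eq_continuous_at[OF os]
    by blast
  then have contG: "continuous_on A G" for A
    by (simp add: continuous_at_imp_continuous_on)
  have holG: "G holomorphic_on UNIV"
  proof -
    have "G field_differentiable (at z)" for z
    proof (cases "s z = 0")
      case False
      then show ?thesis using hol1 os holomorphic_on_imp_differentiable_at by blast
    next
      case True
      then obtain n :: int where n: "z = of_int n" using sin_pi_zero_iff s_def by auto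
      have "G holomorphic_on ball z 1"
      proof (rule no_isolated_singularity[OF contG _ open_ball])
        show "G holomorphic_on ball z 1 - {z}"
        proof (rule holomorphic_on_subset[OF hol1], rule subsetI, rule CollectI, rule notI)
          fix w assume w: "w \<in> ball z 1 - {z}" "s w = 0"
          then obtain k :: int where k: "w = of_int k" using sin_pi_zero_iff s_def by auto
          have "norm (of_int (k - n) :: complex) < 1" using w unfolding n k
            by (simp add: dist_norm norm_minus_commute)
          then have "\<bar>k - n\<bar> < 1" by (simp only: norm_of_int of_int_less_1_iff flip: of_int_abs)
          then show False using n k w by auto
        qed
      qed auto
      then show ?thesis using holomorphic_on_imp_differentiable_at[OF _ open_ball] by auto
    qed
    then show ?thesis by (simp add: holomorphic_on_def field_differentiable_at_within)
  qed
  have C0: "C \<ge> 0" using order_trans[OF norm_ge_zero bd[of 0]] by simp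
  (* On the lines Re z = n + 1/2 the cosine below is -1 and sin (pi z) is as large as possible. *)
  have bnd1: "norm (G z) \<le> 4 * C" if "\<bar>Im z\<bar> \<ge> 1 \<or> cos (2 * (pi * Re z)) = - 1" for z
  proof -
    have 1: "exp (pi * \<bar>Im z\<bar>) / 4 \<le> norm (s z)" unfolding s_def using that by (rule norm_sin_pi_lower)
    then have s0: "norm (s z) > 0" using exp_gt_zero[of "pi * \<bar>Im z\<bar>"] by linarith
    have "norm (H z) \<le> 4 * C * (exp (pi * \<bar>Im z\<bar>) / 4)" using bd[of z] by simp
    also have "\<dots> \<le> 4 * C * norm (s z)" using 1 C0 by (intro mult_left_mono) auto
    finally show ?thesis using s0 by (simp add: G_def norm_divide divide_le_eq)
  qed
  have bnd: "norm (G z) \<le> 4 * C" for z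
  proof (cases "\<bar>Im z\<bar> \<ge> 1")
    case True then show ?thesis using bnd1 by blast
  next
    case False
    define n where "n = round (Re z)"
    define a where "a = Complex (of_int n - 1/2) (-1)"
    define b where "b = Complex (of_int n + 1/2) 1"
    have "of_int n - 1/2 \<le> Re z" "Re z \<le> of_int n + 1/2"
      using of_int_round_abs_le[of "Re z"] unfolding n_def by linarith+
    then have zin: "z \<in> cbox a b"
      using False by (auto simp: a_def b_def in_cbox_complex_iff)
    show ?thesis
    proof (rule maximum_modulus_frontier[where S = "cbox a b" and f = G])
      show "norm (G w) \<le> 4 * C" if "w \<in> frontier (cbox a b)" for w
      proof -
        have "w \<in> cbox a b" "w \<notin> box a b" using that by (auto simp: frontier_cbox)
        then have "\<bar>Im w\<bar> \<ge> 1 \<or> Re w = of_int n - 1/2 \<or> Re w = of_int n + 1/2"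
          by (auto simp: a_def b_def in_cbox_complex_iff in_box_complex_iff)
        moreover have "cos (2 * (pi * (of_int n - 1/2))) = - 1"
        proof -
          have "cos (2 * (pi * (of_int n - 1/2))) = cos (of_int n * (2 * pi) - pi)" by (simp add: algebra_simps)
          also have "\<dots> = - cos (2 * pi * of_int n)" by (simp add: mult.commute)
          finally show ?thesis by (simp add: cos_int_2pin)
        qed
        moreover have "cos (2 * (pi * (of_int n + 1/2))) = - 1"
        proof -
          have "cos (2 * (pi * (of_int n + 1/2))) = cos (of_int n * (2 * pi) + pi)" by (simp add: algebra_simps)
          also have "\<dots> = - cos (2 * pi * of_int n)" by (simp add: mult.commute)
          finally show ?thesis by (simp add: cos_int_2pin)
        qed
        ultimately have "\<bar>Im w\<bar> \<ge> 1 \<or> cos (2 * (pi * Re w)) = - 1" by metis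
        then show ?thesis by (rule bnd1)
      qed
    qed (use zin in \<open>auto intro: holomorphic_on_subset[OF holG] contG\<close>)
  qed
  have "bounded (range G)" unfolding bounded_iff using bnd by blast
  then obtain c where c: "\<And>z. G z = c"
    using Liouville_theorem[OF holG] by (auto simp: constant_on_def)
  have "H z = c * s z" for z
  proof (cases "s z = 0")
    case True
    then obtain n :: int where "z = of_int n" using sin_pi_zero_iff s_def by auto
    then show ?thesis using zero True by simp
  next
    case False
    then show ?thesis using c[of z] by (auto simp: G_def field_simps)
  qed
  then show ?thesis unfolding s_def by blast
qed

section \<open>Shifting the spectral parameter\<close>

lemma exponential_type_times_id:
  assumes "exponential_type_le \<sigma> f"
  shows "exponential_type_le \<sigma> (\<lambda>z. z * f z)"
  unfolding exponential_type_le_def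
proof (intro allI impI)
  fix \<epsilon> :: real assume e: "\<epsilon> > 0"
  then obtain C where C: "\<And>z. norm (f z) \<le> C * exp ((\<sigma> + \<epsilon> / 2) * norm z)"
    using assms unfolding exponential_type_le_def by (meson half_gt_zero)
  have C0: "0 \<le> C" using order_trans[OF norm_ge_zero C[of 0]] by simp
  have "norm (z * f z) \<le> (2 / \<epsilon> * C) * exp ((\<sigma> + \<epsilon>) * norm z)" for z
  proof -
    have "\<epsilon> / 2 * norm z \<le> exp (\<epsilon> / 2 * norm z)"
      using exp_ge_add_one_self[of "\<epsilon> / 2 * norm z"] by linarith
    then have "norm z \<le> 2 / \<epsilon> * exp (\<epsilon> / 2 * norm z)" using e by (simp add: field_simps)
    then have "norm z * norm (f z) \<le> (2 / \<epsilon> * exp (\<epsilon> / 2 * norm z)) * (C * exp ((\<sigma> + \<epsilon> / 2) * norm z))"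
      using e C[of z] by (intro mult_mono) auto
    also have "\<dots> = (2 / \<epsilon> * C) * (exp (\<epsilon> / 2 * norm z) * exp ((\<sigma> + \<epsilon> / 2) * norm z))" by (simp add: mult_ac)
    also have "exp (\<epsilon> / 2 * norm z) * exp ((\<sigma> + \<epsilon> / 2) * norm z) = exp ((\<sigma> + \<epsilon>) * norm z)"
      unfolding exp_add[symmetric] by (simp add: algebra_simps)
    finally show ?thesis by (simp only: norm_mult)
  qed
  then show "\<exists>C. \<forall>z. norm (z * f z) \<le> C * exp ((\<sigma> + \<epsilon>) * norm z)" by blast
qed

lemma exponential_type_power_times:
  assumes "exponential_type_le \<sigma> f"
  shows "exponential_type_le \<sigma> (\<lambda>z. z ^ k * f z)"
proof (induction k)
  case (Suc k)
  from exponential_type_times_id[OF this] show ?case by (simp add: mult.assoc)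
qed (use assms in simp)

lemma exponential_type_divide_id:
  assumes ty: "exponential_type_le \<sigma> (\<lambda>z. z * v z)" and v: "continuous_on UNIV v" and s: "\<sigma> \<ge> 0"
  shows "exponential_type_le \<sigma> v"
  unfolding exponential_type_le_def
proof (intro allI impI)
  fix \<epsilon> :: real assume e: "\<epsilon> > 0"
  then obtain C where C: "\<And>z. norm (z * v z) \<le> C * exp ((\<sigma> + \<epsilon>) * norm z)"
    using ty unfolding exponential_type_le_def by blast
  have C0: "0 \<le> C" using order_trans[OF norm_ge_zero C[of 0]] by simp
  have "bounded (v ` cball 0 1)"
    by (intro compact_imp_bounded compact_continuous_image continuous_on_subset[OF v]) auto
  then obtain K where K: "\<And>z. norm z \<le> 1 \<Longrightarrow> norm (v z) \<le> K"
    unfolding bounded_iff by (metis imageI mem_cball_0)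
  have K0: "K \<ge> 0" using order_trans[OF norm_ge_zero K[of 0]] by simp
  have "norm (v z) \<le> (C + K) * exp ((\<sigma> + \<epsilon>) * norm z)" for z
  proof (cases "norm z \<le> 1")
    case True
    have "0 \<le> (\<sigma> + \<epsilon>) * norm z" using s e by simp
    then have e1: "1 \<le> exp ((\<sigma> + \<epsilon>) * norm z)" by simp
    have "norm (v z) \<le> (C + K) * 1" using K[OF True] C0 by simp
    also have "\<dots> \<le> (C + K) * exp ((\<sigma> + \<epsilon>) * norm z)" using C0 K0 e1 by (intro mult_left_mono) auto
    finally show ?thesis .
  next
    case False
    have "norm (v z) \<le> norm z * norm (v z)" using False mult_right_mono[of 1 "norm z" "norm (v z)"] by simp
    also have "\<dots> \<le> C * exp ((\<sigma> + \<epsilon>) * norm z)" using C[of z] by (simp add: norm_mult)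
    also have "\<dots> \<le> (C + K) * exp ((\<sigma> + \<epsilon>) * norm z)" using K0 by (intro mult_right_mono) auto
    finally show ?thesis .
  qed
  then show "\<exists>C. \<forall>z. norm (v z) \<le> C * exp ((\<sigma> + \<epsilon>) * norm z)" by blast
qed

text \<open>
  An even function does not see which of the two square roots is taken; this removes the branch cut of
  \<^const>\<open>csqrt\<close> everywhere below.
\<close>

lemma even_csqrt:
  fixes v :: "complex \<Rightarrow> 'a"
  assumes even: "\<And>z. v (- z) = v z" and "w = z\<^sup>2"
  shows "v (csqrt w) = v z"
proof -
  have "(csqrt w)\<^sup>2 = z\<^sup>2" using assms(2) by (simp only: power2_csqrt)
  then have "csqrt w = z \<or> csqrt w = - z" by (simp only: power2_eq_iff)
  then show ?thesis using even by auto
qed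

text \<open>
  Away from the origin \<open>w\<close> avoids one of the two half lines, and on the complement of each of them a branch
  of the square root is holomorphic; the origin is a removable singularity.
\<close>

lemma entire_even_csqrt:
  assumes v: "v holomorphic_on UNIV" and even: "\<And>z. v (- z) = v z"
  shows "(\<lambda>w. v (csqrt w)) holomorphic_on UNIV"
proof -
  have 1: "(\<lambda>w. v (csqrt w)) holomorphic_on - \<real>\<^sub>\<le>\<^sub>0"
    using holomorphic_on_compose_gen[OF holomorphic_on_csqrt v] by (simp add: o_def)
  have eq: "v (csqrt w) = v (\<i> * csqrt (- w))" for w
    by (rule even_csqrt[of v, OF even]) (simp add: power_mult_distrib)
  have h2: "(\<lambda>w. \<i> * csqrt (- w)) holomorphic_on - \<real>\<^sub>\<ge>\<^sub>0"
    by (intro holomorphic_intros) (auto simp: complex_nonpos_Reals_iff complex_nonneg_Reals_iff)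
  have "(\<lambda>w. v (\<i> * csqrt (- w))) holomorphic_on - \<real>\<^sub>\<ge>\<^sub>0"
    using holomorphic_on_compose_gen[OF h2 v] by (simp add: o_def)
  then have 2: "(\<lambda>w. v (csqrt w)) holomorphic_on - \<real>\<^sub>\<ge>\<^sub>0"
    using eq by simp
  have "(\<lambda>w. v (csqrt w)) holomorphic_on (- \<real>\<^sub>\<le>\<^sub>0) \<union> (- \<real>\<^sub>\<ge>\<^sub>0)"
    by (rule holomorphic_on_Un[OF 1 2])
       (auto intro: open_Compl closed_nonpos_Reals_complex closed_nonneg_Reals_complex)
  moreover have "(- \<real>\<^sub>\<le>\<^sub>0) \<union> (- \<real>\<^sub>\<ge>\<^sub>0) = UNIV - {0::complex}"
    by (auto simp: complex_nonpos_Reals_iff complex_nonneg_Reals_iff complex_eq_iff)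
  ultimately have hol0: "(\<lambda>w. v (csqrt w)) holomorphic_on UNIV - {0}" by simp
  have "isCont csqrt 0"
  proof -
    have "((\<lambda>w::complex. sqrt (norm w)) \<longlongrightarrow> sqrt (norm (0::complex))) (at 0)"
      by (intro tendsto_intros)
    then have "((\<lambda>w. norm (csqrt w)) \<longlongrightarrow> 0) (at 0)" by simp
    then show ?thesis unfolding isCont_def csqrt_0 by (rule tendsto_norm_zero_cancel)
  qed
  moreover have "isCont v z" for z
    using holomorphic_on_imp_continuous_on[OF v] continuous_on_eq_continuous_at[OF open_UNIV] by blast
  ultimately have "isCont (\<lambda>w. v (csqrt w)) 0" by (intro isCont_o2[where f = csqrt and g = v])
  moreover have "isCont (\<lambda>w. v (csqrt w)) w" if "w \<noteq> 0" for w
    using holomorphic_on_imp_continuous_on[OF hol0] that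
    by (subst (asm) continuous_on_eq_continuous_at) auto
  ultimately have "continuous_on UNIV (\<lambda>w. v (csqrt w))"
    by (metis continuous_at_imp_continuous_on)
  then show ?thesis
    by (rule no_isolated_singularity[OF _ hol0]) auto
qed

text \<open>
  With \<open>\<nu> = sqrt (x\<^sup>2 + Q)\<close> one has \<open>F x = (x / \<nu>) f \<nu>\<close> and \<open>d\<nu> = (x / \<nu>) dx\<close>, so substitution turns the
  energy of \<open>F\<close> on the positive half line into at most that of \<open>f\<close> beyond \<open>sqrt Q\<close>.
\<close>

lemma energy_of_shift:
  fixes f :: "complex \<Rightarrow> complex"
  assumes f: "f holomorphic_on UNIV" and fv: "\<And>z. f z = z * v z" and even: "\<And>z. v (- z) = v z"
    and Q: "Q > 0"
  defines "F \<equiv> \<lambda>\<mu>. \<mu> * v (csqrt (\<mu>\<^sup>2 + of_real Q))"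
  assumes F: "F holomorphic_on UNIV"
  shows "\<exists>c\<ge>sqrt Q. integral {a..b} (\<lambda>x. (norm (of_real x ^ j * F (of_real x)))\<^sup>2)
          \<le> 2 * integral {sqrt Q..c} (\<lambda>x. (norm (of_real x ^ j * f (of_real x)))\<^sup>2)"
proof -
  define h where "h = (\<lambda>x. (norm (of_real x ^ j * f (of_real x)))\<^sup>2)"
  define k where "k = (\<lambda>x. (norm (of_real x ^ j * F (of_real x)))\<^sup>2)"
  define A where "A = max \<bar>a\<bar> \<bar>b\<bar>"
  define \<nu> where "\<nu> = (\<lambda>x. sqrt (x\<^sup>2 + Q))"
  have A: "A \<ge> 0" "{a..b} \<subseteq> {-A..A}" by (auto simp: A_def)
  have \<nu>pos: "\<nu> x > 0" for x unfolding \<nu>_def using Q by (simp add: add_nonneg_pos)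
  have ch: "continuous_on S h" for S unfolding h_def
    by (intro continuous_intros entire_real_continuous f)
  have ck: "continuous_on S k" for S unfolding k_def
    by (intro continuous_intros entire_real_continuous F)
  have kn: "k x \<le> (x / \<nu> x) * h (\<nu> x)" if x: "x \<ge> 0" for x
  proof -
    have "complex_of_real x ^ 2 + of_real Q = (complex_of_real (\<nu> x))\<^sup>2"
      using Q by (simp add: \<nu>_def flip: of_real_power of_real_add)
    then have "v (csqrt ((complex_of_real x)\<^sup>2 + of_real Q)) = v (of_real (\<nu> x))"
      by (rule even_csqrt[of v, OF even])
    then have "F (of_real x) = of_real x * v (of_real (\<nu> x))"
      unfolding F_def by simp
    then have nF: "norm (F (of_real x)) * \<nu> x = x * norm (f (of_real (\<nu> x)))"
      using \<nu>pos[of x] x by (simp add: fv norm_mult mult_ac)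
    have le: "x \<le> \<nu> x" unfolding \<nu>_def using Q by (intro real_le_rsqrt) auto
    define N where "N = norm (f (of_real (\<nu> x)))"
    have "norm (F (of_real x)) = x / \<nu> x * N"
      using nF \<nu>pos[of x] by (simp add: N_def field_simps)
    then have "k x = (x ^ j * (x / \<nu> x * N))\<^sup>2"
      using x by (simp add: k_def norm_mult norm_power)
    also have "\<dots> = (x / \<nu> x) * ((x / \<nu> x) * (x ^ j)\<^sup>2 * N\<^sup>2)"
      by (simp add: power_mult_distrib power2_eq_square)
    also have "\<dots> \<le> (x / \<nu> x) * (1 * (\<nu> x ^ j)\<^sup>2 * N\<^sup>2)"
      using x le \<nu>pos[of x] by (intro mult_left_mono mult_right_mono mult_mono power_mono) (auto simp: divide_le_eq)
    also have "\<dots> = (x / \<nu> x) * h (\<nu> x)"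
      using \<nu>pos[of x] by (simp add: h_def N_def norm_mult norm_power power_mult_distrib)
    finally show ?thesis .
  qed
  have even_k: "k (- x) = k x" for x
    unfolding k_def F_def by (simp add: norm_mult norm_power)
  have c\<nu>: "continuous_on {0..A} \<nu>" unfolding \<nu>_def by (intro continuous_intros)
  have "((\<lambda>x. (x / \<nu> x) *\<^sub>R h (\<nu> x)) has_integral (integral {\<nu> 0..\<nu> A} h)) {0..A}"
  proof (rule has_integral_substitution[where c = "\<nu> 0" and d = "\<nu> A"])
    show "\<nu> ` {0..A} \<subseteq> {\<nu> 0..\<nu> A}" by (auto simp: \<nu>_def)
    show "(\<nu> has_real_derivative x / \<nu> x) (at x within {0..A})" if "x \<in> {0..A}" for x
      unfolding \<nu>_def using Q \<nu>pos[of x, unfolded \<nu>_def]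
      by (auto intro!: derivative_eq_intros simp: field_simps add_nonneg_pos)
  qed (use A ch in \<open>auto simp: \<nu>_def\<close>)
  then have sub: "((\<lambda>x. (x / \<nu> x) * h (\<nu> x)) has_integral (integral {\<nu> 0..\<nu> A} h)) {0..A}" by simp
  have half: "integral {0..A} k \<le> integral {\<nu> 0..\<nu> A} h"
    by (rule integral_le[OF integrable_continuous_interval[OF ck] has_integral_integrable[OF sub], unfolded integral_unique[OF sub]])
       (use kn in auto)
  have "integral {-A..0} k = integral {0..A} k"
    using Henstock_Kurzweil_Integration.integral_reflect_real[of A 0 k] even_k by simp
  moreover have "integral {-A..A} k = integral {-A..0} k + integral {0..A} k"
    using A by (intro Henstock_Kurzweil_Integration.integral_combine[symmetric] integrable_continuous_interval ck) auto
  moreover have "integral {a..b} k \<le> integral {-A..A} k"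
    by (intro integral_subset_le A integrable_continuous_interval ck) (auto simp: k_def)
  ultimately have "integral {a..b} k \<le> 2 * integral {\<nu> 0..\<nu> A} h" using half by simp
  moreover have "\<nu> 0 = sqrt Q" by (simp add: \<nu>_def)
  moreover have "\<nu> A \<ge> sqrt Q" by (simp add: \<nu>_def)
  ultimately show ?thesis unfolding k_def h_def by auto
qed

lemma small_tail:
  fixes h :: "real \<Rightarrow> real"
  assumes c: "continuous_on UNIV h" and h0: "\<And>x. h x \<ge> 0" and E: "\<And>a b. integral {a..b} h \<le> E"
    and \<delta>: "\<delta> > 0"
  shows "\<exists>R>0. \<forall>b. integral {R..b} h \<le> \<delta>"
proof -
  define I where "I = (\<lambda>n::nat. integral {0..real n} h)"
  have ih: "h integrable_on {a..b}" for a b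
    by (intro integrable_continuous_interval continuous_on_subset[OF c]) auto
  have "incseq I" unfolding I_def
    by (intro incseq_SucI integral_subset_le ih) (auto simp: h0)
  moreover have "I n \<le> E" for n unfolding I_def by (rule E)
  ultimately obtain L where L: "I \<longlonglongrightarrow> L" "\<And>n. I n \<le> L"
    using incseq_convergent by (metis)
  then obtain n where n: "L - \<delta> < I n"
    using order_tendstoD(1)[OF L(1), of "L - \<delta>"] \<delta> by (auto simp: eventually_sequentially)
  have "integral {real (Suc n)..b} h \<le> \<delta>" for b
  proof (cases "real (Suc n) \<le> b")
    case False
    then show ?thesis using \<delta> by simp
  next
    case True
    obtain m where m: "b \<le> real m" using real_arch_simple by blast
    have "integral {real (Suc n)..b} h \<le> integral {real n..real m} h"
      using m by (intro integral_subset_le ih) (auto simp: h0)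
    moreover have "I n + integral {real n..real m} h = I m"
      unfolding I_def using m True by (intro Henstock_Kurzweil_Integration.integral_combine ih) auto
    ultimately show ?thesis using L(2)[of m] n by linarith
  qed
  then show ?thesis by (intro exI[of _ "real (Suc n)"]) auto
qed

text \<open>
  The energy of \<open>f\<close> beyond \<open>sqrt Q\<close> is the tail of a convergent integral. The weighted energy need not be
  small; it only has to stay finite, which is what the smoothness of the potential will rest on.
\<close>

lemma small_shifted_data:
  fixes f v :: "complex \<Rightarrow> complex"
  assumes f: "f holomorphic_on UNIV" and ty: "exponential_type_le \<sigma> f" and s: "\<sigma> \<ge> 0"
    and v: "v holomorphic_on UNIV" and fv: "\<And>z. f z = z * v z" and even: "\<And>z. v (- z) = v z"
    and E0: "\<And>a b. integral {a..b} (\<lambda>x. (norm (f (of_real x)))\<^sup>2) \<le> E0"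
    and Em: "\<And>a b. integral {a..b} (\<lambda>x. (norm (of_real x ^ m * f (of_real x)))\<^sup>2) \<le> Em"
    and \<delta>: "\<delta> > 0"
  obtains Q where "Q > 0" "(\<lambda>\<mu>. v (csqrt (\<mu>\<^sup>2 + of_real Q))) holomorphic_on UNIV"
    "exponential_type_le \<sigma> (\<lambda>\<mu>. \<mu> * v (csqrt (\<mu>\<^sup>2 + of_real Q)))"
    "\<And>a b. integral {a..b} (\<lambda>x. (norm (of_real x * v (csqrt ((of_real x)\<^sup>2 + of_real Q))))\<^sup>2) \<le> \<delta>"
    "\<And>a b. integral {a..b} (\<lambda>x. (norm (of_real x ^ m * (of_real x * v (csqrt ((of_real x)\<^sup>2 + of_real Q)))))\<^sup>2) \<le> 2 * Em"
proof -
  have ch: "continuous_on UNIV (\<lambda>x. (norm (f (of_real x)))\<^sup>2)"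
    by (intro continuous_intros entire_real_continuous f)
  obtain R where R: "R > 0" "\<And>b. integral {R..b} (\<lambda>x. (norm (f (of_real x)))\<^sup>2) \<le> \<delta> / 2"
    using small_tail[OF ch _ E0, of "\<delta> / 2"] \<delta> by auto
  define Q where "Q = R\<^sup>2"
  have Q: "Q > 0" "sqrt Q = R" using R by (auto simp: Q_def)
  define V where "V = (\<lambda>\<mu>. v (csqrt (\<mu>\<^sup>2 + of_real Q)))"
  have "(\<lambda>\<mu>::complex. \<mu>\<^sup>2 + of_real Q) holomorphic_on UNIV" by (intro holomorphic_intros)
  from holomorphic_on_compose_gen[OF this entire_even_csqrt[OF v even]]
  have V: "V holomorphic_on UNIV" by (simp add: o_def V_def)
  have F: "(\<lambda>\<mu>. \<mu> * V \<mu>) holomorphic_on UNIV" by (intro holomorphic_intros V)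
  have tv: "exponential_type_le \<sigma> v"
  proof (rule exponential_type_divide_id[OF _ holomorphic_on_imp_continuous_on[OF v] s])
    show "exponential_type_le \<sigma> (\<lambda>z. z * v z)" using ty fv by (simp flip: fv)
  qed
  have "exponential_type_le \<sigma> V"
    unfolding exponential_type_le_def
  proof (intro allI impI)
    fix \<epsilon> :: real assume e: "\<epsilon> > 0"
    then obtain C where C: "\<And>z. norm (v z) \<le> C * exp ((\<sigma> + \<epsilon>) * norm z)"
      using tv unfolding exponential_type_le_def by blast
    have C0: "0 \<le> C" using order_trans[OF norm_ge_zero C[of 0]] by simp
    have "norm (V z) \<le> (C * exp ((\<sigma> + \<epsilon>) * R)) * exp ((\<sigma> + \<epsilon>) * norm z)" for z
    proof -
      have "norm (csqrt (z\<^sup>2 + of_real Q)) \<le> norm z + R"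
      proof (rule power2_le_imp_le)
        have "(norm (csqrt (z\<^sup>2 + of_real Q)))\<^sup>2 = norm (z\<^sup>2 + of_real Q)"
          by (simp flip: norm_power)
        also have "\<dots> \<le> (norm z)\<^sup>2 + Q"
          using Q norm_triangle_ineq[of "z\<^sup>2" "of_real Q"] by (simp add: norm_power)
        also have "\<dots> \<le> (norm z + R)\<^sup>2" using R by (simp add: Q_def power2_sum)
        finally show "(norm (csqrt (z\<^sup>2 + of_real Q)))\<^sup>2 \<le> (norm z + R)\<^sup>2" .
      qed (use R in simp)
      then have "(\<sigma> + \<epsilon>) * norm (csqrt (z\<^sup>2 + of_real Q)) \<le> (\<sigma> + \<epsilon>) * (norm z + R)"
        using s e by (intro mult_left_mono) auto
      then have "C * exp ((\<sigma> + \<epsilon>) * norm (csqrt (z\<^sup>2 + of_real Q))) \<le> C * exp ((\<sigma> + \<epsilon>) * (norm z + R))"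
        using C0 by (intro mult_left_mono) auto
      then have "norm (V z) \<le> C * exp ((\<sigma> + \<epsilon>) * (norm z + R))"
        using C[of "csqrt (z\<^sup>2 + of_real Q)"] by (simp add: V_def)
      then show ?thesis by (simp add: distrib_left exp_add mult_ac)
    qed
    then show "\<exists>C. \<forall>z. norm (V z) \<le> C * exp ((\<sigma> + \<epsilon>) * norm z)" by blast
  qed
  then have "exponential_type_le \<sigma> (\<lambda>\<mu>. \<mu> * V \<mu>)" by (rule exponential_type_times_id)
  moreover have "integral {a..b} (\<lambda>x. (norm (of_real x * V (of_real x)))\<^sup>2) \<le> \<delta>" for a b
  proof -
    obtain c where "integral {a..b} (\<lambda>x. (norm (of_real x ^ 0 * (of_real x * V (of_real x))))\<^sup>2)
        \<le> 2 * integral {sqrt Q..c} (\<lambda>x. (norm (of_real x ^ 0 * f (of_real x)))\<^sup>2)"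
      using energy_of_shift[OF f fv even Q(1) F[unfolded V_def]] unfolding V_def by blast
    then show ?thesis using R(2)[of c] Q(2) by simp
  qed
  moreover have "integral {a..b} (\<lambda>x. (norm (of_real x ^ m * (of_real x * V (of_real x))))\<^sup>2) \<le> 2 * Em" for a b
  proof -
    obtain c where "integral {a..b} (\<lambda>x. (norm (of_real x ^ m * (of_real x * V (of_real x))))\<^sup>2)
        \<le> 2 * integral {sqrt Q..c} (\<lambda>x. (norm (of_real x ^ m * f (of_real x)))\<^sup>2)"
      using energy_of_shift[OF f fv even Q(1) F[unfolded V_def]] unfolding V_def by blast
    then show ?thesis using Em[of "sqrt Q" c] by simp
  qed
  ultimately show ?thesis
    using that[of Q] Q(1) V unfolding V_def by blast
qed

text \<open>
  Bounds on integrals over all compact intervals are the form in which square integrability on the line is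
  used.
\<close>

lemma L2_energy:
  assumes "(\<lambda>x. g (complex_of_real x)) \<in> L2 UNIV" and c: "continuous_on UNIV (\<lambda>x. g (complex_of_real x))"
  obtains E where "\<And>a b. integral {a..b} (\<lambda>x. (norm (g (complex_of_real x)))\<^sup>2) \<le> E"
proof -
  have "integrable lebesgue (\<lambda>x. (norm (g (complex_of_real x)))\<^sup>2)"
    using assms by (simp add: L2_def lebesgue_on_UNIV_eq)
  then have i: "(\<lambda>x. (norm (g (complex_of_real x)))\<^sup>2) integrable_on UNIV"
    by (rule integrable_on_lebesgue)
  have "integral {a..b} (\<lambda>x. (norm (g (complex_of_real x)))\<^sup>2) \<le> integral UNIV (\<lambda>x. (norm (g (complex_of_real x)))\<^sup>2)" for a b
    by (intro integral_subset_le i integrable_continuous_interval continuous_intros continuous_on_subset[OF c]) auto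
  then show ?thesis by (rule that)
qed

section \<open>Growth of the solutions\<close>

definition l1norm :: "(real \<Rightarrow> complex) \<Rightarrow> real" where
  "l1norm p = (LINT t|lebesgue_on {0..pi}. norm (p t))"

lemma integrable_mult_cont:
  fixes f :: "real \<Rightarrow> complex"
  assumes "integrable (lebesgue_on {a..b}) f" "continuous_on {a..b} F"
  shows "integrable (lebesgue_on {a..b}) (\<lambda>x. f x * F x)"
  using integrable_cont_mult[OF assms(2,1)] by (simp add: mult.commute)

lemma norm_lint_le_const:
  fixes f :: "real \<Rightarrow> complex"
  assumes "integrable (lebesgue_on {0..x}) f" "\<And>t. t \<in> {0..x} \<Longrightarrow> norm (f t) \<le> B" "0 \<le> x"
  shows "norm (LINT t|lebesgue_on {0..x}. f t) \<le> B * x"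
proof -
  have "norm (LINT t|lebesgue_on {0..x}. f t) \<le> (LINT t|lebesgue_on {0..x}. B)"
    using assms continuous_imp_integrable_real[of 0 x "\<lambda>_. B"]
    by (intro Bochner_Integration.integral_norm_bound_integral) auto
  also have "\<dots> = B * x" using assms(3) by (simp add: measure_restrict_space)
  finally show ?thesis .
qed

lemma norm_lint_le_l1norm:
  fixes f :: "real \<Rightarrow> complex"
  assumes p: "integrable (lebesgue_on {0..pi}) p" and f: "integrable (lebesgue_on {0..x}) f"
    and le: "\<And>t. t \<in> {0..x} \<Longrightarrow> norm (f t) \<le> B * norm (p t)" and x: "x \<in> {0..pi}" and B: "B \<ge> 0"
  shows "norm (LINT t|lebesgue_on {0..x}. f t) \<le> B * l1norm p"
proof -
  have np: "integrable (lebesgue_on {0..pi}) (\<lambda>t. norm (p t))" using p by simp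
  have npx: "integrable (lebesgue_on {0..x}) (\<lambda>t. norm (p t))" using integrable_sub[OF np x] .
  have "norm (LINT t|lebesgue_on {0..x}. f t) \<le> (LINT t|lebesgue_on {0..x}. B * norm (p t))"
    using f le npx by (intro Bochner_Integration.integral_norm_bound_integral) auto
  also have "\<dots> = B * (LINT t|lebesgue_on {0..x}. norm (p t))" by simp
  also have "(LINT t|lebesgue_on {0..x}. norm (p t)) \<le> l1norm p"
  proof -
    have "l1norm p = (LINT t|lebesgue_on {0..x}. norm (p t)) + (LINT t|lebesgue_on {x..pi}. norm (p t))"
      unfolding l1norm_def using Equivalence_Measurable_On_Borel.integral_combine[OF np, of x] x by auto
    moreover have "(LINT t|lebesgue_on {x..pi}. norm (p t)) \<ge> 0" by simp
    ultimately show ?thesis by linarith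
  qed
  finally show ?thesis using B by (simp add: mult_left_mono)
qed

lemma l1norm_nonneg: "l1norm p \<ge> 0"
  unfolding l1norm_def by simp

text \<open>
  The equations may differ in both potential and spectral parameter. Taking the free equation for \<open>w\<close>
  gives the Volterra equation; taking the same potential with a nearby parameter gives holomorphy in the
  parameter.
\<close>

lemma wronskian_general:
  assumes q: "integrable (lebesgue_on {0..pi}) q" and r: "integrable (lebesgue_on {0..pi}) r"
    and su: "solves q lam u" and sw: "solves r lam' w" and x: "x \<in> {0..pi}"
  shows "u x * deriv_pi w x - deriv_pi u x * w x = u 0 * deriv_pi w 0 - deriv_pi u 0 * w 0
     + (LINT t|lebesgue_on {0..x}. (r t - lam' - q t + lam) * (u t * w t))"
proof -
  obtain u'' where u: "primitive_of u (deriv_pi u)" "primitive_of (deriv_pi u) u''"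
    "AE x in lebesgue_on {0..pi}. u'' x - q x * u x + lam * u x = 0"
    by (rule solvesE[OF su])
  obtain w'' where w: "primitive_of w (deriv_pi w)" "primitive_of (deriv_pi w) w''"
    "AE x in lebesgue_on {0..pi}. w'' x - r x * w x + lam' * w x = 0"
    by (rule solvesE[OF sw])
  define g where "g = (\<lambda>x. (deriv_pi u x * deriv_pi w x + u x * w'' x) - (u'' x * w x + deriv_pi u x * deriv_pi w x))"
  have p: "primitive_of (\<lambda>x. u x * deriv_pi w x - deriv_pi u x * w x) g"
    unfolding g_def
    by (rule primitive_of_diff[OF primitive_of_mult[OF u(1) w(2)] primitive_of_mult[OF u(2) w(1)]])
  define k where "k = (\<lambda>t. (r t - lam' - q t + lam) * (u t * w t))"
  have cu: "continuous_on {0..pi} u" "continuous_on {0..pi} w" using u w primitive_of_continuous by auto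
  have "integrable (lebesgue_on {0..pi}) (\<lambda>t. r t - lam' - q t + lam)"
    using q r continuous_imp_integrable_real[of 0 pi "\<lambda>_. lam"] continuous_imp_integrable_real[of 0 pi "\<lambda>_. lam'"]
    by auto
  then have ik: "integrable (lebesgue_on {0..pi}) k"
    unfolding k_def using cu by (intro integrable_mult_cont continuous_intros)
  have "AE x in lebesgue_on {0..pi}. g x = k x"
    using u(3) w(3)
  proof eventually_elim
    case (elim x)
    have "g x - k x = u x * (w'' x - r x * w x + lam' * w x) - (u'' x - q x * u x + lam * u x) * w x"
      by (simp add: g_def k_def algebra_simps)
    then show ?case unfolding elim by simp
  qed
  then have "AE t in lebesgue. t \<in> {0..pi} \<longrightarrow> g t = k t"
    by (subst (asm) AE_restrict_space_iff) auto
  then have "AE t in lebesgue. t \<in> {0..x} \<longrightarrow> g t = k t"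
    using x by (auto elim!: eventually_mono)
  then have "AE t in lebesgue_on {0..x}. g t = k t"
    by (subst AE_restrict_space_iff) auto
  moreover have "integrable (lebesgue_on {0..pi}) g" using p by (simp add: primitive_of_def)
  ultimately have "(LINT t|lebesgue_on {0..x}. g t) = (LINT t|lebesgue_on {0..x}. k t)"
    using ik by (intro integral_cong_AE borel_measurable_integrable integrable_sub[OF _ x])
  then show ?thesis using primitive_ofD[OF p x] by (simp add: k_def)
qed

lemma smooth_solves:
  assumes d1: "\<And>x. (w has_vector_derivative w' x) (at x)"
    and d2: "\<And>x. (w' has_vector_derivative - lam * w x) (at x)"
  shows "solves (\<lambda>_. 0) lam w" "x \<in> {0..pi} \<Longrightarrow> deriv_pi w x = w' x"
proof -
  have d1': "(w has_vector_derivative w' x) (at x within S)" for x S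
    using d1 by (rule has_vector_derivative_at_within)
  have d2': "(w' has_vector_derivative - lam * w x) (at x within S)" for x S
    using d2 by (rule has_vector_derivative_at_within)
  have "continuous_on {0..pi} w"
    using d1' by (intro continuous_on_vector_derivative) auto
  then have "continuous_on {0..pi} (\<lambda>x. - lam * w x)" by (intro continuous_intros)
  then have "primitive_of w' (\<lambda>x. - lam * w x)"
    using d2' by (intro primitive_of_C1) auto
  then show "solves (\<lambda>_. 0) lam w" unfolding solves_def using d1'
    by (intro exI[of _ w'] exI[of _ "\<lambda>x. - lam * w x"]) auto
  show "x \<in> {0..pi} \<Longrightarrow> deriv_pi w x = w' x"
    using vector_derivative_within_closed_interval[OF _ _ d1'] by simp
qed

lemma has_vector_derivative_of_complex:
  assumes "\<And>z. (F has_field_derivative F' z) (at z)"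
  shows "((\<lambda>t. F (complex_of_real t)) has_vector_derivative F' (complex_of_real t)) (at t)"
  using has_vector_derivative_real_field[OF assms] .

lemma exp_solves:
  fixes \<mu> :: complex
  shows "solves (\<lambda>_. 0) (\<mu>\<^sup>2) (\<lambda>t. exp (- \<i> * \<mu> * of_real t))"
    and "x \<in> {0..pi} \<Longrightarrow> deriv_pi (\<lambda>t. exp (- \<i> * \<mu> * of_real t)) x = - \<i> * \<mu> * exp (- \<i> * \<mu> * of_real x)"
proof -
  have d1: "((\<lambda>t. exp (- \<i> * \<mu> * of_real t)) has_vector_derivative - \<i> * \<mu> * exp (- \<i> * \<mu> * of_real t)) (at t)" for t
    by (rule has_vector_derivative_of_complex[where F = "\<lambda>z. exp (- \<i> * \<mu> * z)"])
       (auto intro!: derivative_eq_intros)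
  have d2: "((\<lambda>t. - \<i> * \<mu> * exp (- \<i> * \<mu> * of_real t)) has_vector_derivative - \<mu>\<^sup>2 * exp (- \<i> * \<mu> * of_real t)) (at t)" for t
    by (rule has_vector_derivative_of_complex[where F = "\<lambda>z. - \<i> * \<mu> * exp (- \<i> * \<mu> * z)" and F' = "\<lambda>z. - \<mu>\<^sup>2 * exp (- \<i> * \<mu> * z)"])
       (auto intro!: derivative_eq_intros simp: power2_eq_square algebra_simps)
  from smooth_solves[OF d1 d2] show "solves (\<lambda>_. 0) (\<mu>\<^sup>2) (\<lambda>t. exp (- \<i> * \<mu> * of_real t))"
    "x \<in> {0..pi} \<Longrightarrow> deriv_pi (\<lambda>t. exp (- \<i> * \<mu> * of_real t)) x = - \<i> * \<mu> * exp (- \<i> * \<mu> * of_real x)"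
    by auto
qed

text \<open>
  The solution of the free equation with value \<open>0\<close> and derivative \<open>1\<close> at the origin, entire also in \<open>\<mu>\<close>.
\<close>

definition sinc :: "complex \<Rightarrow> complex \<Rightarrow> complex" where
  "sinc \<mu> s = (if \<mu> = 0 then s else sin (\<mu> * s) / \<mu>)"

lemma sinc_deriv: "(sinc \<mu> has_field_derivative cos (\<mu> * s)) (at s)"
  unfolding sinc_def by (cases "\<mu> = 0") (auto intro!: derivative_eq_intros)

lemma norm_cos_le_exp: "norm (cos z) \<le> exp \<bar>Im z\<bar>" for z :: complex
proof -
  have "norm (cos z) \<le> (norm (exp (\<i> * z)) + norm (exp (- (\<i> * z)))) / 2"
    unfolding cos_exp_eq norm_divide using norm_triangle_ineq[of "exp (\<i> * z)" "exp (- (\<i> * z))"] by simp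
  also have "\<dots> \<le> (exp \<bar>Im z\<bar> + exp \<bar>Im z\<bar>) / 2" by (intro divide_right_mono add_mono) auto
  finally show ?thesis by simp
qed

lemma norm_sinc_le:
  assumes "s \<ge> 0"
  shows "norm (sinc \<mu> (of_real s)) \<le> s * exp (\<bar>Im \<mu>\<bar> * s)"
proof -
  have "norm (sinc \<mu> (of_real s) - sinc \<mu> 0) \<le> exp (\<bar>Im \<mu>\<bar> * s) * norm (complex_of_real s - 0)"
  proof (rule field_differentiable_bound[where S = "complex_of_real ` {0..s}" and f' = "\<lambda>w. cos (\<mu> * w)"])
    show "convex (complex_of_real ` {0..s})"
      by (intro convex_linear_image bounded_linear.linear[OF bounded_linear_of_real]) auto
    show "norm (cos (\<mu> * w)) \<le> exp (\<bar>Im \<mu>\<bar> * s)" if w: "w \<in> complex_of_real ` {0..s}" for w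
    proof -
      obtain y where y: "0 \<le> y" "y \<le> s" "w = of_real y" using w by auto
      have "\<bar>Im (\<mu> * w)\<bar> = \<bar>Im \<mu>\<bar> * y" unfolding y(3) using y(1) by (simp add: abs_mult)
      also have "\<dots> \<le> \<bar>Im \<mu>\<bar> * s" using y(2) by (intro mult_left_mono) auto
      finally have "exp \<bar>Im (\<mu> * w)\<bar> \<le> exp (\<bar>Im \<mu>\<bar> * s)" by simp
      then show ?thesis using norm_cos_le_exp[of "\<mu> * w"] by linarith
    qed
    show "0 \<in> complex_of_real ` {0..s}" using assms by (intro image_eqI[of _ _ 0]) auto
    show "complex_of_real s \<in> complex_of_real ` {0..s}" using assms by (intro imageI) auto
  qed (auto intro: has_field_derivative_at_within sinc_deriv)
  moreover have "sinc \<mu> 0 = 0" by (simp add: sinc_def)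
  ultimately show ?thesis using assms by (simp add: mult.commute)
qed

lemma sinc_solves:
  fixes x :: real
  shows "solves (\<lambda>_. 0) (\<mu>\<^sup>2) (\<lambda>t. sinc \<mu> (of_real x - of_real t))"
    and "y \<in> {0..pi} \<Longrightarrow> deriv_pi (\<lambda>t. sinc \<mu> (of_real x - of_real t)) y = - cos (\<mu> * (of_real x - of_real y))"
proof -
  have "((\<lambda>z. sinc \<mu> (of_real x - z)) has_field_derivative - cos (\<mu> * (of_real x - z))) (at z)" for z
  proof -
    have "((\<lambda>z. complex_of_real x - z) has_field_derivative - 1) (at z)" by (auto intro!: derivative_eq_intros)
    from DERIV_chain2[OF sinc_deriv this] show ?thesis by simp
  qed
  from has_vector_derivative_of_complex[OF this]
  have d1: "((\<lambda>t. sinc \<mu> (of_real x - of_real t)) has_vector_derivative - cos (\<mu> * (of_real x - of_real t))) (at t)" for t .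
  have "((\<lambda>z. - cos (\<mu> * (of_real x - z))) has_field_derivative - \<mu>\<^sup>2 * sinc \<mu> (of_real x - z)) (at z)" for z
    unfolding sinc_def by (auto intro!: derivative_eq_intros simp: power2_eq_square)
  from has_vector_derivative_of_complex[OF this]
  have d2: "((\<lambda>t. - cos (\<mu> * (of_real x - of_real t))) has_vector_derivative - \<mu>\<^sup>2 * sinc \<mu> (of_real x - of_real t)) (at t)" for t .
  from smooth_solves[OF d1 d2] show "solves (\<lambda>_. 0) (\<mu>\<^sup>2) (\<lambda>t. sinc \<mu> (of_real x - of_real t))"
    "y \<in> {0..pi} \<Longrightarrow> deriv_pi (\<lambda>t. sinc \<mu> (of_real x - of_real t)) y = - cos (\<mu> * (of_real x - of_real y))"
    by auto
qed

lemma integrable_zero_fun: "integrable (lebesgue_on S) (\<lambda>_. 0::complex)" by simp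

text \<open>
  Apply the Wronskian identity to \<open>u\<close> and the free solution that vanishes at \<open>x\<close>.
\<close>

lemma volterra:
  assumes p: "integrable (lebesgue_on {0..pi}) p" and u: "solves p (\<mu>\<^sup>2) u" and x: "x \<in> {0..pi}"
  shows "u x = u 0 * cos (\<mu> * of_real x) + deriv_pi u 0 * sinc \<mu> (of_real x)
     + (LINT t|lebesgue_on {0..x}. p t * (u t * sinc \<mu> (of_real (x - t))))"
proof -
  define w where "w = (\<lambda>t. sinc \<mu> (of_real x - of_real t))"
  have 0: "0 \<in> {0..pi}" by simp
  have "u x * deriv_pi w x - deriv_pi u x * w x = u 0 * deriv_pi w 0 - deriv_pi u 0 * w 0
     + (LINT t|lebesgue_on {0..x}. (0 - \<mu>\<^sup>2 - p t + \<mu>\<^sup>2) * (u t * w t))"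
    using wronskian_general[OF p integrable_zero_fun u sinc_solves(1) x] unfolding w_def .
  moreover have "deriv_pi w x = - 1" "deriv_pi w 0 = - cos (\<mu> * of_real x)" "w x = 0" "w 0 = sinc \<mu> (of_real x)"
    using sinc_solves(2)[OF x, of \<mu> x] sinc_solves(2)[OF 0, of \<mu> x] by (auto simp: w_def sinc_def)
  moreover have "(LINT t|lebesgue_on {0..x}. (0 - \<mu>\<^sup>2 - p t + \<mu>\<^sup>2) * (u t * w t)) =
      - (LINT t|lebesgue_on {0..x}. p t * (u t * w t))" by simp
  ultimately show ?thesis by (simp add: w_def algebra_simps)
qed

lemma solves_continuous: "solves q lam u \<Longrightarrow> continuous_on {0..pi} u"
  by (erule solvesE) (rule primitive_of_continuous)

text \<open>
  At a maximum of \<open>|u x| exp (- |Im \<mu>| x)\<close> the integral in the Volterra equation contributes at most half of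
  that maximum, because the potential is small.
\<close>

lemma solution_growth:
  assumes p: "integrable (lebesgue_on {0..pi}) p" and small: "pi * l1norm p \<le> 1/2"
    and u: "solves p (\<mu>\<^sup>2) u"
    and free: "\<And>x. x \<in> {0..pi} \<Longrightarrow> norm (u 0 * cos (\<mu> * of_real x) + deriv_pi u 0 * sinc \<mu> (of_real x)) \<le> M * exp (\<bar>Im \<mu>\<bar> * x)"
    and x: "x \<in> {0..pi}"
  shows "norm (u x) \<le> 2 * M * exp (\<bar>Im \<mu>\<bar> * x)"
proof -
  (* The weight is the growth of the free solutions. *)
  define \<eta> where "\<eta> = (\<lambda>x. norm (u x) * exp (- (\<bar>Im \<mu>\<bar> * x)))"
  have cu: "continuous_on {0..pi} u" using u by (rule solves_continuous)
  have "continuous_on {0..pi} \<eta>" unfolding \<eta>_def by (intro continuous_intros cu)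
  then obtain y where y: "y \<in> {0..pi}" "\<And>t. t \<in> {0..pi} \<Longrightarrow> \<eta> t \<le> \<eta> y"
    using continuous_attains_sup[of "{0..pi}" \<eta>] by auto
  define B where "B = \<eta> y"
  have B: "B \<ge> 0" by (simp add: B_def \<eta>_def)
  have ub: "norm (u t) \<le> B * exp (\<bar>Im \<mu>\<bar> * t)" if "t \<in> {0..pi}" for t
    using y(2)[OF that] by (simp add: B_def \<eta>_def exp_minus field_simps)
  have cs: "continuous_on S (\<lambda>t. sinc \<mu> (of_real (y - t)))" for S
  proof -
    have "continuous_on UNIV (sinc \<mu>)" using sinc_deriv by (intro DERIV_continuous_on) auto
    then show ?thesis by (rule continuous_on_compose2) (auto intro!: continuous_intros)
  qed
  have "norm (LINT t|lebesgue_on {0..y}. p t * (u t * sinc \<mu> (of_real (y - t)))) \<le> (B * (pi * exp (\<bar>Im \<mu>\<bar> * y))) * l1norm p"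
  proof (rule norm_lint_le_l1norm[OF p _ _ y(1)])
    show "integrable (lebesgue_on {0..y}) (\<lambda>t. p t * (u t * sinc \<mu> (of_real (y - t))))"
      using integrable_sub[OF p y(1)] y(1)
      by (intro integrable_mult_cont continuous_intros cs continuous_on_subset[OF cu]) auto
    fix t assume t: "t \<in> {0..y}"
    have "norm (u t) * norm (sinc \<mu> (of_real (y - t))) \<le> (B * exp (\<bar>Im \<mu>\<bar> * t)) * (pi * exp (\<bar>Im \<mu>\<bar> * (y - t)))"
    proof (intro mult_mono ub)
      have "norm (sinc \<mu> (of_real (y - t))) \<le> (y - t) * exp (\<bar>Im \<mu>\<bar> * (y - t))"
        using t by (intro norm_sinc_le) auto
      also have "\<dots> \<le> pi * exp (\<bar>Im \<mu>\<bar> * (y - t))" using t y(1) by (intro mult_right_mono) auto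
      finally show "norm (sinc \<mu> (of_real (y - t))) \<le> pi * exp (\<bar>Im \<mu>\<bar> * (y - t))" .
    qed (use t y(1) B in auto)
    also have "\<dots> = B * (pi * (exp (\<bar>Im \<mu>\<bar> * t) * exp (\<bar>Im \<mu>\<bar> * (y - t))))" by (simp add: mult_ac)
    also have "exp (\<bar>Im \<mu>\<bar> * t) * exp (\<bar>Im \<mu>\<bar> * (y - t)) = exp (\<bar>Im \<mu>\<bar> * y)"
      unfolding exp_add[symmetric] by (simp add: algebra_simps)
    finally have "norm (p t) * (norm (u t) * norm (sinc \<mu> (of_real (y - t)))) \<le> norm (p t) * (B * (pi * exp (\<bar>Im \<mu>\<bar> * y)))"
      by (rule mult_left_mono) simp
    then show "norm (p t * (u t * sinc \<mu> (of_real (y - t)))) \<le> B * (pi * exp (\<bar>Im \<mu>\<bar> * y)) * norm (p t)"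
      by (simp only: norm_mult mult.commute)
  qed (use B in simp)
  also have "\<dots> = B * exp (\<bar>Im \<mu>\<bar> * y) * (pi * l1norm p)" by (simp add: mult_ac)
  also have "\<dots> \<le> B * exp (\<bar>Im \<mu>\<bar> * y) * (1/2)" using small B by (intro mult_left_mono) auto
  finally have "norm (u y) \<le> M * exp (\<bar>Im \<mu>\<bar> * y) + B * exp (\<bar>Im \<mu>\<bar> * y) * (1/2)"
    unfolding volterra[OF p u y(1)] by (intro norm_triangle_mono free y(1))
  moreover have "norm (u y) = B * exp (\<bar>Im \<mu>\<bar> * y)" by (simp add: B_def \<eta>_def exp_minus field_simps)
  ultimately have "B * exp (\<bar>Im \<mu>\<bar> * y) \<le> 2 * M * exp (\<bar>Im \<mu>\<bar> * y)" by linarith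
  then have "B \<le> 2 * M" by (rule mult_right_le_imp_le) simp
  then have "B * exp (\<bar>Im \<mu>\<bar> * x) \<le> 2 * M * exp (\<bar>Im \<mu>\<bar> * x)" by (intro mult_right_mono) auto
  then show ?thesis using ub[OF x] by linarith
qed

section \<open>The characteristic determinant and the scattering function\<close>

text \<open>
  The Wronskian identity expresses \<open>U \<mu> - U \<mu>0\<close> as \<open>\<mu>\<^sup>2 - \<mu>0\<^sup>2\<close> times integrals of \<open>U \<mu>\<close> against the solutions
  at \<open>\<mu>0\<close>. Local boundedness makes these integrals continuous at \<open>\<mu>0\<close>, which is differentiability of \<open>U\<close>.
\<close>

lemma solutions_holomorphic:
  fixes U :: "complex \<Rightarrow> real \<Rightarrow> complex"
  assumes p: "integrable (lebesgue_on {0..pi}) p"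
    and U: "\<And>\<mu>. solves p (\<mu>\<^sup>2) (U \<mu>)" "\<And>\<mu>. U \<mu> 0 = a" "\<And>\<mu>. deriv_pi (U \<mu>) 0 = b"
    and bd: "\<And>\<mu> t. norm (\<mu> - \<mu>0) \<le> 1 \<Longrightarrow> t \<in> {0..pi} \<Longrightarrow> norm (U \<mu> t) \<le> K"
  shows "(\<lambda>\<mu>. U \<mu> pi) field_differentiable (at \<mu>0)"
    and "(\<lambda>\<mu>. deriv_pi (U \<mu>) pi) field_differentiable (at \<mu>0)"
proof -
  define c where "c = c_sol p \<mu>0"
  define s where "s = s_sol p \<mu>0"
  note cs = c_sol[OF p, of \<mu>0, folded c_def] s_sol[OF p, of \<mu>0, folded s_def]
  have cc: "continuous_on {0..pi} c" "continuous_on {0..pi} s" using cs solves_continuous by auto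
  have cU: "continuous_on {0..pi} (U \<mu>)" for \<mu> using U(1) by (rule solves_continuous)
  define A where "A = (\<lambda>w x \<mu>. LINT t|lebesgue_on {0..x}. U \<mu> t * w t)"
  have W: "U \<mu> x * deriv_pi w x - deriv_pi (U \<mu>) x * w x = a * deriv_pi w 0 - b * w 0 + (\<mu>\<^sup>2 - \<mu>0\<^sup>2) * A w x \<mu>"
    if "solves p (\<mu>0\<^sup>2) w" "x \<in> {0..pi}" for w x \<mu>
    using wronskian_general[OF p p U(1) that, of \<mu>] unfolding U A_def by simp
  have wr: "c x * deriv_pi s x - deriv_pi c x * s x = 1" if "x \<in> {0..pi}" for x
    using wronskian_const[OF cs(1) cs(4) that] cs by simp
  have eqU: "U \<mu> x = a * c x + b * s x + (\<mu>\<^sup>2 - \<mu>0\<^sup>2) * (c x * A s x \<mu> - s x * A c x \<mu>)"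
    and eqU': "deriv_pi (U \<mu>) x = a * deriv_pi c x + b * deriv_pi s x + (\<mu>\<^sup>2 - \<mu>0\<^sup>2) * (deriv_pi c x * A s x \<mu> - deriv_pi s x * A c x \<mu>)"
    if x: "x \<in> {0..pi}" for x \<mu>
  proof -
    have 1: "U \<mu> x * deriv_pi s x - deriv_pi (U \<mu>) x * s x = a + (\<mu>\<^sup>2 - \<mu>0\<^sup>2) * A s x \<mu>"
      using W[OF cs(4) x] cs by simp
    have 2: "U \<mu> x * deriv_pi c x - deriv_pi (U \<mu>) x * c x = - b + (\<mu>\<^sup>2 - \<mu>0\<^sup>2) * A c x \<mu>"
      using W[OF cs(1) x] cs by simp
    have "U \<mu> x = U \<mu> x * (c x * deriv_pi s x - deriv_pi c x * s x)" using wr[OF x] by simp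
    also have "\<dots> = c x * (U \<mu> x * deriv_pi s x - deriv_pi (U \<mu>) x * s x) - s x * (U \<mu> x * deriv_pi c x - deriv_pi (U \<mu>) x * c x)"
      by (simp add: algebra_simps)
    finally show "U \<mu> x = a * c x + b * s x + (\<mu>\<^sup>2 - \<mu>0\<^sup>2) * (c x * A s x \<mu> - s x * A c x \<mu>)"
      unfolding 1 2 by (simp add: algebra_simps)
    have "deriv_pi (U \<mu>) x = deriv_pi (U \<mu>) x * (c x * deriv_pi s x - deriv_pi c x * s x)" using wr[OF x] by simp
    also have "\<dots> = deriv_pi c x * (U \<mu> x * deriv_pi s x - deriv_pi (U \<mu>) x * s x) - deriv_pi s x * (U \<mu> x * deriv_pi c x - deriv_pi (U \<mu>) x * c x)"
      by (simp add: algebra_simps)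
    finally show "deriv_pi (U \<mu>) x = a * deriv_pi c x + b * deriv_pi s x + (\<mu>\<^sup>2 - \<mu>0\<^sup>2) * (deriv_pi c x * A s x \<mu> - deriv_pi s x * A c x \<mu>)"
      unfolding 1 2 by (simp add: algebra_simps)
  qed
  have "bounded (c ` {0..pi} \<union> s ` {0..pi})"
    by (intro bounded_Un[THEN iffD2] conjI compact_imp_bounded compact_continuous_image cc) auto
  then obtain L where L: "\<And>t. t \<in> {0..pi} \<Longrightarrow> norm (c t) \<le> L \<and> norm (s t) \<le> L"
    unfolding bounded_iff by blast
  have zin: "0 \<in> {0..pi}" by simp
  have L0: "L \<ge> 0" using L[OF zin] norm_ge_zero[of "c 0"] by linarith
  have "norm (U \<mu>0 0) \<le> K" by (rule bd) auto
  then have K0: "K \<ge> 0" by (rule order_trans[OF norm_ge_zero])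
  have iA: "integrable (lebesgue_on {0..x}) (\<lambda>t. U \<mu> t * w t)" if "continuous_on {0..pi} w" "x \<in> {0..pi}" for w x \<mu>
    using that by (intro integrable_sub[OF _ that(2)] continuous_imp_integrable_real continuous_intros cU)
  have Ab: "norm (A w x \<mu>) \<le> K * L * pi" if w: "w = c \<or> w = s" and x: "x \<in> {0..pi}" and m: "norm (\<mu> - \<mu>0) \<le> 1" for w x \<mu>
  proof -
    have wL: "norm (w t) \<le> L" if "t \<in> {0..pi}" for t using L[OF that] w by auto
    have "norm (A w x \<mu>) \<le> (K * L) * x"
      unfolding A_def
    proof (rule norm_lint_le_const)
      show "integrable (lebesgue_on {0..x}) (\<lambda>t. U \<mu> t * w t)" using iA cc w x by auto
      show "norm (U \<mu> t * w t) \<le> K * L" if "t \<in> {0..x}" for t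
        unfolding norm_mult using that x m K0 by (intro mult_mono bd wL) auto
    qed (use x in auto)
    also have "\<dots> \<le> K * L * pi" using x K0 L0 by (intro mult_left_mono) auto
    finally show ?thesis .
  qed
  define D where "D = 2 * (L * (K * L * pi))"
  have dU: "norm (U \<mu> t - U \<mu>0 t) \<le> norm (\<mu>\<^sup>2 - \<mu>0\<^sup>2) * D" if t: "t \<in> {0..pi}" and m: "norm (\<mu> - \<mu>0) \<le> 1" for t \<mu>
  proof -
    have "U \<mu> t - U \<mu>0 t = (\<mu>\<^sup>2 - \<mu>0\<^sup>2) * (c t * A s t \<mu> - s t * A c t \<mu>)"
      unfolding eqU[OF t] by simp
    moreover have "norm (c t * A s t \<mu> - s t * A c t \<mu>) \<le> D"
      unfolding D_def mult_2 using L[OF t] Ab[OF _ t m] L0 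
      by (intro order_trans[OF norm_triangle_ineq4] add_mono) (auto simp: norm_mult intro!: mult_mono)
    ultimately show ?thesis by (simp only: norm_mult mult_left_mono norm_ge_zero)
  qed
  have contA: "isCont (A w pi) \<mu>0" if w: "w = c \<or> w = s" for w
  proof -
    have wL: "norm (w t) \<le> L" if "t \<in> {0..pi}" for t using L[OF that] w by auto
    have cw: "continuous_on {0..pi} w" using w cc by auto
    have est: "norm (A w pi \<mu> - A w pi \<mu>0) \<le> norm (\<mu>\<^sup>2 - \<mu>0\<^sup>2) * (D * L * pi)" if m: "norm (\<mu> - \<mu>0) \<le> 1" for \<mu>
    proof -
      have "A w pi \<mu> - A w pi \<mu>0 = (LINT t|lebesgue_on {0..pi}. (U \<mu> t - U \<mu>0 t) * w t)"
        unfolding A_def left_diff_distrib using iA[OF cw, of pi]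
        by (subst Bochner_Integration.integral_diff) auto
      also have "norm \<dots> \<le> (norm (\<mu>\<^sup>2 - \<mu>0\<^sup>2) * D * L) * pi"
      proof (rule norm_lint_le_const)
        show "integrable (lebesgue_on {0..pi}) (\<lambda>t. (U \<mu> t - U \<mu>0 t) * w t)"
          by (intro continuous_imp_integrable_real continuous_intros cU cw)
        show "norm ((U \<mu> t - U \<mu>0 t) * w t) \<le> norm (\<mu>\<^sup>2 - \<mu>0\<^sup>2) * D * L" if "t \<in> {0..pi}" for t
          unfolding norm_mult using dU[OF that m] wL[OF that] L0 K0
          by (intro mult_mono) (auto simp: D_def)
      qed simp
      finally show ?thesis by (simp add: mult_ac)
    qed
    have "((\<lambda>\<mu>. norm (\<mu>\<^sup>2 - \<mu>0\<^sup>2) * (D * L * pi)) \<longlongrightarrow> norm (\<mu>0\<^sup>2 - \<mu>0\<^sup>2) * (D * L * pi)) (at \<mu>0)"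
      by (intro tendsto_intros)
    then have "((\<lambda>\<mu>. norm (\<mu>\<^sup>2 - \<mu>0\<^sup>2) * (D * L * pi)) \<longlongrightarrow> 0) (at \<mu>0)" by simp
    moreover have "eventually (\<lambda>\<mu>. norm (A w pi \<mu> - A w pi \<mu>0) \<le> norm (\<mu>\<^sup>2 - \<mu>0\<^sup>2) * (D * L * pi)) (at \<mu>0)"
      unfolding eventually_at using est by (intro exI[of _ 1]) (auto simp: dist_norm)
    ultimately have "((\<lambda>\<mu>. A w pi \<mu> - A w pi \<mu>0) \<longlongrightarrow> 0) (at \<mu>0)"
      by (rule Lim_null_comparison[rotated])
    then show ?thesis unfolding isCont_def by (simp add: LIM_zero_iff)
  qed
  have pie: "pi \<in> {0..pi}" by simp
  have gen: "F field_differentiable (at \<mu>0)"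
    if F: "\<And>\<mu>. F \<mu> = k + (\<mu>\<^sup>2 - \<mu>0\<^sup>2) * (c1 * A s pi \<mu> - c2 * A c pi \<mu>)" for F k c1 c2
  proof -
    define g where "g = (\<lambda>\<mu>. (\<mu> + \<mu>0) * (c1 * A s pi \<mu> - c2 * A c pi \<mu>))"
    have "F \<mu> - F \<mu>0 = g \<mu> * (\<mu> - \<mu>0)" for \<mu>
      unfolding F g_def by (simp add: power2_eq_square algebra_simps)
    moreover have "isCont g \<mu>0" unfolding g_def by (intro continuous_intros contA) auto
    ultimately have "DERIV F \<mu>0 :> g \<mu>0" by (auto simp: CARAT_DERIV)
    then show ?thesis by (auto simp: field_differentiable_def)
  qed
  show "(\<lambda>\<mu>. U \<mu> pi) field_differentiable (at \<mu>0)"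
    by (rule gen) (rule eqU[OF pie])
  show "(\<lambda>\<mu>. deriv_pi (U \<mu>) pi) field_differentiable (at \<mu>0)"
    by (rule gen) (rule eqU'[OF pie])
qed

lemma char_det_holomorphic:
  assumes p: "integrable (lebesgue_on {0..pi}) p" and small: "pi * l1norm p \<le> 1/2"
  shows "char_det p holomorphic_on UNIV"
proof -
  have 1: "(\<lambda>\<mu>. c_sol p \<mu> pi) field_differentiable (at \<mu>0)" for \<mu>0
  proof (rule solutions_holomorphic(1)[OF p c_sol(1)[OF p] c_sol(2)[OF p] c_sol(3)[OF p], where K = "2 * 1 * exp ((norm \<mu>0 + 1) * pi)"])
    fix \<mu> t assume m: "norm (\<mu> - \<mu>0) \<le> 1" and t: "t \<in> {0..pi}"
    have "norm (c_sol p \<mu> t) \<le> 2 * 1 * exp (\<bar>Im \<mu>\<bar> * t)"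
    proof (rule solution_growth[OF p small c_sol(1)[OF p] _ t])
      show "norm (c_sol p \<mu> 0 * cos (\<mu> * of_real x) + deriv_pi (c_sol p \<mu>) 0 * sinc \<mu> (of_real x)) \<le> 1 * exp (\<bar>Im \<mu>\<bar> * x)"
        if x: "x \<in> {0..pi}" for x
      proof -
        have "\<bar>Im (\<mu> * of_real x)\<bar> = \<bar>Im \<mu>\<bar> * x" using x by (simp add: abs_mult)
        then have "norm (cos (\<mu> * of_real x)) \<le> exp (\<bar>Im \<mu>\<bar> * x)"
          using norm_cos_le_exp[of "\<mu> * of_real x"] by simp
        then show ?thesis by (simp add: c_sol(2,3)[OF p])
      qed
    qed
    moreover have "\<bar>Im \<mu>\<bar> * t \<le> (norm \<mu>0 + 1) * pi"
      using t m abs_Im_le_cmod[of \<mu>] norm_triangle_ineq2[of \<mu> \<mu>0] by (intro mult_mono) auto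
    then have "2 * 1 * exp (\<bar>Im \<mu>\<bar> * t) \<le> 2 * 1 * exp ((norm \<mu>0 + 1) * pi)"
      by (intro mult_left_mono) auto
    ultimately show "norm (c_sol p \<mu> t) \<le> 2 * 1 * exp ((norm \<mu>0 + 1) * pi)" by (rule order_trans)
  qed
  have 2: "(\<lambda>\<mu>. deriv_pi (s_sol p \<mu>) pi) field_differentiable (at \<mu>0)" for \<mu>0
  proof (rule solutions_holomorphic(2)[OF p s_sol(1)[OF p] s_sol(2)[OF p] s_sol(3)[OF p], where K = "2 * pi * exp ((norm \<mu>0 + 1) * pi)"])
    fix \<mu> t assume m: "norm (\<mu> - \<mu>0) \<le> 1" and t: "t \<in> {0..pi}"
    have "norm (s_sol p \<mu> t) \<le> 2 * pi * exp (\<bar>Im \<mu>\<bar> * t)"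
    proof (rule solution_growth[OF p small s_sol(1)[OF p] _ t])
      show "norm (s_sol p \<mu> 0 * cos (\<mu> * of_real x) + deriv_pi (s_sol p \<mu>) 0 * sinc \<mu> (of_real x)) \<le> pi * exp (\<bar>Im \<mu>\<bar> * x)"
        if x: "x \<in> {0..pi}" for x
      proof -
        have "norm (sinc \<mu> (of_real x)) \<le> x * exp (\<bar>Im \<mu>\<bar> * x)" using x by (intro norm_sinc_le) auto
        also have "\<dots> \<le> pi * exp (\<bar>Im \<mu>\<bar> * x)" using x by (intro mult_right_mono) auto
        finally show ?thesis by (simp add: s_sol(2,3)[OF p])
      qed
    qed
    moreover have "\<bar>Im \<mu>\<bar> * t \<le> (norm \<mu>0 + 1) * pi"
      using t m abs_Im_le_cmod[of \<mu>] norm_triangle_ineq2[of \<mu> \<mu>0] by (intro mult_mono) auto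
    then have "2 * pi * exp (\<bar>Im \<mu>\<bar> * t) \<le> 2 * pi * exp ((norm \<mu>0 + 1) * pi)"
      by (intro mult_left_mono) auto
    ultimately show "norm (s_sol p \<mu> t) \<le> 2 * pi * exp ((norm \<mu>0 + 1) * pi)" by (rule order_trans)
  qed
  have "(\<lambda>\<mu>. c_sol p \<mu> pi - deriv_pi (s_sol p \<mu>) pi) field_differentiable (at z)" for z
    by (rule field_differentiable_diff[OF 1 2])
  then show ?thesis unfolding char_det_def[abs_def] holomorphic_on_def
    by (blast intro: field_differentiable_at_within)
qed

text \<open>
  The solution that equals \<open>exp (- \<i> \<mu> x)\<close> for the zero potential.
\<close>

definition psi :: "(real \<Rightarrow> complex) \<Rightarrow> complex \<Rightarrow> real \<Rightarrow> complex" where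
  "psi p \<mu> x = c_sol p \<mu> x - \<i> * \<mu> * s_sol p \<mu> x"

text \<open>
  The exponential factor normalises the free solution to the constant \<open>1\<close>.
\<close>

definition chi :: "(real \<Rightarrow> complex) \<Rightarrow> complex \<Rightarrow> real \<Rightarrow> complex" where
  "chi p \<mu> x = exp (\<i> * \<mu> * of_real x) * psi p \<mu> x"

definition scattering :: "(real \<Rightarrow> complex) \<Rightarrow> complex \<Rightarrow> complex" where
  "scattering p \<mu> = (LINT t|lebesgue_on {0..pi}. p t * (exp (- 2 * \<i> * \<mu> * of_real t) * chi p \<mu> t))"

lemma psi_solution:
  assumes p: "integrable (lebesgue_on {0..pi}) p"
  obtains u where "solves p (\<mu>\<^sup>2) u" "u 0 = 1" "deriv_pi u 0 = - \<i> * \<mu>"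
    "\<And>x. x \<in> {0..pi} \<Longrightarrow> psi p \<mu> x = u x"
    "\<And>x. x \<in> {0..pi} \<Longrightarrow> deriv_pi u x = deriv_pi (c_sol p \<mu>) x - \<i> * \<mu> * deriv_pi (s_sol p \<mu>) x"
proof -
  obtain u where u: "solves p (\<mu>\<^sup>2) u" "u 0 = 1" "deriv_pi u 0 = - \<i> * \<mu>"
    using ex_solution[OF p] by blast
  show ?thesis
    using that[OF u] solution_repr(1,2)[OF p u(1)] u by (simp add: psi_def)
qed

lemma psi_continuous:
  assumes p: "integrable (lebesgue_on {0..pi}) p"
  shows "continuous_on {0..pi} (psi p \<mu>)"
  unfolding psi_def by (intro continuous_intros solves_continuous[OF c_sol(1)[OF p]] solves_continuous[OF s_sol(1)[OF p]])

lemma chi_continuous: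
  assumes p: "integrable (lebesgue_on {0..pi}) p"
  shows "continuous_on {0..pi} (chi p \<mu>)"
  unfolding chi_def by (intro continuous_intros psi_continuous[OF p])

lemma psi_growth:
  assumes p: "integrable (lebesgue_on {0..pi}) p" and small: "pi * l1norm p \<le> 1/2" and x: "x \<in> {0..pi}"
  shows "norm (psi p \<mu> x) \<le> 2 * exp (\<bar>Im \<mu>\<bar> * x)"
proof -
  obtain u where u: "solves p (\<mu>\<^sup>2) u" "u 0 = 1" "deriv_pi u 0 = - \<i> * \<mu>"
    "\<And>x. x \<in> {0..pi} \<Longrightarrow> psi p \<mu> x = u x" by (rule psi_solution[OF p, where \<mu> = \<mu>]) blast
  have "norm (u x) \<le> 2 * 1 * exp (\<bar>Im \<mu>\<bar> * x)"
  proof (rule solution_growth[OF p small u(1) _ x])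
    fix y assume y: "y \<in> {0..pi}"
    have "u 0 * cos (\<mu> * of_real y) + deriv_pi u 0 * sinc \<mu> (of_real y) = exp (- (\<i> * (\<mu> * of_real y)))"
      using exp_Euler[of "- (\<mu> * of_real y)"] by (simp add: u sinc_def)
    moreover have "norm (exp (- (\<i> * (\<mu> * of_real y)))) \<le> 1 * exp (\<bar>Im \<mu>\<bar> * y)"
      using y by (simp add: mult_right_mono)
    ultimately show "norm (u 0 * cos (\<mu> * of_real y) + deriv_pi u 0 * sinc \<mu> (of_real y)) \<le> 1 * exp (\<bar>Im \<mu>\<bar> * y)"
      by simp
  qed
  then show ?thesis using u(4)[OF x] by simp
qed

lemma scattering_alt:
  "scattering p \<mu> = (LINT t|lebesgue_on {0..pi}. p t * (psi p \<mu> t * exp (- \<i> * \<mu> * of_real t)))"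
proof -
  have "exp (- 2 * \<i> * \<mu> * of_real t) * chi p \<mu> t = psi p \<mu> t * exp (- \<i> * \<mu> * of_real t)" for t
  proof -
    have "exp (- 2 * \<i> * \<mu> * of_real t) * exp (\<i> * \<mu> * of_real t) = exp (- \<i> * \<mu> * of_real t)"
      unfolding exp_add[symmetric] by (simp add: algebra_simps)
    then show ?thesis unfolding chi_def by (metis mult.assoc mult.commute)
  qed
  then show ?thesis unfolding scattering_def by (simp only:)
qed

text \<open>
  Up to an exponential factor the scattering function is \<open>psi' + \<i> \<mu> psi\<close> at \<open>\<pi>\<close>, by the Wronskian identity
  for \<open>psi\<close> and \<open>exp (- \<i> \<mu> x)\<close>.
\<close>

lemma scattering_boundary:
  assumes p: "integrable (lebesgue_on {0..pi}) p"
  shows "exp (\<i> * \<mu> * of_real pi) * scattering p \<mu> = deriv_pi (c_sol p \<mu>) pi - \<i> * \<mu> * deriv_pi (s_sol p \<mu>) pi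
     + \<i> * \<mu> * psi p \<mu> pi"
proof -
  have pie: "pi \<in> {0..pi}" "0 \<in> {0..pi}" by auto
  obtain u where u: "solves p (\<mu>\<^sup>2) u" "u 0 = 1" "deriv_pi u 0 = - \<i> * \<mu>"
    "\<And>x. x \<in> {0..pi} \<Longrightarrow> psi p \<mu> x = u x"
    "\<And>x. x \<in> {0..pi} \<Longrightarrow> deriv_pi u x = deriv_pi (c_sol p \<mu>) x - \<i> * \<mu> * deriv_pi (s_sol p \<mu>) x"
    by (rule psi_solution[OF p, where \<mu> = \<mu>]) blast
  define e where "e = (\<lambda>t. exp (- \<i> * \<mu> * complex_of_real t))"
  have e: "solves (\<lambda>_. 0) (\<mu>\<^sup>2) e" "deriv_pi e pi = - \<i> * \<mu> * e pi" "deriv_pi e 0 = - \<i> * \<mu>" "e 0 = 1"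
    using exp_solves(1)[of \<mu>] exp_solves(2)[OF pie(1), of \<mu>] exp_solves(2)[OF pie(2), of \<mu>] by (auto simp: e_def)
  have "(LINT t|lebesgue_on {0..pi}. (0 - \<mu>\<^sup>2 - p t + \<mu>\<^sup>2) * (u t * e t)) = - scattering p \<mu>"
  proof -
    have "(LINT t|lebesgue_on {0..pi}. (0 - \<mu>\<^sup>2 - p t + \<mu>\<^sup>2) * (u t * e t)) =
      (LINT t|lebesgue_on {0..pi}. - (p t * (psi p \<mu> t * e t)))"
      by (intro Bochner_Integration.integral_cong) (auto simp: u(4))
    then show ?thesis unfolding scattering_alt e_def by simp
  qed
  then have "u pi * deriv_pi e pi - deriv_pi u pi * e pi = - scattering p \<mu>"
    using wronskian_general[OF p integrable_zero_fun u(1) e(1) pie(1)] u e by simp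
  then have "scattering p \<mu> = e pi * (deriv_pi u pi + \<i> * \<mu> * u pi)"
    unfolding e by (simp add: algebra_simps)
  moreover have "exp (\<i> * \<mu> * of_real pi) * e pi = 1"
    unfolding e_def exp_add[symmetric] by simp
  ultimately have "exp (\<i> * \<mu> * of_real pi) * scattering p \<mu> = deriv_pi u pi + \<i> * \<mu> * u pi"
    by (metis mult.assoc mult_1)
  then show ?thesis unfolding u(5)[OF pie(1)] u(4)[OF pie(1)] .
qed

lemma c_s_sol_uminus: "c_sol p (- \<mu>) = c_sol p \<mu>" "s_sol p (- \<mu>) = s_sol p \<mu>"
  unfolding c_sol_def s_sol_def by simp_all

text \<open>
  The solutions \<open>c\<close> and \<open>s\<close> are even in \<open>\<mu>\<close>, so antisymmetrising the boundary values in \<open>scattering_boundary\<close>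
  leaves exactly \<open>c - s'\<close>.
\<close>

lemma char_det_scattering:
  assumes p: "integrable (lebesgue_on {0..pi}) p"
  shows "2 * \<i> * (\<mu> * char_det p \<mu>) = exp (\<i> * \<mu> * of_real pi) * scattering p \<mu> - exp (- \<i> * \<mu> * of_real pi) * scattering p (- \<mu>)"
proof -
  have 2: "exp (- \<i> * \<mu> * of_real pi) * scattering p (- \<mu>) = deriv_pi (c_sol p \<mu>) pi + \<i> * \<mu> * deriv_pi (s_sol p \<mu>) pi
     - \<i> * \<mu> * (c_sol p \<mu> pi + \<i> * \<mu> * s_sol p \<mu> pi)"
    using scattering_boundary[OF p, of "- \<mu>"] by (simp add: c_s_sol_uminus psi_def)
  show ?thesis
    unfolding scattering_boundary[OF p, of \<mu>] 2 by (simp add: psi_def char_det_def algebra_simps)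
qed

text \<open>
  The exponential weight in \<open>psi_growth\<close> is compensated by the kernel, so that the type of the determinant
  is at most \<open>\<pi>\<close> and its size is controlled by the potential.
\<close>

lemma char_det_growth:
  assumes p: "integrable (lebesgue_on {0..pi}) p" and small: "pi * l1norm p \<le> 1/2"
  shows "norm (\<mu> * char_det p \<mu>) \<le> 2 * l1norm p * exp (pi * \<bar>Im \<mu>\<bar>)"
proof -
  have 1: "norm (exp (\<i> * \<mu> * of_real pi) * scattering p \<mu>) \<le> 2 * exp (pi * \<bar>Im \<mu>\<bar>) * l1norm p" for \<mu>
  proof -
    have pie: "pi \<in> {0..pi}" by simp
    have "exp (\<i> * \<mu> * of_real pi) * scattering p \<mu> =
      (LINT t|lebesgue_on {0..pi}. p t * (psi p \<mu> t * exp (\<i> * \<mu> * (of_real pi - of_real t))))"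
    proof -
      have "exp (\<i> * \<mu> * of_real pi) * exp (- \<i> * \<mu> * of_real t) = exp (\<i> * \<mu> * (of_real pi - of_real t))" for t
        unfolding exp_add[symmetric] by (simp add: algebra_simps)
      then have *: "exp (\<i> * \<mu> * of_real pi) * (p t * (psi p \<mu> t * exp (- \<i> * \<mu> * of_real t))) = 
          p t * (psi p \<mu> t * exp (\<i> * \<mu> * (of_real pi - of_real t)))" for t
        by (metis mult.left_commute)
      show ?thesis unfolding scattering_alt
        by (subst integral_mult_right_zero[symmetric]) (simp only: *)
    qed
    also have "norm \<dots> \<le> (2 * exp (pi * \<bar>Im \<mu>\<bar>)) * l1norm p"
    proof (rule norm_lint_le_l1norm[OF p _ _ pie])
      show "integrable (lebesgue_on {0..pi}) (\<lambda>t. p t * (psi p \<mu> t * exp (\<i> * \<mu> * (of_real pi - of_real t))))"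
        by (intro integrable_mult_cont p continuous_intros psi_continuous)
      fix t assume t: "t \<in> {0..pi}"
      have "norm (psi p \<mu> t) * norm (exp (\<i> * \<mu> * (of_real pi - of_real t))) \<le> (2 * exp (\<bar>Im \<mu>\<bar> * t)) * exp (\<bar>Im \<mu>\<bar> * (pi - t))"
      proof (intro mult_mono psi_growth p small t)
        have "- Im \<mu> * (pi - t) \<le> \<bar>Im \<mu>\<bar> * (pi - t)" using t by (intro mult_right_mono) auto
        then show "norm (exp (\<i> * \<mu> * (of_real pi - of_real t))) \<le> exp (\<bar>Im \<mu>\<bar> * (pi - t))"
          by (simp add: algebra_simps)
      qed auto
      also have "\<dots> = 2 * (exp (\<bar>Im \<mu>\<bar> * t) * exp (\<bar>Im \<mu>\<bar> * (pi - t)))" by simp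
      also have "exp (\<bar>Im \<mu>\<bar> * t) * exp (\<bar>Im \<mu>\<bar> * (pi - t)) = exp (pi * \<bar>Im \<mu>\<bar>)"
        unfolding exp_add[symmetric] by (simp add: algebra_simps)
      finally have "norm (p t) * (norm (psi p \<mu> t) * norm (exp (\<i> * \<mu> * (of_real pi - of_real t)))) \<le> norm (p t) * (2 * exp (pi * \<bar>Im \<mu>\<bar>))"
        by (rule mult_left_mono) simp
      then show "norm (p t * (psi p \<mu> t * exp (\<i> * \<mu> * (of_real pi - of_real t)))) \<le> 2 * exp (pi * \<bar>Im \<mu>\<bar>) * norm (p t)"
        by (simp only: norm_mult mult.commute)
    qed simp
    finally show ?thesis by simp
  qed
  have "norm (2 * \<i> * (\<mu> * char_det p \<mu>)) \<le> 2 * exp (pi * \<bar>Im \<mu>\<bar>) * l1norm p + 2 * exp (pi * \<bar>Im \<mu>\<bar>) * l1norm p"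
    unfolding char_det_scattering[OF p]
    using 1[of \<mu>] 1[of "- \<mu>"] by (intro order_trans[OF norm_triangle_ineq4] add_mono) auto
  then show ?thesis by (simp add: norm_mult mult_ac)
qed

text \<open>
  The solution operator of \<open>y'' - 2 \<i> \<mu> y' = h\<close> with zero initial data, which is the equation satisfied by
  \<open>chi - 1\<close> with \<open>h = p chi\<close>.
\<close>

definition duhamel :: "complex \<Rightarrow> (real \<Rightarrow> complex) \<Rightarrow> real \<Rightarrow> complex" where
  "duhamel \<mu> h x = (LINT t|lebesgue_on {0..x}. h t * ((exp (2 * \<i> * \<mu> * of_real (x - t)) - 1) / (2 * \<i> * \<mu>)))"

lemma chi_equation:
  assumes p: "integrable (lebesgue_on {0..pi}) p" and x: "x \<in> {0..pi}" and m: "\<mu> \<noteq> 0"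
  shows "chi p \<mu> x = 1 + duhamel \<mu> (\<lambda>t. p t * chi p \<mu> t) x"
proof -
  obtain u where u: "solves p (\<mu>\<^sup>2) u" "u 0 = 1" "deriv_pi u 0 = - \<i> * \<mu>"
    "\<And>x. x \<in> {0..pi} \<Longrightarrow> psi p \<mu> x = u x" by (rule psi_solution[OF p, where \<mu> = \<mu>]) blast
  define E where "E = exp (\<i> * \<mu> * of_real x)"
  have "u 0 * cos (\<mu> * of_real x) + deriv_pi u 0 * sinc \<mu> (of_real x) = exp (- (\<i> * (\<mu> * of_real x)))"
    using exp_Euler[of "- (\<mu> * of_real x)"] m by (simp add: u sinc_def)
  then have "u x = exp (- (\<i> * (\<mu> * of_real x))) + (LINT t|lebesgue_on {0..x}. p t * (u t * sinc \<mu> (of_real (x - t))))"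
    using volterra[OF p u(1) x] by simp
  then have "chi p \<mu> x = E * exp (- (\<i> * (\<mu> * of_real x))) + E * (LINT t|lebesgue_on {0..x}. p t * (u t * sinc \<mu> (of_real (x - t))))"
    unfolding chi_def u(4)[OF x] E_def by (simp add: distrib_left)
  moreover have "E * exp (- (\<i> * (\<mu> * of_real x))) = 1"
    unfolding E_def exp_add[symmetric] by (simp add: mult.assoc)
  moreover have "E * (LINT t|lebesgue_on {0..x}. p t * (u t * sinc \<mu> (of_real (x - t)))) = duhamel \<mu> (\<lambda>t. p t * chi p \<mu> t) x"
    unfolding duhamel_def integral_mult_right_zero[symmetric]
  proof (rule Bochner_Integration.integral_cong[OF refl])
    fix t assume "t \<in> space (lebesgue_on {0..x})"
    then have t: "t \<in> {0..pi}" using x by auto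
    have "exp (\<i> * \<mu> * of_real t) * ((exp (2 * \<i> * \<mu> * of_real (x - t)) - 1) / (2 * \<i> * \<mu>)) = E * sinc \<mu> (of_real (x - t))"
    proof -
      have "sinc \<mu> (of_real (x - t)) = (exp (\<i> * (\<mu> * of_real (x - t))) - exp (- (\<i> * (\<mu> * of_real (x - t))))) / (2 * \<i> * \<mu>)"
      proof -
        have "X / (2 * \<i> * \<mu>) = - (\<i> * X / (2 * \<mu>))" for X
          using m by (simp add: divide_simps)
        then show ?thesis using m by (simp add: sinc_def sin_exp_eq)
      qed
      moreover have "E * exp (\<i> * (\<mu> * of_real (x - t))) = exp (\<i> * \<mu> * of_real t) * exp (2 * \<i> * \<mu> * of_real (x - t))"
        unfolding E_def exp_add[symmetric] by (simp add: algebra_simps)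
      moreover have "E * exp (- (\<i> * (\<mu> * of_real (x - t)))) = exp (\<i> * \<mu> * of_real t)"
        unfolding E_def exp_add[symmetric] by (simp add: algebra_simps)
      ultimately show ?thesis by (simp only: times_divide_eq_right right_diff_distrib mult_1_right)
    qed
    define k where "k = (exp (2 * \<i> * \<mu> * of_real (x - t)) - 1) / (2 * \<i> * \<mu>)"
    have "p t * chi p \<mu> t * k = p t * (u t * (exp (\<i> * \<mu> * of_real t) * k))"
      unfolding chi_def u(4)[OF t] by (simp only: mult_ac)
    also have "exp (\<i> * \<mu> * of_real t) * k = E * sinc \<mu> (of_real (x - t))"
      unfolding k_def by fact
    finally show "E * (p t * (u t * sinc \<mu> (of_real (x - t)))) = p t * chi p \<mu> t * ((exp (2 * \<i> * \<mu> * of_real (x - t)) - 1) / (2 * \<i> * \<mu>))"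
      unfolding k_def by (simp only: mult_ac)
  qed
  ultimately show ?thesis by simp
qed

section \<open>The Duhamel operator\<close>

lemma l1norm_mult_le:
  assumes p: "integrable (lebesgue_on {0..pi}) p" and w: "continuous_on {0..pi} w"
    and B: "\<And>t. t \<in> {0..pi} \<Longrightarrow> norm (w t) \<le> B"
  shows "l1norm (\<lambda>t. p t * w t) \<le> l1norm p * B"
proof -
  have np: "integrable (lebesgue_on {0..pi}) (\<lambda>t. norm (p t))" using p by simp
  have npw: "integrable (lebesgue_on {0..pi}) (\<lambda>t. norm (p t * w t))"
    using integrable_mult_cont[OF p w] by simp
  have "l1norm (\<lambda>t. p t * w t) \<le> (LINT t|lebesgue_on {0..pi}. norm (p t) * B)"
    unfolding l1norm_def using np npw B
    by (intro integral_mono) (auto simp: norm_mult intro!: mult_left_mono)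
  then show ?thesis by (simp add: l1norm_def)
qed

lemma lint_has_vector_derivative:
  fixes G :: "real \<Rightarrow> complex"
  assumes c: "continuous_on {0..pi} G" and x: "x \<in> {0..pi}"
  shows "((\<lambda>x. LINT t|lebesgue_on {0..x}. G t) has_vector_derivative G x) (at x within {0..pi})"
proof -
  have "((\<lambda>y. integral {0..y} G) has_vector_derivative G x) (at x within {0..pi})"
    by (rule integral_has_vector_derivative[OF c x])
  moreover have "integral {0..y} G = (LINT t|lebesgue_on {0..y}. G t)" if "y \<in> {0..pi}" for y
    using integrable_sub[OF continuous_imp_integrable_real[OF c] that] by (simp add: lebesgue_integral_eq_integral)
  ultimately show ?thesis
    by (intro has_vector_derivative_transform[OF x, of "\<lambda>x. LINT t|lebesgue_on {0..x}. G t" "\<lambda>y. integral {0..y} G"]) auto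
qed

lemma lint_point: "(LINT t|lebesgue_on {0..0::real}. (f t::complex)) = 0"
  by (intro integral_eq_zero_null_sets null_setsI) (auto simp: emeasure_restrict_space null_sets_def)

text \<open>
  The difference kernel is separated into two primitives.
\<close>

lemma duhamel_split:
  assumes h: "integrable (lebesgue_on {0..pi}) h" and x: "x \<in> {0..pi}"
  shows "duhamel \<mu> h x = (exp (2 * \<i> * \<mu> * of_real x) * (LINT t|lebesgue_on {0..x}. h t * exp (- 2 * \<i> * \<mu> * of_real t))
      - (LINT t|lebesgue_on {0..x}. h t)) / (2 * \<i> * \<mu>)"
proof -
  have hx: "integrable (lebesgue_on {0..x}) h" using integrable_sub[OF h x] .
  have hex: "integrable (lebesgue_on {0..x}) (\<lambda>t. h t * exp (- 2 * \<i> * \<mu> * of_real t))"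
    by (intro integrable_mult_cont hx continuous_intros)
  have e: "exp (2 * \<i> * \<mu> * of_real (x - t)) = exp (2 * \<i> * \<mu> * of_real x) * exp (- 2 * \<i> * \<mu> * of_real t)" for t
    unfolding exp_add[symmetric] by (simp add: algebra_simps)
  have "duhamel \<mu> h x = (LINT t|lebesgue_on {0..x}. (exp (2 * \<i> * \<mu> * of_real x) * (h t * exp (- 2 * \<i> * \<mu> * of_real t)) - h t) / (2 * \<i> * \<mu>))"
    unfolding duhamel_def e by (simp add: diff_divide_distrib algebra_simps)
  also have "\<dots> = (LINT t|lebesgue_on {0..x}. exp (2 * \<i> * \<mu> * of_real x) * (h t * exp (- 2 * \<i> * \<mu> * of_real t)) - h t) / (2 * \<i> * \<mu>)"
    by (rule integral_divide_zero)
  also have "(LINT t|lebesgue_on {0..x}. exp (2 * \<i> * \<mu> * of_real x) * (h t * exp (- 2 * \<i> * \<mu> * of_real t)) - h t) =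
     exp (2 * \<i> * \<mu> * of_real x) * (LINT t|lebesgue_on {0..x}. h t * exp (- 2 * \<i> * \<mu> * of_real t)) - (LINT t|lebesgue_on {0..x}. h t)"
    using hx hex by (subst Bochner_Integration.integral_diff) auto
  finally show ?thesis .
qed

lemma duhamel_continuous:
  assumes h: "integrable (lebesgue_on {0..pi}) h" and m: "\<mu> \<noteq> 0"
  shows "continuous_on {0..pi} (duhamel \<mu> h)"
proof -
  have "integrable (lebesgue_on {0..pi}) (\<lambda>t. h t * exp (- 2 * \<i> * \<mu> * of_real t))"
    by (intro integrable_mult_cont h continuous_intros)
  then have "continuous_on {0..pi} (\<lambda>x. (exp (2 * \<i> * \<mu> * of_real x) * (LINT t|lebesgue_on {0..x}. h t * exp (- 2 * \<i> * \<mu> * of_real t))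
      - (LINT t|lebesgue_on {0..x}. h t)) / (2 * \<i> * \<mu>))"
    using m by (intro continuous_intros continuous_on_lint h) auto
  then show ?thesis
    using duhamel_split[OF h] by (subst continuous_on_cong[OF refl]) auto
qed

lemma duhamel_integrable:
  assumes h: "integrable (lebesgue_on {0..pi}) h" and x: "x \<in> {0..pi}"
  shows "integrable (lebesgue_on {0..x}) (\<lambda>t. h t * ((exp (2 * \<i> * \<mu> * of_real (x - t)) - 1) / (2 * \<i> * \<mu>)))"
proof (rule integrable_mult_cont[OF integrable_sub[OF h x]])
  show "continuous_on {0..x} (\<lambda>t. (exp (2 * \<i> * \<mu> * of_real (x - t)) - 1) / (2 * \<i> * \<mu>))"
    unfolding divide_inverse by (intro continuous_intros)
qed

lemma duhamel_add:
  assumes "integrable (lebesgue_on {0..pi}) h" "integrable (lebesgue_on {0..pi}) g" "x \<in> {0..pi}"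
  shows "duhamel \<mu> (\<lambda>t. h t + g t) x = duhamel \<mu> h x + duhamel \<mu> g x"
  unfolding duhamel_def distrib_right
  by (intro Bochner_Integration.integral_add duhamel_integrable assms)

lemma duhamel_diff:
  assumes "integrable (lebesgue_on {0..pi}) h" "integrable (lebesgue_on {0..pi}) g" "x \<in> {0..pi}"
  shows "duhamel \<mu> (\<lambda>t. h t - g t) x = duhamel \<mu> h x - duhamel \<mu> g x"
  unfolding duhamel_def left_diff_distrib
  by (intro Bochner_Integration.integral_diff duhamel_integrable assms)

lemma duhamel_sum:
  assumes "\<And>j. j \<in> J \<Longrightarrow> integrable (lebesgue_on {0..pi}) (h j)" "x \<in> {0..pi}"
  shows "duhamel \<mu> (\<lambda>t. \<Sum>j\<in>J. h j t) x = (\<Sum>j\<in>J. duhamel \<mu> (h j) x)"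
  unfolding duhamel_def sum_distrib_right
  by (intro Bochner_Integration.integral_sum duhamel_integrable assms)

lemma duhamel_cong:
  assumes "\<And>t. t \<in> {0..x} \<Longrightarrow> h t = g t"
  shows "duhamel \<mu> h x = duhamel \<mu> g x"
  unfolding duhamel_def using assms by (intro Bochner_Integration.integral_cong) auto

text \<open>
  On the real axis the kernel is at most \<open>1 / |\<mu>|\<close>: every iteration gains one power of \<open>\<mu>\<close>.
\<close>

lemma duhamel_bound:
  assumes h: "integrable (lebesgue_on {0..pi}) h" and x: "x \<in> {0..pi}" and m: "m \<noteq> 0"
  shows "norm (duhamel (complex_of_real m) h x) \<le> l1norm h / \<bar>m\<bar>"
proof -
  have "norm (duhamel (complex_of_real m) h x) \<le> (1 / \<bar>m\<bar>) * l1norm h"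
    unfolding duhamel_def
  proof (rule norm_lint_le_l1norm[OF h duhamel_integrable[OF h x] _ x])
    fix t
    have "norm (exp (2 * \<i> * complex_of_real m * of_real (x - t))) = 1" by (simp add: norm_exp_eq_Re)
    then have this0: "norm (exp (2 * \<i> * complex_of_real m * of_real (x - t)) - 1) \<le> 2"
      using norm_triangle_ineq4[of "exp (2 * \<i> * complex_of_real m * of_real (x - t))" 1] by simp
    have "norm ((exp (2 * \<i> * complex_of_real m * of_real (x - t)) - 1) / (2 * \<i> * complex_of_real m)) \<le> 1 / \<bar>m\<bar>"
    proof -
      have "norm (2 * \<i> * complex_of_real m) = 2 * \<bar>m\<bar>" by (simp add: norm_mult)
      then show ?thesis
        using divide_right_mono[OF this0, of "2 * \<bar>m\<bar>"] unfolding norm_divide by simp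
    qed
    from mult_left_mono[OF this norm_ge_zero, of "h t"]
    show "norm (h t * ((exp (2 * \<i> * complex_of_real m * of_real (x - t)) - 1) / (2 * \<i> * complex_of_real m))) \<le> 1 / \<bar>m\<bar> * norm (h t)"
      unfolding norm_mult[of "h t"] mult.commute[of "1 / \<bar>m\<bar>"] .
  qed simp
  then show ?thesis by simp
qed

lemma primitive_of_integrable: "primitive_of F f \<Longrightarrow> integrable (lebesgue_on {0..pi}) f"
  unfolding primitive_of_def by blast

lemma primitive_of_cong:
  assumes "primitive_of F f" "\<And>x. x \<in> {0..pi} \<Longrightarrow> f x = g x"
  shows "primitive_of F (g :: real \<Rightarrow> complex)"
proof -
  have ig: "integrable (lebesgue_on {0..pi}) g"
    using primitive_of_integrable[OF assms(1)] Bochner_Integration.integrable_cong[of "lebesgue_on {0..pi}" _ f g] assms(2)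
    by simp
  have eq: "(LINT t|lebesgue_on {0..x}. f t) = (LINT t|lebesgue_on {0..x}. g t)" if "x \<in> {0..pi}" for x
    using assms(2) that by (intro Bochner_Integration.integral_cong) auto
  have "F x = F 0 + (LINT t|lebesgue_on {0..x}. g t)" if "x \<in> {0..pi}" for x
    using primitive_ofD[OF assms(1) that] unfolding eq[OF that] .
  with ig show ?thesis unfolding primitive_of_def by blast
qed

lemma exp_cmult_has_field_derivative:
  fixes c :: complex
  shows "((\<lambda>z. exp (c * z)) has_field_derivative c * exp (c * z)) (at z)"
  by (auto intro!: derivative_eq_intros)

lemma exp_has_vector_derivative_at:
  fixes c :: complex
  shows "((\<lambda>t. exp (c * of_real t)) has_vector_derivative c * exp (c * of_real t)) (at t)"
  by (rule has_vector_derivative_of_complex[OF exp_cmult_has_field_derivative])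

lemma exp_has_vector_derivative:
  fixes c :: complex
  shows "((\<lambda>t. exp (c * of_real t)) has_vector_derivative c * exp (c * of_real t)) (at t within S)"
  by (rule has_vector_derivative_at_within[OF exp_has_vector_derivative_at])

lemma exp_primitive:
  fixes c :: complex
  shows "primitive_of (\<lambda>t. exp (c * of_real t)) (\<lambda>t. c * exp (c * of_real t))"
proof (rule primitive_of_C1)
  show "continuous_on {0..pi} (\<lambda>t. c * exp (c * of_real t))" by (intro continuous_intros)
qed (rule exp_has_vector_derivative)

text \<open>
  Convolution commutes with differentiation when the argument vanishes at the origin. This is the source
  of the Leibniz rule for Born terms.
\<close>

lemma duhamel_primitive:
  assumes Y: "primitive_of Y y" and Y0: "Y 0 = 0" and m: "\<mu> \<noteq> 0"
  shows "primitive_of (duhamel \<mu> Y) (duhamel \<mu> y)"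
proof (rule primitive_of_C1)
  have y: "integrable (lebesgue_on {0..pi}) y" using Y by (rule primitive_of_integrable)
  have cY: "continuous_on {0..pi} Y" using Y by (rule primitive_of_continuous)
  have iY: "integrable (lebesgue_on {0..pi}) Y" using cY by (rule continuous_imp_integrable_real)
  show "continuous_on {0..pi} (duhamel \<mu> y)" by (rule duhamel_continuous[OF y m])
  fix x assume x: "x \<in> {0..pi}"
  define E where "E = (\<lambda>x. LINT t|lebesgue_on {0..x}. Y t * exp (- 2 * \<i> * \<mu> * of_real t))"
  have dE: "(E has_vector_derivative Y x * exp (- 2 * \<i> * \<mu> * of_real x)) (at x within {0..pi})"
    unfolding E_def by (rule lint_has_vector_derivative[OF _ x]) (intro continuous_intros cY)
  have dY: "((\<lambda>x. LINT t|lebesgue_on {0..x}. Y t) has_vector_derivative Y x) (at x within {0..pi})"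
    by (rule lint_has_vector_derivative[OF cY x])
  have de: "((\<lambda>x. exp (2 * \<i> * \<mu> * of_real x)) has_vector_derivative 2 * \<i> * \<mu> * exp (2 * \<i> * \<mu> * of_real x)) (at x within {0..pi})"
    by (rule exp_has_vector_derivative)
  have ee: "exp (2 * \<i> * \<mu> * of_real x) * exp (- 2 * \<i> * \<mu> * of_real x) = 1"
    unfolding exp_add[symmetric] by simp
  have "((\<lambda>x. (exp (2 * \<i> * \<mu> * of_real x) * E x - (LINT t|lebesgue_on {0..x}. Y t)) / (2 * \<i> * \<mu>)) has_vector_derivative
      ((exp (2 * \<i> * \<mu> * of_real x) * (Y x * exp (- 2 * \<i> * \<mu> * of_real x)) + 2 * \<i> * \<mu> * exp (2 * \<i> * \<mu> * of_real x) * E x) - Y x) / (2 * \<i> * \<mu>)) (at x within {0..pi})"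
    by (intro has_vector_derivative_divide has_vector_derivative_diff has_vector_derivative_mult dE dY de)
  moreover have "((exp (2 * \<i> * \<mu> * of_real x) * (Y x * exp (- 2 * \<i> * \<mu> * of_real x)) + 2 * \<i> * \<mu> * exp (2 * \<i> * \<mu> * of_real x) * E x) - Y x) / (2 * \<i> * \<mu>)
     = exp (2 * \<i> * \<mu> * of_real x) * E x"
  proof -
    have "exp (2 * \<i> * \<mu> * of_real x) * (Y x * exp (- 2 * \<i> * \<mu> * of_real x)) = Y x"
      using ee by (metis mult.left_commute mult.right_neutral)
    from arg_cong[OF this, of "\<lambda>z. (z + 2 * \<i> * \<mu> * exp (2 * \<i> * \<mu> * of_real x) * E x - Y x) / (2 * \<i> * \<mu>)"]
    show ?thesis using m by (simp only: add_diff_cancel_left') simp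
  qed
  ultimately have "((\<lambda>x. (exp (2 * \<i> * \<mu> * of_real x) * E x - (LINT t|lebesgue_on {0..x}. Y t)) / (2 * \<i> * \<mu>)) has_vector_derivative
      exp (2 * \<i> * \<mu> * of_real x) * E x) (at x within {0..pi})" by simp
  then have d: "(duhamel \<mu> Y has_vector_derivative exp (2 * \<i> * \<mu> * of_real x) * E x) (at x within {0..pi})"
    by (rule has_vector_derivative_transform[OF x, rotated]) (simp add: duhamel_split[OF iY] E_def)
  have "primitive_of (\<lambda>t. Y t * exp ((- 2 * \<i> * \<mu>) * of_real t)) (\<lambda>t. y t * exp ((- 2 * \<i> * \<mu>) * of_real t) + Y t * ((- 2 * \<i> * \<mu>) * exp ((- 2 * \<i> * \<mu>) * of_real t)))"
    by (rule primitive_of_mult[OF Y exp_primitive])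
  from primitive_ofD[OF this x] Y0
  have "Y x * exp (- 2 * \<i> * \<mu> * of_real x) = (LINT t|lebesgue_on {0..x}. y t * exp (- 2 * \<i> * \<mu> * of_real t) + Y t * ((- 2 * \<i> * \<mu>) * exp (- 2 * \<i> * \<mu> * of_real t)))"
    by simp
  also have "\<dots> = (LINT t|lebesgue_on {0..x}. y t * exp (- 2 * \<i> * \<mu> * of_real t)) + (LINT t|lebesgue_on {0..x}. (- 2 * \<i> * \<mu>) * (Y t * exp (- 2 * \<i> * \<mu> * of_real t)))"
  proof (subst Bochner_Integration.integral_add[symmetric])
    show "integrable (lebesgue_on {0..x}) (\<lambda>t. y t * exp (- 2 * \<i> * \<mu> * of_real t))"
      by (intro integrable_mult_cont integrable_sub[OF y x] continuous_intros)
    have "integrable (lebesgue_on {0..x}) (\<lambda>t. Y t * exp (- 2 * \<i> * \<mu> * of_real t))"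
      by (intro integrable_mult_cont integrable_sub[OF iY x] continuous_intros)
    then show "integrable (lebesgue_on {0..x}) (\<lambda>t. (- 2 * \<i> * \<mu>) * (Y t * exp (- 2 * \<i> * \<mu> * of_real t)))"
      by simp
  qed (simp add: mult_ac)
  also have "(LINT t|lebesgue_on {0..x}. (- 2 * \<i> * \<mu>) * (Y t * exp (- 2 * \<i> * \<mu> * of_real t))) = - 2 * \<i> * \<mu> * E x"
    unfolding E_def by (rule integral_mult_right_zero)
  finally have A: "(LINT t|lebesgue_on {0..x}. y t * exp (- 2 * \<i> * \<mu> * of_real t)) = Y x * exp (- 2 * \<i> * \<mu> * of_real x) + 2 * \<i> * \<mu> * E x"
    by simp
  have B: "(LINT t|lebesgue_on {0..x}. y t) = Y x" using primitive_ofD[OF Y x] Y0 by simp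
  have "duhamel \<mu> y x = (exp (2 * \<i> * \<mu> * of_real x) * (Y x * exp (- 2 * \<i> * \<mu> * of_real x) + 2 * \<i> * \<mu> * E x) - Y x) / (2 * \<i> * \<mu>)"
    unfolding duhamel_split[OF y x] A B ..
  also have "\<dots> = exp (2 * \<i> * \<mu> * of_real x) * E x"
  proof -
    have "exp (2 * \<i> * \<mu> * of_real x) * (Y x * exp (- 2 * \<i> * \<mu> * of_real x)) = Y x"
      using ee by (metis mult.left_commute mult.right_neutral)
    then show ?thesis using m unfolding distrib_left by (simp only: add_diff_cancel_left') simp
  qed
  finally show "(duhamel \<mu> Y has_vector_derivative duhamel \<mu> y x) (at x within {0..pi})" using d by simp
qed

section \<open>Born terms and the Leibniz rule\<close>

text \<open>
  The iterated kernels with derivatives of the potential in place of the potential: \<open>P i\<close> stands for the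
  derivative of order \<open>i\<close>, and the list records the orders. The list \<open>replicate n 0\<close> gives the ordinary
  Born iterate.
\<close>

fun born :: "(nat \<Rightarrow> real \<Rightarrow> complex) \<Rightarrow> complex \<Rightarrow> nat list \<Rightarrow> real \<Rightarrow> complex" where
  "born P \<mu> [] = (\<lambda>x. 1)"
| "born P \<mu> (i # is) = duhamel \<mu> (\<lambda>t. P i t * born P \<mu> is t)"

definition born_term :: "(nat \<Rightarrow> real \<Rightarrow> complex) \<Rightarrow> complex \<Rightarrow> nat \<Rightarrow> nat list \<Rightarrow> complex" where
  "born_term P \<mu> i is = (LINT t|lebesgue_on {0..pi}. P i t * (exp (- 2 * \<i> * \<mu> * of_real t) * born P \<mu> is t))"

lemma born_continuous:
  assumes "\<And>i. i \<in> set is \<Longrightarrow> integrable (lebesgue_on {0..pi}) (P i)" "\<mu> \<noteq> 0"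
  shows "continuous_on {0..pi} (born P \<mu> is)"
  using assms(1)
proof (induction "is")
  case (Cons i "is")
  have c: "continuous_on {0..pi} (born P \<mu> is)" by (rule Cons.IH) (rule Cons.prems, simp)
  have "integrable (lebesgue_on {0..pi}) (P i)" by (rule Cons.prems) simp
  then have "integrable (lebesgue_on {0..pi}) (\<lambda>t. P i t * born P \<mu> is t)"
    using c by (rule integrable_mult_cont)
  then show ?case unfolding born.simps using assms(2) by (rule duhamel_continuous)
qed simp

lemma born_bound:
  assumes "\<And>i. i \<in> set is \<Longrightarrow> integrable (lebesgue_on {0..pi}) (P i) \<and> l1norm (P i) \<le> B" "m \<noteq> 0" "x \<in> {0..pi}"
  shows "norm (born P (of_real m) is x) \<le> (B / \<bar>m\<bar>) ^ length is"
  using assms(1,3)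
proof (induction "is" arbitrary: x)
  case (Cons i "is")
  have c: "continuous_on {0..pi} (born P (of_real m) is)"
    by (rule born_continuous) (use Cons.prems assms(2) in simp_all)
  have Pi: "integrable (lebesgue_on {0..pi}) (P i)" "l1norm (P i) \<le> B" using Cons.prems by auto
  have B0: "B \<ge> 0" using Pi l1norm_nonneg[of "P i"] by simp
  have "norm (born P (of_real m) (i # is) x) \<le> l1norm (\<lambda>t. P i t * born P (of_real m) is t) / \<bar>m\<bar>"
    unfolding born.simps by (intro duhamel_bound integrable_mult_cont Pi c assms(2) Cons.prems(2))
  also have "\<dots> \<le> (l1norm (P i) * (B / \<bar>m\<bar>) ^ length is) / \<bar>m\<bar>"
  proof (intro divide_right_mono l1norm_mult_le Pi c)
    show "norm (born P (of_real m) is t) \<le> (B / \<bar>m\<bar>) ^ length is" if "t \<in> {0..pi}" for t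
      by (rule Cons.IH[OF _ that]) (rule Cons.prems, simp)
  qed simp
  also have "\<dots> \<le> (B * (B / \<bar>m\<bar>) ^ length is) / \<bar>m\<bar>"
    using Pi B0 by (intro divide_right_mono mult_right_mono) auto
  finally show ?case by simp
qed auto

lemma chain_integrable:
  assumes P: "\<And>i. i < k \<Longrightarrow> primitive_of (P i) (P (Suc i))" and j: "j \<le> k" and k: "0 < k"
  shows "integrable (lebesgue_on {0..pi}) (P j :: real \<Rightarrow> complex)"
proof (cases j)
  case 0
  have "continuous_on {0..pi} (P 0)" by (rule primitive_of_continuous[OF P[OF k]])
  then show ?thesis unfolding 0 by (rule continuous_imp_integrable_real)
next
  case (Suc l)
  then have "l < k" using j by simp
  from primitive_of_integrable[OF P[OF this]] show ?thesis unfolding Suc .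
qed

text \<open>
  A derivative of a Born iterate falls on one of its factors. Vanishing of the factors at the origin
  excludes boundary terms.
\<close>

lemma born_leibniz:
  assumes P: "\<And>i. i < k \<Longrightarrow> primitive_of (P i) (P (Suc i))" and P0: "\<And>i. i < k \<Longrightarrow> P i 0 = 0"
    and m: "\<mu> \<noteq> 0" and less: "\<And>i. i \<in> set is \<Longrightarrow> i < k"
  shows "primitive_of (born P \<mu> is) (\<lambda>x. \<Sum>j<length is. born P \<mu> (is[j := Suc (is ! j)]) x)"
  using less
proof (induction "is")
  case Nil
  have "primitive_of (\<lambda>x. 1 :: complex) (\<lambda>x. 0)" by (rule primitive_of_C1) auto
  then show ?case by simp
next
  case (Cons i "is")
  have Pint: "integrable (lebesgue_on {0..pi}) (P j)" if "j \<le> k" "0 < k" for j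
    by (rule chain_integrable[where P = P and k = k, OF P that])
  have i: "i < k" using Cons.prems by simp
  have k0: "k > 0" using i by simp
  have IH: "primitive_of (born P \<mu> is) (\<lambda>x. \<Sum>j<length is. born P \<mu> (is[j := Suc (is ! j)]) x)"
    using Cons by auto
  have c: "continuous_on {0..pi} (born P \<mu> is)" using IH by (rule primitive_of_continuous)
  have cj: "continuous_on {0..pi} (born P \<mu> (is[j := Suc (is ! j)]))" if "j < length is" for j
  proof (rule born_continuous[OF Pint m])
    fix l assume "l \<in> set (is[j := Suc (is ! j)])"
    then have "l = Suc (is ! j) \<or> l \<in> set is" using set_update_subset_insert by fast
    then show "l \<le> k" using Cons.prems[of "is ! j"] Cons.prems[of l] nth_mem[OF that] by auto
  qed (rule k0)
  define y where "y = (\<lambda>x. P (Suc i) x * born P \<mu> is x + P i x * (\<Sum>j<length is. born P \<mu> (is[j := Suc (is ! j)]) x))"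
  have "primitive_of (\<lambda>x. P i x * born P \<mu> is x) y"
    unfolding y_def by (rule primitive_of_mult[OF P[OF i] IH])
  then have pr: "primitive_of (born P \<mu> (i # is)) (duhamel \<mu> y)"
    using P0[OF i] m by (simp add: duhamel_primitive)
  show ?case
  proof (rule primitive_of_cong[OF pr])
    fix x assume x: "x \<in> {0..pi}"
    have "duhamel \<mu> y x = duhamel \<mu> (\<lambda>x. P (Suc i) x * born P \<mu> is x + (\<Sum>j<length is. P i x * born P \<mu> (is[j := Suc (is ! j)]) x)) x"
      unfolding y_def sum_distrib_left ..
    also have "\<dots> = duhamel \<mu> (\<lambda>x. P (Suc i) x * born P \<mu> is x) x + (\<Sum>j<length is. duhamel \<mu> (\<lambda>x. P i x * born P \<mu> (is[j := Suc (is ! j)]) x) x)"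
    proof (subst duhamel_add)
      show "integrable (lebesgue_on {0..pi}) (\<lambda>x. P (Suc i) x * born P \<mu> is x)"
        using i k0 by (intro integrable_mult_cont Pint c) auto
      have ij: "integrable (lebesgue_on {0..pi}) (\<lambda>x. P i x * born P \<mu> (is[j := Suc (is ! j)]) x)" if "j \<in> {..<length is}" for j
        using i k0 that by (intro integrable_mult_cont Pint cj) auto
      then show "integrable (lebesgue_on {0..pi}) (\<lambda>x. \<Sum>j<length is. P i x * born P \<mu> (is[j := Suc (is ! j)]) x)"
        by (intro Bochner_Integration.integrable_sum)
      show "duhamel \<mu> (\<lambda>x. P (Suc i) x * born P \<mu> is x) x + duhamel \<mu> (\<lambda>x. \<Sum>j<length is. P i x * born P \<mu> (is[j := Suc (is ! j)]) x) x =
        duhamel \<mu> (\<lambda>x. P (Suc i) x * born P \<mu> is x) x + (\<Sum>j<length is. duhamel \<mu> (\<lambda>x. P i x * born P \<mu> (is[j := Suc (is ! j)]) x) x)"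
        using duhamel_sum[where J = "{..<length is}" and h = "\<lambda>j x. P i x * born P \<mu> (is[j := Suc (is ! j)]) x", OF ij x] by simp
    qed (rule x)
    also have "\<dots> = (\<Sum>j<length (i # is). born P \<mu> ((i # is)[j := Suc ((i # is) ! j)]) x)"
      by (simp only: length_Cons sum.lessThan_Suc_shift nth_Cons_0 nth_Cons_Suc list_update_code born.simps o_def)
    finally show "duhamel \<mu> y x = (\<Sum>j<length (i # is). born P \<mu> ((i # is)[j := Suc ((i # is) ! j)]) x)" .
  qed
qed

text \<open>
  Integration of \<open>exp (- 2 \<i> \<mu> t)\<close> by parts: multiplication by \<open>2 \<i> \<mu>\<close> moves one derivative onto one of the
  factors in all possible ways, and the boundary terms vanish at both ends.
\<close>

lemma born_term_leibniz:
  assumes P: "\<And>i. i < k \<Longrightarrow> primitive_of (P i) (P (Suc i))"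
    and P0: "\<And>i. i < k \<Longrightarrow> P i 0 = 0" "\<And>i. i < k \<Longrightarrow> P i pi = 0"
    and m: "\<mu> \<noteq> 0" and less: "\<And>i. i \<in> set is \<Longrightarrow> i < k" and i: "i < k"
  shows "2 * \<i> * \<mu> * born_term P \<mu> i is = born_term P \<mu> (Suc i) is + (\<Sum>j<length is. born_term P \<mu> i (is[j := Suc (is ! j)]))"
proof -
  have k0: "0 < k" using i by simp
  have Pint: "integrable (lebesgue_on {0..pi}) (P j)" if "j \<le> k" for j
    by (rule chain_integrable[where P = P and k = k, OF P that k0])
  have L: "primitive_of (born P \<mu> is) (\<lambda>x. \<Sum>j<length is. born P \<mu> (is[j := Suc (is ! j)]) x)"
    by (rule born_leibniz[where P = P and k = k, OF P P0(1) m less])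
  have c: "continuous_on {0..pi} (born P \<mu> is)" using L by (rule primitive_of_continuous)
  have cj: "continuous_on {0..pi} (born P \<mu> (is[j := Suc (is ! j)]))" if "j < length is" for j
  proof (rule born_continuous[OF Pint m])
    fix l assume "l \<in> set (is[j := Suc (is ! j)])"
    then have "l = Suc (is ! j) \<or> l \<in> set is" using set_update_subset_insert by fast
    then show "l \<le> k" using less[of "is ! j"] less[of l] nth_mem[OF that] by auto
  qed
  define e where "e = (\<lambda>t. exp (- 2 * \<i> * \<mu> * complex_of_real t))"
  have ce: "continuous_on S e" for S unfolding e_def by (intro continuous_intros)
  have e: "primitive_of e (\<lambda>t. - 2 * \<i> * \<mu> * e t)" unfolding e_def using exp_primitive[of "- 2 * \<i> * \<mu>"] by simp
  have pie: "pi \<in> {0..pi}" by simp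
  have "primitive_of (\<lambda>t. P i t * (e t * born P \<mu> is t))
     (\<lambda>t. P (Suc i) t * (e t * born P \<mu> is t) + P i t * ((- 2 * \<i> * \<mu> * e t) * born P \<mu> is t + e t * (\<Sum>j<length is. born P \<mu> (is[j := Suc (is ! j)]) t)))"
    by (rule primitive_of_mult[OF P[OF i] primitive_of_mult[OF e L]])
  from primitive_ofD[OF this pie] P0[OF i]
  have "0 = (LINT t|lebesgue_on {0..pi}. P (Suc i) t * (e t * born P \<mu> is t) + P i t * ((- 2 * \<i> * \<mu> * e t) * born P \<mu> is t + e t * (\<Sum>j<length is. born P \<mu> (is[j := Suc (is ! j)]) t)))"
    by simp
  also have "\<dots> = (LINT t|lebesgue_on {0..pi}. P (Suc i) t * (e t * born P \<mu> is t) + (\<Sum>j<length is. P i t * (e t * born P \<mu> (is[j := Suc (is ! j)]) t)) - (2 * \<i> * \<mu>) * (P i t * (e t * born P \<mu> is t)))"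
    by (intro Bochner_Integration.integral_cong refl) (simp add: algebra_simps sum_distrib_left)
  also have "\<dots> = born_term P \<mu> (Suc i) is + (\<Sum>j<length is. born_term P \<mu> i (is[j := Suc (is ! j)])) - 2 * \<i> * \<mu> * born_term P \<mu> i is"
  proof -
    have 1: "integrable (lebesgue_on {0..pi}) (\<lambda>t. P (Suc i) t * (e t * born P \<mu> is t))"
      using i by (intro integrable_mult_cont Pint continuous_on_mult c ce) auto
    have 2: "integrable (lebesgue_on {0..pi}) (\<lambda>t. P i t * (e t * born P \<mu> (is[j := Suc (is ! j)]) t))" if "j \<in> {..<length is}" for j
      using i that by (intro integrable_mult_cont Pint continuous_on_mult cj ce) auto
    have 3: "integrable (lebesgue_on {0..pi}) (\<lambda>t. P i t * (e t * born P \<mu> is t))"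
      using i by (intro integrable_mult_cont Pint continuous_on_mult c ce) auto
    have 4: "(LINT t|lebesgue_on {0..pi}. (2 * \<i> * \<mu>) * (P i t * (e t * born P \<mu> is t))) = 2 * \<i> * \<mu> * born_term P \<mu> i is"
      unfolding born_term_def e_def by (rule integral_mult_right_zero)
    have 5: "(LINT t|lebesgue_on {0..pi}. (\<Sum>j<length is. P i t * (e t * born P \<mu> (is[j := Suc (is ! j)]) t))) = (\<Sum>j<length is. born_term P \<mu> i (is[j := Suc (is ! j)]))"
      unfolding born_term_def e_def using 2[unfolded e_def] by (rule Bochner_Integration.integral_sum)
    have 6: "integrable (lebesgue_on {0..pi}) (\<lambda>t. \<Sum>j<length is. P i t * (e t * born P \<mu> (is[j := Suc (is ! j)]) t))"
      by (intro Bochner_Integration.integrable_sum 2)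
    have 7: "integrable (lebesgue_on {0..pi}) (\<lambda>t. (2 * \<i> * \<mu>) * (P i t * (e t * born P \<mu> is t)))"
      using 3 by simp
    show ?thesis
      unfolding Bochner_Integration.integral_diff[OF Bochner_Integration.integrable_add[OF 1 6] 7]
        Bochner_Integration.integral_add[OF 1 6] 4 5
      unfolding born_term_def e_def ..
  qed
  finally show ?thesis by (simp add: algebra_simps)
qed

section \<open>Decay and Lipschitz bounds for the higher Born terms\<close>

lemma born_term_bound:
  assumes P: "\<And>j. j \<in> set (i # is) \<Longrightarrow> integrable (lebesgue_on {0..pi}) (P j) \<and> l1norm (P j) \<le> B" and m: "m \<noteq> 0"
  shows "norm (born_term P (complex_of_real m) i is) \<le> B * (B / \<bar>m\<bar>) ^ length is"
proof -
  have Pi: "integrable (lebesgue_on {0..pi}) (P i)" "l1norm (P i) \<le> B" using P by auto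
  have B0: "B \<ge> 0" using Pi l1norm_nonneg[of "P i"] by simp
  have pie: "pi \<in> {0..pi}" by simp
  have c: "continuous_on {0..pi} (born P (complex_of_real m) is)"
    by (rule born_continuous) (use P m in auto)
  have "norm (born_term P (complex_of_real m) i is) \<le> (B / \<bar>m\<bar>) ^ length is * l1norm (P i)"
    unfolding born_term_def
  proof (rule norm_lint_le_l1norm[OF Pi(1) _ _ pie])
    show "integrable (lebesgue_on {0..pi}) (\<lambda>t. P i t * (exp (- 2 * \<i> * complex_of_real m * of_real t) * born P (complex_of_real m) is t))"
      by (intro integrable_mult_cont Pi(1) continuous_on_mult c continuous_intros)
    fix t assume t: "t \<in> {0..pi}"
    have "norm (exp (- 2 * \<i> * complex_of_real m * of_real t)) = 1" by (simp add: norm_exp_eq_Re)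
    moreover have "norm (born P (complex_of_real m) is t) \<le> (B / \<bar>m\<bar>) ^ length is"
      by (rule born_bound[OF _ m t]) (use P in auto)
    then have "norm (P i t) * norm (born P (complex_of_real m) is t) \<le> norm (P i t) * (B / \<bar>m\<bar>) ^ length is"
      by (rule mult_left_mono) simp
    ultimately show "norm (P i t * (exp (- 2 * \<i> * complex_of_real m * of_real t) * born P (complex_of_real m) is t)) \<le> (B / \<bar>m\<bar>) ^ length is * norm (P i t)"
      by (simp only: norm_mult mult_1_left mult.commute)
  qed (use B0 in simp)
  also have "\<dots> \<le> (B / \<bar>m\<bar>) ^ length is * B"
    using Pi(2) B0 by (intro mult_left_mono) auto
  finally show ?thesis by (simp only: mult.commute)
qed

text \<open>
  Each use of the Leibniz rule gains a factor \<open>2 |m|\<close> and produces as many terms as there are factors; the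
  number of factors does not change.
\<close>

lemma born_term_decay:
  assumes P: "\<And>i. i < K \<Longrightarrow> primitive_of (P i) (P (Suc i))"
    and P0: "\<And>i. i < K \<Longrightarrow> P i 0 = 0" "\<And>i. i < K \<Longrightarrow> P i pi = 0"
    and B: "\<And>i. i \<le> K \<Longrightarrow> integrable (lebesgue_on {0..pi}) (P i) \<and> l1norm (P i) \<le> B"
    and m: "m \<noteq> 0" and le: "\<And>j. j \<in> set (i # is) \<Longrightarrow> j + k \<le> K"
  shows "(2 * \<bar>m\<bar>) ^ k * norm (born_term P (complex_of_real m) i is) \<le> real (Suc (length is)) ^ k * (B * (B / \<bar>m\<bar>) ^ length is)"
  using le
proof (induction k arbitrary: i "is")
  case 0
  have "norm (born_term P (complex_of_real m) i is) \<le> B * (B / \<bar>m\<bar>) ^ length is"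
    by (rule born_term_bound[OF _ m]) (use B 0 in auto)
  then show ?case by simp
next
  case (Suc k)
  define R where "R = real (Suc (length is)) ^ k * (B * (B / \<bar>m\<bar>) ^ length is)"
  have lt: "j < K" if "j \<in> set (i # is)" for j using Suc.prems[OF that] by simp
  have eq: "2 * \<i> * of_real m * born_term P (of_real m) i is = born_term P (of_real m) (Suc i) is + (\<Sum>j<length is. born_term P (of_real m) i (is[j := Suc (is ! j)]))"
    by (rule born_term_leibniz[where P = P and k = K, OF P P0]) (use m lt in auto)
  have 1: "(2 * \<bar>m\<bar>) ^ k * norm (born_term P (of_real m) (Suc i) is) \<le> R"
    unfolding R_def
  proof (rule Suc.IH)
    fix j assume "j \<in> set (Suc i # is)"
    then show "j + k \<le> K" using Suc.prems[of i] Suc.prems[of j] by auto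
  qed
  have 2: "(2 * \<bar>m\<bar>) ^ k * norm (born_term P (of_real m) i (is[j := Suc (is ! j)])) \<le> R" if j: "j < length is" for j
  proof -
    have "(2 * \<bar>m\<bar>) ^ k * norm (born_term P (of_real m) i (is[j := Suc (is ! j)])) \<le> real (Suc (length (is[j := Suc (is ! j)]))) ^ k * (B * (B / \<bar>m\<bar>) ^ length (is[j := Suc (is ! j)]))"
    proof (rule Suc.IH)
      fix l assume "l \<in> set (i # is[j := Suc (is ! j)])"
      then have "l = i \<or> l = Suc (is ! j) \<or> l \<in> set is" using set_update_subset_insert by fastforce
      then show "l + k \<le> K" using Suc.prems[of i] Suc.prems[of l] Suc.prems[of "is ! j"] nth_mem[OF j] by auto
    qed
    then show ?thesis by (simp add: R_def)
  qed
  have "2 * \<bar>m\<bar> * norm (born_term P (of_real m) i is) = norm (2 * \<i> * of_real m * born_term P (of_real m) i is)"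
    by (simp add: norm_mult)
  also have "\<dots> \<le> norm (born_term P (of_real m) (Suc i) is) + (\<Sum>j<length is. norm (born_term P (of_real m) i (is[j := Suc (is ! j)])))"
    unfolding eq by (intro order_trans[OF norm_triangle_ineq] add_left_mono norm_sum)
  finally have "(2 * \<bar>m\<bar>) ^ k * (2 * \<bar>m\<bar> * norm (born_term P (of_real m) i is)) \<le>
     (2 * \<bar>m\<bar>) ^ k * (norm (born_term P (of_real m) (Suc i) is) + (\<Sum>j<length is. norm (born_term P (of_real m) i (is[j := Suc (is ! j)]))))"
    by (rule mult_left_mono) simp
  also have "\<dots> = (2 * \<bar>m\<bar>) ^ k * norm (born_term P (of_real m) (Suc i) is) + (\<Sum>j<length is. (2 * \<bar>m\<bar>) ^ k * norm (born_term P (of_real m) i (is[j := Suc (is ! j)])))"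
    by (simp only: distrib_left sum_distrib_left)
  also have "\<dots> \<le> R + (\<Sum>j<length is. R)"
    using 1 2 by (intro add_mono sum_mono) auto
  also have "\<dots> = real (Suc (length is)) * R" by (simp add: algebra_simps)
  finally show ?case unfolding R_def power_Suc2[of "2 * \<bar>m\<bar>"] power_Suc[of "real (Suc (length is))"] by (simp only: mult.assoc)
qed

text \<open>
  The part of the scattering function of third and higher order in the potential.
\<close>

definition scattering3 :: "(real \<Rightarrow> complex) \<Rightarrow> complex \<Rightarrow> complex" where
  "scattering3 p \<mu> = (LINT t|lebesgue_on {0..pi}. p t * (exp (- 2 * \<i> * \<mu> * of_real t) * duhamel \<mu> (\<lambda>s. p s * (chi p \<mu> s - 1)) t))"

text \<open>
  The remainder of the Born series after \<open>n\<close> iterations.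
\<close>

fun born_rest :: "(real \<Rightarrow> complex) \<Rightarrow> complex \<Rightarrow> nat \<Rightarrow> real \<Rightarrow> complex" where
  "born_rest p \<mu> 0 = chi p \<mu>"
| "born_rest p \<mu> (Suc n) = duhamel \<mu> (\<lambda>t. p t * born_rest p \<mu> n t)"

lemma chi_bound:
  assumes p: "integrable (lebesgue_on {0..pi}) p" and small: "pi * l1norm p \<le> 1/2" and x: "x \<in> {0..pi}"
  shows "norm (chi p (complex_of_real m) x) \<le> 2"
  using psi_growth[OF p small x, of "complex_of_real m"] by (simp add: chi_def norm_mult norm_exp_eq_Re)

lemma born_rest_continuous:
  assumes p: "integrable (lebesgue_on {0..pi}) p" and m: "\<mu> \<noteq> 0"
  shows "continuous_on {0..pi} (born_rest p \<mu> n)"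
proof (induction n)
  case 0
  then show ?case unfolding born_rest.simps by (rule chi_continuous[OF p])
next
  case (Suc n)
  then show ?case unfolding born_rest.simps by (intro duhamel_continuous integrable_mult_cont p m)
qed

lemma born_rest_bound:
  assumes p: "integrable (lebesgue_on {0..pi}) p" and small: "pi * l1norm p \<le> 1/2" and m: "m \<noteq> 0" and x: "x \<in> {0..pi}"
  shows "norm (born_rest p (complex_of_real m) n x) \<le> 2 * (l1norm p / \<bar>m\<bar>) ^ n"
  using x
proof (induction n arbitrary: x)
  case 0
  then show ?case using chi_bound[OF p small] by simp
next
  case (Suc n)
  have c: "continuous_on {0..pi} (born_rest p (complex_of_real m) n)"
    by (rule born_rest_continuous[OF p]) (use m in simp)
  have "norm (born_rest p (complex_of_real m) (Suc n) x) \<le> l1norm (\<lambda>t. p t * born_rest p (complex_of_real m) n t) / \<bar>m\<bar>"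
    unfolding born_rest.simps by (intro duhamel_bound integrable_mult_cont p c m Suc.prems)
  also have "\<dots> \<le> (l1norm p * (2 * (l1norm p / \<bar>m\<bar>) ^ n)) / \<bar>m\<bar>"
    by (intro divide_right_mono l1norm_mult_le p c Suc.IH) auto
  finally show ?case by (simp add: mult.left_commute)
qed

lemma chi_expansion:
  assumes p: "integrable (lebesgue_on {0..pi}) p" and m: "\<mu> \<noteq> 0" and P: "P 0 = p" and x: "x \<in> {0..pi}"
  shows "chi p \<mu> x = (\<Sum>n<N. born P \<mu> (replicate n 0) x) + born_rest p \<mu> N x"
  using x
proof (induction N arbitrary: x)
  case (Suc N)
  have cb: "continuous_on {0..pi} (born P \<mu> (replicate n 0))" for n
    by (rule born_continuous) (use P p m in auto)
  have ib: "integrable (lebesgue_on {0..pi}) (\<lambda>t. p t * born P \<mu> (replicate n 0) t)" for n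
    by (intro integrable_mult_cont p cb)
  have ir: "integrable (lebesgue_on {0..pi}) (\<lambda>t. p t * born_rest p \<mu> N t)"
    by (intro integrable_mult_cont p born_rest_continuous m)
  have "duhamel \<mu> (\<lambda>t. p t * chi p \<mu> t) x = duhamel \<mu> (\<lambda>t. (\<Sum>n<N. p t * born P \<mu> (replicate n 0) t) + p t * born_rest p \<mu> N t) x"
    using Suc.prems by (intro duhamel_cong) (simp add: Suc.IH distrib_left sum_distrib_left)
  also have "\<dots> = duhamel \<mu> (\<lambda>t. \<Sum>n<N. p t * born P \<mu> (replicate n 0) t) x + duhamel \<mu> (\<lambda>t. p t * born_rest p \<mu> N t) x"
    by (intro duhamel_add Bochner_Integration.integrable_sum ib ir Suc.prems)
  also have "duhamel \<mu> (\<lambda>t. \<Sum>n<N. p t * born P \<mu> (replicate n 0) t) x = (\<Sum>n<N. born P \<mu> (replicate (Suc n) 0) x)"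
    using duhamel_sum[where J = "{..<N}" and h = "\<lambda>n t. p t * born P \<mu> (replicate n 0) t", OF ib Suc.prems] by (simp add: P)
  finally have "chi p \<mu> x = 1 + (\<Sum>n<N. born P \<mu> (replicate (Suc n) 0) x) + born_rest p \<mu> (Suc N) x"
    using chi_equation[OF p Suc.prems m] by (simp only: add.assoc born_rest.simps)
  moreover have "(\<Sum>n<Suc N. born P \<mu> (replicate n 0) x) = 1 + (\<Sum>n<N. born P \<mu> (replicate (Suc n) 0) x)"
    unfolding sum.lessThan_Suc_shift by simp
  ultimately show ?case by simp
qed simp

lemma scattering_expansion:
  assumes p: "integrable (lebesgue_on {0..pi}) p" and m: "\<mu> \<noteq> 0" and P: "P 0 = p"
  shows "scattering p \<mu> = (\<Sum>n<N. born_term P \<mu> 0 (replicate n 0)) +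
     (LINT t|lebesgue_on {0..pi}. p t * (exp (- 2 * \<i> * \<mu> * of_real t) * born_rest p \<mu> N t))"
proof -
  have cb: "continuous_on {0..pi} (born P \<mu> (replicate n 0))" for n
    by (rule born_continuous) (use P p m in auto)
  have ib: "integrable (lebesgue_on {0..pi}) (\<lambda>t. p t * (exp (- 2 * \<i> * \<mu> * of_real t) * born P \<mu> (replicate n 0) t))" for n
    by (intro integrable_mult_cont p continuous_on_mult cb continuous_intros)
  have ir: "integrable (lebesgue_on {0..pi}) (\<lambda>t. p t * (exp (- 2 * \<i> * \<mu> * of_real t) * born_rest p \<mu> N t))"
    by (intro integrable_mult_cont p continuous_on_mult born_rest_continuous m continuous_intros)
  have "scattering p \<mu> = (LINT t|lebesgue_on {0..pi}. (\<Sum>n<N. p t * (exp (- 2 * \<i> * \<mu> * of_real t) * born P \<mu> (replicate n 0) t)) +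
      p t * (exp (- 2 * \<i> * \<mu> * of_real t) * born_rest p \<mu> N t))"
    unfolding scattering_def
  proof (rule Bochner_Integration.integral_cong[OF refl])
    fix t assume "t \<in> space (lebesgue_on {0..pi})"
    then have t: "t \<in> {0..pi}" by simp
    show "p t * (exp (- 2 * \<i> * \<mu> * of_real t) * chi p \<mu> t) = (\<Sum>n<N. p t * (exp (- 2 * \<i> * \<mu> * of_real t) * born P \<mu> (replicate n 0) t)) +
      p t * (exp (- 2 * \<i> * \<mu> * of_real t) * born_rest p \<mu> N t)"
      unfolding chi_expansion[where P = P and N = N, OF p m P t] by (simp only: distrib_left sum_distrib_left)
  qed
  also have "\<dots> = (LINT t|lebesgue_on {0..pi}. (\<Sum>n<N. p t * (exp (- 2 * \<i> * \<mu> * of_real t) * born P \<mu> (replicate n 0) t))) +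
      (LINT t|lebesgue_on {0..pi}. p t * (exp (- 2 * \<i> * \<mu> * of_real t) * born_rest p \<mu> N t))"
    by (intro Bochner_Integration.integral_add Bochner_Integration.integrable_sum ib ir)
  also have "(LINT t|lebesgue_on {0..pi}. (\<Sum>n<N. p t * (exp (- 2 * \<i> * \<mu> * of_real t) * born P \<mu> (replicate n 0) t))) = (\<Sum>n<N. born_term P \<mu> 0 (replicate n 0))"
    unfolding born_term_def P by (intro Bochner_Integration.integral_sum ib)
  finally show ?thesis .
qed

text \<open>
  The first two Born terms are separated: the first is the Fourier transform of the potential, the second
  cancels in the determinant for odd potentials.
\<close>

lemma scattering_split:
  assumes p: "integrable (lebesgue_on {0..pi}) p" and m: "\<mu> \<noteq> 0" and P: "P 0 = p"
  shows "scattering p \<mu> = born_term P \<mu> 0 [] + born_term P \<mu> 0 [0] + scattering3 p \<mu>"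
proof -
  have "born_rest p \<mu> 2 t = duhamel \<mu> (\<lambda>s. p s * (chi p \<mu> s - 1)) t" if t: "t \<in> {0..pi}" for t
  proof -
    have "born_rest p \<mu> 2 t = duhamel \<mu> (\<lambda>s. p s * duhamel \<mu> (\<lambda>t. p t * chi p \<mu> t) s) t"
      by (simp add: numeral_2_eq_2)
    also have "\<dots> = duhamel \<mu> (\<lambda>s. p s * (chi p \<mu> s - 1)) t"
      using t by (intro duhamel_cong) (simp add: chi_equation[OF p _ m])
    finally show ?thesis .
  qed
  then have "(LINT t|lebesgue_on {0..pi}. p t * (exp (- 2 * \<i> * \<mu> * of_real t) * born_rest p \<mu> 2 t)) = scattering3 p \<mu>"
    unfolding scattering3_def by (intro Bochner_Integration.integral_cong) auto
  then show ?thesis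
    using scattering_expansion[where P = P and N = 2, OF p m P] by (simp add: numeral_2_eq_2)
qed

text \<open>
  The Born terms of degree between \<open>3\<close> and \<open>K + 3\<close> already carry \<open>|m|\<close> to the power \<open>-2\<close> and gain
  \<open>K\<close> further powers from the Leibniz rule; the rest of the series is of order \<open>K + 3\<close> by the crude bound.
\<close>

lemma scattering3_decay:
  assumes P: "\<And>i. i < K \<Longrightarrow> primitive_of (P i) (P (Suc i))"
    and P0: "\<And>i. i < K \<Longrightarrow> P i 0 = 0" "\<And>i. i < K \<Longrightarrow> P i pi = 0"
    and Pint: "\<And>i. i \<le> K \<Longrightarrow> integrable (lebesgue_on {0..pi}) (P i)"
    and small: "pi * l1norm (P 0) \<le> 1/2"
  shows "\<exists>C. \<forall>m. \<bar>m\<bar> \<ge> 1 \<longrightarrow> norm (scattering3 (P 0) (complex_of_real m)) \<le> C / \<bar>m\<bar> ^ (K + 2)"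
proof -
  define B where "B = (\<Sum>i\<le>K. l1norm (P i))"
  have B: "integrable (lebesgue_on {0..pi}) (P i) \<and> l1norm (P i) \<le> B" if "i \<le> K" for i
    unfolding B_def using that Pint by (auto intro!: member_le_sum l1norm_nonneg)
  have B0: "B \<ge> 0" unfolding B_def by (intro sum_nonneg l1norm_nonneg)
  (* Enough iterations for the crude bound on the rest to beat the decay of order K + 2. *)
  define N where "N = K + 3"
  define C1 where "C1 = (\<lambda>n. real (Suc n) ^ K * (B * B ^ n))"
  define C where "C = (\<Sum>n\<in>{2..<N}. C1 n) + 2 * B ^ N * B"
  have pie: "pi \<in> {0..pi}" by simp
  have "norm (scattering3 (P 0) (complex_of_real m)) \<le> C / \<bar>m\<bar> ^ (K + 2)" if m1: "\<bar>m\<bar> \<ge> 1" for m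
  proof -
    have m: "m \<noteq> 0" and mc: "complex_of_real m \<noteq> 0" using m1 by auto
    define M where "M = \<bar>m\<bar>"
    have M: "M \<ge> 1" "M > 0" using m1 by (auto simp: M_def)
    define Rest where "Rest = (LINT t|lebesgue_on {0..pi}. P 0 t * (exp (- 2 * \<i> * complex_of_real m * of_real t) * born_rest (P 0) (complex_of_real m) N t))"
    have "(\<Sum>n<N. born_term P (of_real m) 0 (replicate n 0)) = born_term P (of_real m) 0 [] + born_term P (of_real m) 0 [0] + (\<Sum>n\<in>{2..<N}. born_term P (of_real m) 0 (replicate n 0))"
    proof -
      have "{..<N} = {0, 1} \<union> {2..<N}" by (auto simp: N_def)
      then show ?thesis by (simp add: sum.union_disjoint)
    qed
    then have eq: "scattering3 (P 0) (of_real m) = (\<Sum>n\<in>{2..<N}. born_term P (of_real m) 0 (replicate n 0)) + Rest"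
      using scattering_expansion[where P = P and N = N, OF Pint[OF le0] mc refl] scattering_split[where P = P, OF Pint[OF le0] mc refl]
      unfolding Rest_def by simp
    have t1: "norm (born_term P (of_real m) 0 (replicate n 0)) \<le> C1 n / M ^ (K + 2)" if n: "n \<ge> 2" for n
    proof -
      have "(2 * \<bar>m\<bar>) ^ K * norm (born_term P (of_real m) 0 (replicate n 0)) \<le> real (Suc (length (replicate n (0::nat)))) ^ K * (B * (B / \<bar>m\<bar>) ^ length (replicate n (0::nat)))"
        by (rule born_term_decay[where P = P and K = K and B = B, OF P P0 B m]) auto
      then have "(2 * M) ^ K * norm (born_term P (of_real m) 0 (replicate n 0)) \<le> real (Suc n) ^ K * (B * (B / M) ^ n)"
        by (simp add: M_def)
      moreover have "M ^ K * norm (born_term P (of_real m) 0 (replicate n 0)) \<le> (2 * M) ^ K * norm (born_term P (of_real m) 0 (replicate n 0))"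
        using M by (intro mult_right_mono power_mono) auto
      ultimately have "M ^ K * norm (born_term P (of_real m) 0 (replicate n 0)) \<le> C1 n / M ^ n"
        by (simp add: C1_def power_divide)
      also have "\<dots> \<le> C1 n / M ^ 2"
        using M n B0 by (intro divide_left_mono power_increasing mult_pos_pos) (auto simp: C1_def)
      finally show ?thesis using M by (simp add: pos_le_divide_eq power_add power2_eq_square mult_ac)
    qed
    have t2: "norm Rest \<le> 2 * B ^ N * B / M ^ (K + 2)"
    proof -
      have "norm Rest \<le> (2 * (l1norm (P 0) / \<bar>m\<bar>) ^ N) * l1norm (P 0)"
        unfolding Rest_def
      proof (rule norm_lint_le_l1norm[OF Pint[OF le0] _ _ pie])
        show "integrable (lebesgue_on {0..pi}) (\<lambda>t. P 0 t * (exp (- 2 * \<i> * complex_of_real m * of_real t) * born_rest (P 0) (complex_of_real m) N t))"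
          by (intro integrable_mult_cont Pint continuous_on_mult born_rest_continuous mc continuous_intros le0)
        fix t assume t: "t \<in> {0..pi}"
        have "norm (exp (- 2 * \<i> * complex_of_real m * of_real t)) = 1" by (simp add: norm_exp_eq_Re)
        moreover have "norm (P 0 t) * norm (born_rest (P 0) (complex_of_real m) N t) \<le> norm (P 0 t) * (2 * (l1norm (P 0) / \<bar>m\<bar>) ^ N)"
          by (intro mult_left_mono born_rest_bound Pint small m t) auto
        ultimately show "norm (P 0 t * (exp (- 2 * \<i> * complex_of_real m * of_real t) * born_rest (P 0) (complex_of_real m) N t)) \<le> 2 * (l1norm (P 0) / \<bar>m\<bar>) ^ N * norm (P 0 t)"
          by (simp only: norm_mult mult_1_left mult.commute)
      qed (simp add: l1norm_nonneg)
      also have "\<dots> \<le> (2 * (B / M) ^ N) * B"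
        unfolding M_def using B[of 0] B0 by (intro mult_mono power_mono divide_right_mono) (auto simp: l1norm_nonneg)
      also have "\<dots> = 2 * B ^ N * B / M ^ N" by (simp add: power_divide)
      also have "\<dots> \<le> 2 * B ^ N * B / M ^ (K + 2)"
        using M B0 by (intro divide_left_mono power_increasing mult_pos_pos) (auto simp: N_def)
      finally show ?thesis .
    qed
    have "norm (scattering3 (P 0) (of_real m)) \<le> (\<Sum>n\<in>{2..<N}. C1 n / M ^ (K + 2)) + 2 * B ^ N * B / M ^ (K + 2)"
      unfolding eq using t1 t2
      by (intro order_trans[OF norm_triangle_ineq] add_mono order_trans[OF norm_sum] sum_mono) auto
    also have "\<dots> = C / M ^ (K + 2)" by (simp add: C_def sum_divide_distrib add_divide_distrib)
    finally show ?thesis by (simp add: M_def)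
  qed
  then show ?thesis by blast
qed

lemma l1norm_triangle:
  assumes "integrable (lebesgue_on {0..pi}) f" "integrable (lebesgue_on {0..pi}) g"
  shows "l1norm (\<lambda>t. f t + g t) \<le> l1norm f + l1norm g"
proof -
  have i: "integrable (lebesgue_on {0..pi}) (\<lambda>t. norm (f t))" "integrable (lebesgue_on {0..pi}) (\<lambda>t. norm (g t))"
    "integrable (lebesgue_on {0..pi}) (\<lambda>t. norm (f t + g t))" using assms by auto
  have "l1norm (\<lambda>t. f t + g t) \<le> (LINT t|lebesgue_on {0..pi}. norm (f t) + norm (g t))"
    unfolding l1norm_def using i by (intro integral_mono) (auto intro: norm_triangle_ineq)
  then show ?thesis using i by (simp add: l1norm_def)
qed

text \<open>
  The product rule for differences, for the operator \<open>h \<mapsto> duhamel (p h)\<close>.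
\<close>

lemma duhamel_product_difference:
  assumes p: "integrable (lebesgue_on {0..pi}) p" and q: "integrable (lebesgue_on {0..pi}) q"
    and f: "continuous_on {0..pi} f" "\<And>t. t \<in> {0..pi} \<Longrightarrow> norm (f t) \<le> A"
    and d: "continuous_on {0..pi} g" "\<And>t. t \<in> {0..pi} \<Longrightarrow> norm (f t - g t) \<le> D"
    and m: "m \<noteq> 0" and x: "x \<in> {0..pi}"
  shows "norm (duhamel (complex_of_real m) (\<lambda>t. p t * f t) x - duhamel (complex_of_real m) (\<lambda>t. q t * g t) x)
    \<le> (l1norm (\<lambda>t. p t - q t) * A + l1norm q * D) / \<bar>m\<bar>"
proof -
  have pq: "integrable (lebesgue_on {0..pi}) (\<lambda>t. p t - q t)" using p q by simp
  have i1: "integrable (lebesgue_on {0..pi}) (\<lambda>t. (p t - q t) * f t)" by (intro integrable_mult_cont pq f)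
  have i2: "integrable (lebesgue_on {0..pi}) (\<lambda>t. q t * (f t - g t))" by (intro integrable_mult_cont q continuous_on_diff f d)
  have i3: "integrable (lebesgue_on {0..pi}) (\<lambda>t. p t * f t)" "integrable (lebesgue_on {0..pi}) (\<lambda>t. q t * g t)"
    by (intro integrable_mult_cont p q f d)+
  have "duhamel (complex_of_real m) (\<lambda>t. p t * f t) x - duhamel (complex_of_real m) (\<lambda>t. q t * g t) x
    = duhamel (complex_of_real m) (\<lambda>t. (p t - q t) * f t + q t * (f t - g t)) x"
    unfolding duhamel_diff[OF i3 x, symmetric] by (simp add: algebra_simps)
  also have "norm \<dots> \<le> l1norm (\<lambda>t. (p t - q t) * f t + q t * (f t - g t)) / \<bar>m\<bar>"
    by (intro duhamel_bound Bochner_Integration.integrable_add i1 i2 m x)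
  also have "\<dots> \<le> (l1norm (\<lambda>t. p t - q t) * A + l1norm q * D) / \<bar>m\<bar>"
    by (intro divide_right_mono order_trans[OF l1norm_triangle[OF i1 i2]] add_mono l1norm_mult_le pq q f d continuous_on_diff) auto
  finally show ?thesis .
qed

text \<open>
  Being of third order, this part has a Lipschitz constant of second order in the size \<open>\<epsilon>\<close> of the
  potentials. That smallness makes the fixed point map a contraction.
\<close>

lemma scattering3_lipschitz:
  assumes p: "integrable (lebesgue_on {0..pi}) p" and q: "integrable (lebesgue_on {0..pi}) q"
    and pe: "l1norm p \<le> \<epsilon>" and qe: "l1norm q \<le> \<epsilon>" and e: "pi * \<epsilon> \<le> 1/2" and m: "\<bar>m\<bar> \<ge> 1"
  shows "norm (scattering3 p (complex_of_real m) - scattering3 q (complex_of_real m)) \<le> 8 * \<epsilon>\<^sup>2 * l1norm (\<lambda>t. p t - q t) / m\<^sup>2"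
proof -
  define \<mu> where "\<mu> = complex_of_real m"
  define M where "M = \<bar>m\<bar>"
  have M: "M \<ge> 1" "M > 0" using m by (auto simp: M_def)
  have m0: "m \<noteq> 0" "\<mu> \<noteq> 0" using m by (auto simp: \<mu>_def)
  have e0: "\<epsilon> \<ge> 0" using pe l1norm_nonneg[of p] by linarith
  have e1: "\<epsilon> \<le> 1/2"
  proof -
    have "1 * \<epsilon> \<le> pi * \<epsilon>" using e0 pi_gt3 by (intro mult_right_mono) auto
    then show ?thesis using e by simp
  qed
  have ps: "pi * l1norm p \<le> 1/2" and qs: "pi * l1norm q \<le> 1/2"
    using e mult_left_mono[OF pe, of pi] mult_left_mono[OF qe, of pi] pi_ge_zero by linarith+
  define d where "d = l1norm (\<lambda>t. p t - q t)"
  have d0: "d \<ge> 0" by (simp add: d_def l1norm_nonneg)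
  have cp: "continuous_on {0..pi} (chi p \<mu>)" and cq: "continuous_on {0..pi} (chi q \<mu>)"
    by (rule chi_continuous[OF p], rule chi_continuous[OF q])
  have bp: "norm (chi p \<mu> t) \<le> 2" if "t \<in> {0..pi}" for t
    unfolding \<mu>_def by (rule chi_bound[OF p ps that])
  have diff: "norm (chi p \<mu> t - chi q \<mu> t) \<le> 4 * d / M" if t: "t \<in> {0..pi}" for t
  proof -
    have "continuous_on {0..pi} (\<lambda>t. norm (chi p \<mu> t - chi q \<mu> t))" by (intro continuous_intros cp cq)
    then obtain y where y: "y \<in> {0..pi}" "\<And>s. s \<in> {0..pi} \<Longrightarrow> norm (chi p \<mu> s - chi q \<mu> s) \<le> norm (chi p \<mu> y - chi q \<mu> y)"
      using continuous_attains_sup[of "{0..pi}" "\<lambda>t. norm (chi p \<mu> t - chi q \<mu> t)"] by auto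
    define D where "D = norm (chi p \<mu> y - chi q \<mu> y)"
    have "D \<le> (d * 2 + l1norm q * D) / M"
      unfolding D_def d_def M_def chi_equation[OF p y(1) m0(2)] chi_equation[OF q y(1) m0(2)] add_diff_cancel_left
      unfolding \<mu>_def
      by (rule duhamel_product_difference[OF p q cp[unfolded \<mu>_def] bp[unfolded \<mu>_def] cq[unfolded \<mu>_def] _ m0(1) y(1)])
         (use y(2) in \<open>simp_all add: \<mu>_def chi_equation[OF p y(1) m0(2), unfolded \<mu>_def] chi_equation[OF q y(1) m0(2), unfolded \<mu>_def]\<close>)
    then have "D * M \<le> d * 2 + l1norm q * D" using M by (simp add: field_simps)
    moreover have "l1norm q * D \<le> (1/2) * D" using qe e1 by (intro mult_right_mono) (auto simp: D_def)
    moreover have "(1/2) * D \<le> D * M / 2"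
      using mult_left_mono[OF M(1), of D] by (simp add: D_def)
    ultimately have "D * M \<le> 4 * d" by linarith
    then have "D \<le> 4 * d / M" using M by (simp add: field_simps)
    then show ?thesis using y(2)[OF t] unfolding D_def by linarith
  qed
  have wp: "norm (chi p \<mu> t - 1) \<le> 2 * \<epsilon> / M" if t: "t \<in> {0..pi}" for t
  proof -
    have "norm (chi p \<mu> t - 1) = norm (duhamel \<mu> (\<lambda>t. p t * chi p \<mu> t) t)"
      using chi_equation[OF p t m0(2)] by simp
    also have "\<dots> \<le> l1norm (\<lambda>t. p t * chi p \<mu> t) / M"
      unfolding \<mu>_def M_def by (intro duhamel_bound integrable_mult_cont p cp[unfolded \<mu>_def] t m0)
    also have "\<dots> \<le> (l1norm p * 2) / M" using M by (intro divide_right_mono l1norm_mult_le p cp bp) auto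
    also have "\<dots> \<le> 2 * \<epsilon> / M" using pe M by (intro divide_right_mono) auto
    finally show ?thesis .
  qed
  define G where "G = (\<lambda>p. duhamel \<mu> (\<lambda>s. p s * (chi p \<mu> s - 1)))"
  have cG: "continuous_on {0..pi} (G p)" "continuous_on {0..pi} (G q)"
    unfolding G_def by (intro duhamel_continuous integrable_mult_cont continuous_intros p q cp cq m0)+
  have Gp: "norm (G p t) \<le> 2 * \<epsilon>\<^sup>2 / M\<^sup>2" if t: "t \<in> {0..pi}" for t
  proof -
    have "norm (G p t) \<le> l1norm (\<lambda>s. p s * (chi p \<mu> s - 1)) / M"
      unfolding G_def \<mu>_def M_def by (intro duhamel_bound integrable_mult_cont p continuous_intros cp[unfolded \<mu>_def] t m0)
    also have "\<dots> \<le> (l1norm p * (2 * \<epsilon> / M)) / M"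
      using M by (intro divide_right_mono l1norm_mult_le p continuous_intros cp wp) auto
    also have "\<dots> \<le> (\<epsilon> * (2 * \<epsilon> / M)) / M"
      using M e0 pe by (intro divide_right_mono mult_right_mono) auto
    finally show ?thesis by (simp add: power2_eq_square mult_ac)
  qed
  have Gd: "norm (G p t - G q t) \<le> 6 * \<epsilon> * d / M\<^sup>2" if t: "t \<in> {0..pi}" for t
  proof -
    have "norm (G p t - G q t) \<le> (d * (2 * \<epsilon> / M) + l1norm q * (4 * d / M)) / M"
      unfolding G_def d_def M_def unfolding \<mu>_def
      by (rule duhamel_product_difference[OF p q _ _ _ _ m0(1) t])
         (use cp cq wp diff in \<open>auto simp: \<mu>_def M_def d_def intro!: continuous_intros\<close>)
    also have "\<dots> \<le> (d * (2 * \<epsilon> / M) + \<epsilon> * (4 * d / M)) / M"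
      using M qe d0 by (intro divide_right_mono add_left_mono mult_right_mono) auto
    also have "\<dots> = 6 * \<epsilon> * d / M\<^sup>2" using M by (simp add: power2_eq_square field_simps)
    finally show ?thesis .
  qed
  define e where "e = (\<lambda>t. exp (- 2 * \<i> * \<mu> * complex_of_real t))"
  have ce: "continuous_on S e" for S unfolding e_def by (intro continuous_intros)
  have ne: "norm (e t) = 1" for t unfolding e_def \<mu>_def by (simp add: norm_exp_eq_Re)
  have pq: "integrable (lebesgue_on {0..pi}) (\<lambda>t. p t - q t)" using p q by simp
  have pie: "pi \<in> {0..pi}" by simp
  have i: "integrable (lebesgue_on {0..pi}) (\<lambda>t. p t * (e t * G p t))" "integrable (lebesgue_on {0..pi}) (\<lambda>t. q t * (e t * G q t))"
    "integrable (lebesgue_on {0..pi}) (\<lambda>t. (p t - q t) * (e t * G p t))" "integrable (lebesgue_on {0..pi}) (\<lambda>t. q t * (e t * (G p t - G q t)))"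
    by (intro integrable_mult_cont p q pq continuous_on_mult ce cG continuous_on_diff)+
  have "scattering3 p \<mu> - scattering3 q \<mu> = (LINT t|lebesgue_on {0..pi}. p t * (e t * G p t)) - (LINT t|lebesgue_on {0..pi}. q t * (e t * G q t))"
    unfolding scattering3_def G_def e_def ..
  also have "\<dots> = (LINT t|lebesgue_on {0..pi}. (p t - q t) * (e t * G p t) + q t * (e t * (G p t - G q t)))"
    unfolding Bochner_Integration.integral_diff[OF i(1,2), symmetric]
    by (intro Bochner_Integration.integral_cong refl) (simp add: algebra_simps)
  also have "\<dots> = (LINT t|lebesgue_on {0..pi}. (p t - q t) * (e t * G p t)) + (LINT t|lebesgue_on {0..pi}. q t * (e t * (G p t - G q t)))"
    by (rule Bochner_Integration.integral_add[OF i(3,4)])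
  finally have "norm (scattering3 p \<mu> - scattering3 q \<mu>) \<le> norm (LINT t|lebesgue_on {0..pi}. (p t - q t) * (e t * G p t)) + norm (LINT t|lebesgue_on {0..pi}. q t * (e t * (G p t - G q t)))"
    by (simp add: norm_triangle_ineq)
  also have "\<dots> \<le> (2 * \<epsilon>\<^sup>2 / M\<^sup>2) * d + (6 * \<epsilon> * d / M\<^sup>2) * l1norm q"
  proof (rule add_mono)
    show "norm (LINT t|lebesgue_on {0..pi}. (p t - q t) * (e t * G p t)) \<le> (2 * \<epsilon>\<^sup>2 / M\<^sup>2) * d"
      unfolding d_def
    proof (rule norm_lint_le_l1norm[OF pq i(3) _ pie])
      show "norm ((p t - q t) * (e t * G p t)) \<le> 2 * \<epsilon>\<^sup>2 / M\<^sup>2 * norm (p t - q t)" if "t \<in> {0..pi}" for t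
        using mult_left_mono[OF Gp[OF that] norm_ge_zero, of "p t - q t"] by (simp only: norm_mult ne mult_1_left mult.commute)
    qed simp
    show "norm (LINT t|lebesgue_on {0..pi}. q t * (e t * (G p t - G q t))) \<le> (6 * \<epsilon> * d / M\<^sup>2) * l1norm q"
    proof (rule norm_lint_le_l1norm[OF q i(4) _ pie])
      show "norm (q t * (e t * (G p t - G q t))) \<le> 6 * \<epsilon> * d / M\<^sup>2 * norm (q t)" if "t \<in> {0..pi}" for t
        using mult_left_mono[OF Gd[OF that] norm_ge_zero, of "q t"] by (simp only: norm_mult ne mult_1_left mult.commute)
    qed (use e0 d0 in simp)
  qed
  also have "(6 * \<epsilon> * d / M\<^sup>2) * l1norm q \<le> (6 * \<epsilon> * d / M\<^sup>2) * \<epsilon>"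
    using qe e0 d0 by (intro mult_left_mono) auto
  also have "(2 * \<epsilon>\<^sup>2 / M\<^sup>2) * d + (6 * \<epsilon> * d / M\<^sup>2) * \<epsilon> = 8 * \<epsilon>\<^sup>2 * d / M\<^sup>2"
    by (simp add: power2_eq_square add_divide_distrib[symmetric] algebra_simps)
  finally show ?thesis by (simp add: \<mu>_def M_def d_def)
qed

section \<open>Square integrable functions on the interval\<close>

definition L2c :: "(real \<Rightarrow> complex) \<Rightarrow> bool" where
  "L2c f \<longleftrightarrow> f \<in> borel_measurable (lebesgue_on {0..pi}) \<and> integrable (lebesgue_on {0..pi}) (\<lambda>x. (norm (f x))\<^sup>2)"

definition l2sq :: "(real \<Rightarrow> complex) \<Rightarrow> real" where
  "l2sq f = (LINT x|lebesgue_on {0..pi}. (norm (f x))\<^sup>2)"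

lemma l2sq_nonneg: "l2sq f \<ge> 0" unfolding l2sq_def by simp

lemma integrable_const_pi: "integrable (lebesgue_on {0..pi}) (\<lambda>x. c :: 'a :: euclidean_space)"
  by (rule continuous_imp_integrable_real) auto

lemma L2c_integrable:
  assumes "L2c f" shows "integrable (lebesgue_on {0..pi}) f"
proof (rule Bochner_Integration.integrable_bound[of _ "\<lambda>x. 1 + (norm (f x))\<^sup>2"])
  show "integrable (lebesgue_on {0..pi}) (\<lambda>x. 1 + (norm (f x))\<^sup>2)"
    using assms integrable_const_pi[of "1::real"] by (auto simp: L2c_def)
  have "norm y \<le> norm (1 + (norm y)\<^sup>2)" for y :: complex
  proof -
    have "2 * norm y \<le> (norm y)\<^sup>2 + 1" using sum_squares_bound[of "norm y" 1] by simp
    then have "norm y \<le> 1 + (norm y)\<^sup>2" using norm_ge_zero[of y] by linarith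
    then show ?thesis by simp
  qed
  then show "AE x in lebesgue_on {0..pi}. norm (f x) \<le> norm (1 + (norm (f x))\<^sup>2)" by simp
qed (use assms in \<open>simp add: L2c_def\<close>)

lemma L2c_continuous:
  assumes "continuous_on {0..pi} f" shows "L2c f"
  using assms unfolding L2c_def
  by (auto intro!: continuous_imp_measurable_on_sets_lebesgue continuous_imp_integrable_real continuous_intros)

lemma L2c_combine:
  assumes f: "L2c f" and g: "L2c g"
  shows "L2c (\<lambda>x. a * f x + b * g x)"
proof -
  have m: "(\<lambda>x. a * f x + b * g x) \<in> borel_measurable (lebesgue_on {0..pi})"
    using f g by (auto simp: L2c_def)
  have "integrable (lebesgue_on {0..pi}) (\<lambda>x. (norm (a * f x + b * g x))\<^sup>2)"
  proof (rule Bochner_Integration.integrable_bound[of _ "\<lambda>x. 2 * (norm a)\<^sup>2 * (norm (f x))\<^sup>2 + 2 * (norm b)\<^sup>2 * (norm (g x))\<^sup>2"])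
    show "integrable (lebesgue_on {0..pi}) (\<lambda>x. 2 * (norm a)\<^sup>2 * (norm (f x))\<^sup>2 + 2 * (norm b)\<^sup>2 * (norm (g x))\<^sup>2)"
      using f g by (auto simp: L2c_def)
    have "(norm (a * y + b * z))\<^sup>2 \<le> 2 * (norm a)\<^sup>2 * (norm y)\<^sup>2 + 2 * (norm b)\<^sup>2 * (norm z)\<^sup>2" for y z
    proof -
      have "(norm (a * y + b * z))\<^sup>2 \<le> (norm a * norm y + norm b * norm z)\<^sup>2"
        by (intro power_mono) (auto intro: order_trans[OF norm_triangle_ineq] simp: norm_mult)
      also have "\<dots> \<le> 2 * (norm a * norm y)\<^sup>2 + 2 * (norm b * norm z)\<^sup>2"
        using sum_squares_bound[of "norm a * norm y" "norm b * norm z"] by (simp add: power2_sum)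
      finally show ?thesis by (simp add: power_mult_distrib)
    qed
    then show "AE x in lebesgue_on {0..pi}. norm ((norm (a * f x + b * g x))\<^sup>2) \<le> norm (2 * (norm a)\<^sup>2 * (norm (f x))\<^sup>2 + 2 * (norm b)\<^sup>2 * (norm (g x))\<^sup>2)"
      by (auto intro!: AE_I2 order_trans[OF _ abs_ge_self])
  qed (use m in measurable)
  then show ?thesis using m by (simp add: L2c_def)
qed

lemma L2c_diff: "L2c f \<Longrightarrow> L2c g \<Longrightarrow> L2c (\<lambda>x. f x - g x)"
  using L2c_combine[of f g 1 "-1"] by simp

lemma L2c_add: "L2c f \<Longrightarrow> L2c g \<Longrightarrow> L2c (\<lambda>x. f x + g x)"
  using L2c_combine[of f g 1 1] by simp

text \<open>
  Cauchy-Schwarz, by integrating \<open>2 |f| \<le> s + |f|\<^sup>2 / s\<close> and choosing \<open>s\<close> optimally.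
\<close>

lemma l1_le_l2:
  assumes "L2c f" shows "(l1norm f)\<^sup>2 \<le> pi * l2sq f"
proof -
  define A where "A = l1norm f"
  define B where "B = l2sq f"
  have i1: "integrable (lebesgue_on {0..pi}) (\<lambda>x. norm (f x))" using L2c_integrable[OF assms] by simp
  have i2: "integrable (lebesgue_on {0..pi}) (\<lambda>x. (norm (f x))\<^sup>2)" using assms by (simp add: L2c_def)
  have key: "2 * A \<le> s * pi + B / s" if s: "s > 0" for s
  proof -
    have "(LINT x|lebesgue_on {0..pi}. 2 * norm (f x)) \<le> (LINT x|lebesgue_on {0..pi}. s + (norm (f x))\<^sup>2 / s)"
    proof (rule integral_mono)
      show "integrable (lebesgue_on {0..pi}) (\<lambda>x. s + (norm (f x))\<^sup>2 / s)"
        using i2 integrable_const_pi[of s] by auto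
      show "2 * norm (f x) \<le> s + (norm (f x))\<^sup>2 / s" for x
      proof -
        have "0 \<le> (norm (f x) - s)\<^sup>2 / s" using s by simp
        also have "\<dots> = s + (norm (f x))\<^sup>2 / s - 2 * norm (f x)" using s by (simp add: power2_eq_square field_simps)
        finally show ?thesis by simp
      qed
    qed (use i1 in simp)
    also have "\<dots> = s * pi + B / s"
      using i2 integrable_const_pi[of s] by (simp add: B_def l2sq_def measure_restrict_space)
    finally show ?thesis by (simp add: A_def l1norm_def)
  qed
  have A0: "A \<ge> 0" and B0: "B \<ge> 0" by (auto simp: A_def B_def l1norm_nonneg l2sq_nonneg)
  show ?thesis
  proof (cases "A = 0")
    case True
    then show ?thesis using B0 by (simp add: A_def B_def)
  next
    case False
    then have A: "A > 0" using A0 by simp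
    have "2 * A \<le> A / pi * pi + B / (A / pi)" using key[of "A / pi"] A by simp
    then have "A \<le> B * pi / A" by simp
    then have "A * A \<le> B * pi" using A by (simp add: field_simps)
    then show ?thesis by (simp add: A_def B_def power2_eq_square mult.commute)
  qed
qed

lemma l1_le_sqrt_l2: "L2c f \<Longrightarrow> l1norm f \<le> sqrt (pi * l2sq f)"
  using l1_le_l2 by (rule real_le_rsqrt)

lemma pythagoras:
  fixes \<phi> :: "nat \<Rightarrow> real \<Rightarrow> complex"
  assumes c: "\<And>n. continuous_on {0..pi} (\<phi> n)"
    and orth: "\<And>m n. (LINT x|lebesgue_on {0..pi}. \<phi> m x * cnj (\<phi> n x)) = (if m = n then of_real C else 0)"
    and A: "finite A"
  shows "l2sq (\<lambda>x. \<Sum>n\<in>A. a n * \<phi> n x) = C * (\<Sum>n\<in>A. (norm (a n))\<^sup>2)"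
proof -
  have i: "integrable (lebesgue_on {0..pi}) (\<lambda>x. \<phi> m x * cnj (\<phi> n x))" for m n
    by (intro continuous_imp_integrable_real continuous_intros c)
  have "complex_of_real (l2sq (\<lambda>x. \<Sum>n\<in>A. a n * \<phi> n x)) = (LINT x|lebesgue_on {0..pi}. complex_of_real ((norm (\<Sum>n\<in>A. a n * \<phi> n x))\<^sup>2))"
    unfolding l2sq_def by (rule integral_complex_of_real[symmetric])
  also have "\<dots> = (LINT x|lebesgue_on {0..pi}. (\<Sum>m\<in>A. \<Sum>n\<in>A. (a m * cnj (a n)) * (\<phi> m x * cnj (\<phi> n x))))"
    unfolding complex_norm_square cnj_sum sum_product complex_cnj_mult
    by (intro Bochner_Integration.integral_cong refl sum.cong) (simp add: mult_ac)
  also have "\<dots> = (\<Sum>m\<in>A. \<Sum>n\<in>A. (a m * cnj (a n)) * (if m = n then of_real C else 0))"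
    using i orth by (simp add: Bochner_Integration.integral_sum)
  also have "\<dots> = (\<Sum>m\<in>A. (a m * cnj (a m)) * of_real C)"
    using A by (simp add: if_distrib cong: if_cong)
  also have "\<dots> = complex_of_real (C * (\<Sum>n\<in>A. (norm (a n))\<^sup>2))"
    unfolding of_real_mult of_real_sum complex_norm_square sum_distrib_left by (simp add: mult.commute)
  finally show ?thesis by (simp only: of_real_eq_iff)
qed

text \<open>
  Convergence in mean square of continuous functions to a chosen representative of the limit.
\<close>

definition l2lim :: "(nat \<Rightarrow> real \<Rightarrow> complex) \<Rightarrow> (real \<Rightarrow> complex) \<Rightarrow> bool" where
  "l2lim S g \<longleftrightarrow> (\<forall>N. continuous_on {0..pi} (S N)) \<and> L2c g \<and> (\<lambda>N. l2sq (\<lambda>x. g x - S N x)) \<longlonglongrightarrow> 0"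

lemma l2lim_L1:
  assumes "l2lim S g"
  shows "(\<lambda>N. l1norm (\<lambda>x. g x - S N x)) \<longlonglongrightarrow> 0"
proof -
  have "(\<lambda>N. sqrt (pi * l2sq (\<lambda>x. g x - S N x))) \<longlonglongrightarrow> sqrt (pi * 0)"
    using assms unfolding l2lim_def by (intro tendsto_intros) auto
  then have lim: "(\<lambda>N. sqrt (pi * l2sq (\<lambda>x. g x - S N x))) \<longlonglongrightarrow> 0" by simp
  have "norm (l1norm (\<lambda>x. g x - S N x)) \<le> sqrt (pi * l2sq (\<lambda>x. g x - S N x))" for N
  proof -
    have "L2c g" "L2c (S N)" using assms L2c_continuous unfolding l2lim_def by blast+
    then have "L2c (\<lambda>x. g x - S N x)" by (rule L2c_diff)
    then show ?thesis using l1_le_sqrt_l2 l1norm_nonneg by simp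
  qed
  then show ?thesis by (intro Lim_null_comparison[OF _ lim] always_eventually allI)
qed

lemma LIMSEQ_by_bound:
  fixes X :: "nat \<Rightarrow> complex"
  assumes "\<And>N. norm (X N - Y) \<le> Z N" "Z \<longlonglongrightarrow> 0"
  shows "X \<longlonglongrightarrow> Y"
proof -
  have "(\<lambda>N. X N - Y) \<longlonglongrightarrow> 0"
    by (rule Lim_null_comparison[OF _ assms(2)]) (simp add: assms(1))
  then show ?thesis by (rule LIM_zero_cancel)
qed

text \<open>
  Mean square convergence implies convergence of integrals over every initial interval, against any
  continuous weight.
\<close>

lemma l2lim_integral:
  assumes S: "l2lim S g" and w: "continuous_on {0..pi} w" and x: "x \<in> {0..pi}"
  shows "(\<lambda>N. LINT t|lebesgue_on {0..x}. S N t * w t) \<longlonglongrightarrow> (LINT t|lebesgue_on {0..x}. g t * w t)"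
proof -
  have "bounded (w ` {0..pi})" by (intro compact_imp_bounded compact_continuous_image w) auto
  then obtain B where B: "B > 0" "\<And>t. t \<in> {0..pi} \<Longrightarrow> norm (w t) \<le> B" unfolding bounded_pos by blast
  have g: "integrable (lebesgue_on {0..pi}) g" using S by (auto simp: l2lim_def intro: L2c_integrable)
  have iS: "integrable (lebesgue_on {0..pi}) (S N)" for N
    using S by (auto simp: l2lim_def intro: continuous_imp_integrable_real)
  have wx: "continuous_on {0..x} w" using continuous_on_subset[OF w] x by auto
  have "norm ((LINT t|lebesgue_on {0..x}. S N t * w t) - (LINT t|lebesgue_on {0..x}. g t * w t)) \<le> B * l1norm (\<lambda>x. g x - S N x)" for N
  proof -
    have i: "integrable (lebesgue_on {0..x}) (\<lambda>t. S N t * w t)" "integrable (lebesgue_on {0..x}) (\<lambda>t. g t * w t)"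
      by (intro integrable_mult_cont integrable_sub[OF _ x] g iS wx)+
    have "(LINT t|lebesgue_on {0..x}. S N t * w t) - (LINT t|lebesgue_on {0..x}. g t * w t) = (LINT t|lebesgue_on {0..x}. S N t * w t - g t * w t)"
      using i by simp
    also have "norm \<dots> \<le> B * l1norm (\<lambda>x. g x - S N x)"
    proof (rule norm_lint_le_l1norm[OF _ _ _ x])
      show "integrable (lebesgue_on {0..pi}) (\<lambda>x. g x - S N x)" using g iS by simp
      show "integrable (lebesgue_on {0..x}) (\<lambda>t. S N t * w t - g t * w t)" using i by simp
      fix t assume "t \<in> {0..x}"
      then have "norm (w t) \<le> B" using B x by auto
      then have "norm (g t - S N t) * norm (w t) \<le> norm (g t - S N t) * B" by (rule mult_left_mono) simp
      then show "norm (S N t * w t - g t * w t) \<le> B * norm (g t - S N t)"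
        unfolding left_diff_distrib[symmetric] norm_mult norm_minus_commute[of "S N t"] by (simp add: mult.commute)
    qed (use B in simp)
    finally show ?thesis .
  qed
  moreover have "(\<lambda>N. B * l1norm (\<lambda>x. g x - S N x)) \<longlonglongrightarrow> B * 0"
    by (intro tendsto_intros l2lim_L1 S)
  then have "(\<lambda>N. B * l1norm (\<lambda>x. g x - S N x)) \<longlonglongrightarrow> 0" by simp
  ultimately show ?thesis by (rule LIMSEQ_by_bound)
qed

lemma l1norm_zero_AE:
  assumes f: "integrable (lebesgue_on {0..pi}) f" and z: "l1norm f = 0"
  shows "AE x in lebesgue_on {0..pi}. f x = 0"
proof -
  have "integrable (lebesgue_on {0..pi}) (\<lambda>x. norm (f x))" using f by simp
  then have "AE x in lebesgue_on {0..pi}. norm (f x) = 0"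
    using z unfolding l1norm_def by (subst (asm) integral_nonneg_eq_0_iff_AE) auto
  then show ?thesis by simp
qed

lemma l2lim_unique:
  assumes g: "l2lim S g" and h: "l2lim S h"
  shows "AE x in lebesgue_on {0..pi}. g x = h x"
proof -
  have ig: "integrable (lebesgue_on {0..pi}) g" "integrable (lebesgue_on {0..pi}) h"
    using g h by (auto simp: l2lim_def intro: L2c_integrable)
  have iS: "integrable (lebesgue_on {0..pi}) (S N)" for N
    using g by (auto simp: l2lim_def intro: continuous_imp_integrable_real)
  have "l1norm (\<lambda>x. g x - h x) \<le> l1norm (\<lambda>x. g x - S N x) + l1norm (\<lambda>x. h x - S N x)" for N
  proof -
    have i: "integrable (lebesgue_on {0..pi}) (\<lambda>x. norm (g x - S N x))" "integrable (lebesgue_on {0..pi}) (\<lambda>x. norm (h x - S N x))"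
      "integrable (lebesgue_on {0..pi}) (\<lambda>x. norm (g x - h x))"
      using ig iS by auto
    have "l1norm (\<lambda>x. g x - h x) \<le> (LINT x|lebesgue_on {0..pi}. norm (g x - S N x) + norm (h x - S N x))"
      unfolding l1norm_def using i
      using norm_triangle_ineq4[of "g x - S N x" "h x - S N x" for x] by (intro integral_mono) auto
    then show ?thesis using i by (simp add: l1norm_def)
  qed
  moreover have "(\<lambda>N. l1norm (\<lambda>x. g x - S N x) + l1norm (\<lambda>x. h x - S N x)) \<longlonglongrightarrow> 0 + 0"
    by (intro tendsto_add l2lim_L1 g h)
  ultimately have "l1norm (\<lambda>x. g x - h x) \<le> 0"
    by (intro LIMSEQ_le_const[of "\<lambda>N. l1norm (\<lambda>x. g x - S N x) + l1norm (\<lambda>x. h x - S N x)"]) auto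
  then have "l1norm (\<lambda>x. g x - h x) = 0" using l1norm_nonneg by (metis antisym)
  then have "AE x in lebesgue_on {0..pi}. g x - h x = 0"
    using ig by (intro l1norm_zero_AE) auto
  then show ?thesis by simp
qed

lemma l2lim_uniform:
  assumes c: "\<And>N. continuous_on {0..pi} (S N)" and u: "uniform_limit {0..pi} S g sequentially"
  shows "l2lim S g"
proof -
  have cg: "continuous_on {0..pi} g"
    by (rule uniform_limit_theorem[OF _ u]) (auto simp: c)
  have "(\<lambda>N. l2sq (\<lambda>x. g x - S N x)) \<longlonglongrightarrow> 0"
  proof (rule LIMSEQ_I)
    fix e :: real assume e: "e > 0"
    define d where "d = sqrt (e / 4)"
    have d: "d > 0" "d\<^sup>2 = e / 4" using e by (auto simp: d_def)
    from uniform_limitD[OF u d(1)] obtain N0 where N0: "\<And>N x. N \<ge> N0 \<Longrightarrow> x \<in> {0..pi} \<Longrightarrow> dist (S N x) (g x) < d"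
      unfolding eventually_sequentially by blast
    have "norm (l2sq (\<lambda>x. g x - S N x) - 0) < e" if N: "N \<ge> N0" for N
    proof -
      have "l2sq (\<lambda>x. g x - S N x) \<le> (LINT x|lebesgue_on {0..pi}. d\<^sup>2)"
        unfolding l2sq_def
      proof (rule integral_mono)
        show "integrable (lebesgue_on {0..pi}) (\<lambda>x. (norm (g x - S N x))\<^sup>2)"
          by (intro continuous_imp_integrable_real continuous_intros cg c)
        show "(norm (g x - S N x))\<^sup>2 \<le> d\<^sup>2" if "x \<in> space (lebesgue_on {0..pi})" for x
        proof -
          have "norm (S N x - g x) < d" using N0[OF N, of x] that by (simp add: dist_norm)
          then show ?thesis by (intro power_mono) (simp_all add: norm_minus_commute[of "g x"])
        qed
      qed (rule integrable_const_pi)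
      also have "\<dots> = pi * (e / 4)" using d by (simp add: measure_restrict_space)
      also have "pi * (e / 4) < 4 * (e / 4)" using e by (intro mult_strict_right_mono pi_less_4) auto
      finally show ?thesis using l2sq_nonneg[of "\<lambda>x. g x - S N x"] by simp
    qed
    then show "\<exists>no. \<forall>n\<ge>no. norm (l2sq (\<lambda>x. g x - S n x) - 0) < e" by blast
  qed
  then show ?thesis unfolding l2lim_def using c L2c_continuous[OF cg] by blast
qed

section \<open>The Riesz-Fischer theorem and the Bessel inequality\<close>

text \<open>
  Along a subsequence the partial sums converge almost everywhere, since the \<open>L\<^sub>1\<close> norms of consecutive
  differences are dominated by a geometric series. The Fatou lemma shows that the pointwise limit is the
  limit in mean square. The limit is set to \<open>0\<close> where the subsequence diverges, which makes the second
  conclusion, on pointwise symmetries, hold without exceptional points.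
\<close>

lemma Riesz_Fischer:
  fixes \<phi> :: "nat \<Rightarrow> real \<Rightarrow> complex"
  assumes c: "\<And>n. continuous_on {0..pi} (\<phi> n)"
    and orth: "\<And>m n. (LINT x|lebesgue_on {0..pi}. \<phi> m x * cnj (\<phi> n x)) = (if m = n then of_real C else 0)"
    and C: "C \<ge> 0" and a: "summable (\<lambda>n. (norm (a n))\<^sup>2)"
  defines "S \<equiv> \<lambda>N x. \<Sum>n<N. a n * \<phi> n x"
  obtains g where "l2lim S g" "\<And>x y. (\<And>N. S N x = - S N y) \<Longrightarrow> g x = - g y"
proof -
  define M where "M = lebesgue_on {0..pi}"
  define T where "T = (\<lambda>N. (\<Sum>n. (norm (a (n + N)))\<^sup>2))"
  have T0: "T \<longlonglongrightarrow> 0" unfolding T_def using suminf_exist_split2[OF a] .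
  have cS: "continuous_on {0..pi} (S N)" for N unfolding S_def by (intro continuous_intros c)
  have dS: "l2sq (\<lambda>x. S N' x - S N x) \<le> C * T N" if "N \<le> N'" for N N'
  proof -
    have "S N' x - S N x = (\<Sum>n\<in>{N..<N'}. a n * \<phi> n x)" for x
      unfolding S_def using sum_diff_nat_ivl[of 0 N N' "\<lambda>n. a n * \<phi> n x"] that by (simp add: atLeast0LessThan)
    then have "l2sq (\<lambda>x. S N' x - S N x) = C * (\<Sum>n\<in>{N..<N'}. (norm (a n))\<^sup>2)"
      using pythagoras[OF c orth, of "{N..<N'}" a] by simp
    also have "(\<Sum>n\<in>{N..<N'}. (norm (a n))\<^sup>2) = (\<Sum>n<N' - N. (norm (a (n + N)))\<^sup>2)"
      using that by (intro sum.reindex_bij_witness[of _ "\<lambda>n. n + N" "\<lambda>n. n - N"]) auto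
    also have "\<dots> \<le> T N"
      unfolding T_def by (rule sum_le_suminf) (auto intro: summable_ignore_initial_segment[OF a])
    finally show ?thesis using C by (simp add: mult_left_mono)
  qed
  have "\<exists>N. C * T N < (1/4) ^ j" for j
  proof -
    have "(\<lambda>N. C * T N) \<longlonglongrightarrow> C * 0" by (intro tendsto_intros T0)
    then have "(\<lambda>N. C * T N) \<longlonglongrightarrow> 0" by simp
    from order_tendstoD(2)[OF this, of "(1/4) ^ j"] show ?thesis by (auto simp: eventually_sequentially)
  qed
  then obtain R where R: "\<And>j. C * T (R j) < (1/4) ^ j" by metis
  (* Increasing indices along which C times the tail is at most 4 to the power -j. *)
  define r where "r = (\<lambda>j. \<Sum>i\<le>j. R i + 1)"
  have rR: "R j \<le> r j" for j
    unfolding r_def using member_le_sum[of j "{..j}" "\<lambda>i. R i + 1"] by simp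
  have rmono: "r j \<le> r (Suc j)" for j unfolding r_def by simp
  have rge: "j \<le> r j" for j
  proof (induction j)
    case (Suc j)
    then show ?case unfolding r_def by simp
  qed simp
  have Tanti: "T N' \<le> T N" if "N \<le> N'" for N N'
  proof -
    have s: "summable (\<lambda>n. (norm (a (n + N)))\<^sup>2)" using a by (rule summable_ignore_initial_segment)
    have "T N = (\<Sum>n. (norm (a (n + (N' - N) + N)))\<^sup>2) + (\<Sum>n<N' - N. (norm (a (n + N)))\<^sup>2)"
      unfolding T_def by (rule suminf_split_initial_segment[OF s])
    moreover have "(\<lambda>n. (norm (a (n + (N' - N) + N)))\<^sup>2) = (\<lambda>n. (norm (a (n + N')))\<^sup>2)"
      using that by (simp add: add.assoc)
    moreover have "(\<Sum>n<N' - N. (norm (a (n + N)))\<^sup>2) \<ge> 0" by (intro sum_nonneg) auto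
    ultimately show ?thesis unfolding T_def by simp
  qed
  define D where "D = (\<lambda>j x. S (r (Suc j)) x - S (r j) x)"
  have cD: "continuous_on {0..pi} (D j)" for j unfolding D_def by (intro continuous_intros cS)
  have l1D: "l1norm (D j) \<le> 2 * (1/2) ^ j" for j
  proof -
    have "l2sq (D j) \<le> C * T (r j)" unfolding D_def by (rule dS[OF rmono])
    also have "C * T (r j) \<le> C * T (R j)" using Tanti[OF rR] C by (intro mult_left_mono) auto
    also have "C * T (R j) \<le> (1/4) ^ j" using R[of j] by simp
    finally have "pi * l2sq (D j) \<le> pi * (1/4) ^ j" by (intro mult_left_mono) auto
    also have "pi * (1/4) ^ j \<le> 4 * (1/4) ^ j" using pi_less_4 by (intro mult_right_mono) auto
    finally have "(l1norm (D j))\<^sup>2 \<le> 4 * (1/4) ^ j"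
      using l1_le_l2[OF L2c_continuous[OF cD[of j]]] by linarith
    also have "\<dots> = (2 * (1/2) ^ j)\<^sup>2"
    proof -
      have "((1/2) ^ j * (1/2) ^ j :: real) = (1/4) ^ j" unfolding power_mult_distrib[symmetric] by simp
      then show ?thesis by (simp add: power2_eq_square)
    qed
    finally have "(l1norm (D j))\<^sup>2 \<le> (2 * (1/2) ^ j)\<^sup>2" .
    then show ?thesis by (rule power2_le_imp_le) simp
  qed
  have Dm: "(\<lambda>x. norm (D j x)) \<in> borel_measurable M" for j
    unfolding M_def by (intro continuous_imp_measurable_on_sets_lebesgue continuous_intros cD) auto
  have Di: "integrable M (\<lambda>x. norm (D j x))" for j
    unfolding M_def by (intro continuous_imp_integrable_real continuous_intros cD)
  have "(\<integral>\<^sup>+x. (\<Sum>j. ennreal (norm (D j x))) \<partial>M) = (\<Sum>j. \<integral>\<^sup>+x. ennreal (norm (D j x)) \<partial>M)"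
    using Dm by (intro nn_integral_suminf) auto
  also have "\<dots> \<le> (\<Sum>j. ennreal (2 * (1/2) ^ j))"
  proof (intro suminf_le summableI)
    show "(\<integral>\<^sup>+x. ennreal (norm (D j x)) \<partial>M) \<le> ennreal (2 * (1/2) ^ j)" for j
      using l1D[of j] Di[of j] by (subst nn_integral_eq_integral) (auto simp: l1norm_def M_def ennreal_leI)
  qed
  also have "\<dots> = ennreal (\<Sum>j. 2 * (1/2) ^ j)"
    by (intro suminf_ennreal2 summable_mult summable_geometric) auto
  also have "\<dots> < \<infinity>" by simp
  finally have fin: "(\<integral>\<^sup>+x. (\<Sum>j. ennreal (norm (D j x))) \<partial>M) \<noteq> \<infinity>" by simp
  have "AE x in M. (\<Sum>j. ennreal (norm (D j x))) \<noteq> \<infinity>"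
    using Dm fin by (intro nn_integral_PInf_AE) auto
  then have AEs: "AE x in M. summable (\<lambda>j. D j x)"
  proof eventually_elim
    case (elim x)
    then have "summable (\<lambda>j. norm (D j x))" by (intro summable_suminf_not_top) (auto simp: top.not_eq_extremum)
    then show ?case by (rule summable_norm_cancel)
  qed
  have tel: "S (r j) x = S (r 0) x + (\<Sum>i<j. D i x)" for j x
    by (induction j) (simp_all add: D_def)
  define g where "g = (\<lambda>x. if convergent (\<lambda>j. S (r j) x) then lim (\<lambda>j. S (r j) x) else 0)"
  have AEg: "AE x in M. (\<lambda>j. S (r j) x) \<longlonglongrightarrow> g x"
    using AEs
  proof eventually_elim
    case (elim x)
    have "(\<lambda>j. S (r 0) x + (\<Sum>i<j. D i x)) \<longlonglongrightarrow> S (r 0) x + (\<Sum>i. D i x)"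
      using summable_LIMSEQ[OF elim] by (intro tendsto_intros)
    then have "convergent (\<lambda>j. S (r j) x)" unfolding tel[symmetric] by (auto simp: convergent_def)
    then show ?case unfolding g_def by (simp add: convergent_LIMSEQ_iff)
  qed
  have Sm [measurable]: "S N \<in> borel_measurable M" for N
    unfolding M_def by (intro continuous_imp_measurable_on_sets_lebesgue cS) auto
  have gm: "g \<in> borel_measurable M"
    unfolding g_def Cauchy_convergent_iff[symmetric] by measurable
  have odd: "g x = - g y" if xy: "\<And>N. S N x = - S N y" for x y
  proof -
    have "(\<lambda>j. S (r j) x) = (\<lambda>j. - S (r j) y)" using xy by simp
    moreover have "convergent (\<lambda>j. - S (r j) y) \<longleftrightarrow> convergent (\<lambda>j. S (r j) y)" by (simp add: convergent_minus_iff[symmetric])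
    moreover have "lim (\<lambda>j. - S (r j) y) = - lim (\<lambda>j. S (r j) y)" if "convergent (\<lambda>j. S (r j) y)"
      using that by (intro limI tendsto_minus) (simp add: convergent_LIMSEQ_iff)
    ultimately show ?thesis unfolding g_def by auto
  qed
  have fatou: "(\<integral>\<^sup>+x. ennreal ((norm (g x - S N x))\<^sup>2) \<partial>M) \<le> ennreal (C * T N)" for N
  proof -
    have "AE x in M. liminf (\<lambda>j. ennreal ((norm (S (r j) x - S N x))\<^sup>2)) = ennreal ((norm (g x - S N x))\<^sup>2)"
      using AEg
    proof eventually_elim
      case (elim x)
      then have "(\<lambda>j. ennreal ((norm (S (r j) x - S N x))\<^sup>2)) \<longlonglongrightarrow> ennreal ((norm (g x - S N x))\<^sup>2)"
        by (intro tendsto_ennrealI tendsto_intros)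
      then show ?case by (intro lim_imp_Liminf) auto
    qed
    then have "(\<integral>\<^sup>+x. ennreal ((norm (g x - S N x))\<^sup>2) \<partial>M) = (\<integral>\<^sup>+x. liminf (\<lambda>j. ennreal ((norm (S (r j) x - S N x))\<^sup>2)) \<partial>M)"
      by (intro nn_integral_cong_AE) (auto elim!: eventually_mono)
    also have "\<dots> \<le> liminf (\<lambda>j. \<integral>\<^sup>+x. ennreal ((norm (S (r j) x - S N x))\<^sup>2) \<partial>M)"
      by (intro nn_integral_liminf) measurable
    also have "\<dots> \<le> liminf (\<lambda>j. ennreal (C * T N))"
    proof (intro Liminf_mono, unfold eventually_sequentially, intro exI[of _ N] allI impI)
      fix j assume "N \<le> j"
      then have "N \<le> r j" using rge[of j] by simp
      have "integrable M (\<lambda>x. (norm (S (r j) x - S N x))\<^sup>2)"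
        unfolding M_def by (intro continuous_imp_integrable_real continuous_intros cS)
      then have "(\<integral>\<^sup>+x. ennreal ((norm (S (r j) x - S N x))\<^sup>2) \<partial>M) = ennreal (l2sq (\<lambda>x. S (r j) x - S N x))"
        unfolding l2sq_def M_def by (intro nn_integral_eq_integral) auto
      also have "\<dots> \<le> ennreal (C * T N)" using dS[OF \<open>N \<le> r j\<close>] by (rule ennreal_leI)
      finally show "(\<integral>\<^sup>+x. ennreal ((norm (S (r j) x - S N x))\<^sup>2) \<partial>M) \<le> ennreal (C * T N)" .
    qed
    also have "\<dots> = ennreal (C * T N)" by (simp add: Liminf_const)
    finally show ?thesis .
  qed
  have Tn: "T N \<ge> 0" for N unfolding T_def by (intro suminf_nonneg) (auto intro: summable_ignore_initial_segment[OF a])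
  have int: "integrable M (\<lambda>x. (norm (g x - S N x))\<^sup>2)" for N
  proof (rule integrableI_bounded)
    show "(\<lambda>x. (norm (g x - S N x))\<^sup>2) \<in> borel_measurable M" using gm by measurable
    have "(\<integral>\<^sup>+x. ennreal (norm ((norm (g x - S N x))\<^sup>2)) \<partial>M) = (\<integral>\<^sup>+x. ennreal ((norm (g x - S N x))\<^sup>2) \<partial>M)" by simp
    also have "\<dots> < \<infinity>" using fatou[of N] by (rule order.strict_trans1) simp
    finally show "(\<integral>\<^sup>+x. ennreal (norm ((norm (g x - S N x))\<^sup>2)) \<partial>M) < \<infinity>" .
  qed
  have l2: "l2sq (\<lambda>x. g x - S N x) \<le> C * T N" for N
  proof -
    have "ennreal (l2sq (\<lambda>x. g x - S N x)) \<le> ennreal (C * T N)"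
      using fatou[of N] nn_integral_eq_integral[OF int[of N]] by (simp add: l2sq_def M_def)
    then show ?thesis using C Tn[of N] by (simp add: ennreal_le_iff)
  qed
  have "L2c g" unfolding L2c_def using gm int[of 0] by (simp add: M_def S_def)
  moreover have "(\<lambda>N. l2sq (\<lambda>x. g x - S N x)) \<longlonglongrightarrow> 0"
  proof (rule Lim_null_comparison)
    show "eventually (\<lambda>N. norm (l2sq (\<lambda>x. g x - S N x)) \<le> C * T N) sequentially"
      using l2 l2sq_nonneg by simp
    have "(\<lambda>N. C * T N) \<longlonglongrightarrow> C * 0" by (intro tendsto_intros T0)
    then show "(\<lambda>N. C * T N) \<longlonglongrightarrow> 0" by simp
  qed
  ultimately have "l2lim S g" unfolding l2lim_def using cS by blast
  then show ?thesis using odd by (rule that)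
qed

text \<open>
  The coefficients are square summable by the Bessel inequality, hence tend to \<open>0\<close>.
\<close>

lemma Bessel:
  fixes \<phi> :: "nat \<Rightarrow> real \<Rightarrow> complex"
  assumes f: "L2c f" and c: "\<And>n. continuous_on {0..pi} (\<phi> n)"
    and orth: "\<And>m n. (LINT x|lebesgue_on {0..pi}. \<phi> m x * cnj (\<phi> n x)) = (if m = n then of_real C else 0)"
    and C: "C > 0"
  shows "(\<lambda>n. LINT x|lebesgue_on {0..pi}. f x * cnj (\<phi> n x)) \<longlonglongrightarrow> 0"
proof -
  define b where "b = (\<lambda>n. LINT x|lebesgue_on {0..pi}. f x * cnj (\<phi> n x))"
  have fi: "integrable (lebesgue_on {0..pi}) f" by (rule L2c_integrable[OF f])
  have f2: "integrable (lebesgue_on {0..pi}) (\<lambda>x. complex_of_real ((norm (f x))\<^sup>2))"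
    by (intro integrable_of_real) (use f in \<open>simp add: L2c_def\<close>)
  have ic: "integrable (lebesgue_on {0..pi}) (\<lambda>x. f x * cnj (\<phi> n x))" for n
    by (intro integrable_mult_cont fi continuous_intros c)
  have le: "(\<Sum>n<N. (norm (b n))\<^sup>2) \<le> C * l2sq f" for N
  proof -
    define S where "S = (\<lambda>x. \<Sum>n<N. (b n / of_real C) * \<phi> n x)"
    define Sig where "Sig = (\<Sum>n<N. (norm (b n))\<^sup>2)"
    have cS: "continuous_on {0..pi} S" unfolding S_def by (intro continuous_intros c)
    have S2: "l2sq S = Sig / C"
      unfolding S_def pythagoras[OF c orth finite_lessThan] Sig_def using C
      by (simp add: norm_divide power_divide sum_distrib_left sum_divide_distrib power2_eq_square)
    have cross: "(LINT x|lebesgue_on {0..pi}. f x * cnj (S x)) = of_real (Sig / C)"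
    proof -
      have "(LINT x|lebesgue_on {0..pi}. f x * cnj (S x)) = (LINT x|lebesgue_on {0..pi}. (\<Sum>n<N. cnj (b n / of_real C) * (f x * cnj (\<phi> n x))))"
        unfolding S_def cnj_sum sum_distrib_left complex_cnj_mult by (simp add: mult_ac)
      also have "\<dots> = (\<Sum>n<N. cnj (b n / of_real C) * b n)"
        unfolding b_def using ic by (subst Bochner_Integration.integral_sum) auto
      also have "\<dots> = of_real (Sig / C)"
        unfolding Sig_def of_real_divide of_real_sum complex_norm_square by (simp add: sum_divide_distrib mult.commute)
      finally show ?thesis .
    qed
    have iS: "integrable (lebesgue_on {0..pi}) (\<lambda>x. f x * cnj (S x))"
      by (intro integrable_mult_cont fi continuous_intros cS)
    have iS': "integrable (lebesgue_on {0..pi}) (\<lambda>x. cnj (f x * cnj (S x)))"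
      by (rule integrable_bounded_linear[OF bounded_linear_cnj iS])
    have S3: "integrable (lebesgue_on {0..pi}) (\<lambda>x. complex_of_real ((norm (S x))\<^sup>2))"
      by (intro continuous_imp_integrable_real continuous_intros cS)
    have "complex_of_real (l2sq (\<lambda>x. f x - S x)) = (LINT x|lebesgue_on {0..pi}. complex_of_real ((norm (f x - S x))\<^sup>2))"
      unfolding l2sq_def by (rule integral_complex_of_real[symmetric])
    also have "\<dots> = (LINT x|lebesgue_on {0..pi}. complex_of_real ((norm (f x))\<^sup>2) - f x * cnj (S x) - cnj (f x * cnj (S x)) + complex_of_real ((norm (S x))\<^sup>2))"
      unfolding complex_norm_square by (intro Bochner_Integration.integral_cong refl) (simp add: algebra_simps)
    also have "\<dots> = of_real (l2sq f) - of_real (Sig / C) - cnj (of_real (Sig / C)) + of_real (l2sq S)"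
      unfolding Bochner_Integration.integral_add[OF Bochner_Integration.integrable_diff[OF Bochner_Integration.integrable_diff[OF f2 iS] iS'] S3]
        Bochner_Integration.integral_diff[OF Bochner_Integration.integrable_diff[OF f2 iS] iS'] Bochner_Integration.integral_diff[OF f2 iS]
        integral_bounded_linear[OF bounded_linear_cnj iS] cross
      unfolding l2sq_def by (simp only: integral_complex_of_real)
    also have "\<dots> = of_real (l2sq f - Sig / C)" by (simp add: S2)
    finally have "l2sq (\<lambda>x. f x - S x) = l2sq f - Sig / C" by (simp only: of_real_eq_iff)
    then have "Sig / C \<le> l2sq f" using l2sq_nonneg[of "\<lambda>x. f x - S x"] by simp
    then show ?thesis using C by (simp add: Sig_def field_simps)
  qed
  have "summable (\<lambda>n. (norm (b n))\<^sup>2)"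
    by (rule summableI_nonneg_bounded[OF _ le]) simp
  then have "(\<lambda>n. (norm (b n))\<^sup>2) \<longlonglongrightarrow> 0" by (rule summable_LIMSEQ_zero)
  then have "(\<lambda>n. sqrt ((norm (b n))\<^sup>2)) \<longlonglongrightarrow> sqrt 0" by (rule tendsto_real_sqrt)
  then have "(\<lambda>n. norm (b n)) \<longlonglongrightarrow> 0" by simp
  then show ?thesis unfolding b_def by (rule tendsto_norm_zero_cancel)
qed

section \<open>Potentials odd about the midpoint\<close>

lemma lint_reflect:
  fixes h :: "real \<Rightarrow> complex"
  shows "(LINT s|lebesgue_on {a..b}. h s) = (LINT s|lebesgue_on {c - b..c - a}. h (c - s))"
proof -
  have "(LINT s|lebesgue_on {a..b}. h s) = (LINT s|lebesgue. indicator {a..b} s *\<^sub>R h s)"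
    by (rule integral_restrict_space) auto
  also have "\<dots> = \<bar>- 1\<bar> *\<^sub>R (LINT s|lebesgue. indicator {a..b} (c + (- 1) * s) *\<^sub>R h (c + (- 1) * s))"
    by (rule lebesgue_integral_real_affine) simp
  also have "\<dots> = (LINT s|lebesgue. indicator {c - b..c - a} s *\<^sub>R h (c - s))"
  proof -
    have "indicator {a..b} (c + (- 1) * s) = (indicator {c - b..c - a} s :: real)" for s
      by (auto simp: indicator_def)
    then show ?thesis by simp
  qed
  also have "\<dots> = (LINT s|lebesgue_on {c - b..c - a}. h (c - s))"
    by (rule integral_restrict_space[symmetric]) auto
  finally show ?thesis .
qed

lemma lint_reflect_pi:
  fixes h :: "real \<Rightarrow> complex"
  shows "(LINT s|lebesgue_on {0..pi}. h s) = (LINT s|lebesgue_on {0..pi}. h (pi - s))"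
  using lint_reflect[of 0 pi h pi] by simp

text \<open>
  Oddness about the midpoint is required at every point of the interval, which suits the representatives
  provided by \<open>Riesz_Fischer\<close>.
\<close>

definition odd_pi :: "(real \<Rightarrow> complex) \<Rightarrow> bool" where
  "odd_pi p \<longleftrightarrow> (\<forall>t\<in>{0..pi}. p (pi - t) = - p t)"

lemma lint_odd_even:
  assumes p: "odd_pi p" and e: "\<And>t. t \<in> {0..pi} \<Longrightarrow> w (pi - t) = w t"
  shows "(LINT t|lebesgue_on {0..pi}. p t * w t) = 0"
proof -
  have "(LINT t|lebesgue_on {0..pi}. p t * w t) = (LINT t|lebesgue_on {0..pi}. p (pi - t) * w (pi - t))"
    by (rule lint_reflect_pi)
  also have "\<dots> = (LINT t|lebesgue_on {0..pi}. - (p t * w t))"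
    using p e unfolding odd_pi_def by (intro Bochner_Integration.integral_cong) auto
  also have "\<dots> = - (LINT t|lebesgue_on {0..pi}. p t * w t)" by simp
  finally show ?thesis by simp
qed

text \<open>
  For \<open>p\<close> odd about \<open>\<pi>/2\<close> the primitive \<open>Q\<close> that vanishes at \<open>0\<close> also vanishes at \<open>\<pi>\<close> and is even about
  \<open>\<pi>/2\<close>. Integration by parts reduces the second Born term to the integral of
  \<open>p Q exp (\<i> \<mu> (\<pi> - 2 t))\<close>, and \<open>p Q\<close> is odd about \<open>\<pi>/2\<close>. So this integral changes sign with \<open>\<mu>\<close>, as does
  the factor \<open>1 / (\<i> \<mu>)\<close>.
\<close>

lemma second_term_cancels:
  assumes p: "integrable (lebesgue_on {0..pi}) p" and odd: "odd_pi p" and m: "\<mu> \<noteq> 0" and P: "P 0 = p"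
  shows "exp (\<i> * \<mu> * of_real pi) * born_term P \<mu> 0 [0] = exp (- \<i> * \<mu> * of_real pi) * born_term P (- \<mu>) 0 [0]"
proof -
  define Q where "Q = (\<lambda>x. 0 + (LINT t|lebesgue_on {0..x}. p t))"
  have Qp: "primitive_of Q p" unfolding Q_def by (rule primitive_of_lint[OF p])
  have cQ: "continuous_on {0..pi} Q" by (rule primitive_of_continuous[OF Qp])
  have pie: "pi \<in> {0..pi}" by simp
  have Q0: "Q 0 = 0" unfolding Q_def using lint_point[of p] by simp
  have Qpi: "Q pi = 0" using lint_odd_even[OF odd, of "\<lambda>_. 1"] by (simp add: Q_def)
  (* The integral of p over the whole interval is 0, so the two ends can be exchanged. *)
  have Qeven: "Q (pi - x) = Q x" if x: "x \<in> {0..pi}" for x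
  proof -
    have "Q pi = Q (pi - x) + (LINT t|lebesgue_on {pi - x..pi}. p t)"
      unfolding Q_def using Equivalence_Measurable_On_Borel.integral_combine[OF p, of "pi - x"] x by auto
    also have "(LINT t|lebesgue_on {pi - x..pi}. p t) = (LINT t|lebesgue_on {0..x}. p (pi - t))"
      using lint_reflect[of "pi - x" pi p pi] by simp
    also have "\<dots> = (LINT t|lebesgue_on {0..x}. - p t)"
      using odd x unfolding odd_pi_def by (intro Bochner_Integration.integral_cong) auto
    also have "\<dots> = - Q x" by (simp add: Q_def)
    finally show ?thesis using Qpi by simp
  qed
  define J where "J = (\<lambda>\<mu>. LINT t|lebesgue_on {0..pi}. p t * (Q t * exp (\<i> * \<mu> * of_real (pi - 2 * t))))"
  have Jodd: "J (- \<mu>) = - J \<mu>" for \<mu>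
  proof -
    have "J \<mu> = (LINT t|lebesgue_on {0..pi}. p (pi - t) * (Q (pi - t) * exp (\<i> * \<mu> * of_real (pi - 2 * (pi - t)))))"
      unfolding J_def by (rule lint_reflect_pi)
    also have "\<dots> = (LINT t|lebesgue_on {0..pi}. - (p t * (Q t * exp (\<i> * (- \<mu>) * of_real (pi - 2 * t)))))"
    proof (rule Bochner_Integration.integral_cong[OF refl])
      fix t assume "t \<in> space (lebesgue_on {0..pi})"
      then have t: "t \<in> {0..pi}" by simp
      have "\<i> * \<mu> * complex_of_real (pi - 2 * (pi - t)) = \<i> * (- \<mu>) * complex_of_real (pi - 2 * t)"
        by (simp add: algebra_simps)
      then show "p (pi - t) * (Q (pi - t) * exp (\<i> * \<mu> * of_real (pi - 2 * (pi - t)))) = - (p t * (Q t * exp (\<i> * (- \<mu>) * of_real (pi - 2 * t))))"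
        using odd t Qeven[OF t] unfolding odd_pi_def by simp
    qed
    also have "\<dots> = - J (- \<mu>)" unfolding J_def by (rule integral_minus)
    finally show ?thesis by simp
  qed
  have key: "exp (\<i> * \<mu> * of_real pi) * born_term P \<mu> 0 [0] = - (J \<mu>) / (\<i> * \<mu>)" if m: "\<mu> \<noteq> 0" for \<mu>
  proof -
    define e where "e = (\<lambda>t. exp (- 2 * \<i> * \<mu> * complex_of_real t))"
    have ce: "continuous_on S e" for S unfolding e_def by (intro continuous_intros)
    define A where "A = (\<lambda>x. 0 + (LINT t|lebesgue_on {0..x}. p t * e t))"
    have pe: "integrable (lebesgue_on {0..pi}) (\<lambda>t. p t * e t)" by (intro integrable_mult_cont p ce)
    have Ap: "primitive_of A (\<lambda>t. p t * e t)" unfolding A_def by (rule primitive_of_lint[OF pe])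
    have cA: "continuous_on {0..pi} A" by (rule primitive_of_continuous[OF Ap])
    have i1: "integrable (lebesgue_on {0..pi}) (\<lambda>t. p t * A t)" by (intro integrable_mult_cont p cA)
    have i2: "integrable (lebesgue_on {0..pi}) (\<lambda>t. p t * (Q t * e t))" by (intro integrable_mult_cont p continuous_on_mult cQ ce)
    have "Q pi * A pi = Q 0 * A 0 + (LINT t|lebesgue_on {0..pi}. p t * A t + Q t * (p t * e t))"
      using primitive_ofD[OF primitive_of_mult[OF Qp Ap] pie] .
    then have "(LINT t|lebesgue_on {0..pi}. p t * A t + p t * (Q t * e t)) = 0"
      by (simp add: Qpi Q0 mult.left_commute)
    then have pA: "(LINT t|lebesgue_on {0..pi}. p t * A t) = - (LINT t|lebesgue_on {0..pi}. p t * (Q t * e t))"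
      unfolding Bochner_Integration.integral_add[OF i1 i2] by (simp add: add_eq_0_iff2)
    have "born_term P \<mu> 0 [0] = (LINT t|lebesgue_on {0..pi}. (p t * A t - p t * (Q t * e t)) / (2 * \<i> * \<mu>))"
      unfolding born_term_def P
    proof (rule Bochner_Integration.integral_cong[OF refl])
      fix t assume "t \<in> space (lebesgue_on {0..pi})"
      then have t: "t \<in> {0..pi}" by simp
      have ee: "e t * exp (2 * \<i> * \<mu> * of_real t) = 1" unfolding e_def exp_add[symmetric] by simp
      have "born P \<mu> [0] t = (exp (2 * \<i> * \<mu> * of_real t) * A t - Q t) / (2 * \<i> * \<mu>)"
        using duhamel_split[OF p t, of \<mu>] by (simp add: P A_def Q_def e_def)
      then have "e t * born P \<mu> [0] t = ((e t * exp (2 * \<i> * \<mu> * of_real t)) * A t - Q t * e t) / (2 * \<i> * \<mu>)"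
        by (simp add: algebra_simps)
      then have eb: "e t * born P \<mu> [0] t = (A t - Q t * e t) / (2 * \<i> * \<mu>)" unfolding ee by simp
      have "p t * (e t * born P \<mu> [0] t) = (p t * A t - p t * (Q t * e t)) / (2 * \<i> * \<mu>)"
        unfolding eb by (simp add: algebra_simps)
      then show "p t * (exp (- 2 * \<i> * \<mu> * of_real t) * born P \<mu> [0] t) = (p t * A t - p t * (Q t * e t)) / (2 * \<i> * \<mu>)"
        by (simp only: e_def)
    qed
    also have "\<dots> = ((LINT t|lebesgue_on {0..pi}. p t * A t) - (LINT t|lebesgue_on {0..pi}. p t * (Q t * e t))) / (2 * \<i> * \<mu>)"
      unfolding integral_divide_zero Bochner_Integration.integral_diff[OF i1 i2] ..
    also have "\<dots> = - (LINT t|lebesgue_on {0..pi}. p t * (Q t * e t)) / (\<i> * \<mu>)"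
      unfolding pA using m by (simp add: field_simps)
    finally have "exp (\<i> * \<mu> * of_real pi) * born_term P \<mu> 0 [0] = - (exp (\<i> * \<mu> * of_real pi) * (LINT t|lebesgue_on {0..pi}. p t * (Q t * e t))) / (\<i> * \<mu>)"
      by simp
    also have "exp (\<i> * \<mu> * of_real pi) * (LINT t|lebesgue_on {0..pi}. p t * (Q t * e t)) = J \<mu>"
      unfolding J_def integral_mult_right_zero[symmetric]
    proof (rule Bochner_Integration.integral_cong[OF refl])
      fix t
      have "exp (\<i> * \<mu> * of_real pi) * e t = exp (\<i> * \<mu> * of_real (pi - 2 * t))"
        unfolding e_def exp_add[symmetric] by (simp add: algebra_simps)
      then show "exp (\<i> * \<mu> * of_real pi) * (p t * (Q t * e t)) = p t * (Q t * exp (\<i> * \<mu> * of_real (pi - 2 * t)))"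
        by (metis mult.left_commute)
    qed
    finally show ?thesis .
  qed
  have "exp (\<i> * (- \<mu>) * of_real pi) * born_term P (- \<mu>) 0 [0] = - (J (- \<mu>)) / (\<i> * (- \<mu>))"
    by (rule key) (use m in simp)
  then show ?thesis using key[OF m] by (simp add: Jodd)
qed

definition linear_part :: "(real \<Rightarrow> complex) \<Rightarrow> complex \<Rightarrow> complex" where
  "linear_part p \<mu> = (LINT t|lebesgue_on {0..pi}. p t * sin (\<mu> * of_real (pi - 2 * t)))"

definition remainder :: "(real \<Rightarrow> complex) \<Rightarrow> complex \<Rightarrow> complex" where
  "remainder p \<mu> = (exp (\<i> * \<mu> * of_real pi) * scattering3 p \<mu> - exp (- \<i> * \<mu> * of_real pi) * scattering3 p (- \<mu>)) / (2 * \<i>)"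

definition fourier :: "(real \<Rightarrow> complex) \<Rightarrow> complex \<Rightarrow> complex" where
  "fourier p \<mu> = (LINT t|lebesgue_on {0..pi}. p t * exp (- 2 * \<i> * \<mu> * of_real t))"

lemma fourier_centred:
  "exp (\<i> * \<mu> * of_real pi) * fourier p \<mu> = (LINT t|lebesgue_on {0..pi}. p t * exp (\<i> * \<mu> * of_real (pi - 2 * t)))"
  unfolding fourier_def integral_mult_right_zero[symmetric]
proof (rule Bochner_Integration.integral_cong[OF refl])
  fix t
  have "exp (\<i> * \<mu> * of_real pi) * exp (- 2 * \<i> * \<mu> * of_real t) = exp (\<i> * \<mu> * of_real (pi - 2 * t))"
    unfolding exp_add[symmetric] by (simp add: algebra_simps)
  then show "exp (\<i> * \<mu> * of_real pi) * (p t * exp (- 2 * \<i> * \<mu> * of_real t)) = p t * exp (\<i> * \<mu> * of_real (pi - 2 * t))"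
    by (metis mult.left_commute)
qed

lemma linear_part_fourier:
  assumes p: "integrable (lebesgue_on {0..pi}) p"
  shows "2 * \<i> * linear_part p \<mu> = exp (\<i> * \<mu> * of_real pi) * fourier p \<mu> - exp (- \<i> * \<mu> * of_real pi) * fourier p (- \<mu>)"
proof -
  have i: "integrable (lebesgue_on {0..pi}) (\<lambda>t. p t * exp (\<i> * \<mu> * of_real (pi - 2 * t)))" for \<mu>
    by (intro integrable_mult_cont p continuous_intros)
  have "2 * \<i> * linear_part p \<mu> = (LINT t|lebesgue_on {0..pi}. p t * exp (\<i> * \<mu> * of_real (pi - 2 * t)) - p t * exp (\<i> * (- \<mu>) * of_real (pi - 2 * t)))"
    unfolding linear_part_def integral_mult_right_zero[symmetric]
  proof (rule Bochner_Integration.integral_cong[OF refl])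
    fix t
    have "2 * \<i> * sin z = exp (\<i> * z) - exp (- (\<i> * z))" for z :: complex by (simp add: sin_exp_eq)
    from arg_cong[OF this, of "\<lambda>w. p t * w" "\<mu> * of_real (pi - 2 * t)"]
    show "2 * \<i> * (p t * sin (\<mu> * of_real (pi - 2 * t))) = p t * exp (\<i> * \<mu> * of_real (pi - 2 * t)) - p t * exp (\<i> * (- \<mu>) * of_real (pi - 2 * t))"
      by (simp add: mult.assoc mult.left_commute right_diff_distrib del: of_real_diff)
  qed
  also have "\<dots> = exp (\<i> * \<mu> * of_real pi) * fourier p \<mu> - exp (\<i> * (- \<mu>) * of_real pi) * fourier p (- \<mu>)"
    unfolding fourier_centred by (rule Bochner_Integration.integral_diff[OF i i])
  finally show ?thesis by simp
qed

text \<open>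
  The first Born term gives the sine transform, the second cancels, and the others form the remainder.
\<close>

lemma char_det_odd:
  assumes p: "integrable (lebesgue_on {0..pi}) p" and odd: "odd_pi p" and m: "\<mu> \<noteq> 0"
  shows "\<mu> * char_det p \<mu> = linear_part p \<mu> + remainder p \<mu>"
proof -
  define P where "P = (\<lambda>i::nat. p)"
  have P: "P 0 = p" by (simp add: P_def)
  have b0: "born_term P \<mu> 0 [] = fourier p \<mu>" for \<mu>
    by (simp add: born_term_def fourier_def P)
  have s1: "scattering p \<mu> = fourier p \<mu> + born_term P \<mu> 0 [0] + scattering3 p \<mu>"
    and s2: "scattering p (- \<mu>) = fourier p (- \<mu>) + born_term P (- \<mu>) 0 [0] + scattering3 p (- \<mu>)"
    using scattering_split[where P = P, OF p m P] scattering_split[where P = P and \<mu> = "- \<mu>", OF p _ P] m by (simp_all add: b0)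
  have "2 * \<i> * (\<mu> * char_det p \<mu>) = 2 * \<i> * linear_part p \<mu> + 2 * \<i> * remainder p \<mu>"
    unfolding char_det_scattering[OF p] s1 s2 linear_part_fourier[OF p] remainder_def distrib_left second_term_cancels[where P = P, OF p odd m P]
    by simp
  then have "2 * \<i> * (\<mu> * char_det p \<mu>) = 2 * \<i> * (linear_part p \<mu> + remainder p \<mu>)" by (simp only: distrib_left)
  then show ?thesis by simp
qed

text \<open>
  Bounds for the third order part at \<open>m\<close> and \<open>- m\<close> pass to the remainder: the exponentials have modulus
  \<open>1\<close>, and the factor \<open>1 / 2\<close> averages the two errors.
\<close>

lemma remainder_bound:
  assumes "norm (scattering3 p (of_real m) - s1) \<le> B" "norm (scattering3 p (of_real (- m)) - s2) \<le> B"
  shows "norm (remainder p (of_real m) - (exp (\<i> * of_real m * of_real pi) * s1 - exp (- \<i> * of_real m * of_real pi) * s2) / (2 * \<i>)) \<le> B"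
proof -
  define E where "E = exp (\<i> * complex_of_real m * of_real pi)"
  define E' where "E' = exp (- \<i> * complex_of_real m * of_real pi)"
  have nE: "norm E = 1" "norm E' = 1" by (simp_all add: E_def E'_def norm_exp_eq_Re)
  have "remainder p (of_real m) - (E * s1 - E' * s2) / (2 * \<i>) = (E * (scattering3 p (of_real m) - s1) - E' * (scattering3 p (of_real (- m)) - s2)) / (2 * \<i>)"
    unfolding remainder_def E_def[symmetric] E'_def[symmetric] of_real_minus by (simp add: algebra_simps diff_divide_distrib add_divide_distrib)
  also have "norm \<dots> \<le> (norm (scattering3 p (of_real m) - s1) + norm (scattering3 p (of_real (- m)) - s2)) / 2"
    unfolding norm_divide using norm_triangle_ineq4[of "E * (scattering3 p (of_real m) - s1)" "E' * (scattering3 p (of_real (- m)) - s2)"]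
    by (simp add: norm_mult nE)
  also have "\<dots> \<le> B" using assms by simp
  finally show ?thesis unfolding E_def E'_def .
qed

lemma remainder_lipschitz:
  assumes p: "integrable (lebesgue_on {0..pi}) p" and q: "integrable (lebesgue_on {0..pi}) q"
    and pe: "l1norm p \<le> \<epsilon>" and qe: "l1norm q \<le> \<epsilon>" and e: "pi * \<epsilon> \<le> 1/2" and m: "\<bar>m\<bar> \<ge> 1"
  shows "norm (remainder p (complex_of_real m) - remainder q (complex_of_real m)) \<le> 8 * \<epsilon>\<^sup>2 * l1norm (\<lambda>t. p t - q t) / m\<^sup>2"
proof -
  have "norm (remainder p (complex_of_real m) - (exp (\<i> * of_real m * of_real pi) * scattering3 q (of_real m) - exp (- \<i> * of_real m * of_real pi) * scattering3 q (of_real (- m))) / (2 * \<i>))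
     \<le> 8 * \<epsilon>\<^sup>2 * l1norm (\<lambda>t. p t - q t) / m\<^sup>2"
    by (rule remainder_bound) (use scattering3_lipschitz[OF p q pe qe e, of m] scattering3_lipschitz[OF p q pe qe e, of "- m"] m in simp_all)
  then show ?thesis unfolding remainder_def by simp
qed

lemma remainder_zero: "remainder (\<lambda>_. 0) \<mu> = 0"
  unfolding remainder_def scattering3_def by simp

lemma sin_plus_int_period: "sin (x + of_int k * (2 * pi)) = sin (x::real)"
  using sin_int_2pin[of k] cos_int_2pin[of k] by (simp add: sin_add mult.commute)

lemma sin_plus_half_pi: "sin (y + pi / 2) = cos (y::real)"
  by (simp add: sin_add)

text \<open>
  The derivatives of the sine functions up to scaling: \<open>trig i n\<close> is the derivative of order \<open>i\<close> of
  \<open>sin (2 (n + 1) x)\<close>, divided by \<open>(2 (n + 1))^i\<close>. Indices are shifted so that \<open>n = 0\<close> is the lowest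
  frequency.
\<close>

definition trig :: "nat \<Rightarrow> nat \<Rightarrow> real \<Rightarrow> complex" where
  "trig i n x = complex_of_real (sin (2 * (real n + 1) * x + real i * pi / 2))"

lemma trig_continuous: "continuous_on S (trig i n)"
  unfolding trig_def by (intro continuous_intros)

lemma norm_trig_le: "norm (trig i n x) \<le> 1"
  unfolding trig_def by simp

lemma trig_pi: "trig i n pi = trig i n 0"
proof -
  have "sin (2 * (real n + 1) * pi + real i * pi / 2) = sin (real i * pi / 2 + of_int (int n + 1) * (2 * pi))"
    by (simp add: algebra_simps)
  also have "\<dots> = sin (real i * pi / 2)" by (rule sin_plus_int_period)
  finally show ?thesis by (simp add: trig_def)
qed

lemma trig_odd: "trig 0 n (pi - x) = - trig 0 n x"
proof -
  have "sin (2 * (real n + 1) * (pi - x)) = sin (- (2 * (real n + 1) * x) + of_int (int n + 1) * (2 * pi))"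
    by (simp add: algebra_simps)
  also have "\<dots> = sin (- (2 * (real n + 1) * x))" by (rule sin_plus_int_period)
  finally show ?thesis by (simp add: trig_def)
qed

lemma trig_deriv: "(trig i n has_vector_derivative of_real (2 * (real n + 1)) * trig (Suc i) n x) (at x within S)"
proof -
  have "((\<lambda>x. sin (2 * (real n + 1) * x + real i * pi / 2)) has_real_derivative
      2 * (real n + 1) * sin (2 * (real n + 1) * x + real (Suc i) * pi / 2)) (at x within S)"
  proof -
    have "sin (2 * (real n + 1) * x + real (Suc i) * pi / 2) = cos (2 * (real n + 1) * x + real i * pi / 2)"
      using sin_plus_half_pi[of "2 * (real n + 1) * x + real i * pi / 2"] by (simp add: add_divide_distrib distrib_right add.assoc add.commute add.left_commute)
    then show ?thesis by (auto intro!: derivative_eq_intros)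
  qed
  then have "((\<lambda>x. complex_of_real (sin (2 * (real n + 1) * x + real i * pi / 2))) has_vector_derivative
      complex_of_real (2 * (real n + 1) * sin (2 * (real n + 1) * x + real (Suc i) * pi / 2))) (at x within S)"
    by (intro has_vector_derivative_of_real) (simp add: has_real_derivative_iff_has_vector_derivative)
  then show ?thesis by (simp only: trig_def[abs_def] of_real_mult)
qed

lemma lint_eq_diff:
  fixes F :: "real \<Rightarrow> complex"
  assumes d: "\<And>x. x \<in> {0..pi} \<Longrightarrow> (F has_vector_derivative f x) (at x within {0..pi})" and c: "continuous_on {0..pi} f"
    and x: "x \<in> {0..pi}"
  shows "(LINT t|lebesgue_on {0..x}. f t) = F x - F 0"
  using primitive_ofD[OF primitive_of_C1[OF d c] x] by simp

lemma lint_exp_even: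
  assumes k: "k \<noteq> (0::int)"
  shows "(LINT x|lebesgue_on {0..pi}. exp (2 * \<i> * of_int k * complex_of_real x)) = 0"
proof -
  define c where "c = 2 * \<i> * of_int k"
  have c: "c \<noteq> 0" using k by (simp add: c_def)
  have d: "((\<lambda>x. exp (c * of_real x) / c) has_vector_derivative exp (c * of_real x)) (at x within {0..pi})" for x
  proof -
    have "((\<lambda>x. inverse c * exp (c * of_real x)) has_vector_derivative inverse c * (c * exp (c * of_real x))) (at x within {0..pi})"
      by (rule has_vector_derivative_mult_right[OF exp_has_vector_derivative])
    moreover have "inverse c * (c * w) = w" for w using c by simp
    moreover have "inverse c * w = w / c" for w by (simp add: divide_inverse)
    ultimately show ?thesis by (simp only:)
  qed
  have "(LINT x|lebesgue_on {0..pi}. exp (c * of_real x)) = exp (c * of_real pi) / c - exp (c * of_real 0) / c"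
    by (rule lint_eq_diff[OF d]) (auto intro!: continuous_intros)
  moreover have "exp (c * of_real pi) = 1"
  proof -
    have "c * of_real pi = of_int (2 * k) * (of_real pi * \<i>)" by (simp add: c_def)
    then show ?thesis using exp_integer_2pi[of "of_int k"] by (simp add: c_def mult_ac)
  qed
  ultimately show ?thesis by (simp add: c_def)
qed

text \<open>
  The products have even frequencies, although the exponentials themselves are not periodic with period
  \<open>\<pi>\<close>.
\<close>

lemma half_exp_orth:
  "(LINT x|lebesgue_on {0..pi}. exp (\<i> * of_real (2 * real m + 1) * of_real x) * cnj (exp (\<i> * of_real (2 * real n + 1) * of_real x))) =
     (if m = n then complex_of_real pi else 0)"
proof -
  have "exp (\<i> * of_real (2 * real m + 1) * of_real x) * cnj (exp (\<i> * of_real (2 * real n + 1) * of_real x)) = exp (2 * \<i> * of_int (int m - int n) * complex_of_real x)" for x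
    unfolding exp_cnj exp_add[symmetric] by (simp add: algebra_simps)
  then show ?thesis
    using lint_exp_even[of "int m - int n"] by (auto simp: measure_restrict_space scaleR_conv_of_real)
qed

text \<open>
  At the half integers the Fourier transform gives coefficients in the orthogonal system above.
\<close>

lemma fourier_half_tendsto:
  assumes "L2c f"
  shows "(\<lambda>n. fourier f (of_real (real n + 1/2))) \<longlonglongrightarrow> 0"
proof -
  have "(\<lambda>n. LINT x|lebesgue_on {0..pi}. f x * cnj (exp (\<i> * of_real (2 * real n + 1) * of_real x))) \<longlonglongrightarrow> 0"
    by (rule Bessel[OF assms _ half_exp_orth]) (auto intro!: continuous_intros)
  moreover have "cnj (exp (\<i> * of_real (2 * real n + 1) * of_real x)) = exp (- 2 * \<i> * of_real (real n + 1/2) * of_real x)" for n x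
    unfolding exp_cnj by (simp add: algebra_simps)
  ultimately show ?thesis unfolding fourier_def by simp
qed

lemma trig_orth:
  "(LINT x|lebesgue_on {0..pi}. trig i m x * cnj (trig i n x)) = (if m = n then complex_of_real (pi / 2) else 0)"
proof -
  define k where "k = int m - int n"
  define l where "l = int m + int n + 2"
  define a where "a = exp (\<i> * of_real (real i * pi))"
  define b where "b = exp (- \<i> * of_real (real i * pi))"
  define ex where "ex = (\<lambda>j::int. \<lambda>x. exp (2 * \<i> * of_int j * complex_of_real x))"
  have cex: "continuous_on S (ex j)" for S j unfolding ex_def by (intro continuous_intros)
  have iex: "integrable (lebesgue_on {0..pi}) (\<lambda>x. c * ex j x)" for j c
    by (intro continuous_imp_integrable_real continuous_on_mult continuous_on_const cex)
  have eq: "trig i m x * cnj (trig i n x) = (1/4) * ex k x + (1/4) * ex (- k) x - ((1/4 * a) * ex l x + (1/4 * b) * ex (- l) x)" for x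
  proof -
    define A where "A = 2 * (real m + 1) * x + real i * pi / 2"
    define B where "B = 2 * (real n + 1) * x + real i * pi / 2"
    have "trig i m x * cnj (trig i n x) = complex_of_real (sin A * sin B)" by (simp add: trig_def A_def B_def)
    also have "sin A * sin B = (cos (A - B) - cos (A + B)) / 2" by (simp add: sin_times_sin)
    finally have 1: "trig i m x * cnj (trig i n x) = (cos (of_real (A - B)) - cos (of_real (A + B))) / 2"
      unfolding cos_of_real by simp
    have 2: "exp (\<i> * of_real (A - B)) = ex k x" "exp (- (\<i> * of_real (A - B))) = ex (- k) x"
      by (simp_all add: ex_def A_def B_def k_def algebra_simps)
    have 3: "exp (\<i> * of_real (A + B)) = a * ex l x" "exp (- (\<i> * of_real (A + B))) = b * ex (- l) x"
      unfolding a_def b_def ex_def exp_add[symmetric] by (simp_all add: A_def B_def l_def algebra_simps)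
    show ?thesis unfolding 1 cos_exp_eq 2 3 by (simp add: field_simps)
  qed
  have "(LINT x|lebesgue_on {0..pi}. trig i m x * cnj (trig i n x)) =
     (1/4) * (LINT x|lebesgue_on {0..pi}. ex k x) + (1/4) * (LINT x|lebesgue_on {0..pi}. ex (- k) x)
      - ((1/4 * a) * (LINT x|lebesgue_on {0..pi}. ex l x) + (1/4 * b) * (LINT x|lebesgue_on {0..pi}. ex (- l) x))"
    unfolding eq
      Bochner_Integration.integral_diff[OF Bochner_Integration.integrable_add[OF iex iex] Bochner_Integration.integrable_add[OF iex iex]]
      Bochner_Integration.integral_add[OF iex iex] integral_mult_right_zero ..
  moreover have "(LINT x|lebesgue_on {0..pi}. ex j x) = 0" if "j \<noteq> 0" for j
    unfolding ex_def by (rule lint_exp_even[OF that])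
  moreover have "(LINT x|lebesgue_on {0..pi}. ex 0 x) = of_real pi"
    by (simp add: ex_def measure_restrict_space scaleR_conv_of_real)
  moreover have "l \<noteq> 0" by (simp add: l_def)
  moreover have "m = n \<longleftrightarrow> k = 0" by (simp add: k_def)
  ultimately show ?thesis by (cases "m = n") auto
qed

text \<open>
  The partial sums of the derivative of order \<open>i\<close> of the sine series with coefficients \<open>a\<close>.
\<close>

definition psum :: "nat \<Rightarrow> (nat \<Rightarrow> complex) \<Rightarrow> nat \<Rightarrow> real \<Rightarrow> complex" where
  "psum i a N x = (\<Sum>n<N. (a n * of_real (2 * (real n + 1)) ^ i) * trig i n x)"

lemma psum_continuous: "continuous_on S (psum i a N)"
  unfolding psum_def by (intro continuous_on_sum continuous_on_mult continuous_on_const trig_continuous)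

text \<open>
  Each partial sum is odd pointwise for \<open>i = 0\<close>, and \<open>Riesz_Fischer\<close> preserves pointwise symmetries.
\<close>

lemma psum_limit_exists:
  assumes "summable (\<lambda>n. (norm (a n) * (2 * (real n + 1)) ^ i)\<^sup>2)"
  obtains g where "l2lim (psum i a) g" "i = 0 \<Longrightarrow> odd_pi g"
proof -
  have "summable (\<lambda>n. (norm (a n * of_real (2 * (real n + 1)) ^ i))\<^sup>2)"
  proof -
    have "norm (a n * of_real (2 * (real n + 1)) ^ i) = norm (a n) * (2 * (real n + 1)) ^ i" for n
      unfolding norm_mult norm_power norm_of_real by simp
    then show ?thesis using assms by simp
  qed
  from Riesz_Fischer[OF trig_continuous trig_orth _ this, of i]
  obtain g where g: "l2lim (\<lambda>N x. \<Sum>n<N. (a n * of_real (2 * (real n + 1)) ^ i) * trig i n x) g"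
    "\<And>x y. (\<And>N. (\<Sum>n<N. (a n * of_real (2 * (real n + 1)) ^ i) * trig i n x) = - (\<Sum>n<N. (a n * of_real (2 * (real n + 1)) ^ i) * trig i n y)) \<Longrightarrow> g x = - g y"
    by auto
  have "l2lim (psum i a) g" using g(1) unfolding psum_def[abs_def] .
  moreover have "odd_pi g" if "i = 0"
    unfolding odd_pi_def
  proof (intro ballI g(2))
    show "(\<Sum>n<N. (a n * of_real (2 * (real n + 1)) ^ i) * trig i n (pi - t)) = - (\<Sum>n<N. (a n * of_real (2 * (real n + 1)) ^ i) * trig i n t)" for N t
      using that by (simp add: trig_odd sum_negf)
  qed
  ultimately show ?thesis by (rule that)
qed

lemma psum_coefficient:
  assumes "l2lim (psum 0 a) p"
  shows "(LINT t|lebesgue_on {0..pi}. p t * trig 0 n t) = of_real (pi / 2) * a n"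
proof -
  have "(\<lambda>N. LINT t|lebesgue_on {0..pi}. psum 0 a N t * trig 0 n t) \<longlonglongrightarrow> (LINT t|lebesgue_on {0..pi}. p t * trig 0 n t)"
    by (rule l2lim_integral[OF assms trig_continuous]) simp
  moreover have "(LINT t|lebesgue_on {0..pi}. psum 0 a N t * trig 0 n t) = of_real (pi / 2) * a n" if N: "N > n" for N
  proof -
    have i: "integrable (lebesgue_on {0..pi}) (\<lambda>t. a j * (trig 0 j t * cnj (trig 0 n t)))" for j
      by (intro continuous_imp_integrable_real continuous_intros trig_continuous)
    have "(LINT t|lebesgue_on {0..pi}. psum 0 a N t * trig 0 n t) = (LINT t|lebesgue_on {0..pi}. (\<Sum>j<N. a j * (trig 0 j t * cnj (trig 0 n t))))"
      by (simp add: psum_def sum_distrib_right mult.assoc trig_def)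
    also have "\<dots> = (\<Sum>j<N. a j * (if j = n then complex_of_real (pi / 2) else 0))"
      using i by (simp add: Bochner_Integration.integral_sum trig_orth)
    also have "\<dots> = (\<Sum>j<N. if j = n then a n * complex_of_real (pi / 2) else 0)"
      by (intro sum.cong) auto
    also have "\<dots> = of_real (pi / 2) * a n" using N by (simp add: mult.commute)
    finally show ?thesis .
  qed
  then have "eventually (\<lambda>N. (LINT t|lebesgue_on {0..pi}. psum 0 a N t * trig 0 n t) = of_real (pi / 2) * a n) sequentially"
    by (rule eventually_mono[OF eventually_gt_at_top[of n]])
  then have "(\<lambda>N. LINT t|lebesgue_on {0..pi}. psum 0 a N t * trig 0 n t) \<longlonglongrightarrow> of_real (pi / 2) * a n"
    by (rule tendsto_eventually)
  ultimately show ?thesis by (rule LIMSEQ_unique)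
qed

text \<open>
  The sine functions are exactly the kernels of the sine transform at the integers, up to the sign
  \<open>(-1)^n\<close>.
\<close>

lemma linear_part_integer:
  assumes "l2lim (psum 0 a) p"
  shows "linear_part p (of_nat (Suc n)) = (-1) ^ n * of_real (pi / 2) * a n"
proof -
  have s: "sin (of_nat (Suc n) * complex_of_real (pi - 2 * t)) = (-1) ^ n * trig 0 n t" for t
  proof -
    have "sin (real (Suc n) * (pi - 2 * t)) = sin (real (Suc n) * pi) * cos (2 * (real n + 1) * t) - cos (real (Suc n) * pi) * sin (2 * (real n + 1) * t)"
      using sin_diff[of "real (Suc n) * pi" "2 * (real n + 1) * t"] by (simp add: algebra_simps)
    also have "\<dots> = (-1) ^ n * sin (2 * (real n + 1) * t)"
      using sin_npi[of "Suc n"] cos_npi[of "Suc n"] by simp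
    finally have "complex_of_real (sin (real (Suc n) * (pi - 2 * t))) = complex_of_real ((-1) ^ n * sin (2 * (real n + 1) * t))" by (simp only:)
    then show ?thesis by (simp add: trig_def sin_of_real[symmetric])
  qed
  have "linear_part p (of_nat (Suc n)) = (LINT t|lebesgue_on {0..pi}. (-1) ^ n * (p t * trig 0 n t))"
    unfolding linear_part_def s by (simp add: mult.left_commute)
  also have "\<dots> = (-1) ^ n * (LINT t|lebesgue_on {0..pi}. p t * trig 0 n t)" by (rule integral_mult_right_zero)
  finally show ?thesis unfolding psum_coefficient[OF assms] by simp
qed

section \<open>Solving for the potential at the integer samples\<close>

lemma l2sq_add_le:
  assumes "L2c u" "L2c v"
  shows "l2sq (\<lambda>x. u x + v x) \<le> 2 * l2sq u + 2 * l2sq v"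
proof -
  have i: "integrable (lebesgue_on {0..pi}) (\<lambda>x. (norm (u x))\<^sup>2)" "integrable (lebesgue_on {0..pi}) (\<lambda>x. (norm (v x))\<^sup>2)"
    "integrable (lebesgue_on {0..pi}) (\<lambda>x. (norm (u x + v x))\<^sup>2)"
    using assms L2c_add[OF assms] by (simp_all add: L2c_def)
  have "(norm (y + z))\<^sup>2 \<le> 2 * (norm y)\<^sup>2 + 2 * (norm z)\<^sup>2" for y z :: complex
  proof -
    have "(norm (y + z))\<^sup>2 \<le> (norm y + norm z)\<^sup>2" by (intro power_mono norm_triangle_ineq) auto
    also have "\<dots> \<le> 2 * (norm y)\<^sup>2 + 2 * (norm z)\<^sup>2" using sum_squares_bound[of "norm y" "norm z"] by (simp add: power2_sum)
    finally show ?thesis .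
  qed
  then have "l2sq (\<lambda>x. u x + v x) \<le> (LINT x|lebesgue_on {0..pi}. 2 * (norm (u x))\<^sup>2 + 2 * (norm (v x))\<^sup>2)"
    unfolding l2sq_def using i by (intro integral_mono) auto
  then show ?thesis using i by (simp add: l2sq_def)
qed

lemma l2lim_add:
  assumes g: "l2lim S g" and h: "l2lim T h"
  shows "l2lim (\<lambda>N x. S N x + T N x) (\<lambda>x. g x + h x)"
proof -
  have L: "L2c g" "L2c h" "\<And>N. L2c (S N)" "\<And>N. L2c (T N)"
    using g h L2c_continuous unfolding l2lim_def by blast+
  have "(\<lambda>N. l2sq (\<lambda>x. g x + h x - (S N x + T N x))) \<longlonglongrightarrow> 0"
  proof (rule Lim_null_comparison)
    have "l2sq (\<lambda>x. g x + h x - (S N x + T N x)) \<le> 2 * l2sq (\<lambda>x. g x - S N x) + 2 * l2sq (\<lambda>x. h x - T N x)" for N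
      using l2sq_add_le[OF L2c_diff[OF L(1) L(3)] L2c_diff[OF L(2) L(4)], of N N] by (simp add: algebra_simps)
    then show "eventually (\<lambda>N. norm (l2sq (\<lambda>x. g x + h x - (S N x + T N x))) \<le> 2 * l2sq (\<lambda>x. g x - S N x) + 2 * l2sq (\<lambda>x. h x - T N x)) sequentially"
      using l2sq_nonneg by simp
    have "(\<lambda>N. 2 * l2sq (\<lambda>x. g x - S N x) + 2 * l2sq (\<lambda>x. h x - T N x)) \<longlonglongrightarrow> 2 * 0 + 2 * 0"
      using g h unfolding l2lim_def by (intro tendsto_intros) auto
    then show "(\<lambda>N. 2 * l2sq (\<lambda>x. g x - S N x) + 2 * l2sq (\<lambda>x. h x - T N x)) \<longlonglongrightarrow> 0" by simp
  qed
  moreover have "continuous_on {0..pi} (\<lambda>x. S N x + T N x)" for N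
    using g h unfolding l2lim_def by (intro continuous_intros) auto
  ultimately show ?thesis using L2c_add[OF L(1,2)] unfolding l2lim_def by blast
qed

lemma l2lim_l1norm_le:
  assumes S: "l2lim S g" and B: "\<And>N. l1norm (S N) \<le> B"
  shows "l1norm g \<le> B"
proof -
  have i: "integrable (lebesgue_on {0..pi}) g" "\<And>N. integrable (lebesgue_on {0..pi}) (S N)"
    using S by (auto simp: l2lim_def intro: L2c_integrable continuous_imp_integrable_real)
  have "l1norm g \<le> l1norm (\<lambda>x. g x - S N x) + B" for N
  proof -
    have "l1norm (\<lambda>x. (g x - S N x) + S N x) \<le> l1norm (\<lambda>x. g x - S N x) + l1norm (S N)"
      using i by (intro l1norm_triangle) auto
    then show ?thesis using B[of N] by simp
  qed
  moreover have "(\<lambda>N. l1norm (\<lambda>x. g x - S N x) + B) \<longlonglongrightarrow> 0 + B" by (intro tendsto_intros l2lim_L1 S)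
  ultimately show ?thesis by (intro LIMSEQ_le_const[of "\<lambda>N. l1norm (\<lambda>x. g x - S N x) + B"]) auto
qed

lemma l1norm_le_sup:
  assumes c: "continuous_on {0..pi} f" and "\<And>x. x \<in> {0..pi} \<Longrightarrow> norm (f x) \<le> B"
  shows "l1norm f \<le> B * pi"
proof -
  have "l1norm f \<le> (LINT t|lebesgue_on {0..pi}. B)"
    unfolding l1norm_def using assms(2)
    by (intro integral_mono integrable_const_pi continuous_imp_integrable_real continuous_intros c) auto
  then show ?thesis by (simp add: measure_restrict_space mult.commute)
qed

text \<open>
  The termwise derivative of order \<open>i\<close> of the sine series, used only when it converges absolutely.
\<close>

definition tsum :: "nat \<Rightarrow> (nat \<Rightarrow> complex) \<Rightarrow> real \<Rightarrow> complex" where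
  "tsum i a x = (\<Sum>n. (a n * of_real (2 * (real n + 1)) ^ i) * trig i n x)"

lemma norm_psum_term:
  "norm ((a n * of_real (2 * (real n + 1)) ^ i) * trig j n x) \<le> norm (a n) * (2 * (real n + 1)) ^ i"
proof -
  have "norm ((a n * of_real (2 * (real n + 1)) ^ i) * trig j n x) = (norm (a n) * (2 * (real n + 1)) ^ i) * norm (trig j n x)"
    unfolding norm_mult norm_power norm_of_real by simp
  also have "\<dots> \<le> (norm (a n) * (2 * (real n + 1)) ^ i) * 1"
    by (intro mult_left_mono norm_trig_le) simp
  finally show ?thesis by simp
qed

lemma psum_uniform_limit:
  assumes "summable (\<lambda>n. norm (a n) * (2 * (real n + 1)) ^ i)"
  shows "uniform_limit A (psum i a) (tsum i a) sequentially"
  unfolding psum_def[abs_def] tsum_def[abs_def]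
  by (rule Weierstrass_m_test[OF _ assms]) (rule norm_psum_term)

lemma tsum_l2lim:
  assumes "summable (\<lambda>n. norm (a n) * (2 * (real n + 1)) ^ i)"
  shows "l2lim (psum i a) (tsum i a)"
  by (rule l2lim_uniform[OF psum_continuous psum_uniform_limit[OF assms]])

lemma tsum_continuous:
  assumes "summable (\<lambda>n. norm (a n) * (2 * (real n + 1)) ^ i)"
  shows "continuous_on A (tsum i a)"
  by (rule uniform_limit_theorem[OF _ psum_uniform_limit[OF assms]]) (simp_all add: psum_continuous)

lemma tsum_pi:
  "tsum i a pi = tsum i a 0"
  unfolding tsum_def trig_pi ..

lemma tsum_odd: 
  assumes "summable (\<lambda>n. norm (a n))"
  shows "odd_pi (tsum 0 a)"
proof -
  have s: "summable (\<lambda>n. a n * trig 0 n x)" for x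
    by (rule summable_comparison_test'[OF assms]) (use norm_psum_term[of a _ 0 0 x] in simp)
  show ?thesis unfolding odd_pi_def tsum_def trig_odd using suminf_minus[OF s] by simp
qed

text \<open>
  The orthogonality relation has the constant \<open>\<pi>/2\<close>, and Cauchy-Schwarz on the interval another factor
  \<open>\<pi>\<close>.
\<close>

lemma l1norm_psum_le:
  assumes "\<And>N. (\<Sum>n<N. (norm (a n))\<^sup>2) \<le> E"
  shows "l1norm (psum 0 a N) \<le> sqrt (pi\<^sup>2 * E / 2)"
proof -
  have "l2sq (psum 0 a N) = pi / 2 * (\<Sum>n<N. (norm (a n))\<^sup>2)"
    using pythagoras[where \<phi> = "trig 0" and A = "{..<N}" and a = a, OF trig_continuous trig_orth] by (simp add: psum_def[abs_def])
  also have "\<dots> \<le> pi / 2 * E" using assms by (intro mult_left_mono) auto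
  finally have "pi * l2sq (psum 0 a N) \<le> pi * (pi / 2 * E)" by (intro mult_left_mono) auto
  then have "sqrt (pi * l2sq (psum 0 a N)) \<le> sqrt (pi\<^sup>2 * E / 2)" by (intro real_sqrt_le_mono) (simp add: power2_eq_square)
  then show ?thesis using l1_le_sqrt_l2[OF L2c_continuous[OF psum_continuous, of 0 a N]] by linarith
qed

lemma inverse_squares_le_3: "summable (\<lambda>n. 1 / (real n + 1)\<^sup>2)" "(\<Sum>n. 1 / (real n + 1)\<^sup>2) \<le> 3"
proof -
  have s: "(\<lambda>n. 1 / (real n + 1)\<^sup>2) sums (pi\<^sup>2 / 6)" using inverse_squares_sums by (simp add: add.commute)
  then show "summable (\<lambda>n. 1 / (real n + 1)\<^sup>2)" by (rule sums_summable)
  have "pi\<^sup>2 \<le> 4\<^sup>2" by (intro power_mono less_imp_le pi_less_4) auto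
  then show "(\<Sum>n. 1 / (real n + 1)\<^sup>2) \<le> 3" using sums_unique[OF s] by simp
qed

text \<open>
  The contraction principle for the supremum norm on bounded sequences, by Picard iteration; the iterates
  converge uniformly by comparison with a geometric series.
\<close>

lemma sequence_contraction:
  fixes T :: "(nat \<Rightarrow> complex) \<Rightarrow> nat \<Rightarrow> complex"
  assumes inv: "\<And>b n. (\<And>n. norm (b n) \<le> r) \<Longrightarrow> norm (T b n) \<le> r"
    and lip: "\<And>b b' d n. (\<And>n. norm (b n) \<le> r) \<Longrightarrow> (\<And>n. norm (b' n) \<le> r) \<Longrightarrow> (\<And>n. norm (b n - b' n) \<le> d) \<Longrightarrow> norm (T b n - T b' n) \<le> k * d"
    and k: "0 \<le> k" "k < 1" and r: "0 \<le> r"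
  obtains b where "\<And>n. norm (b n) \<le> r" "T b = b"
proof -
  define x where "x = (\<lambda>j. (T ^^ j) (\<lambda>_. 0))"
  have xS: "x (Suc j) = T (x j)" for j by (simp add: x_def)
  have xr: "norm (x j n) \<le> r" for j n
    by (induction j arbitrary: n) (simp_all add: xS inv r, simp add: x_def r)
  have step: "norm (x (Suc j) n - x j n) \<le> r * k ^ j" for j n
  proof (induction j arbitrary: n)
    case 0
    show ?case using xr[of 1 n] by (simp add: x_def)
  next
    case (Suc j)
    have "norm (T (x (Suc j)) n - T (x j) n) \<le> k * (r * k ^ j)" by (intro lip xr Suc)
    then show ?case by (simp add: xS mult.left_commute)
  qed
  define b where "b = (\<lambda>n. \<Sum>j. x (Suc j) n - x j n)"
  have "uniform_limit UNIV (\<lambda>N n. \<Sum>j<N. x (Suc j) n - x j n) b sequentially"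
    unfolding b_def by (rule Weierstrass_m_test[of _ _ "\<lambda>j. r * k ^ j"]) (use step k in \<open>auto intro!: summable_mult summable_geometric\<close>)
  moreover have "(\<lambda>N n. \<Sum>j<N. x (Suc j) n - x j n) = x"
    using sum_lessThan_telescope[of "\<lambda>j. x j n" for n] by (intro ext) (simp add: x_def)
  ultimately have u: "uniform_limit UNIV x b sequentially" by simp
  have br: "norm (b n) \<le> r" for n
    by (rule LIMSEQ_le_const2[OF tendsto_norm[OF tendsto_uniform_limitI[OF u]]]) (auto simp: xr)
  have "T b n = b n" for n
  proof (rule LIMSEQ_unique)
    show "(\<lambda>N. x (Suc N) n) \<longlonglongrightarrow> b n" by (rule LIMSEQ_Suc[OF tendsto_uniform_limitI[OF u]]) simp
    show "(\<lambda>N. x (Suc N) n) \<longlonglongrightarrow> T b n"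
    proof (rule tendstoI)
      fix e :: real assume e: "e > 0"
      from uniform_limitD[OF u e] show "eventually (\<lambda>N. dist (x (Suc N) n) (T b n) < e) sequentially"
      proof eventually_elim
        case (elim N)
        then have "norm (x N n - b n) \<le> e" for n by (auto simp: dist_norm intro: less_imp_le)
        then have "norm (T (x N) n - T b n) \<le> k * e" by (intro lip xr br)
        also have "\<dots> < 1 * e" using k e by (intro mult_strict_right_mono) auto
        finally show ?case by (simp add: xS dist_norm)
      qed
    qed
  qed
  then show ?thesis using br by (intro that[of b]) auto
qed

text \<open>
  The potential is written as \<open>g + (\<Sum>n. b n / (n + 1)\<^sup>2 sin (2 (n + 1) x))\<close>, where \<open>g\<close> solves the linearised
  problem and \<open>b\<close> is an unknown bounded sequence. The equations at the integers say that \<open>b\<close> is a fixed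
  point of the remainder multiplied by \<open>(n + 1)\<^sup>2\<close>, which is bounded because the remainder decays like
  \<open>1/n\<^sup>2\<close>, and contracting because it is of third order in a small potential. The last conclusion records
  that the coefficients inherit the decay of the data and of the remainder.
\<close>

lemma exists_small_potential:
  fixes fn :: "nat \<Rightarrow> complex"
  assumes fn: "\<And>N. (\<Sum>n<N. (norm (fn n))\<^sup>2) \<le> 1 / 2048"
  obtains p a where "l2lim (psum 0 a) p" "odd_pi p" "l1norm p \<le> 1 / 16"
    "\<And>n. linear_part p (of_nat (Suc n)) + remainder p (of_nat (Suc n)) = fn n"
    "\<And>n. norm (a n) \<le> norm (fn n) + norm (remainder p (of_nat (Suc n)))"
proof -
  (* The inverse of the factor in linear_part_integer. *)
  define s where "s = (\<lambda>n::nat. (-1) ^ n * complex_of_real (2 / pi))"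
  have ns: "norm (s n) = 2 / pi" for n by (simp add: s_def norm_mult norm_power norm_divide)
  have ns1: "norm (s n * z) \<le> norm z" for n z
  proof -
    have "2 / pi \<le> 1" using pi_ge_two by simp
    then have "2 / pi * norm z \<le> 1 * norm z" by (intro mult_right_mono) auto
    then show ?thesis by (simp add: norm_mult ns)
  qed
  define a0 where "a0 = (\<lambda>n. s n * fn n)"
  have a0E: "(\<Sum>n<N. (norm (a0 n))\<^sup>2) \<le> 4 / pi\<^sup>2 / 2048" for N
  proof -
    have "(\<Sum>n<N. (norm (a0 n))\<^sup>2) = 4 / pi\<^sup>2 * (\<Sum>n<N. (norm (fn n))\<^sup>2)"
      unfolding a0_def norm_mult ns by (simp add: power_mult_distrib power_divide sum_distrib_left)
    also have "\<dots> \<le> 4 / pi\<^sup>2 * (1 / 2048)" by (intro mult_left_mono fn) auto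
    finally show ?thesis by simp
  qed
  have "summable (\<lambda>n. (norm (a0 n))\<^sup>2)" by (rule summableI_nonneg_bounded[OF _ a0E]) simp
  then obtain g where g: "l2lim (psum 0 a0) g" "odd_pi g"
    using psum_limit_exists[of a0 0] by auto
  have g1: "l1norm g \<le> 1 / 32"
  proof (rule l2lim_l1norm_le[OF g(1)])
    fix N
    have "pi\<^sup>2 * (4 / pi\<^sup>2 / 2048) / 2 = (1 / 32)\<^sup>2" by (simp add: field_simps)
    then have "sqrt (pi\<^sup>2 * (4 / pi\<^sup>2 / 2048) / 2) = 1 / 32" by (simp only: real_sqrt_abs abs_of_nonneg)
    then show "l1norm (psum 0 a0 N) \<le> 1 / 32" using l1norm_psum_le[OF a0E, of N] by simp
  qed
  have ig: "integrable (lebesgue_on {0..pi}) g" using g(1) by (auto simp: l2lim_def intro: L2c_integrable)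
  define c where "c = (\<lambda>b n. b n / complex_of_real ((real n + 1)\<^sup>2))"
  have nc: "norm (c b n) = norm (b n) * (1 / (real n + 1)\<^sup>2)" for b n unfolding c_def norm_divide norm_of_real by simp
  have sc: "summable (\<lambda>n. norm (c b n))" "(\<Sum>n. norm (c b n)) \<le> 3 * B" if b: "\<And>n. norm (b n) \<le> B" for b B
  proof -
    have le: "norm (norm (c b n)) \<le> B * (1 / (real n + 1)\<^sup>2)" for n
      unfolding nc using b[of n] by (simp add: divide_right_mono)
    have sB: "summable (\<lambda>n. B * (1 / (real n + 1)\<^sup>2))" by (intro summable_mult inverse_squares_le_3)
    show s: "summable (\<lambda>n. norm (c b n))" by (rule summable_comparison_test'[OF sB le])
    have "(\<Sum>n. norm (c b n)) \<le> (\<Sum>n. B * (1 / (real n + 1)\<^sup>2))" using le by (intro suminf_le s sB) simp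
    also have "\<dots> = B * (\<Sum>n. 1 / (real n + 1)\<^sup>2)" by (intro suminf_mult inverse_squares_le_3)
    also have "\<dots> \<le> B * 3" using order_trans[OF norm_ge_zero b[of 0]] by (intro mult_left_mono inverse_squares_le_3) auto
    finally show "(\<Sum>n. norm (c b n)) \<le> 3 * B" by simp
  qed
  have h1: "l1norm (tsum 0 (c b)) \<le> 12 * B" if b: "\<And>n. norm (b n) \<le> B" for b B
  proof -
    have B0: "B \<ge> 0" using order_trans[OF norm_ge_zero b[of 0]] .
    have "norm (tsum 0 (c b) x) \<le> 3 * B" for x
      unfolding tsum_def
      by (rule order_trans[OF norm_suminf_le[OF _ sc(1)] sc(2)]) (use b norm_psum_term[of "c b" _ 0 0 x] in auto)
    then have "l1norm (tsum 0 (c b)) \<le> 3 * B * pi"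
      using sc(1)[OF b] by (intro l1norm_le_sup tsum_continuous) auto
    also have "\<dots> \<le> 3 * B * 4" using B0 pi_less_4 by (intro mult_left_mono) auto
    finally show ?thesis by simp
  qed
  define p where "p = (\<lambda>b x. g x + tsum 0 (c b) x)"
  have ih: "integrable (lebesgue_on {0..pi}) (tsum 0 (c b))" if b: "\<And>n. norm (b n) \<le> B" for b B
    using sc(1)[OF b] by (intro continuous_imp_integrable_real tsum_continuous) auto
  have ip: "integrable (lebesgue_on {0..pi}) (p b)" if b: "\<And>n. norm (b n) \<le> B" for b B
    unfolding p_def using ig ih[OF b] by auto
  have p1: "l1norm (p b) \<le> 1 / 16" if b: "\<And>n. norm (b n) \<le> 1 / 512" for b
    using l1norm_triangle[OF ig ih[of b, OF b]] g1 h1[of b, OF b] by (simp add: p_def)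
  have podd: "odd_pi (p b)" if b: "\<And>n. norm (b n) \<le> B" for b B
    using g(2) tsum_odd[OF sc(1)[of b, OF b]] unfolding odd_pi_def p_def by simp
  have small: "pi * (1 / 16) \<le> (1 / 2 :: real)" using pi_less_4 by simp
  (* The corrections b solve b = R p, where p itself depends on b. *)
  define R where "R = (\<lambda>p n. - (s n * of_real ((real n + 1)\<^sup>2) * remainder p (of_nat (Suc n))))"
  have lip: "norm (R p n - R q n) \<le> 1 / 32 * l1norm (\<lambda>t. p t - q t)"
    if "integrable (lebesgue_on {0..pi}) p" "integrable (lebesgue_on {0..pi}) q" "l1norm p \<le> 1/16" "l1norm q \<le> 1/16" for p q n
  proof -
    have r: "norm (remainder p (of_nat (Suc n)) - remainder q (of_nat (Suc n))) \<le> 8 * (1/16)\<^sup>2 * l1norm (\<lambda>t. p t - q t) / (real n + 1)\<^sup>2"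
      using remainder_lipschitz[OF that small, of "real (Suc n)"] by (simp add: add.commute)
    have "R p n - R q n = s n * (of_real ((real n + 1)\<^sup>2) * (remainder q (of_nat (Suc n)) - remainder p (of_nat (Suc n))))"
      by (simp add: R_def algebra_simps)
    then have "norm (R p n - R q n) \<le> norm (complex_of_real ((real n + 1)\<^sup>2) * (remainder q (of_nat (Suc n)) - remainder p (of_nat (Suc n))))"
      using ns1 by simp
    also have "\<dots> = (real n + 1)\<^sup>2 * norm (remainder p (of_nat (Suc n)) - remainder q (of_nat (Suc n)))"
      unfolding norm_mult norm_of_real norm_minus_commute[of "remainder q (of_nat (Suc n))"] by simp
    also have "\<dots> \<le> (real n + 1)\<^sup>2 * (8 * (1/16)\<^sup>2 * l1norm (\<lambda>t. p t - q t) / (real n + 1)\<^sup>2)"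
      by (intro mult_left_mono r) simp
    also have "\<dots> = 1 / 32 * l1norm (\<lambda>t. p t - q t)"
    proof -
      have cancel: "X \<noteq> 0 \<Longrightarrow> X * (Y / X) = Y" for X Y :: real by simp
      have "(real n + 1)\<^sup>2 \<noteq> 0" by simp
      from cancel[OF this] show ?thesis by (simp add: power2_eq_square)
    qed
    finally show ?thesis .
  qed
  have Rb: "norm (R (p b) n) \<le> 1 / 512" if b: "\<And>n. norm (b n) \<le> 1 / 512" for b n
  proof -
    have "norm (R (p b) n - R (\<lambda>_. 0) n) \<le> 1 / 32 * l1norm (\<lambda>t. p b t - 0)"
      by (rule lip[OF ip[of b, OF b]]) (use p1[of b, OF b] in \<open>simp_all add: l1norm_def\<close>)
    then show ?thesis using p1[of b, OF b] by (simp add: R_def remainder_zero)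
  qed
  obtain b where b: "\<And>n. norm (b n) \<le> 1 / 512" "R (p b) = b"
  proof (rule sequence_contraction[of "1 / 512" "\<lambda>b. R (p b)" "3 / 8"])
    show "norm (R (p b) n) \<le> 1 / 512" if "\<And>n. norm (b n) \<le> 1 / 512" for b n by (rule Rb[OF that])
    show "norm (R (p b) n - R (p b') n) \<le> 3 / 8 * d"
      if b: "\<And>n. norm (b n) \<le> 1 / 512" and b': "\<And>n. norm (b' n) \<le> 1 / 512" and d: "\<And>n. norm (b n - b' n) \<le> d" for b b' d n
    proof -
      have "p b t - p b' t = tsum 0 (c (\<lambda>n. b n - b' n)) t" for t
      proof -
        have sm: "summable (\<lambda>n. c b n * trig 0 n t)" if b: "\<And>n. norm (b n) \<le> 1 / 512" for b
          by (rule summable_comparison_test'[OF sc(1)[of b, OF b]]) (use norm_psum_term[of "c b" _ 0 0 t] in simp)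
        show ?thesis
          using suminf_diff[OF sm[of b, OF b] sm[of b', OF b']] by (simp add: p_def tsum_def c_def diff_divide_distrib left_diff_distrib)
      qed
      then have l: "l1norm (\<lambda>t. p b t - p b' t) \<le> 12 * d"
        using h1[of "\<lambda>n. b n - b' n", OF d] by simp
      have "norm (R (p b) n - R (p b') n) \<le> 1 / 32 * l1norm (\<lambda>t. p b t - p b' t)"
        by (rule lip[OF ip[of b, OF b] ip[of b', OF b'] p1[of b, OF b] p1[of b', OF b']])
      also have "\<dots> \<le> 1 / 32 * (12 * d)" by (intro mult_left_mono l) simp
      finally show ?thesis by simp
    qed
  qed auto
  define q where "q = p b"
  define a where "a = (\<lambda>n. a0 n + c b n)"
  have bn: "b n = R q n" for n using b(2) by (simp add: q_def)
  have an: "a n = s n * (fn n - remainder q (of_nat (Suc n)))" for n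
  proof -
    have ne: "complex_of_real ((real n + 1)\<^sup>2) \<noteq> 0" by (simp only: of_real_eq_0_iff) simp
    have "c b n = - (s n * of_real ((real n + 1)\<^sup>2) * remainder q (of_nat (Suc n))) / of_real ((real n + 1)\<^sup>2)"
      unfolding c_def bn by (simp only: R_def)
    also have "\<dots> = - (s n * remainder q (of_nat (Suc n)))" using ne by (simp del: of_real_power)
    finally show ?thesis by (simp add: a_def a0_def algebra_simps)
  qed
  have "l2lim (\<lambda>N x. psum 0 a0 N x + psum 0 (c b) N x) q"
    unfolding q_def p_def by (intro l2lim_add g tsum_l2lim) (use sc(1)[of b, OF b(1)] in simp)
  moreover have "(\<lambda>N x. psum 0 a0 N x + psum 0 (c b) N x) = psum 0 a"
    by (intro ext) (simp add: psum_def a_def sum.distrib algebra_simps)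
  ultimately have lim: "l2lim (psum 0 a) q" by simp
  show ?thesis
  proof (rule that[OF lim])
    show "odd_pi q" unfolding q_def by (rule podd[of b, OF b(1)])
    show "l1norm q \<le> 1 / 16" unfolding q_def by (rule p1[of b, OF b(1)])
    fix n
    have ss: "((-1) ^ n * complex_of_real (pi / 2)) * s n = 1"
      by (simp add: s_def power_mult_distrib[symmetric])
    have "linear_part q (of_nat (Suc n)) = ((-1) ^ n * complex_of_real (pi / 2)) * (s n * (fn n - remainder q (of_nat (Suc n))))"
      unfolding linear_part_integer[OF lim] an ..
    also have "\<dots> = fn n - remainder q (of_nat (Suc n))" unfolding mult.assoc[symmetric, of _ "s n"] ss by simp
    finally show "linear_part q (of_nat (Suc n)) + remainder q (of_nat (Suc n)) = fn n" by simp
    show "norm (a n) \<le> norm (fn n) + norm (remainder q (of_nat (Suc n)))"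
      unfolding an by (rule order_trans[OF ns1 norm_triangle_ineq4])
  qed
qed

section \<open>From the samples to the whole plane\<close>

text \<open>
  Reflection about \<open>\<pi>/2\<close> shows that the two exponentials in the sine contribute equally.
\<close>

lemma linear_part_odd:
  assumes p: "integrable (lebesgue_on {0..pi}) p" and odd: "odd_pi p"
  shows "\<i> * linear_part p \<mu> = exp (\<i> * \<mu> * of_real pi) * fourier p \<mu>"
proof -
  have "exp (\<i> * (- \<mu>) * of_real pi) * fourier p (- \<mu>) = (LINT t|lebesgue_on {0..pi}. p (pi - t) * exp (\<i> * (- \<mu>) * of_real (pi - 2 * (pi - t))))"
    unfolding fourier_centred by (rule lint_reflect_pi)
  also have "\<dots> = (LINT t|lebesgue_on {0..pi}. - (p t * exp (\<i> * \<mu> * of_real (pi - 2 * t))))"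
  proof (rule Bochner_Integration.integral_cong[OF refl])
    fix t assume "t \<in> space (lebesgue_on {0..pi})"
    then have t: "p (pi - t) = - p t" using odd by (simp add: odd_pi_def)
    have "\<i> * (- \<mu>) * complex_of_real (pi - 2 * (pi - t)) = \<i> * \<mu> * of_real (pi - 2 * t)" by (simp add: algebra_simps)
    then show "p (pi - t) * exp (\<i> * (- \<mu>) * of_real (pi - 2 * (pi - t))) = - (p t * exp (\<i> * \<mu> * of_real (pi - 2 * t)))"
      unfolding t by simp
  qed
  also have "\<dots> = - (exp (\<i> * \<mu> * of_real pi) * fourier p \<mu>)" unfolding fourier_centred by (rule integral_minus)
  finally have "2 * (\<i> * linear_part p \<mu>) = 2 * (exp (\<i> * \<mu> * of_real pi) * fourier p \<mu>)"
    using linear_part_fourier[OF p, of \<mu>] by simp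
  then show ?thesis by (simp only: mult_left_cancel[of 2] zero_neq_numeral[symmetric] simp_thms)
qed

lemma norm_linear_part_odd:
  assumes p: "integrable (lebesgue_on {0..pi}) p" and odd: "odd_pi p"
  shows "norm (linear_part p (of_real x)) = norm (fourier p (of_real x))"
proof -
  have "norm (\<i> * linear_part p (of_real x)) = norm (exp (\<i> * of_real x * of_real pi) * fourier p (of_real x))"
    unfolding linear_part_odd[OF assms] ..
  then show ?thesis by (simp add: norm_mult norm_exp_eq_Re)
qed

lemma char_det_minus: "char_det p (- \<mu>) = char_det p \<mu>"
  by (simp add: char_det_def c_sol_def s_sol_def)

text \<open>
  Comparison with the zero potential, whose remainder is \<open>0\<close>.
\<close>

lemma remainder_decay:
  assumes p: "integrable (lebesgue_on {0..pi}) p" and p1: "l1norm p \<le> 1 / 16" and m: "\<bar>m\<bar> \<ge> 1"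
  shows "norm (remainder p (complex_of_real m)) \<le> 1 / m\<^sup>2"
proof -
  have "norm (remainder p (complex_of_real m) - remainder (\<lambda>_. 0) (complex_of_real m)) \<le> 8 * (1/16)\<^sup>2 * l1norm (\<lambda>t. p t - 0) / m\<^sup>2"
    by (rule remainder_lipschitz[OF p _ p1 _ _ m]) (use pi_less_4 in \<open>simp_all add: l1norm_def\<close>)
  also have "\<dots> \<le> 1 / m\<^sup>2" using p1 by (intro divide_right_mono) (simp_all add: power2_eq_square)
  finally show ?thesis by (simp add: remainder_zero)
qed

text \<open>
  The difference of the two sides, multiplied by \<open>\<mu>\<close>, vanishes at all integers: at positive ones by
  assumption, at negative ones by oddness. Its growth makes it \<open>c sin (\<pi> \<mu>)\<close>, and \<open>c = 0\<close> because all three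
  parts of the difference tend to \<open>0\<close> along the half integers, where the sine has modulus \<open>1\<close>. The value at
  \<open>\<mu> = 0\<close> follows by continuity.
\<close>

lemma char_det_eq_from_samples:
  fixes V :: "complex \<Rightarrow> complex"
  assumes V: "V holomorphic_on UNIV" and even: "\<And>\<mu>. V (- \<mu>) = V \<mu>"
    and ty: "exponential_type_le pi (\<lambda>\<mu>. \<mu> * V \<mu>)"
    and E: "\<And>a b. integral {a..b} (\<lambda>x. (norm (of_real x * V (of_real x)))\<^sup>2) \<le> E"
    and p: "L2c p" and odd: "odd_pi p" and p1: "l1norm p \<le> 1 / 16"
    and samples: "\<And>n. linear_part p (of_nat (Suc n)) + remainder p (of_nat (Suc n)) = of_nat (Suc n) * V (of_nat (Suc n))"
  shows "char_det p \<mu> = V \<mu>"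
proof -
  have ip: "integrable (lebesgue_on {0..pi}) p" by (rule L2c_integrable[OF p])
  have small: "pi * l1norm p \<le> 1 / 2"
  proof -
    have "pi * l1norm p \<le> 4 * (1 / 16)" using p1 pi_less_4 by (intro mult_mono) (auto simp: l1norm_nonneg)
    then show ?thesis by simp
  qed
  define F where "F = (\<lambda>\<mu>. \<mu> * V \<mu>)"
  define G where "G = (\<lambda>\<mu>. \<mu> * char_det p \<mu> - F \<mu>)"
  have hF: "F holomorphic_on UNIV" unfolding F_def by (intro holomorphic_intros V)
  have hG: "G holomorphic_on UNIV" unfolding G_def by (intro holomorphic_intros hF char_det_holomorphic ip small)
  have tyF: "exponential_type_le pi F" using ty unfolding F_def .
  have EF: "integral {a..b} (\<lambda>x. (norm (F (of_real x)))\<^sup>2) \<le> E" for a b using E by (simp add: F_def)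
  have GS: "G (of_nat (Suc n)) = 0" for n
    using samples[of n] char_det_odd[OF ip odd, of "of_nat (Suc n)"] by (simp add: G_def F_def del: of_nat_Suc)
  have Godd: "G (- z) = - G z" for z by (simp add: G_def F_def char_det_minus even)
  have zero: "G (of_int n) = 0" for n :: int
  proof (cases n rule: int_cases)
    case (nonneg k)
    then show ?thesis by (cases k) (use GS in \<open>auto simp: G_def F_def simp del: of_nat_Suc\<close>)
  next
    case (neg k)
    then have "complex_of_int n = - of_nat (Suc k)" by simp
    then show ?thesis using GS[of k] Godd[of "of_nat (Suc k)"] by (simp only: minus_zero)
  qed
  have "norm (G z) \<le> (2 * l1norm p + (1 + exp pi) * sqrt E) * exp (pi * \<bar>Im z\<bar>)" for z
    using norm_triangle_ineq4[of "z * char_det p z" "F z"] char_det_growth[OF ip small, of z] real_line_bound[OF hF tyF _ EF, of z]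
    by (simp add: G_def distrib_right)
  from entire_vanishing_at_integers[OF hG zero this] obtain c where c: "\<And>z. G z = c * sin (of_real pi * z)" by blast
  define h where "h = (\<lambda>n. real n + 1 / 2)"
  have "(\<lambda>n. G (of_real (h n))) \<longlonglongrightarrow> 0"
  proof -
    have "(\<lambda>n. norm (fourier p (of_real (h n)))) \<longlonglongrightarrow> 0"
      using fourier_half_tendsto[OF p] unfolding h_def by (rule tendsto_norm_zero)
    then have 1: "(\<lambda>n. linear_part p (of_real (h n))) \<longlonglongrightarrow> 0" unfolding norm_linear_part_odd[OF ip odd, symmetric] by (rule tendsto_norm_zero_cancel)
    have 2: "(\<lambda>n. remainder p (of_real (h n))) \<longlonglongrightarrow> 0"
    proof (rule Lim_null_comparison)
      have "norm (remainder p (of_real (h n))) \<le> 1 / real n" if n: "n \<ge> 1" for n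
      proof -
        have "norm (remainder p (of_real (h n))) \<le> 1 / (h n)\<^sup>2" using n by (intro remainder_decay ip p1) (simp add: h_def)
        also have "\<dots> \<le> 1 / real n"
        proof (rule divide_left_mono)
          show "real n \<le> (h n)\<^sup>2" by (simp add: h_def power2_eq_square algebra_simps)
          show "0 < (h n)\<^sup>2 * real n" using n by (intro mult_pos_pos zero_less_power) (simp_all add: h_def)
        qed simp
        finally show ?thesis .
      qed
      then show "eventually (\<lambda>n. norm (remainder p (of_real (h n))) \<le> 1 / real n) sequentially"
        unfolding eventually_sequentially by blast
      show "(\<lambda>n. 1 / real n) \<longlonglongrightarrow> 0" by (rule lim_1_over_n)
    qed
    have 3: "(\<lambda>n. F (of_real (h n))) \<longlonglongrightarrow> 0"
    proof -
      have le: "(\<Sum>n<N. (norm (F (of_real (h n))))\<^sup>2) \<le> (1 + exp pi)\<^sup>2 * E" for N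
        using Plancherel_Polya[OF hF tyF _ EF, where b = "1 / 2" and N = N] by (simp add: h_def add.commute)
      have "summable (\<lambda>n. (norm (F (of_real (h n))))\<^sup>2)" by (rule summableI_nonneg_bounded[OF _ le]) simp
      then have "(\<lambda>n. sqrt ((norm (F (of_real (h n))))\<^sup>2)) \<longlonglongrightarrow> sqrt 0" by (intro tendsto_real_sqrt summable_LIMSEQ_zero)
      then show ?thesis unfolding real_sqrt_abs abs_norm_cancel real_sqrt_zero by (rule tendsto_norm_zero_cancel)
    qed
    have "h n \<noteq> 0" for n by (simp add: h_def add_eq_0_iff)
    then have "G (of_real (h n)) = linear_part p (of_real (h n)) + remainder p (of_real (h n)) - F (of_real (h n))" for n
      using char_det_odd[OF ip odd, of "of_real (h n)"] by (simp add: G_def)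
    then show ?thesis using tendsto_diff[OF tendsto_add[OF 1 2] 3] by simp
  qed
  then have "(\<lambda>n. norm (G (of_real (h n)))) \<longlonglongrightarrow> 0" by (rule tendsto_norm_zero)
  moreover have "norm (G (of_real (h n))) = norm c" for n
  proof -
    have "sin (of_real pi * complex_of_real (h n)) = complex_of_real (sin (pi * h n))" by (simp only: of_real_mult[symmetric] sin_of_real)
    also have "sin (pi * h n) = (-1) ^ n"
      using sin_add[of "real n * pi" "pi / 2"] by (simp add: h_def distrib_left mult.commute[of pi] )
    finally show ?thesis by (simp add: c norm_mult norm_power)
  qed
  ultimately have "norm c = 0" by (simp add: LIMSEQ_const_iff)
  then have G0: "G z = 0" for z by (simp add: c)
  have eq: "char_det p z = V z" if "z \<noteq> 0" for z using G0[of z] that by (simp add: G_def F_def)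
  show ?thesis
  proof (cases "\<mu> = 0")
    case True
    have cc: "isCont f 0" if "f holomorphic_on UNIV" for f :: "complex \<Rightarrow> complex"
      using holomorphic_on_imp_continuous_on[OF that] by (simp add: continuous_on_eq_continuous_at)
    have "(char_det p \<longlongrightarrow> char_det p 0) (at 0)" using cc[OF char_det_holomorphic[OF ip small]] by (simp add: isCont_def)
    moreover have "(char_det p \<longlongrightarrow> V 0) (at 0)"
    proof (rule Lim_transform_eventually[of V])
      show "(V \<longlongrightarrow> V 0) (at 0)" using cc[OF V] by (simp add: isCont_def)
      show "eventually (\<lambda>z. V z = char_det p z) (at 0)"
        unfolding eventually_at by (intro exI[of _ 1]) (simp add: eq)
    qed
    ultimately show ?thesis unfolding True by (rule LIM_unique)
  qed (rule eq)
qed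

section \<open>Smoothness of the potential\<close>

lemma solves_AE_cong:
  assumes "AE x in lebesgue_on {0..pi}. p x = q x"
  shows "solves p lam u \<longleftrightarrow> solves q lam u"
proof -
  have imp: "solves q' lam u" if s: "solves p' lam u" and ae: "AE x in lebesgue_on {0..pi}. p' x = q' x" for p' q'
  proof -
    from s obtain u' u'' where 1: "\<forall>x\<in>{0..pi}. (u has_vector_derivative u' x) (at x within {0..pi})" "primitive_of u' u''"
      and 2: "AE x in lebesgue_on {0..pi}. u'' x - p' x * u x + lam * u x = 0"
      unfolding solves_def by blast
    have "AE x in lebesgue_on {0..pi}. u'' x - q' x * u x + lam * u x = 0"
      using ae 2 by eventually_elim simp
    with 1 show ?thesis unfolding solves_def by blast
  qed
  have "AE x in lebesgue_on {0..pi}. q x = p x" using assms by eventually_elim simp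
  then show ?thesis using imp assms by blast
qed

lemma char_det_AE_cong:
  assumes "AE x in lebesgue_on {0..pi}. p x = q x"
  shows "char_det p = char_det q"
  by (intro ext) (simp add: char_det_def c_sol_def s_sol_def solves_AE_cong[OF assms])

text \<open>
  The remainder is the difference of two quantities that depend on the potential only up to null sets.
\<close>

lemma remainder_AE_cong:
  assumes p: "integrable (lebesgue_on {0..pi}) p" "odd_pi p" and q: "integrable (lebesgue_on {0..pi}) q" "odd_pi q"
    and ae: "AE x in lebesgue_on {0..pi}. p x = q x" and m: "\<mu> \<noteq> 0"
  shows "remainder p \<mu> = remainder q \<mu>"
proof -
  have i: "integrable (lebesgue_on {0..pi}) (\<lambda>t. f t * sin (\<mu> * of_real (pi - 2 * t)))" if "integrable (lebesgue_on {0..pi}) f" for f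
    by (intro integrable_mult_cont that continuous_intros)
  have "linear_part p \<mu> = linear_part q \<mu>"
    unfolding linear_part_def
  proof (rule integral_cong_AE)
    show "AE t in lebesgue_on {0..pi}. p t * sin (\<mu> * of_real (pi - 2 * t)) = q t * sin (\<mu> * of_real (pi - 2 * t))"
      using ae by eventually_elim simp
  qed (use i[OF p(1)] i[OF q(1)] in auto)
  then show ?thesis
    using char_det_odd[OF p m] char_det_odd[OF q m] char_det_AE_cong[OF ae] by simp
qed

text \<open>
  Square summability with weight of order \<open>k\<close> gives absolute summability with weight of order less than
  \<open>k\<close>, since \<open>1 / (n + 1)\<close> is square summable.
\<close>

lemma weighted_coefficients:
  assumes s: "summable (\<lambda>n. ((real n + 1) ^ k * norm (a n))\<^sup>2)"
  shows weighted_coefficients_square: "i \<le> k \<Longrightarrow> summable (\<lambda>n. (norm (a n) * (2 * (real n + 1)) ^ i)\<^sup>2)"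
    and weighted_coefficients_abs: "i < k \<Longrightarrow> summable (\<lambda>n. norm (a n) * (2 * (real n + 1)) ^ i)"
proof -
  have le: "norm (a n) * (2 * (real n + 1)) ^ i \<le> 2 ^ i * ((real n + 1) ^ k * norm (a n))" if "i \<le> k" for i n
  proof -
    have "(real n + 1) ^ i \<le> (real n + 1) ^ k" using that by (intro power_increasing) auto
    then have "2 ^ i * norm (a n) * (real n + 1) ^ i \<le> 2 ^ i * norm (a n) * (real n + 1) ^ k" by (intro mult_left_mono) auto
    then show ?thesis by (simp only: power_mult_distrib mult_ac)
  qed
  show "summable (\<lambda>n. (norm (a n) * (2 * (real n + 1)) ^ i)\<^sup>2)" if i: "i \<le> k"
  proof (rule summable_comparison_test'[OF summable_mult[OF s, of "(2 ^ i)\<^sup>2"]])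
    fix n
    have "(norm (a n) * (2 * (real n + 1)) ^ i)\<^sup>2 \<le> (2 ^ i * ((real n + 1) ^ k * norm (a n)))\<^sup>2"
      by (intro power_mono le i) simp
    then show "norm ((norm (a n) * (2 * (real n + 1)) ^ i)\<^sup>2) \<le> (2 ^ i)\<^sup>2 * ((real n + 1) ^ k * norm (a n))\<^sup>2"
      unfolding power_mult_distrib[of "2 ^ i"] by simp
  qed
  show "summable (\<lambda>n. norm (a n) * (2 * (real n + 1)) ^ i)" if i: "i < k"
  proof (rule summable_comparison_test'[OF summable_mult[OF summable_add[OF s inverse_squares_le_3(1)], of "2 ^ i"]])
    fix n
    define Y where "Y = (real n + 1) ^ k * norm (a n)"
    define r where "r = 1 / (real n + 1)"
    have "(real n + 1) ^ Suc i \<le> (real n + 1) ^ k" using i by (intro power_increasing) auto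
    then have "norm (a n) * (real n + 1) ^ Suc i \<le> norm (a n) * (real n + 1) ^ k" by (intro mult_left_mono) auto
    then have "norm (a n) * (real n + 1) ^ Suc i * r \<le> Y * r" unfolding Y_def by (intro mult_right_mono) (auto simp: r_def mult.commute)
    moreover have "norm (a n) * (real n + 1) ^ Suc i * r = norm (a n) * (real n + 1) ^ i" by (simp add: r_def add_eq_0_iff)
    moreover have "2 * (Y * r) \<le> Y\<^sup>2 + r\<^sup>2" using sum_squares_bound[of Y r] by simp
    moreover have "Y * r \<ge> 0" by (simp add: Y_def r_def)
    ultimately have "norm (a n) * (real n + 1) ^ i \<le> Y\<^sup>2 + r\<^sup>2" by linarith
    then have "2 ^ i * (norm (a n) * (real n + 1) ^ i) \<le> 2 ^ i * (Y\<^sup>2 + r\<^sup>2)" by (intro mult_left_mono) auto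
    moreover have "r\<^sup>2 = 1 / (real n + 1)\<^sup>2" by (simp add: r_def power_divide)
    moreover have "norm (norm (a n) * (2 * (real n + 1)) ^ i) = 2 ^ i * (norm (a n) * (real n + 1) ^ i)"
      unfolding power_mult_distrib by simp
    ultimately show "norm (norm (a n) * (2 * (real n + 1)) ^ i) \<le> 2 ^ i * (((real n + 1) ^ k * norm (a n))\<^sup>2 + 1 / (real n + 1)\<^sup>2)"
      by (simp only: Y_def)
  qed
qed

text \<open>
  The identity holds for the partial sums and passes to the limit, uniformly on the left and in mean square
  on the right.
\<close>

lemma tsum_primitive:
  assumes s: "summable (\<lambda>n. norm (a n) * (2 * (real n + 1)) ^ i)" and h: "l2lim (psum (Suc i) a) h"
  shows "primitive_of (tsum i a) h"
proof -
  have ih: "integrable (lebesgue_on {0..pi}) h" using h by (auto simp: l2lim_def intro: L2c_integrable)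
  have "tsum i a x = tsum i a 0 + (LINT t|lebesgue_on {0..x}. h t)" if x: "x \<in> {0..pi}" for x
  proof (rule LIMSEQ_unique)
    have pt: "(\<lambda>N. psum i a N y) \<longlonglongrightarrow> tsum i a y" for y
      by (rule tendsto_uniform_limitI[OF psum_uniform_limit[OF s, of UNIV]]) simp
    then show "(\<lambda>N. psum i a N x) \<longlonglongrightarrow> tsum i a x" .
    have "(psum i a N has_vector_derivative psum (Suc i) a N y) (at y within {0..pi})" for N y
    proof -
      have "((\<lambda>x. \<Sum>n<N. (a n * of_real (2 * (real n + 1)) ^ i) * trig i n x) has_vector_derivative
         (\<Sum>n<N. (a n * of_real (2 * (real n + 1)) ^ i) * (of_real (2 * (real n + 1)) * trig (Suc i) n y))) (at y within {0..pi})"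
        by (intro has_vector_derivative_sum has_vector_derivative_mult_right trig_deriv)
      then show ?thesis unfolding psum_def[abs_def] power_Suc2 mult.assoc .
    qed
    from lint_eq_diff[OF this psum_continuous x]
    have "psum i a N x = psum i a N 0 + (LINT t|lebesgue_on {0..x}. psum (Suc i) a N t * 1)" for N by simp
    moreover have "(\<lambda>N. psum i a N 0 + (LINT t|lebesgue_on {0..x}. psum (Suc i) a N t * 1)) \<longlonglongrightarrow> tsum i a 0 + (LINT t|lebesgue_on {0..x}. h t * 1)"
      by (intro tendsto_add pt l2lim_integral[OF h _ x] continuous_on_const)
    ultimately show "(\<lambda>N. psum i a N x) \<longlonglongrightarrow> tsum i a 0 + (LINT t|lebesgue_on {0..x}. h t)" by simp
  qed
  with ih show ?thesis unfolding primitive_of_def by blast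
qed

text \<open>
  The chain of derivatives of the series. Only the last one may fail to be continuous, and there a mean
  square limit replaces the sum. The representative \<open>P 0\<close> may differ from \<open>p\<close> on a null set.
\<close>

lemma chain_exists:
  assumes s: "summable (\<lambda>n. ((real n + 1) ^ k * norm (a n))\<^sup>2)" and p: "l2lim (psum 0 a) p" "odd_pi p"
  obtains P where "\<And>i. i \<le> k \<Longrightarrow> l2lim (psum i a) (P i)" "\<And>i. i < k \<Longrightarrow> P i = tsum i a"
    "\<And>i. i < k \<Longrightarrow> primitive_of (P i) (P (Suc i))" "odd_pi (P 0)"
proof -
  obtain g where g: "l2lim (psum k a) g" "k = 0 \<Longrightarrow> odd_pi g"
    using psum_limit_exists[OF weighted_coefficients_square[OF s order_refl]] by blast
  define P where "P = (\<lambda>i. if i < k then tsum i a else g)"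
  have 1: "l2lim (psum i a) (P i)" if "i \<le> k" for i
    using that g(1) tsum_l2lim[OF weighted_coefficients_abs[OF s]] by (cases "i = k") (auto simp: P_def)
  have 2: "P i = tsum i a" if "i < k" for i using that by (simp add: P_def)
  have 3: "primitive_of (P i) (P (Suc i))" if "i < k" for i
    unfolding 2[OF that] by (rule tsum_primitive[OF weighted_coefficients_abs[OF s that] 1]) (use that in simp)
  have 4: "odd_pi (P 0)"
  proof (cases "k = 0")
    case False
    then have "summable (\<lambda>n. norm (a n) * (2 * (real n + 1)) ^ 0)" by (intro weighted_coefficients_abs[OF s]) simp
    then show ?thesis using False tsum_odd[of a] by (simp add: P_def)
  qed (use g(2) in \<open>simp add: P_def\<close>)
  show ?thesis by (rule that[of P, OF 1 2 3 4])
qed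

lemma l1norm_AE_cong:
  assumes "integrable (lebesgue_on {0..pi}) p" "integrable (lebesgue_on {0..pi}) q" "AE x in lebesgue_on {0..pi}. p x = q x"
  shows "l1norm p = l1norm q"
  unfolding l1norm_def by (rule integral_cong_AE) (use assms in auto)

text \<open>
  The decay of the third order part is transferred from the smooth representative \<open>P 0\<close> to \<open>p\<close>.
\<close>

lemma remainder_decay_smooth:
  assumes s: "summable (\<lambda>n. ((real n + 1) ^ k * norm (a n))\<^sup>2)" and p: "l2lim (psum 0 a) p" "odd_pi p" "l1norm p \<le> 1 / 16"
    and zero: "\<And>i. i < k \<Longrightarrow> tsum i a 0 = 0"
  obtains C where "\<And>x. \<bar>x\<bar> \<ge> 1 \<Longrightarrow> norm (remainder p (complex_of_real x)) \<le> C / \<bar>x\<bar> ^ (k + 2)"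
proof -
  obtain P where P: "\<And>i. i \<le> k \<Longrightarrow> l2lim (psum i a) (P i)" "\<And>i. i < k \<Longrightarrow> P i = tsum i a"
    "\<And>i. i < k \<Longrightarrow> primitive_of (P i) (P (Suc i))" "odd_pi (P 0)"
    using chain_exists[OF s p(1,2)] by blast
  have iP: "integrable (lebesgue_on {0..pi}) (P i)" if "i \<le> k" for i
    using P(1)[OF that] by (auto simp: l2lim_def intro: L2c_integrable)
  have ip: "integrable (lebesgue_on {0..pi}) p" using p(1) by (auto simp: l2lim_def intro: L2c_integrable)
  have ae: "AE x in lebesgue_on {0..pi}. p x = P 0 x" by (rule l2lim_unique[OF p(1) P(1)]) simp
  have l: "l1norm (P 0) \<le> 1 / 16" using l1norm_AE_cong[OF ip iP ae] p(3) by simp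
  have "pi * l1norm (P 0) \<le> 4 * (1 / 16)" using l pi_less_4 by (intro mult_mono) (auto simp: l1norm_nonneg)
  then have small: "pi * l1norm (P 0) \<le> 1 / 2" by simp
  obtain C where C: "\<And>x. \<bar>x\<bar> \<ge> 1 \<Longrightarrow> norm (scattering3 (P 0) (complex_of_real x)) \<le> C / \<bar>x\<bar> ^ (k + 2)"
    using scattering3_decay[of k P, OF P(3) _ _ iP small] P(2) zero by (auto simp: tsum_pi)
  have "norm (remainder p (complex_of_real x)) \<le> C / \<bar>x\<bar> ^ (k + 2)" if x: "\<bar>x\<bar> \<ge> 1" for x
  proof -
    have "norm (remainder (P 0) (of_real x) - (exp (\<i> * of_real x * of_real pi) * 0 - exp (- \<i> * of_real x * of_real pi) * 0) / (2 * \<i>)) \<le> C / \<bar>x\<bar> ^ (k + 2)"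
      by (rule remainder_bound) (use C[of x] C[of "- x"] x in simp_all)
    moreover have "remainder p (of_real x) = remainder (P 0) (of_real x)"
      using x by (intro remainder_AE_cong ip p iP P(4) ae) auto
    ultimately show ?thesis by simp
  qed
  then show ?thesis by (rule that)
qed

text \<open>
  At the half integers \<open>exp (- 2 \<i> \<mu> \<pi>) = -1\<close>, so that equal boundary values add up instead of cancelling.
\<close>

lemma fourier_by_parts:
  assumes U: "primitive_of U u" and e: "U pi = U 0" and h: "\<mu> = of_real (real n + 1 / 2)"
  shows "fourier u \<mu> = 2 * \<i> * \<mu> * fourier U \<mu> - 2 * U 0"
proof -
  define c where "c = - 2 * \<i> * \<mu>"
  have cU: "continuous_on {0..pi} U" by (rule primitive_of_continuous[OF U])
  have iu: "integrable (lebesgue_on {0..pi}) u" by (rule primitive_of_integrable[OF U])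
  have i1: "integrable (lebesgue_on {0..pi}) (\<lambda>t. u t * exp (c * of_real t))" by (intro integrable_mult_cont iu continuous_intros)
  have i2: "integrable (lebesgue_on {0..pi}) (\<lambda>t. c * (U t * exp (c * of_real t)))" by (intro continuous_imp_integrable_real continuous_intros cU)
  have "exp (c * of_real pi) = - 1"
  proof -
    have "c * of_real pi = - (2 * of_nat n * of_real pi * \<i>) - of_real pi * \<i>" by (simp add: c_def h algebra_simps)
    then have "exp (c * of_real pi) = exp (- (2 * of_nat n * of_real pi * \<i>)) / exp (of_real pi * \<i>)" by (simp add: exp_diff)
    also have "exp (- (2 * of_nat n * of_real pi * \<i>)) = 1" using exp_integer_2pi[of "- of_nat n"] by simp
    finally show ?thesis by (simp add: exp_pi_i)
  qed
  moreover have "primitive_of (\<lambda>t. exp (c * of_real t)) (\<lambda>t. c * exp (c * of_real t))" by (rule exp_primitive)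
  note primitive_ofD[OF primitive_of_mult[OF U this], of pi]
  ultimately have "- U 0 = U 0 + (LINT t|lebesgue_on {0..pi}. u t * exp (c * of_real t) + c * (U t * exp (c * of_real t)))"
    using e by (simp add: mult.left_commute)
  then have "- U 0 = U 0 + (LINT t|lebesgue_on {0..pi}. u t * exp (c * of_real t)) + c * (LINT t|lebesgue_on {0..pi}. U t * exp (c * of_real t))"
    unfolding Bochner_Integration.integral_add[OF i1 i2] by simp
  then have "- U 0 = U 0 + fourier u \<mu> + c * fourier U \<mu>" unfolding fourier_def c_def .
  note eq = this
  have "fourier u \<mu> = (U 0 + fourier u \<mu> + c * fourier U \<mu>) - U 0 - c * fourier U \<mu>" by simp
  also have "\<dots> = - U 0 - U 0 - c * fourier U \<mu>" by (simp only: eq[symmetric])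
  finally have "fourier u \<mu> = - (c * fourier U \<mu>) - (U 0 + U 0)" by simp
  then show ?thesis by (simp add: c_def)
qed

text \<open>
  Iterated integration by parts at the half integers expresses the boundary value of the derivative of order
  \<open>k\<close> by the Fourier transform of the derivative of order \<open>k + 1\<close>, which tends to \<open>0\<close>, and by \<open>\<mu>^(k + 1)\<close>
  times the transform of \<open>p\<close>. The latter has the modulus of the sine transform, which is the data minus the
  remainder, and both decay fast enough. At the integers this argument would give nothing.
\<close>

lemma boundary_values_vanish:
  fixes F :: "real \<Rightarrow> complex"
  assumes s: "summable (\<lambda>n. ((real n + 1) ^ Suc k * norm (a n))\<^sup>2)" and p: "l2lim (psum 0 a) p" "odd_pi p"
    and zero: "\<And>i. i < k \<Longrightarrow> tsum i a 0 = 0"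
    and rem: "\<And>x. \<bar>x\<bar> \<ge> 1 \<Longrightarrow> norm (remainder p (complex_of_real x)) \<le> C / \<bar>x\<bar> ^ (k + 2)"
    and half: "\<And>n. linear_part p (of_real (real n + 1/2)) + remainder p (of_real (real n + 1/2)) = F (real n + 1/2)"
    and F: "(\<lambda>n. (real n + 1/2) ^ Suc k * norm (F (real n + 1/2))) \<longlonglongrightarrow> 0"
  shows "tsum k a 0 = 0"
proof -
  define h where "h = (\<lambda>n. real n + 1 / 2)"
  have h0: "h n > 0" for n by (simp add: h_def)
  obtain P where P: "\<And>i. i \<le> Suc k \<Longrightarrow> l2lim (psum i a) (P i)" "\<And>i. i < Suc k \<Longrightarrow> P i = tsum i a"
    "\<And>i. i < Suc k \<Longrightarrow> primitive_of (P i) (P (Suc i))" "odd_pi (P 0)"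
    using chain_exists[OF s p] by blast
  have ip: "integrable (lebesgue_on {0..pi}) p" using p(1) by (auto simp: l2lim_def intro: L2c_integrable)
  have iP: "integrable (lebesgue_on {0..pi}) (P 0)" using P(1)[of 0] by (auto simp: l2lim_def intro: L2c_integrable)
  have ae: "AE x in lebesgue_on {0..pi}. P 0 x = p x" by (rule l2lim_unique[OF P(1) p(1)]) simp
  have step: "fourier (P (Suc i)) (of_real (h n)) = 2 * \<i> * of_real (h n) * fourier (P i) (of_real (h n)) - 2 * P i 0" if "i < Suc k" for i n
    by (rule fourier_by_parts[OF P(3)[OF that]]) (use P(2)[OF that] in \<open>simp_all add: tsum_pi h_def\<close>)
  have pow: "fourier (P i) (of_real (h n)) = (2 * \<i> * of_real (h n)) ^ i * fourier (P 0) (of_real (h n))" if "i \<le> k" for i n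
    using that
  proof (induction i)
    case (Suc i)
    then have "P i 0 = 0" using P(2)[of i] zero[of i] by simp
    then show ?case using Suc step[of i n] by simp
  qed simp
  have "fourier (P 0) \<mu> = fourier p \<mu>" for \<mu>
    unfolding fourier_def
  proof (rule integral_cong_AE)
    show "AE t in lebesgue_on {0..pi}. P 0 t * exp (- 2 * \<i> * \<mu> * of_real t) = p t * exp (- 2 * \<i> * \<mu> * of_real t)"
      using ae by eventually_elim simp
    show "(\<lambda>t. P 0 t * exp (- 2 * \<i> * \<mu> * of_real t)) \<in> borel_measurable (lebesgue_on {0..pi})"
      "(\<lambda>t. p t * exp (- 2 * \<i> * \<mu> * of_real t)) \<in> borel_measurable (lebesgue_on {0..pi})"
      by (intro borel_measurable_integrable integrable_mult_cont iP ip continuous_intros)+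
  qed
  then have "norm (fourier (P 0) (of_real (h n))) = norm (linear_part p (of_real (h n)))" for n
    by (simp add: norm_linear_part_odd[OF ip p(2)])
  then have nP: "norm ((2 * \<i> * of_real (h n)) ^ Suc k * fourier (P 0) (of_real (h n))) = 2 ^ Suc k * (h n ^ Suc k * norm (linear_part p (of_real (h n))))" for n
    unfolding norm_mult norm_power using h0[of n] by (simp add: power_mult_distrib)
  have lim: "(\<lambda>n. (2 * \<i> * of_real (h n)) ^ Suc k * fourier (P 0) (of_real (h n))) \<longlonglongrightarrow> 0"
  proof (rule Lim_null_comparison)
    have "h n ^ Suc k * norm (linear_part p (of_real (h n))) \<le> h n ^ Suc k * norm (F (h n)) + \<bar>C\<bar> * (1 / real n)" if n: "n \<ge> 1" for n
    proof -
      have "linear_part p (of_real (h n)) = F (h n) - remainder p (of_real (h n))"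
        using half[of n] unfolding h_def by (simp add: eq_diff_eq)
      then have "norm (linear_part p (of_real (h n))) \<le> norm (F (h n)) + norm (remainder p (of_real (h n)))"
        by (simp add: norm_triangle_ineq4)
      also have "\<dots> \<le> norm (F (h n)) + C / h n ^ (k + 2)" using rem[of "h n"] n by (simp add: h_def)
      finally have "h n ^ Suc k * norm (linear_part p (of_real (h n))) \<le> h n ^ Suc k * (norm (F (h n)) + C / h n ^ (k + 2))"
        using h0[of n] by (intro mult_left_mono) auto
      also have "\<dots> = h n ^ Suc k * norm (F (h n)) + C / h n" using h0[of n] by (simp add: distrib_left)
      also have "C / h n \<le> \<bar>C\<bar> / h n" using h0[of n] by (intro divide_right_mono) auto
      also have "\<bar>C\<bar> / h n \<le> \<bar>C\<bar> / real n" using n by (intro divide_left_mono) (auto simp: h_def)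
      finally show ?thesis by simp
    qed
    then have "norm ((2 * \<i> * of_real (h n)) ^ Suc k * fourier (P 0) (of_real (h n))) \<le> 2 ^ Suc k * (h n ^ Suc k * norm (F (h n)) + \<bar>C\<bar> * (1 / real n))" if "n \<ge> 1" for n
      unfolding nP using that by (intro mult_left_mono) auto
    then show "eventually (\<lambda>n. norm ((2 * \<i> * of_real (h n)) ^ Suc k * fourier (P 0) (of_real (h n))) \<le> 2 ^ Suc k * (h n ^ Suc k * norm (F (h n)) + \<bar>C\<bar> * (1 / real n))) sequentially"
      unfolding eventually_sequentially by blast
    have "(\<lambda>n. 2 ^ Suc k * (h n ^ Suc k * norm (F (h n)) + \<bar>C\<bar> * (1 / real n))) \<longlonglongrightarrow> 2 ^ Suc k * (0 + \<bar>C\<bar> * 0)"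
      unfolding h_def by (intro tendsto_intros F lim_1_over_n)
    then show "(\<lambda>n. 2 ^ Suc k * (h n ^ Suc k * norm (F (h n)) + \<bar>C\<bar> * (1 / real n))) \<longlonglongrightarrow> 0" by simp
  qed
  have lim2: "(\<lambda>n. fourier (P (Suc k)) (of_real (h n))) \<longlonglongrightarrow> 0"
    unfolding h_def by (rule fourier_half_tendsto) (use P(1)[of "Suc k"] in \<open>simp add: l2lim_def\<close>)
  have "2 * P k 0 = (2 * \<i> * of_real (h n)) ^ Suc k * fourier (P 0) (of_real (h n)) - fourier (P (Suc k)) (of_real (h n))" for n
    using step[of k n] pow[of k n] by simp
  then have "(\<lambda>n::nat. 2 * P k 0) \<longlonglongrightarrow> 0 - 0" using tendsto_diff[OF lim lim2] by simp
  then have "2 * P k 0 = 0" unfolding LIMSEQ_const_iff by simp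
  then show ?thesis using P(2)[of k] by simp
qed

text \<open>
  One step: the boundary values of order less than \<open>k\<close> vanish, so the remainder decays like \<open>1/x^(k + 2)\<close>.
  Hence the coefficients are square summable with weight \<open>k + 1\<close>, and the boundary value of order \<open>k\<close>
  vanishes as well.
\<close>

lemma bootstrap:
  fixes F :: "real \<Rightarrow> complex"
  assumes p: "l2lim (psum 0 a) p" "odd_pi p" "l1norm p \<le> 1 / 16"
    and an: "\<And>n. norm (a n) \<le> norm (F (real n + 1)) + norm (remainder p (of_real (real n + 1)))"
    and half: "\<And>n. linear_part p (of_real (real n + 1/2)) + remainder p (of_real (real n + 1/2)) = F (real n + 1/2)"
    and sF: "\<And>i. i \<le> m \<Longrightarrow> summable (\<lambda>n. ((real n + 1) ^ i * norm (F (real n + 1)))\<^sup>2)"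
    and tF: "\<And>i. i \<le> m \<Longrightarrow> (\<lambda>n. (real n + 1/2) ^ i * norm (F (real n + 1/2))) \<longlonglongrightarrow> 0"
  shows "k \<le> m \<Longrightarrow> summable (\<lambda>n. ((real n + 1) ^ k * norm (a n))\<^sup>2) \<and> (\<forall>i<k. tsum i a 0 = 0)"
proof (induction k)
  have sum: "summable (\<lambda>n. ((real n + 1) ^ i * norm (a n))\<^sup>2)"
    if i: "i \<le> m" and C: "\<And>x. \<bar>x\<bar> \<ge> 1 \<Longrightarrow> norm (remainder p (complex_of_real x)) \<le> C / \<bar>x\<bar> ^ (i + 1)" for i C
  proof (rule summable_comparison_test'[OF summable_add[OF summable_mult[OF sF[OF i], of 2] summable_mult[OF inverse_squares_le_3(1), of "2 * C\<^sup>2"]]])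
    fix n
    define r where "r = real n + 1"
    have r: "r \<ge> 1" by (simp add: r_def)
    have "norm (a n) \<le> norm (F r) + C / r ^ (i + 1)" using an[of n] C[of r] r unfolding r_def by simp
    then have "r ^ i * norm (a n) \<le> r ^ i * (norm (F r) + C / r ^ (i + 1))" using r by (intro mult_left_mono) auto
    also have "\<dots> = r ^ i * norm (F r) + C / r" using r by (simp add: distrib_left)
    finally have "(r ^ i * norm (a n))\<^sup>2 \<le> (r ^ i * norm (F r) + C / r)\<^sup>2" using r by (intro power_mono) auto
    also have "\<dots> \<le> 2 * (r ^ i * norm (F r))\<^sup>2 + 2 * (C / r)\<^sup>2" using sum_squares_bound[of "r ^ i * norm (F r)" "C / r"] by (simp add: power2_sum)
    finally show "norm (((real n + 1) ^ i * norm (a n))\<^sup>2) \<le> 2 * ((real n + 1) ^ i * norm (F (real n + 1)))\<^sup>2 + 2 * C\<^sup>2 * (1 / (real n + 1)\<^sup>2)"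
      by (simp add: r_def power_divide)
  qed
  {
    case 0
    have ip: "integrable (lebesgue_on {0..pi}) p" using p(1) by (auto simp: l2lim_def intro: L2c_integrable)
    have "norm (remainder p (complex_of_real x)) \<le> 1 / \<bar>x\<bar> ^ (0 + 1)" if x: "\<bar>x\<bar> \<ge> 1" for x
    proof -
      have "1 / x\<^sup>2 \<le> 1 / \<bar>x\<bar> ^ (0 + 1)"
      proof (rule divide_left_mono)
        show "\<bar>x\<bar> ^ (0 + 1) \<le> x\<^sup>2" using power_increasing[of 1 2 "\<bar>x\<bar>"] x by simp
        show "0 < x\<^sup>2 * \<bar>x\<bar> ^ (0 + 1)" using x by auto
      qed simp
      then show ?thesis using remainder_decay[OF ip p(3) x] by linarith
    qed
    from sum[of 0, OF _ this] show ?case by simp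
  next
    case (Suc k)
    then have IH: "summable (\<lambda>n. ((real n + 1) ^ k * norm (a n))\<^sup>2)" "\<And>i. i < k \<Longrightarrow> tsum i a 0 = 0" by simp_all
    obtain C where C: "\<And>x. \<bar>x\<bar> \<ge> 1 \<Longrightarrow> norm (remainder p (complex_of_real x)) \<le> C / \<bar>x\<bar> ^ (k + 2)"
      using remainder_decay_smooth[OF IH(1) p IH(2)] by blast
    have s: "summable (\<lambda>n. ((real n + 1) ^ Suc k * norm (a n))\<^sup>2)"
      by (rule sum[of "Suc k" C]) (use Suc C in auto)
    have "tsum k a 0 = 0"
      by (rule boundary_values_vanish[OF s p(1,2) IH(2) C half tF]) (use Suc in auto)
    then show ?case using s IH(2) by (auto simp: less_Suc_eq)
  }
qed

section \<open>Weak derivatives and conclusion\<close>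

lemma lint_open_interval:
  fixes h :: "real \<Rightarrow> complex"
  assumes "integrable (lebesgue_on {0..pi}) h"
  shows "(LINT x|lebesgue_on {0<..<pi}. h x) = (LINT x|lebesgue_on {0..pi}. h x)"
proof -
  have "set_integrable lebesgue {0..pi} h"
    using assms by (simp add: set_integrable_def integrable_restrict_space)
  then have "set_integrable lebesgue {0<..<pi} h"
    by (rule set_integrable_subset) auto
  then have "integrable (lebesgue_on {0<..<pi}) h"
    by (simp add: set_integrable_def integrable_restrict_space)
  then show ?thesis
    using assms by (simp add: lebesgue_integral_eq_integral integral_open_interval_real)
qed

lemma L2c_L2:
  assumes "L2c f"
  shows "f \<in> L2 {0<..<pi}"
proof -
  have "f \<in> borel_measurable (lebesgue_on {0<..<pi})"
    by (rule measurable_restrict_mono[of f lebesgue "{0..pi}"]) (use assms in \<open>auto simp: L2c_def\<close>)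
  moreover have "integrable (lebesgue_on {0<..<pi}) (\<lambda>x. (norm (f x))\<^sup>2)"
  proof -
    have "set_integrable lebesgue {0..pi} (\<lambda>x. (norm (f x))\<^sup>2)"
      using assms by (simp add: L2c_def set_integrable_def integrable_restrict_space)
    then have "set_integrable lebesgue {0<..<pi} (\<lambda>x. (norm (f x))\<^sup>2)"
      by (rule set_integrable_subset) auto
    then show ?thesis by (simp add: set_integrable_def integrable_restrict_space)
  qed
  ultimately show ?thesis by (simp add: L2_def)
qed

text \<open>
  A test function vanishes on an open set that contains both end points, hence so do its derivatives.
\<close>

lemma test_function_deriv:
  assumes "test_function \<phi>"
  shows test_function_has_deriv: "((deriv ^^ j) \<phi> has_field_derivative (deriv ^^ Suc j) \<phi> x) (at x)"
    and test_function_endpoints: "(deriv ^^ j) \<phi> 0 = 0" "(deriv ^^ j) \<phi> pi = 0"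
proof -
  show d: "((deriv ^^ j) \<phi> has_field_derivative (deriv ^^ Suc j) \<phi> x) (at x)" for j x
    using assms field_differentiable_derivI[of "(deriv ^^ j) \<phi>" x] by (simp add: test_function_def)
  obtain a b where ab: "0 < a" "b < pi" "\<And>x. x \<notin> {a..b} \<Longrightarrow> \<phi> x = 0"
    using assms unfolding test_function_def by blast
  have z: "(deriv ^^ j) \<phi> x = 0" if "x \<in> - {a..b}" for x
    using that
  proof (induction j arbitrary: x)
    case 0
    then show ?case using ab(3)[of x] by simp
  next
    case (Suc j)
    have "((deriv ^^ j) \<phi> has_field_derivative 0) (at x)"
    proof (rule has_field_derivative_transform_within_open[OF DERIV_const _ Suc.prems])
      show "open (- {a..b})" by (rule open_Compl) simp
      show "0 = (deriv ^^ j) \<phi> y" if "y \<in> - {a..b}" for y using Suc.IH[OF that] by simp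
    qed
    then show ?case using DERIV_unique[OF d[of j x]] by blast
  qed
  show "(deriv ^^ j) \<phi> 0 = 0" "(deriv ^^ j) \<phi> pi = 0" using z ab by auto
qed

lemma weak_derivative_step:
  fixes U u :: "real \<Rightarrow> complex"
  assumes U: "primitive_of U u" and \<phi>: "test_function \<phi>"
  shows "(LINT x|lebesgue_on {0..pi}. U x * of_real ((deriv ^^ Suc j) \<phi> x)) = - (LINT x|lebesgue_on {0..pi}. u x * of_real ((deriv ^^ j) \<phi> x))"
proof -
  define \<psi> where "\<psi> = (\<lambda>j x. complex_of_real ((deriv ^^ j) \<phi> x))"
  have d: "(\<psi> j has_vector_derivative \<psi> (Suc j) x) (at x within {0..pi})" for j x
    unfolding \<psi>_def
    by (rule has_vector_derivative_of_real, rule has_field_derivative_at_within, rule test_function_has_deriv[OF \<phi>])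
  have c: "continuous_on {0..pi} (\<psi> j)" for j
    unfolding continuous_on_eq_continuous_within using has_vector_derivative_continuous[OF d] by blast
  have ppsi: "primitive_of (\<psi> j) (\<psi> (Suc j))" by (rule primitive_of_C1[OF d c])
  have i1: "integrable (lebesgue_on {0..pi}) (\<lambda>x. u x * \<psi> j x)" by (intro integrable_mult_cont primitive_of_integrable[OF U] c)
  have i2: "integrable (lebesgue_on {0..pi}) (\<lambda>x. U x * \<psi> (Suc j) x)"
    by (intro continuous_imp_integrable_real continuous_intros c primitive_of_continuous[OF U])
  have "U pi * \<psi> j pi = U 0 * \<psi> j 0 + (LINT x|lebesgue_on {0..pi}. u x * \<psi> j x + U x * \<psi> (Suc j) x)"
    by (rule primitive_ofD[OF primitive_of_mult[OF U ppsi]]) simp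
  moreover have "\<psi> j pi = 0" "\<psi> j 0 = 0" by (simp_all add: \<psi>_def test_function_endpoints[OF \<phi>])
  ultimately have "(LINT x|lebesgue_on {0..pi}. u x * \<psi> j x) + (LINT x|lebesgue_on {0..pi}. U x * \<psi> (Suc j) x) = 0"
    unfolding Bochner_Integration.integral_add[OF i1 i2] by simp
  then show ?thesis unfolding \<psi>_def by (simp only: add_eq_0_iff)
qed

text \<open>
  Absolutely continuous functions may be integrated by parts against test functions; after \<open>k\<close> steps all
  derivatives have moved from the test function to the potential.
\<close>

lemma chain_sobolev:
  assumes P: "\<And>i. i \<le> m \<Longrightarrow> L2c (P i)" and prim: "\<And>i. i < m \<Longrightarrow> primitive_of (P i) (P (Suc i))"
  shows "P 0 \<in> sobolev m"
proof -
  have "weak_derivative k (P 0) (P k)" if k: "k \<le> m" for k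
    unfolding weak_derivative_def
  proof (intro allI impI)
    fix \<phi> assume \<phi>: "test_function \<phi>"
    have eq: "(LINT x|lebesgue_on {0..pi}. P 0 x * of_real ((deriv ^^ k) \<phi> x)) = (-1) ^ j * (LINT x|lebesgue_on {0..pi}. P j x * of_real ((deriv ^^ (k - j)) \<phi> x))" if "j \<le> k" for j
      using that
    proof (induction j)
      case (Suc j)
      then have kj: "k - j = Suc (k - Suc j)" by simp
      have "primitive_of (P j) (P (Suc j))" using Suc.prems k by (intro prim) simp
      note step = weak_derivative_step[OF this \<phi>, of "k - Suc j"]
      have "j \<le> k" using Suc.prems by simp
      from Suc.IH[OF this] show ?case unfolding kj step by (simp only: power_Suc mult_minus_left mult_minus_right mult_1_left)
    qed (simp only: power_0 mult_1_left minus_nat.diff_0)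
    have c: "continuous_on {0..pi} (\<lambda>x. complex_of_real ((deriv ^^ j) \<phi> x))" for j
    proof -
      have "isCont ((deriv ^^ j) \<phi>) x" for x by (rule DERIV_isCont[OF test_function_has_deriv[OF \<phi>]])
      then have "continuous_on {0..pi} ((deriv ^^ j) \<phi>)" by (simp add: continuous_at_imp_continuous_on)
      then show ?thesis by (rule continuous_on_of_real)
    qed
    have i: "integrable (lebesgue_on {0..pi}) (\<lambda>x. P i x * of_real ((deriv ^^ j) \<phi> x))" if "i \<le> m" for i j
      by (rule integrable_mult_cont[OF L2c_integrable[OF P[OF that]] c])
    show "(LINT x|lebesgue_on {0<..<pi}. P 0 x * of_real ((deriv ^^ k) \<phi> x)) = (-1) ^ k * (LINT x|lebesgue_on {0<..<pi}. P k x * of_real (\<phi> x))"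
    proof -
      have e1: "(LINT x|lebesgue_on {0<..<pi}. P 0 x * of_real ((deriv ^^ k) \<phi> x)) = (LINT x|lebesgue_on {0..pi}. P 0 x * of_real ((deriv ^^ k) \<phi> x))"
        by (rule lint_open_interval[OF i[OF le0]])
      have e2: "(LINT x|lebesgue_on {0<..<pi}. P k x * of_real ((deriv ^^ 0) \<phi> x)) = (LINT x|lebesgue_on {0..pi}. P k x * of_real ((deriv ^^ 0) \<phi> x))"
        by (rule lint_open_interval[OF i[OF k]])
      have "(LINT x|lebesgue_on {0..pi}. P 0 x * of_real ((deriv ^^ k) \<phi> x)) = (-1) ^ k * (LINT x|lebesgue_on {0..pi}. P k x * of_real ((deriv ^^ 0) \<phi> x))"
        using eq[OF order_refl] by (simp only: diff_self_eq_0)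
      then show ?thesis unfolding e1 using e2 by (simp only: funpow_0)
    qed
  qed
  then have "\<exists>g\<in>L2 {0<..<pi}. weak_derivative k (P 0) g" if "k \<in> {1..m}" for k
    using that L2c_L2[OF P[of k]] by (intro bexI[of _ "P k"]) auto
  then show ?thesis unfolding sobolev_def using L2c_L2[OF P[of 0]] by blast
qed

lemma primitive_of_add_const:
  assumes U: "primitive_of U (u :: real \<Rightarrow> complex)"
  shows "primitive_of (\<lambda>x. U x + c) u"
proof -
  have "U x + c = U 0 + c + (LINT t|lebesgue_on {0..x}. u t)" if "x \<in> {0..pi}" for x
    by (subst primitive_ofD[OF U that]) simp
  then show ?thesis using primitive_of_integrable[OF U] unfolding primitive_of_def by blast
qed

lemma solves_shift: "solves (\<lambda>x. p x + c) lam u \<longleftrightarrow> solves p (lam - c) u"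
proof -
  have "A - (B + c) * U + lam * U = A - B * U + (lam - c) * U" for A B U by (simp add: algebra_simps)
  then show ?thesis unfolding solves_def by (simp only:)
qed

text \<open>
  The solutions depend on the potential and on \<open>\<mu>\<close> only through the equation, so this is an identity between
  the chosen solutions themselves.
\<close>

lemma char_det_shift: "char_det (\<lambda>x. p x + c) \<mu> = char_det p (csqrt (\<mu>\<^sup>2 - c))"
  by (simp add: char_det_def c_sol_def s_sol_def solves_shift)

lemma PW_sample_decay:
  assumes f: "f holomorphic_on UNIV" and ty: "exponential_type_le pi f"
    and E: "\<And>a b. integral {a..b} (\<lambda>x. (norm (f (complex_of_real x)))\<^sup>2) \<le> E"
  shows PW_samples_summable: "summable (\<lambda>n. (norm (f (of_real (real n + b))))\<^sup>2)"
    and PW_samples_tendsto: "(\<lambda>n. norm (f (of_real (real n + b)))) \<longlonglongrightarrow> 0"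
proof -
  have le: "(\<Sum>n<N. (norm (f (of_real (real n + b))))\<^sup>2) \<le> (1 + exp pi)\<^sup>2 * E" for N
    using Plancherel_Polya[OF f ty _ E, where b = b and N = N] by (simp add: add.commute)
  show s: "summable (\<lambda>n. (norm (f (of_real (real n + b))))\<^sup>2)" by (rule summableI_nonneg_bounded[OF _ le]) simp
  then have "(\<lambda>n. sqrt ((norm (f (of_real (real n + b))))\<^sup>2)) \<longlonglongrightarrow> sqrt 0" by (intro tendsto_real_sqrt summable_LIMSEQ_zero)
  then show "(\<lambda>n. norm (f (of_real (real n + b)))) \<longlonglongrightarrow> 0" by simp
qed

theorem theorem2:
  fixes \<theta> m :: nat and f v :: "complex \<Rightarrow> complex"
  assumes "\<theta> \<in> {0, 1}"
    and "f \<in> PW_odd pi"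
    and "(\<lambda>x. complex_of_real x ^ m * f (complex_of_real x)) \<in> L2 UNIV"
    and "v holomorphic_on UNIV"
    and "\<And>\<mu>. \<mu> \<noteq> 0 \<Longrightarrow> v \<mu> = f \<mu> / \<mu>"
  shows "\<exists>q \<in> sobolev m.
    (\<forall>\<mu>. char_det q \<mu> = v \<mu>) \<and>
    (\<forall>\<mu>. bvp_eigenvalue \<theta> q (\<mu>\<^sup>2) \<longleftrightarrow> char_det q \<mu> = 0)"
proof -
  have f: "f holomorphic_on UNIV" "exponential_type_le pi f" "(\<lambda>x. f (complex_of_real x)) \<in> L2 UNIV" "\<And>z. f (- z) = - f z"
    using assms(2) by (auto simp: PW_odd_def PW_def)
  have f0: "f 0 = 0" using f(4)[of 0] by simp
  have fv: "f z = z * v z" for z using assms(5)[of z] f0 by (cases "z = 0") auto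
  have even: "v (- z) = v z" for z using assms(5)[of z] assms(5)[of "- z"] f(4)[of z] by (cases "z = 0") auto
  have cr: "continuous_on UNIV (\<lambda>x. complex_of_real x ^ m * f (complex_of_real x))" for m
    using entire_real_continuous[OF f(1)] by (intro continuous_intros)
  obtain E0 where E0: "\<And>a b. integral {a..b} (\<lambda>x. (norm (f (complex_of_real x)))\<^sup>2) \<le> E0"
    using L2_energy[of f, OF f(3)] cr[of 0] by auto
  obtain Em where Em: "\<And>a b. integral {a..b} (\<lambda>x. (norm (complex_of_real x ^ m * f (complex_of_real x)))\<^sup>2) \<le> Em"
    using L2_energy[of "\<lambda>z. z ^ m * f z", OF assms(3) cr] by auto
  (* The Plancherel-Polya constant turns this energy into the bound 1/2048 on the samples. *)
  define \<delta> where "\<delta> = 1 / (2048 * (1 + exp pi)\<^sup>2)"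
  have pos: "1 + exp pi > 0" by (simp add: add_pos_pos)
  then have \<delta>: "\<delta> > 0" by (simp add: \<delta>_def)
  obtain Q where "Q > 0" and V0: "(\<lambda>\<mu>. v (csqrt (\<mu>\<^sup>2 + of_real Q))) holomorphic_on UNIV"
    "exponential_type_le pi (\<lambda>\<mu>. \<mu> * v (csqrt (\<mu>\<^sup>2 + of_real Q)))"
    "\<And>a b. integral {a..b} (\<lambda>x. (norm (of_real x * v (csqrt ((of_real x)\<^sup>2 + of_real Q))))\<^sup>2) \<le> \<delta>"
    "\<And>a b. integral {a..b} (\<lambda>x. (norm (of_real x ^ m * (of_real x * v (csqrt ((of_real x)\<^sup>2 + of_real Q)))))\<^sup>2) \<le> 2 * Em"
    using small_shifted_data[OF f(1,2) _ assms(4) fv even E0 Em \<delta>] by auto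
  define V where "V = (\<lambda>\<mu>. v (csqrt (\<mu>\<^sup>2 + of_real Q)))"
  define F where "F = (\<lambda>\<mu>. \<mu> * V \<mu>)"
  have V: "V holomorphic_on UNIV" "exponential_type_le pi (\<lambda>\<mu>. \<mu> * V \<mu>)"
    "\<And>a b. integral {a..b} (\<lambda>x. (norm (of_real x * V (of_real x)))\<^sup>2) \<le> \<delta>"
    using V0(1-3) by (simp_all add: V_def)
  have Veven: "V (- z) = V z" for z by (simp add: V_def)
  have hF: "F holomorphic_on UNIV" unfolding F_def by (intro holomorphic_intros V)
  have tF: "exponential_type_le pi F" using V(2) by (simp add: F_def)
  have EF: "integral {a..b} (\<lambda>x. (norm (F (of_real x)))\<^sup>2) \<le> \<delta>" for a b using V(3) by (simp add: F_def)
  have sum_le: "(\<Sum>n<N. (norm (F (of_nat (Suc n))))\<^sup>2) \<le> 1 / 2048" for N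
  proof -
    have "(\<Sum>n<N. (norm (F (of_real (1 + real n))))\<^sup>2) \<le> (1 + exp pi)\<^sup>2 * \<delta>"
      by (rule Plancherel_Polya[OF hF tF _ EF]) simp
    also have "\<dots> = 1 / 2048" using pos by (simp add: \<delta>_def)
    finally show ?thesis by simp
  qed
  obtain p a where p: "l2lim (psum 0 a) p" "odd_pi p" "l1norm p \<le> 1 / 16"
    and samples: "\<And>n. linear_part p (of_nat (Suc n)) + remainder p (of_nat (Suc n)) = F (of_nat (Suc n))"
    and an: "\<And>n. norm (a n) \<le> norm (F (of_nat (Suc n))) + norm (remainder p (of_nat (Suc n)))"
    by (rule exists_small_potential[of "\<lambda>n. F (of_nat (Suc n))", OF sum_le], rule that)
  have Lp: "L2c p" using p(1) by (simp add: l2lim_def)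
  have det: "char_det p \<mu> = V \<mu>" for \<mu>
    by (rule char_det_eq_from_samples[OF V(1) Veven V(2,3) Lp p(2,3)]) (use samples in \<open>simp add: F_def\<close>)
  (* The samples of G carry the weight of order m, which dominates all lower weights. *)
  define G where "G = (\<lambda>z. z ^ m * F z)"
  have hG: "G holomorphic_on UNIV" unfolding G_def by (intro holomorphic_intros hF)
  have tG: "exponential_type_le pi G" unfolding G_def by (rule exponential_type_power_times[OF tF])
  have EG: "integral {a..b} (\<lambda>x. (norm (G (of_real x)))\<^sup>2) \<le> 2 * Em" for a b
    using V0(4) by (simp add: G_def F_def V_def)
  have G_ge: "x ^ i * norm (F (of_real x)) \<le> norm (G (of_real x))" if "i \<le> m" "x \<ge> 1" for i x
    unfolding G_def norm_mult norm_power using that by (auto intro!: mult_right_mono power_increasing)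
  have "summable (\<lambda>n. ((real n + 1) ^ m * norm (a n))\<^sup>2) \<and> (\<forall>i<m. tsum i a 0 = 0)"
  proof (rule bootstrap[OF p, where F = "\<lambda>x. F (of_real x)"])
    show "norm (a n) \<le> norm (F (of_real (real n + 1))) + norm (remainder p (of_real (real n + 1)))" for n
      using an[of n] by (simp add: add.commute)
    show "linear_part p (of_real (real n + 1/2)) + remainder p (of_real (real n + 1/2)) = F (of_real (real n + 1/2))" for n
    proof -
      have "complex_of_real (real n + 1/2) \<noteq> 0" unfolding of_real_eq_0_iff by simp
      from char_det_odd[OF L2c_integrable[OF Lp] p(2) this] show ?thesis by (simp only: det F_def)
    qed
    show "summable (\<lambda>n. ((real n + 1) ^ i * norm (F (of_real (real n + 1))))\<^sup>2)" if i: "i \<le> m" for i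
    proof (rule summable_comparison_test'[OF PW_samples_summable[OF hG tG EG, where b = 1]])
      show "norm (((real n + 1) ^ i * norm (F (of_real (real n + 1))))\<^sup>2) \<le> (norm (G (of_real (real n + 1))))\<^sup>2" for n
        using power_mono[OF G_ge[OF i, of "real n + 1"], of 2] by simp
    qed
    show "(\<lambda>n. (real n + 1/2) ^ i * norm (F (of_real (real n + 1/2)))) \<longlonglongrightarrow> 0" if i: "i \<le> m" for i
    proof (rule Lim_null_comparison[OF _ PW_samples_tendsto[OF hG tG EG, where b = "1/2"]])
      have "norm ((real n + 1/2) ^ i * norm (F (of_real (real n + 1/2)))) \<le> norm (G (of_real (real n + 1/2)))" if "n \<ge> 1" for n
        using G_ge[OF i, of "real n + 1/2"] that by (simp add: abs_mult)
      then show "eventually (\<lambda>n. norm ((real n + 1/2) ^ i * norm (F (of_real (real n + 1/2)))) \<le> norm (G (of_real (real n + 1/2)))) sequentially"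
        unfolding eventually_sequentially by blast
    qed
  qed simp
  then have "summable (\<lambda>n. ((real n + 1) ^ m * norm (a n))\<^sup>2)" ..
  then obtain P where P: "\<And>i. i \<le> m \<Longrightarrow> l2lim (psum i a) (P i)" "\<And>i. i < m \<Longrightarrow> primitive_of (P i) (P (Suc i))"
    using chain_exists[OF _ p(1,2)] by metis
  have LP: "L2c (P i)" if "i \<le> m" for i using P(1)[OF that] by (simp add: l2lim_def)
  (* The shift affects only the potential itself and none of its derivatives. *)
  define R where "R = (\<lambda>i. if i = 0 then (\<lambda>x. P 0 x + complex_of_real Q) else P i)"
  have LR: "L2c (R i)" if "i \<le> m" for i
    using LP[OF that] L2c_add[OF LP[of 0] L2c_continuous[of "\<lambda>_. complex_of_real Q"]] by (simp add: R_def)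
  have "primitive_of (R i) (R (Suc i))" if "i < m" for i
    using P(2)[OF that] primitive_of_add_const[of "P 0" "P 1"] by (cases i) (simp_all add: R_def)
  from chain_sobolev[of m R, OF LR this] have sob: "R 0 \<in> sobolev m" .
  have "AE x in lebesgue_on {0..pi}. P 0 x = p x" by (rule l2lim_unique[OF P(1) p(1)]) simp
  then have detR: "char_det (R 0) \<mu> = v \<mu>" for \<mu>
    by (simp add: R_def char_det_shift char_det_AE_cong det V_def even_csqrt[of v, OF even])
  have "bvp_eigenvalue \<theta> (R 0) (\<mu>\<^sup>2) \<longleftrightarrow> char_det (R 0) \<mu> = 0" for \<mu>
    by (rule bvp_eigenvalue_iff[OF L2c_integrable[OF LR]]) simp
  then show ?thesis using sob detR by blast
qed

end
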